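(* Let $W_0,W_1,W_2,W_3$ be Hermitian vector spaces with real structure (not necessarily complete), and let $L_{01}\subset W_0\oplus -W_1$, $L_{12}\subset W_1\oplus -W_2$, $L_{23}\subset W_2\oplus -W_3$ be Lagrangians. Assume that all (iterated) compositions $L_{02}=L_{01}\circ L_{12}$, $L_{13}=L_{12}\circ L_{23}$, $L_{03}=L_{01}\circ L_{12}\circ L_{23}$ are again Lagrangians, that for each $0\le i<j<k\le3$ the pair $(L_{ij},L_{jk})$ satisfies the closedness conditions (1) and (2) stated in the context, and that each of the spaces $$K_{ijk}=\{u\in W_j\mid(0,u)\in L_{ij},\ (u,0)\in L_{jk}\},\qquad 0\le i<j<k\le3,$$ is finite-dimensional. Let $\alpha_{ijk}$ be the gluing isomorphisms and $\rho:K_{013}\oplus K_{123}\to K_{012}\oplus K_{023}$ the vector space isomorphism defined in the context. Then the following two composite maps from $\Lambda L_{03}\otimes\Lambda^{\mathrm{top}}(K_{013}\oplus K_{123})$ coincide, after identifying their targets by the associator of the tensor product: (a) the composition $$\Lambda L_{03}\otimes\Lambda^{\mathrm{top}}(K_{013}\oplus K_{123})\cong(\Lambda L_{03}\otimes\Lambda^{\mathrm{top}}K_{013})\otimes\Lambda^{\mathrm{top}}K_{123}\xrightarrow{\alpha_{013}\otimes\mathrm{id}}(\Lambda L_{01}\otimes_{\mathrm{Cl}(W_1)}\Lambda L_{13})\otimes\Lambda^{\mathrm{top}}K_{123}$$ $$\cong\Lambda L_{01}\otimes_{\mathrm{Cl}(W_1)}(\Lambda L_{13}\otimes\Lambda^{\mathrm{top}}K_{123})\xrightarrow{\mathrm{id}\otimes\alpha_{123}}\Lambda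 L_{01}\otimes_{\mathrm{Cl}(W_1)}(\Lambda L_{12}\otimes_{\mathrm{Cl}(W_2)}\Lambda L_{23});$$ (b) the composition $$\Lambda L_{03}\otimes\Lambda^{\mathrm{top}}(K_{013}\oplus K_{123})\xrightarrow{\ \mathrm{id}\otimes\frac{\Lambda^{\mathrm{top}}\rho}{\det(\rho^*\rho)}\ }\Lambda L_{03}\otimes\Lambda^{\mathrm{top}}(K_{012}\oplus K_{023})\cong(\Lambda L_{03}\otimes\Lambda^{\mathrm{top}}K_{023})\otimes\Lambda^{\mathrm{top}}K_{012}$$ $$\xrightarrow{\alpha_{023}\otimes\mathrm{id}}(\Lambda L_{02}\otimes_{\mathrm{Cl}(W_2)}\Lambda L_{23})\otimes\Lambda^{\mathrm{top}}K_{012}\cong(\Lambda L_{02}\otimes\Lambda^{\mathrm{top}}K_{012})\otimes_{\mathrm{Cl}(W_2)}\Lambda L_{23}\xrightarrow{\alpha_{012}\otimes\mathrm{id}}(\Lambda L_{01}\otimes_{\mathrm{Cl}(W_1)}\Lambda L_{12})\otimes_{\mathrm{Cl}(W_2)}\Lambda L_{23}.$$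
   Context: Hermitian forms are $\mathbb{C}$-antilinear in the first entry (and positive definite). A real structure on a Hermitian vector space $V$ is an anti-unitary involution $v\mapsto\overline{v}$; $-V$ is the same Hermitian space with real structure $v\mapsto-\overline{v}$. For $S\subset V$, $\overline{S}=\{\overline{s}\mid s\in S\}$. Direct sums are orthogonal with the direct sum real structure. A complex subspace $L\subset V$ is Lagrangian if $\overline{L}=L^\perp$ (Hermitian orthogonal complement); it is understood that then $V=L\oplus\overline{L}$. Composition: $L_{ij}\circ L_{jk}=\{(w_i,w_k)\in W_i\oplus -W_k\mid\exists w_j\in W_j:(w_i,w_j)\in L_{ij},(w_j,w_k)\in L_{jk}\}$. Conditions (1), (2) for $(L_{ij},L_{jk})$: put $W=W_i\oplus -W_j\oplus W_j\oplus -W_k$ (real structure $\overline{(v_i,v_j,v_j',v_k)}=(\overline{v}_i,-\overline{v}_j,\overline{v}_j',-\overline{v}_k)$), $L=L_{ij}\oplus L_{jk}$, $U=\{(0,w,w,0)\mid w\in W_j\}$, $\sigma(v_i,v_j,v_j',v_k)=v_j-v_j'$. (1): $\sigma|_L$ has closed range in $W_j$. (2): $P_L\overline{U}$ and $P_{\overline{L}}U$ are closed, where $P_L,P_{\overline{L}}$ are the orthogonal projections onto $L,\overline{L}$. Clifford algebra: $\mathrm{Cl}(V)$ is the complex algebra generated by $V$ with relations $v\cdot w+w\cdot v=\langle\overline{v},w\rangle$, $\mathbb{Z}_2$-graded with $V$ odd. For a Lagrangian $L\subset V$, the algebraic exterior algebra $\Lambda L$ is a graded left $\mathrm{Cl}(V)$-module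 via $v\cdot\xi=v\wedge\xi$, $\overline{v}\cdot\xi=\iota(v)\xi$ for $v\in L$, with $\iota(v)$ the odd derivation such that $\iota(v)w=\langle v,w\rangle$. $\Omega_{ij}=1\in\Lambda^0L_{ij}$ is the vacuum vector. $\Lambda L_{ij}$ is a $\mathrm{Cl}(W_i)$-$\mathrm{Cl}(W_j)$-bimodule via $w_i\cdot\xi=(w_i,0)\cdot\xi$, $\xi\cdot w_j=(-1)^{|\xi|}(0,w_j)\cdot\xi$. For $K$ finite-dimensional, $\Lambda^{\mathrm{top}}K=\Lambda^{\dim K}K$ is a line of parity $\dim K\bmod2$ (with $\Lambda^{\mathrm{top}}\{0\}=\mathbb{C}$); on $\Lambda L_{ik}\otimes\Lambda^{\mathrm{top}}K$ the left action is on the first factor and $(\xi\otimes\kappa)\cdot w=(-1)^{|\kappa|}(\xi\cdot w)\otimes\kappa$. Unlabelled isomorphisms $\cong$ are the canonical ones (reassociation, $\Lambda^{\mathrm{top}}(A\oplus B)\cong\Lambda^{\mathrm{top}}A\otimes\Lambda^{\mathrm{top}}B$ induced by $a\wedge b\leftrightarrow a\otimes b$, and interchange of graded tensor factors with the Koszul sign). All tensor products are algebraic. Gluing isomorphisms: let $W_0,W_1,W_2,W_3$ be Hermitian vector spaces with real structure and $L_{01}\subset W_0\oplus -W_1$, $L_{12}\subset W_1\oplus -W_2$, $L_{23}\subset W_2\oplus -W_3$ Lagrangians such that the compositions $L_{02}=L_{01}\circ L_{12}$, $L_{13}=L_{12}\circ L_{23}$, $L_{03}=L_{01}\circ L_{12}\circ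 L_{23}$ are again Lagrangians, and such that for each $0\le i<j<k\le3$ the pair $(L_{ij},L_{jk})$ satisfies conditions (1) and (2) and the space $K_{ijk}=\{u\in W_j\mid(0,u)\in L_{ij},\ (u,0)\in L_{jk}\}$ is finite-dimensional. Then for $0\le i<j<k\le3$ there is a unique bimodule isomorphism $\alpha_{ijk}:\Lambda L_{ik}\otimes\Lambda^{\mathrm{top}}K_{ijk}\to\Lambda L_{ij}\otimes_{\mathrm{Cl}(W_j)}\Lambda L_{jk}$ with $\alpha_{ijk}(\Omega_{ik}\otimes u_1\wedge\cdots\wedge u_n)=\Omega_{ij}\cdot u_1\cdots u_n\otimes\Omega_{jk}$ for $u_1,\dots,u_n\in K_{ijk}$, $n=\dim K_{ijk}$. The map $\rho$: one has $K_{012}\subset K_{013}$ and $K_{123}\subset K_{023}$. For each $u_1\in K_{012}^\perp\cap K_{013}$ there is a unique $u_2=:\rho_0(u_1)\in K_{123}^\perp\cap K_{023}$ with $(u_1,u_2)\in L_{12}$, and $\rho_0:K_{012}^\perp\cap K_{013}\to K_{123}^\perp\cap K_{023}$ is a linear isomorphism. With respect to $K_{013}=K_{012}\oplus(K_{012}^\perp\cap K_{013})$, put $\rho(u_1+v_1^\perp,u_2)=(u_1,u_2+\rho_0(v_1^\perp))$ for $u_1\in K_{012}$, $v_1^\perp\in K_{012}^\perp\cap K_{013}$, $u_2\in K_{123}$. $\Lambda^{\mathrm{top}}\rho$ is the induced map of top exterior powers, and $\rho^*$ is the adjoint with respect to the inner products inherited from the $W_j$. *)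

theory Defs
  imports
    "HOL-Analysis.Euclidean_Space"
    "HOL-Combinatorics.Permutations"
    "HOL-Library.Poly_Mapping"
    "HOL-Algebra.Module"
begin

section \<open>Complex vector spaces and Hermitian spaces\<close>

class scaleC =
  fixes scaleC :: "complex \<Rightarrow> 'a \<Rightarrow> 'a" (infixr "*\<^sub>C" 75)

class complex_vector = scaleC + ab_group_add +
  assumes scaleC_add_right: "a *\<^sub>C (x + y) = a *\<^sub>C x + a *\<^sub>C y"
    and scaleC_add_left: "(a + b) *\<^sub>C x = a *\<^sub>C x + b *\<^sub>C x"
    and scaleC_scaleC: "a *\<^sub>C b *\<^sub>C x = (a * b) *\<^sub>C x"
    and scaleC_one: "1 *\<^sub>C x = x"

global_interpretation complex_vector: vector_space "scaleC :: complex \<Rightarrow> 'a \<Rightarrow> 'a::complex_vector"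
  defines cdependent = complex_vector.dependent
    and csubspace = complex_vector.subspace
    and cspan = complex_vector.span
    and cextend_basis = complex_vector.extend_basis
    and cdim = complex_vector.dim
    and crepresentation = complex_vector.representation
  by unfold_locales (rule scaleC_add_right scaleC_add_left scaleC_scaleC scaleC_one)+

definition cfinite_dim :: "'a::complex_vector set \<Rightarrow> bool" where
  "cfinite_dim S \<longleftrightarrow> (\<exists>B. finite B \<and> S \<subseteq> cspan B)"

text \<open>
  The real inner product, norm and topology of a Hermitian space are those of \<open>Re \<langle>x, y\<rangle>\<close>;
  positive definiteness is inherited from \<^class>\<open>real_inner\<close>. No completeness is assumed.
\<close>

class hermitian_space = complex_vector + real_inner +
  fixes cinner :: "'a \<Rightarrow> 'a \<Rightarrow> complex"
  assumes scaleR_eq_scaleC: "scaleR r x = complex_of_real r *\<^sub>C x"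
    and inner_eq_Re_cinner: "inner x y = Re (cinner x y)"
    and cinner_commute: "cinner x y = cnj (cinner y x)"
    and cinner_add_right: "cinner x (y + z) = cinner x y + cinner x z"
    and cinner_scaleC_right: "cinner x (a *\<^sub>C y) = a * cinner x y"

instantiation complex :: complex_vector
begin
definition scaleC_complex :: "complex \<Rightarrow> complex \<Rightarrow> complex" where
  "scaleC_complex a x = a * x"
instance
  by standard (simp_all add: scaleC_complex_def algebra_simps)
end

instantiation prod :: (complex_vector, complex_vector) complex_vector
begin
definition scaleC_prod :: "complex \<Rightarrow> 'a \<times> 'b \<Rightarrow> 'a \<times> 'b" where
  "scaleC_prod a x = (a *\<^sub>C fst x, a *\<^sub>C snd x)"
instance
  by standard (simp_all add: scaleC_prod_def scaleC_add_right scaleC_add_left scaleC_scaleC scaleC_one)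
end

instantiation prod :: (hermitian_space, hermitian_space) hermitian_space
begin
definition cinner_prod :: "'a \<times> 'b \<Rightarrow> 'a \<times> 'b \<Rightarrow> complex" where
  "cinner_prod x y = cinner (fst x) (fst y) + cinner (snd x) (snd y)"
instance
proof
  fix r :: real and a :: complex and x y z :: "'a \<times> 'b"
  show "r *\<^sub>R x = complex_of_real r *\<^sub>C x"
    by (simp add: scaleC_prod_def prod_eq_iff scaleR_eq_scaleC)
  show "inner x y = Re (cinner x y)"
    by (simp add: cinner_prod_def inner_prod_def inner_eq_Re_cinner)
  show "cinner x y = cnj (cinner y x)"
    unfolding cinner_prod_def complex_cnj_add by (metis cinner_commute)
  show "cinner x (y + z) = cinner x y + cinner x z"
    by (simp add: cinner_prod_def cinner_add_right)
  show "cinner x (a *\<^sub>C y) = a * cinner x y"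
    by (simp add: cinner_prod_def scaleC_prod_def cinner_scaleC_right distrib_left)
qed
end

instantiation poly_mapping :: (type, complex_vector) complex_vector
begin
definition scaleC_poly_mapping :: "complex \<Rightarrow> ('a \<Rightarrow>\<^sub>0 'b) \<Rightarrow> ('a \<Rightarrow>\<^sub>0 'b)" where
  "scaleC_poly_mapping a = Poly_Mapping.map (scaleC a)"
instance
proof
  fix a b :: complex and x y :: "'a \<Rightarrow>\<^sub>0 'b"
  have lk: "Poly_Mapping.lookup (a *\<^sub>C x) k = a *\<^sub>C Poly_Mapping.lookup x k" for a and x :: "'a \<Rightarrow>\<^sub>0 'b" and k
    by (simp add: scaleC_poly_mapping_def Poly_Mapping.map.rep_eq when_def)
  show "a *\<^sub>C (x + y) = a *\<^sub>C x + a *\<^sub>C y"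
    by (rule poly_mapping_eqI) (simp add: lk lookup_add scaleC_add_right)
  show "(a + b) *\<^sub>C x = a *\<^sub>C x + b *\<^sub>C x"
    by (rule poly_mapping_eqI) (simp add: lk lookup_add scaleC_add_left)
  show "a *\<^sub>C b *\<^sub>C x = (a * b) *\<^sub>C x"
    by (rule poly_mapping_eqI) (simp add: lk scaleC_scaleC)
  show "1 *\<^sub>C x = x"
    by (rule poly_mapping_eqI) (simp add: lk scaleC_one)
qed
end

definition real_structure :: "('v::hermitian_space \<Rightarrow> 'v) \<Rightarrow> bool" where
  "real_structure c \<longleftrightarrow>
     (\<forall>v. c (c v) = v) \<and> (\<forall>v w. c (v + w) = c v + c w) \<and>
     (\<forall>a v. c (a *\<^sub>C v) = cnj a *\<^sub>C c v) \<and> (\<forall>v w. cinner (c v) (c w) = cinner w v)"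

definition neg_conj :: "('v::hermitian_space \<Rightarrow> 'v) \<Rightarrow> 'v \<Rightarrow> 'v" where
  "neg_conj c v = - c v"

text \<open>The real structure of \<open>W\<^sub>i \<oplus> -W\<^sub>j\<close>.\<close>

definition pair_conj ::
  "('a::hermitian_space \<Rightarrow> 'a) \<Rightarrow> ('b::hermitian_space \<Rightarrow> 'b) \<Rightarrow> 'a \<times> 'b \<Rightarrow> 'a \<times> 'b" where
  "pair_conj ci cj = map_prod ci (neg_conj cj)"

definition orth :: "'v::hermitian_space set \<Rightarrow> 'v set" where
  "orth S = {v. \<forall>s\<in>S. cinner s v = 0}"

definition proj :: "'v::hermitian_space set \<Rightarrow> 'v \<Rightarrow> 'v" where
  "proj S v = (THE s. s \<in> S \<and> v - s \<in> orth S)"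

definition lagrangian :: "('v::hermitian_space \<Rightarrow> 'v) \<Rightarrow> 'v set \<Rightarrow> bool" where
  "lagrangian c L \<longleftrightarrow> csubspace L \<and> c ` L = orth L \<and> (\<forall>v. \<exists>l\<in>L. \<exists>l'\<in>L. v = l + c l')"

text \<open>
  Lagrangians in \<open>W\<^sub>i \<oplus> -W\<^sub>j\<close> are subsets of a product type, so their composition is
  relation composition \<^term>\<open>R O S\<close>.
\<close>

definition Kspace :: "('a::hermitian_space \<times> 'b::hermitian_space) set \<Rightarrow>
    ('b \<times> 'c::hermitian_space) set \<Rightarrow> 'b set" where
  "Kspace Lij Ljk = {u. (0, u) \<in> Lij \<and> (u, 0) \<in> Ljk}"

definition closed_range_condition :: "('a::hermitian_space \<times> 'b::hermitian_space) set \<Rightarrow>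
    ('b \<times> 'c::hermitian_space) set \<Rightarrow> bool" where
  "closed_range_condition Lij Ljk \<longleftrightarrow>
     closed {vj - vj' | vi vj vj' vk. (vi, vj) \<in> Lij \<and> (vj', vk) \<in> Ljk}"

definition closed_projection_condition ::
  "('a::hermitian_space \<Rightarrow> 'a) \<Rightarrow> ('b::hermitian_space \<Rightarrow> 'b) \<Rightarrow> ('c::hermitian_space \<Rightarrow> 'c) \<Rightarrow>
   ('a \<times> 'b) set \<Rightarrow> ('b \<times> 'c) set \<Rightarrow> bool" where
  "closed_projection_condition ci cj ck Lij Ljk \<longleftrightarrow>
     (let c = map_prod ci (map_prod (neg_conj cj) (map_prod cj (neg_conj ck)));
          L = {(vi, vj, vj', vk). (vi, vj) \<in> Lij \<and> (vj', vk) \<in> Ljk};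
          U = {(0, w, w, 0) | w. True}
      in closed (proj L ` c ` U) \<and> closed (proj (c ` L) ` U))"


section \<open>Free algebras and quotients\<close>

text \<open>
  The free complex algebra on a type \<open>'v\<close> is \<open>'v word \<Rightarrow>\<^sub>0 complex\<close>, whose ring structure
  comes from the concatenation monoid of words.
\<close>

datatype 'v word = Word (letters: "'v list")

instantiation word :: (type) monoid_add
begin
definition zero_word :: "'a word" where
  "zero_word = Word []"
definition plus_word :: "'a word \<Rightarrow> 'a word \<Rightarrow> 'a word" where
  "plus_word u v = Word (letters u @ letters v)"
instance
  by standard (simp_all add: zero_word_def plus_word_def)
end

type_synonym 'v free_alg = "'v word \<Rightarrow>\<^sub>0 complex"

definition letter :: "'v \<Rightarrow> 'v free_alg" where
  "letter v = Poly_Mapping.single (Word [v]) 1"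

definition words_on :: "'v set \<Rightarrow> 'v word set" where
  "words_on X = {w. set (letters w) \<subseteq> X}"

definition free_on :: "'g set \<Rightarrow> ('g \<Rightarrow>\<^sub>0 complex) set" where
  "free_on G = {x. Poly_Mapping.keys x \<subseteq> G}"

text \<open>Linear extension of a map on generators, with values in a type or in a module record.\<close>

definition lin_ext :: "('g \<Rightarrow> 'x::complex_vector) \<Rightarrow> ('g \<Rightarrow>\<^sub>0 complex) \<Rightarrow> 'x" where
  "lin_ext f x = (\<Sum>g\<in>Poly_Mapping.keys x. Poly_Mapping.lookup x g *\<^sub>C f g)"

definition mod_ext :: "(complex, 'm, 'r) module_scheme \<Rightarrow> ('g \<Rightarrow> 'm) \<Rightarrow> ('g \<Rightarrow>\<^sub>0 complex) \<Rightarrow> 'm" where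
  "mod_ext M f x = (\<Oplus>\<^bsub>M\<^esub>g\<in>Poly_Mapping.keys x. Poly_Mapping.lookup x g \<odot>\<^bsub>M\<^esub> f g)"

text \<open>
  Elements of a quotient by a subspace \<open>N\<close> are cosets. Operations on them are given by a
  representative and do not depend on its choice.
\<close>

definition coset :: "'x::complex_vector set \<Rightarrow> 'x \<Rightarrow> 'x set" where
  "coset N x = {y. y - x \<in> N}"

definition repr :: "'x set \<Rightarrow> 'x" where
  "repr A = (SOME x. x \<in> A)"

definition induced :: "'y::complex_vector set \<Rightarrow> ('x \<Rightarrow> 'y) \<Rightarrow> 'x set \<Rightarrow> 'y set" where
  "induced N f A = coset N (f (repr A))"

text \<open>
  Complex vector spaces are records of type \<open>module\<close>, which extends rings; when there is no
  multiplication the corresponding fields are irrelevant.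
\<close>

definition quot_space :: "'x::complex_vector set \<Rightarrow> 'x set \<Rightarrow> (complex, 'x set) module" where
  "quot_space C N =
    \<lparr>carrier = coset N ` C, mult = undefined, one = undefined, zero = coset N 0,
     add = (\<lambda>A B. coset N (repr A + repr B)), smult = (\<lambda>a A. coset N (a *\<^sub>C repr A))\<rparr>"

definition ideal_on :: "'v set \<Rightarrow> 'v free_alg set \<Rightarrow> 'v free_alg set" where
  "ideal_on X R =
     cspan {p * r * q | p r q. p \<in> free_on (words_on X) \<and> r \<in> R \<and> q \<in> free_on (words_on X)}"

definition quot_alg :: "'v set \<Rightarrow> 'v free_alg set \<Rightarrow> (complex, 'v free_alg set) module" where
  "quot_alg X I =
     (quot_space (free_on (words_on X)) I)
       \<lparr>mult := (\<lambda>A B. coset I (repr A * repr B)), one := coset I 1\<rparr>"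

definition linear_relators :: "'v::complex_vector set \<Rightarrow> 'v free_alg set" where
  "linear_relators X =
     {letter (v + w) - letter v - letter w | v w. v \<in> X \<and> w \<in> X} \<union>
     {letter (a *\<^sub>C v) - a *\<^sub>C letter v | a v. v \<in> X}"


section \<open>Clifford algebras and exterior algebras\<close>

definition clifford_ideal :: "('v::hermitian_space \<Rightarrow> 'v) \<Rightarrow> 'v free_alg set" where
  "clifford_ideal c = ideal_on UNIV
     (linear_relators UNIV \<union>
      {letter v * letter w + letter w * letter v - cinner (c v) w *\<^sub>C 1 | v w. True})"

definition clifford :: "('v::hermitian_space \<Rightarrow> 'v) \<Rightarrow> (complex, 'v free_alg set) module" where
  "clifford c = quot_alg UNIV (clifford_ideal c)"

type_synonym 'v ext = "'v free_alg set"

definition ext_ideal :: "'v::hermitian_space set \<Rightarrow> 'v free_alg set" where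
  "ext_ideal L = ideal_on L (linear_relators L \<union> {letter v * letter v | v. v \<in> L})"

definition exterior :: "'v::hermitian_space set \<Rightarrow> (complex, 'v ext) module" where
  "exterior L = quot_alg L (ext_ideal L)"

definition ext_gen :: "'v::hermitian_space set \<Rightarrow> 'v \<Rightarrow> 'v ext" where
  "ext_gen L v = coset (ext_ideal L) (letter v)"

text \<open>\<open>(-1)\<^bsup>|\<xi>|\<^esup> \<xi>\<close> on homogeneous elements.\<close>

definition ext_parity :: "'v::hermitian_space set \<Rightarrow> 'v ext \<Rightarrow> 'v ext" where
  "ext_parity L = induced (ext_ideal L)
     (lin_ext (\<lambda>w. (-1) ^ length (letters w) *\<^sub>C Poly_Mapping.single w 1))"

text \<open>The odd derivation with \<open>\<iota>(v) w = \<langle>v, w\<rangle>\<close>, on words and on the exterior algebra.\<close>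

primrec contract_list :: "'v::hermitian_space \<Rightarrow> 'v list \<Rightarrow> 'v free_alg" where
  "contract_list v [] = 0"
| "contract_list v (w # ws) =
     cinner v w *\<^sub>C Poly_Mapping.single (Word ws) 1 - letter w * contract_list v ws"

definition contract :: "'v::hermitian_space set \<Rightarrow> 'v \<Rightarrow> 'v ext \<Rightarrow> 'v ext" where
  "contract L v = induced (ext_ideal L) (lin_ext (\<lambda>w. contract_list v (letters w)))"

text \<open>
  Action of \<open>v \<in> V\<close> on \<open>\<Lambda>L\<close>: with \<open>v = l + c l'\<close>, \<open>l, l' \<in> L\<close>, one has \<open>l = P\<^sub>L v\<close> and
  \<open>l' = c (v - P\<^sub>L v)\<close>.
\<close>

definition spin_act :: "('v::hermitian_space \<Rightarrow> 'v) \<Rightarrow> 'v set \<Rightarrow> 'v \<Rightarrow> 'v ext \<Rightarrow> 'v ext" where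
  "spin_act c L v \<xi> =
     ext_gen L (proj L v) \<otimes>\<^bsub>exterior L\<^esub> \<xi> \<oplus>\<^bsub>exterior L\<^esub> contract L (c (v - proj L v)) \<xi>"

definition ext_map :: "'w::hermitian_space set \<Rightarrow> ('v \<Rightarrow> 'w) \<Rightarrow> 'v ext \<Rightarrow> 'w ext" where
  "ext_map L' f = induced (ext_ideal L')
     (lin_ext (\<lambda>w. Poly_Mapping.single (Word (map f (letters w))) 1))"

definition ext_top :: "'v::hermitian_space set \<Rightarrow> (complex, 'v ext) module" where
  "ext_top K = (exterior K)\<lparr>carrier := coset (ext_ideal K) `
     {x \<in> free_on (words_on K). \<forall>w\<in>Poly_Mapping.keys x. length (letters w) = cdim K}\<rparr>"


section \<open>Bimodules over Clifford algebras and tensor products\<close>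

text \<open>
  The record stores the actions of the generating spaces \<open>'p\<close> and \<open>'q\<close>; the resulting actions
  of the Clifford algebras are \<open>cl_left\<close> and \<open>cl_right\<close>.
\<close>

record ('p, 'q, 'm) bimod = "(complex, 'm) module" +
  lact :: "'p \<Rightarrow> 'm \<Rightarrow> 'm"
  ract :: "'m \<Rightarrow> 'q \<Rightarrow> 'm"

definition cl_left :: "('p, 'q, 'm) bimod \<Rightarrow> 'p free_alg set \<Rightarrow> 'm \<Rightarrow> 'm" where
  "cl_left M a m = mod_ext M (\<lambda>w. foldr (lact M) (letters w) m) (repr a)"

definition cl_right :: "('p, 'q, 'm) bimod \<Rightarrow> 'm \<Rightarrow> 'q free_alg set \<Rightarrow> 'm" where
  "cl_right M m a = mod_ext M (\<lambda>w. foldl (ract M) m (letters w)) (repr a)"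

definition bimod_iso :: "('p::hermitian_space \<Rightarrow> 'p) \<Rightarrow> ('q::hermitian_space \<Rightarrow> 'q) \<Rightarrow>
    ('p, 'q, 'm) bimod \<Rightarrow> ('p, 'q, 'n) bimod \<Rightarrow> ('m \<Rightarrow> 'n) \<Rightarrow> bool" where
  "bimod_iso cp cq M N f \<longleftrightarrow>
     bij_betw f (carrier M) (carrier N) \<and>
     (\<forall>x\<in>carrier M. \<forall>y\<in>carrier M. f (x \<oplus>\<^bsub>M\<^esub> y) = f x \<oplus>\<^bsub>N\<^esub> f y) \<and>
     (\<forall>a. \<forall>x\<in>carrier M. f (a \<odot>\<^bsub>M\<^esub> x) = a \<odot>\<^bsub>N\<^esub> f x) \<and>
     (\<forall>a\<in>carrier (clifford cp). \<forall>x\<in>carrier M. f (cl_left M a x) = cl_left N a (f x)) \<and>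
     (\<forall>a\<in>carrier (clifford cq). \<forall>x\<in>carrier M. f (cl_right M x a) = cl_right N (f x) a)"

definition ext_bimod :: "('a::hermitian_space \<Rightarrow> 'a) \<Rightarrow> ('b::hermitian_space \<Rightarrow> 'b) \<Rightarrow>
    ('a \<times> 'b) set \<Rightarrow> ('a, 'b, ('a \<times> 'b) ext) bimod" where
  "ext_bimod ci cj L = module.extend (exterior L)
     (bimod.fields
       (\<lambda>w \<xi>. spin_act (pair_conj ci cj) L (w, 0) \<xi>)
       (\<lambda>\<xi> w. spin_act (pair_conj ci cj) L (0, w) (ext_parity L \<xi>)))"

text \<open>Tensor products are quotients of the free vector space on the pairs \<open>(m, n)\<close>.\<close>

type_synonym ('m, 'n) tens = "('m \<times> 'n \<Rightarrow>\<^sub>0 complex) set"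

definition bilinear_relators ::
  "(complex, 'm, 'r) module_scheme \<Rightarrow> (complex, 'n, 's) module_scheme \<Rightarrow> ('m, 'n) tens" where
  "bilinear_relators M N = (let e = (\<lambda>m n. Poly_Mapping.single (m, n) 1) in
     {e (m \<oplus>\<^bsub>M\<^esub> m') n - e m n - e m' n | m m' n. m \<in> carrier M \<and> m' \<in> carrier M \<and> n \<in> carrier N} \<union>
     {e m (n \<oplus>\<^bsub>N\<^esub> n') - e m n - e m n' | m n n'. m \<in> carrier M \<and> n \<in> carrier N \<and> n' \<in> carrier N} \<union>
     {e (a \<odot>\<^bsub>M\<^esub> m) n - a *\<^sub>C e m n | a m n. m \<in> carrier M \<and> n \<in> carrier N} \<union>
     {e m (a \<odot>\<^bsub>N\<^esub> n) - a *\<^sub>C e m n | a m n. m \<in> carrier M \<and> n \<in> carrier N})"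

definition balanced_relators :: "('q::hermitian_space \<Rightarrow> 'q) \<Rightarrow>
    ('p, 'q, 'm) bimod \<Rightarrow> ('q, 'r, 'n) bimod \<Rightarrow> ('m, 'n) tens" where
  "balanced_relators c M N =
     {Poly_Mapping.single (cl_right M m a, n) 1 - Poly_Mapping.single (m, cl_left N a n) 1 | m a n.
        m \<in> carrier M \<and> a \<in> carrier (clifford c) \<and> n \<in> carrier N}"

definition tens_null :: "(complex, 'm, 'r) module_scheme \<Rightarrow> (complex, 'n, 's) module_scheme \<Rightarrow>
    ('m, 'n) tens" where
  "tens_null M N = cspan (bilinear_relators M N)"

definition cl_tens_null :: "('q::hermitian_space \<Rightarrow> 'q) \<Rightarrow>
    ('p, 'q, 'm) bimod \<Rightarrow> ('q, 'r, 'n) bimod \<Rightarrow> ('m, 'n) tens" where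
  "cl_tens_null c M N = cspan (bilinear_relators M N \<union> balanced_relators c M N)"

text \<open>The linear map on a tensor product induced by a bilinear (balanced) map with values in \<open>T\<close>.\<close>

definition tens_lift :: "(complex, 't, 'r) module_scheme \<Rightarrow> ('m \<Rightarrow> 'n \<Rightarrow> 't) \<Rightarrow> ('m, 'n) tens \<Rightarrow> 't" where
  "tens_lift T f x = mod_ext T (\<lambda>(m, n). f m n) (repr x)"

definition tens :: "(complex, 'm, 'r) module_scheme \<Rightarrow> (complex, 'n, 's) module_scheme \<Rightarrow>
    (complex, ('m, 'n) tens) module" where
  "tens M N = quot_space (free_on (carrier M \<times> carrier N)) (tens_null M N)"

definition pure :: "(complex, 'm, 'r) module_scheme \<Rightarrow> (complex, 'n, 's) module_scheme \<Rightarrow>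
    'm \<Rightarrow> 'n \<Rightarrow> ('m, 'n) tens" where
  "pure M N m n = coset (tens_null M N) (Poly_Mapping.single (m, n) 1)"

definition cl_pure :: "('q::hermitian_space \<Rightarrow> 'q) \<Rightarrow>
    ('p, 'q, 'm) bimod \<Rightarrow> ('q, 'r, 'n) bimod \<Rightarrow> 'm \<Rightarrow> 'n \<Rightarrow> ('m, 'n) tens" where
  "cl_pure c M N m n = coset (cl_tens_null c M N) (Poly_Mapping.single (m, n) 1)"

definition cl_tens :: "('q::hermitian_space \<Rightarrow> 'q) \<Rightarrow>
    ('p, 'q, 'm) bimod \<Rightarrow> ('q, 'r, 'n) bimod \<Rightarrow> ('p, 'r, ('m, 'n) tens) bimod" where
  "cl_tens c M N =
     (let T = quot_space (free_on (carrier M \<times> carrier N)) (cl_tens_null c M N)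
      in module.extend T (bimod.fields
           (\<lambda>w. tens_lift T (\<lambda>m n. cl_pure c M N (lact M w m) n))
           (\<lambda>x w. tens_lift T (\<lambda>m n. cl_pure c M N m (ract N n w)) x)))"

text \<open>\<open>M \<otimes> \<Lambda>\<^sup>t\<^sup>o\<^sup>pK\<close> as a bimodule; elements of \<open>\<Lambda>\<^sup>t\<^sup>o\<^sup>pK\<close> have parity \<open>dim K\<close>.\<close>

definition top_twist :: "('p, 'q, 'm) bimod \<Rightarrow> 'k::hermitian_space set \<Rightarrow>
    ('p, 'q, ('m, 'k ext) tens) bimod" where
  "top_twist M K =
     (let T = tens M (ext_top K)
      in module.extend T (bimod.fields
           (\<lambda>w. tens_lift T (\<lambda>\<xi> \<kappa>. pure M (ext_top K) (lact M w \<xi>) \<kappa>))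
           (\<lambda>x w. tens_lift T
              (\<lambda>\<xi> \<kappa>. (-1) ^ cdim K \<odot>\<^bsub>T\<^esub> pure M (ext_top K) (ract M \<xi> w) \<kappa>) x)))"


section \<open>Canonical maps between tensor products\<close>

text \<open>\<open>f \<otimes> g\<close> with target \<open>M' \<otimes> N'\<close>, over the complex numbers and over a Clifford algebra.\<close>

definition tens_map :: "(complex, 'm', 'r) module_scheme \<Rightarrow> (complex, 'n', 's) module_scheme \<Rightarrow>
    ('m \<Rightarrow> 'm') \<Rightarrow> ('n \<Rightarrow> 'n') \<Rightarrow> ('m, 'n) tens \<Rightarrow> ('m', 'n') tens" where
  "tens_map M' N' f g = tens_lift (tens M' N') (\<lambda>m n. pure M' N' (f m) (g n))"

definition cl_tens_map :: "('q::hermitian_space \<Rightarrow> 'q) \<Rightarrow>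
    ('p, 'q, 'm') bimod \<Rightarrow> ('q, 'r, 'n') bimod \<Rightarrow>
    ('m \<Rightarrow> 'm') \<Rightarrow> ('n \<Rightarrow> 'n') \<Rightarrow> ('m, 'n) tens \<Rightarrow> ('m', 'n') tens" where
  "cl_tens_map c M' N' f g = tens_lift (cl_tens c M' N') (\<lambda>m n. cl_pure c M' N' (f m) (g n))"

text \<open>\<open>\<Lambda>\<^sup>t\<^sup>o\<^sup>p(A \<oplus> B) \<cong> \<Lambda>\<^sup>t\<^sup>o\<^sup>pA \<otimes> \<Lambda>\<^sup>t\<^sup>o\<^sup>pB\<close>, the inverse of \<open>a \<otimes> b \<mapsto> a \<and> b\<close>.\<close>

definition top_split :: "'a::hermitian_space set \<Rightarrow> 'b::hermitian_space set \<Rightarrow>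
    ('a \<times> 'b) ext \<Rightarrow> ('a ext, 'b ext) tens" where
  "top_split A B = inv_into (carrier (tens (ext_top A) (ext_top B)))
     (tens_lift (exterior (A \<times> B))
       (\<lambda>a b. ext_map (A \<times> B) (\<lambda>v. (v, 0)) a \<otimes>\<^bsub>exterior (A \<times> B)\<^esub> ext_map (A \<times> B) (\<lambda>w. (0, w)) b))"

text \<open>\<open>a \<otimes> b \<mapsto> (-1)\<^bsup>|a||b|\<^esup> b \<otimes> a\<close>.\<close>

definition top_swap :: "'a::hermitian_space set \<Rightarrow> 'b::hermitian_space set \<Rightarrow>
    ('a ext, 'b ext) tens \<Rightarrow> ('b ext, 'a ext) tens" where
  "top_swap A B = tens_lift (tens (ext_top B) (ext_top A))
     (\<lambda>a b. (-1) ^ (cdim A * cdim B) \<odot>\<^bsub>tens (ext_top B) (ext_top A)\<^esub> pure (ext_top B) (ext_top A) b a)"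

text \<open>\<open>M \<otimes> (\<Lambda>\<^sup>t\<^sup>o\<^sup>pA \<otimes> \<Lambda>\<^sup>t\<^sup>o\<^sup>pB) \<cong> (M \<otimes> \<Lambda>\<^sup>t\<^sup>o\<^sup>pA) \<otimes> \<Lambda>\<^sup>t\<^sup>o\<^sup>pB\<close>.\<close>

definition assoc_top :: "('p, 'q, 'm) bimod \<Rightarrow> 'a::hermitian_space set \<Rightarrow> 'b::hermitian_space set \<Rightarrow>
    ('m, ('a ext, 'b ext) tens) tens \<Rightarrow> (('m, 'a ext) tens, 'b ext) tens" where
  "assoc_top M A B =
     (let T = tens (top_twist M A) (ext_top B)
      in tens_lift T (\<lambda>\<xi>. tens_lift T
           (\<lambda>a b. pure (top_twist M A) (ext_top B) (pure M (ext_top A) \<xi> a) b)))"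

text \<open>\<open>(M \<otimes>\<^sub>C\<^sub>l N) \<otimes> \<Lambda>\<^sup>t\<^sup>o\<^sup>pK \<cong> M \<otimes>\<^sub>C\<^sub>l (N \<otimes> \<Lambda>\<^sup>t\<^sup>o\<^sup>pK)\<close>.\<close>

definition assoc_twist :: "('q::hermitian_space \<Rightarrow> 'q) \<Rightarrow>
    ('p, 'q, 'm) bimod \<Rightarrow> ('q, 'r, 'n) bimod \<Rightarrow> 'k::hermitian_space set \<Rightarrow>
    (('m, 'n) tens, 'k ext) tens \<Rightarrow> ('m, ('n, 'k ext) tens) tens" where
  "assoc_twist c M N K =
     (let T = cl_tens c M (top_twist N K)
      in tens_lift T (\<lambda>x \<kappa>. tens_lift T
           (\<lambda>\<xi> \<eta>. cl_pure c M (top_twist N K) \<xi> (pure N (ext_top K) \<eta> \<kappa>)) x))"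

text \<open>
  \<open>(M \<otimes>\<^sub>C\<^sub>l \<Lambda>L) \<otimes> \<Lambda>\<^sup>t\<^sup>o\<^sup>pK \<cong> (M \<otimes> \<Lambda>\<^sup>t\<^sup>o\<^sup>pK) \<otimes>\<^sub>C\<^sub>l \<Lambda>L\<close>, mapping
  \<open>(\<xi> \<otimes> \<eta>) \<otimes> \<kappa>\<close> to \<open>(-1)\<^bsup>|\<eta>||\<kappa>|\<^esup> (\<xi> \<otimes> \<kappa>) \<otimes> \<eta>\<close>; the sign is the parity
  operator applied \<open>|\<kappa>| = dim K\<close> times to \<open>\<eta>\<close>.
\<close>

definition interchange_twist ::
  "('b::hermitian_space \<Rightarrow> 'b) \<Rightarrow> ('d::hermitian_space \<Rightarrow> 'd) \<Rightarrow>
   ('p, 'b, 'm) bimod \<Rightarrow> ('b \<times> 'd) set \<Rightarrow> 'k::hermitian_space set \<Rightarrow>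
   (('m, ('b \<times> 'd) ext) tens, 'k ext) tens \<Rightarrow> (('m, 'k ext) tens, ('b \<times> 'd) ext) tens" where
  "interchange_twist cb cd M L K =
     (let F = ext_bimod cb cd L; T = cl_tens cb (top_twist M K) F
      in tens_lift T (\<lambda>x \<kappa>. tens_lift T
           (\<lambda>\<xi> \<eta>. cl_pure cb (top_twist M K) F
             (pure M (ext_top K) \<xi> \<kappa>) ((ext_parity L ^^ cdim K) \<eta>)) x))"

definition cl_assoc :: "('b::hermitian_space \<Rightarrow> 'b) \<Rightarrow> ('c::hermitian_space \<Rightarrow> 'c) \<Rightarrow>
    ('a, 'b, 'l) bimod \<Rightarrow> ('b, 'c, 'm) bimod \<Rightarrow> ('c, 'd, 'n) bimod \<Rightarrow>
    (('l, 'm) tens, 'n) tens \<Rightarrow> ('l, ('m, 'n) tens) tens" where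
  "cl_assoc cb cc L M N =
     (let T = cl_tens cb L (cl_tens cc M N)
      in tens_lift T (\<lambda>x \<zeta>. tens_lift T
           (\<lambda>\<xi> \<eta>. cl_pure cb L (cl_tens cc M N) \<xi> (cl_pure cc M N \<eta> \<zeta>)) x))"


section \<open>Gluing isomorphisms\<close>

definition gluing_iso ::
  "('a::hermitian_space \<Rightarrow> 'a) \<Rightarrow> ('b::hermitian_space \<Rightarrow> 'b) \<Rightarrow> ('c::hermitian_space \<Rightarrow> 'c) \<Rightarrow>
   ('a \<times> 'b) set \<Rightarrow> ('b \<times> 'c) set \<Rightarrow>
   ((('a \<times> 'c) ext, 'b ext) tens \<Rightarrow> (('a \<times> 'b) ext, ('b \<times> 'c) ext) tens) \<Rightarrow> bool" where
  "gluing_iso ci cj ck Lij Ljk \<alpha> \<longleftrightarrow>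
     (let Lik = Lij O Ljk; K = Kspace Lij Ljk;
          Fij = ext_bimod ci cj Lij; Fjk = ext_bimod cj ck Ljk; Fik = ext_bimod ci ck Lik
      in bimod_iso ci ck (top_twist Fik K) (cl_tens cj Fij Fjk) \<alpha> \<and>
         (\<forall>us. set us \<subseteq> K \<and> length us = cdim K \<longrightarrow>
            \<alpha> (pure Fik (ext_top K) \<one>\<^bsub>exterior Lik\<^esub>
                 (foldr (\<lambda>u x. ext_gen K u \<otimes>\<^bsub>exterior K\<^esub> x) us \<one>\<^bsub>exterior K\<^esub>)) =
            cl_pure cj Fij Fjk (foldl (ract Fij) \<one>\<^bsub>exterior Lij\<^esub> us) \<one>\<^bsub>exterior Ljk\<^esub>))"


section \<open>The comparison map and its determinant\<close>

definition rho0 :: "'b::hermitian_space set \<Rightarrow> 'b set \<Rightarrow> ('a \<times> 'b) set \<Rightarrow> 'a \<Rightarrow> 'b" where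
  "rho0 K123 K023 L12 u1 = (THE u2. u2 \<in> orth K123 \<inter> K023 \<and> (u1, u2) \<in> L12)"

definition rho :: "'a::hermitian_space set \<Rightarrow> 'b::hermitian_space set \<Rightarrow> 'b set \<Rightarrow> ('a \<times> 'b) set \<Rightarrow>
    'a \<times> 'b \<Rightarrow> 'a \<times> 'b" where
  "rho K012 K123 K023 L12 =
     (\<lambda>(x, u2). (proj K012 x, u2 + rho0 K123 K023 L12 (x - proj K012 x)))"

definition adjoint_on :: "'v::hermitian_space set \<Rightarrow> ('v \<Rightarrow> 'w::hermitian_space) \<Rightarrow> 'w \<Rightarrow> 'v" where
  "adjoint_on K f y = (THE x. x \<in> K \<and> (\<forall>k\<in>K. cinner x k = cinner y (f k)))"

text \<open>
  Determinant of an endomorphism of a finite-dimensional subspace \<open>K\<close>: the Leibniz formula for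
  its matrix in an arbitrary basis, with the basis vectors themselves as row and column indices.
\<close>

definition endo_det :: "'v::complex_vector set \<Rightarrow> ('v \<Rightarrow> 'v) \<Rightarrow> complex" where
  "endo_det K T =
     (let B = (SOME B. \<not> cdependent B \<and> cspan B = K)
      in \<Sum>p | p permutes B. of_int (sign p) * (\<Prod>b\<in>B. crepresentation B (T b) (p b)))"

end

theory Submission imports Defs
begin

text \<open>
  Both composites are linear, commute with the left action of \<open>Cl(W\<^sub>0)\<close> on \<open>\<Lambda>L\<^sub>0\<^sub>3\<close>, and commute with the
  right action of \<open>Cl(W\<^sub>3)\<close> up to a sign, which is the same for both because
  \<open>dim K\<^sub>0\<^sub>1\<^sub>3 + dim K\<^sub>1\<^sub>2\<^sub>3 = dim K\<^sub>0\<^sub>1\<^sub>2 + dim K\<^sub>0\<^sub>2\<^sub>3\<close>. The vacuum generates \<open>\<Lambda>L\<^sub>0\<^sub>3\<close> and a top exterior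
  power is a line, so one value on vacuum \<open>\<otimes>\<close> generator decides.

  Let \<open>as\<close>, \<open>bs\<close>, \<open>\<beta>s\<close> be orthonormal bases of \<open>K\<^sub>0\<^sub>1\<^sub>2\<close>, of \<open>K\<^sub>1\<^sub>2\<^sub>3\<close>, and of the orthogonal complement of
  \<open>K\<^sub>1\<^sub>2\<^sub>3\<close> in \<open>K\<^sub>0\<^sub>2\<^sub>3\<close>. Let \<open>ps = \<rho>\<^sub>0\<^sup>-\<^sup>1 \<beta>s\<close>, and let \<open>cs = \<rho>\<^sub>0\<^sup>* \<beta>s\<close>, which is the basis dual to \<open>ps\<close>.
  Write \<open>inserted A B\<close> for \<open>\<Omega>\<^sub>0\<^sub>1\<cdot>A \<otimes> (\<Omega>\<^sub>1\<^sub>2\<cdot>B \<otimes> \<Omega>\<^sub>2\<^sub>3)\<close>. The defining property of the \<open>\<alpha>\<close> gives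
  \<open>inserted (as @ cs) bs\<close> for the first composite on \<open>as \<and> cs \<and> bs\<close>, and it gives
  \<open>inserted as (\<beta>s @ bs) / det(\<rho>\<^sup>*\<rho>)\<close> for the second one on \<open>as \<and> ps \<and> bs\<close>
  (\<open>first_on_vacuum\<close>, \<open>second_on_vacuum\<close>). The endomorphism \<open>\<rho>\<^sup>*\<rho>\<close> fixes \<open>as\<close> and \<open>bs\<close> and maps \<open>ps\<close> to
  \<open>cs\<close>, so the first wedge product is \<open>det(\<rho>\<^sup>*\<rho>)\<close> times the second (\<open>wdg_gs\<close>). This is where the
  determinant comes from, and it remains to see that \<open>inserted (as @ cs) bs = inserted as (\<beta>s @ bs)\<close>.

  A vector \<open>c\<close> on the left of \<open>\<Omega>\<^sub>1\<^sub>2\<close> can be traded for a vector \<open>\<beta>\<close> on its right if \<open>c = x + x'\<close> and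
  \<open>\<beta> = y' - y\<close> where \<open>(z, x)\<close>, \<open>(x', y)\<close>, \<open>(y', v)\<close> lie in the conjugates of \<open>L\<^sub>0\<^sub>1\<close>, \<open>L\<^sub>1\<^sub>2\<close>, \<open>L\<^sub>2\<^sub>3\<close> and
  so annihilate the vacua: \<open>x\<close> moves out to \<open>W\<^sub>0\<close> through \<open>\<Omega>\<^sub>0\<^sub>1\<close>, \<open>x'\<close> becomes \<open>-y\<close> at \<open>\<Omega>\<^sub>1\<^sub>2\<close>, and \<open>y'\<close> moves
  out to \<open>W\<^sub>3\<close> through \<open>\<Omega>\<^sub>2\<^sub>3\<close>. All correction terms are words that are orthogonal to some
  \<open>(p, \<rho>\<^sub>0 p)\<close>, and such words vanish (\<open>incomplete_word_vanishes\<close>, \<open>vector_passes_middle\<close>). The pairs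
  \<open>(c, \<beta>)\<close> that can be traded in this way span everything modulo \<open>K\<^sub>0\<^sub>1\<^sub>3 \<oplus> K\<^sub>1\<^sub>2\<^sub>3\<close>, so they are described by
  orthogonality relations, and those hold for \<open>c = \<rho>\<^sub>0\<^sup>* \<beta>\<close> (\<open>cs_pass\<close>).

  The spanning statement needs \<open>W\<^sub>j = A + B + K\<^sub>i\<^sub>j\<^sub>k\<close>, where \<open>A\<close> and \<open>B\<close> are the
  projections to \<open>W\<^sub>j\<close> of the conjugates of \<open>L\<^sub>i\<^sub>j\<close> and \<open>L\<^sub>j\<^sub>k\<close>. This follows from the bijectivity of
  \<open>\<alpha>\<^sub>i\<^sub>j\<^sub>k\<close>: a functional that vanishes on the right-hand side gives an odd derivation of
  \<open>\<Lambda>L\<^sub>i\<^sub>j \<otimes> \<Lambda>L\<^sub>j\<^sub>k\<close> that kills the generator, hence everything, and this forces the functional to be zero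
  (\<open>functional_zero\<close>, \<open>middle_space_spanned\<close>).
\<close>

section \<open>Complex modules as records\<close>

text \<open>
  Quotients of free vector spaces, algebras and bimodules are all records with the fields of a module,
  and the scalars are the type of complex numbers instead of a ring record. The locale speaks about the
  additive and scalar fields only, so it applies to all of them.
\<close>

locale cmod = abelian_group M for M :: "(complex, 'm, 'r) module_scheme" (structure) +
  assumes smult_closed [simp, intro]: "x \<in> carrier M \<Longrightarrow> a \<odot> x \<in> carrier M"
    and smult_l_distr: "x \<in> carrier M \<Longrightarrow> (a + b) \<odot> x = a \<odot> x \<oplus> b \<odot> x"
    and smult_r_distr: "x \<in> carrier M \<Longrightarrow> y \<in> carrier M \<Longrightarrow> a \<odot> (x \<oplus> y) = a \<odot> x \<oplus> a \<odot> y"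
    and smult_assoc: "x \<in> carrier M \<Longrightarrow> a \<odot> (b \<odot> x) = (a * b) \<odot> x"
    and smult_one: "x \<in> carrier M \<Longrightarrow> 1 \<odot> x = x"
begin

lemma smult_zero_left [simp]: "x \<in> carrier M \<Longrightarrow> 0 \<odot> x = \<zero>"
  using smult_l_distr[of x 0 0] by (metis add.r_cancel_one' add_0 smult_closed)

lemma smult_zero_right [simp]: "a \<odot> \<zero> = \<zero>"
  by (metis mult_zero_right smult_assoc smult_zero_left zero_closed)

lemma smult_minus_one: "x \<in> carrier M \<Longrightarrow> (-1) \<odot> x = \<ominus> x"
  by (metis add.inv_equality add.left_inverse smult_closed smult_l_distr smult_one smult_zero_left)

lemma smult_minus_left: "x \<in> carrier M \<Longrightarrow> (- a) \<odot> x = \<ominus> (a \<odot> x)"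
  by (metis mult_minus1 smult_assoc smult_closed smult_minus_one)

lemma smult_minus_right: "x \<in> carrier M \<Longrightarrow> a \<odot> (\<ominus> x) = \<ominus> (a \<odot> x)"
  by (metis mult.commute mult_minus1 smult_assoc smult_closed smult_minus_one)

lemma smult_eq_zero: "x \<in> carrier M \<Longrightarrow> a \<noteq> 0 \<Longrightarrow> a \<odot> x = \<zero> \<Longrightarrow> x = \<zero>"
  by (metis left_inverse smult_assoc smult_one smult_zero_right)

lemma add_eq_zero_iff: "x \<in> carrier M \<Longrightarrow> y \<in> carrier M \<Longrightarrow> x \<oplus> y = \<zero> \<longleftrightarrow> x = \<ominus> y"
  by (metis add.inv_closed add.inv_equality add.l_inv)

end

lemma cmod_cong:
  assumes "cmod M" "carrier M' = carrier M" "add M' = add M" "zero M' = zero M" "smult M' = smult M"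
  shows "cmod M'"
proof -
  interpret cmod M by fact
  have "abelian_group M'"
    by (rule abelian_groupI) (simp_all add: assms(2-5) a_ac add.l_inv_ex)
  then interpret A: abelian_group M' .
  show ?thesis
    by unfold_locales
      (simp_all add: assms(2-5) smult_l_distr smult_r_distr smult_assoc smult_one)
qed

definition clin :: "(complex, 'm, 'r) module_scheme \<Rightarrow> (complex, 'n, 's) module_scheme \<Rightarrow> ('m \<Rightarrow> 'n) \<Rightarrow> bool" where
  "clin M N f \<longleftrightarrow> (\<forall>x\<in>carrier M. f x \<in> carrier N) \<and>
     (\<forall>x\<in>carrier M. \<forall>y\<in>carrier M. f (x \<oplus>\<^bsub>M\<^esub> y) = f x \<oplus>\<^bsub>N\<^esub> f y) \<and>
     (\<forall>a. \<forall>x\<in>carrier M. f (a \<odot>\<^bsub>M\<^esub> x) = a \<odot>\<^bsub>N\<^esub> f x)"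

lemma clinI:
  assumes "\<And>x. x \<in> carrier M \<Longrightarrow> f x \<in> carrier N"
    and "\<And>x y. x \<in> carrier M \<Longrightarrow> y \<in> carrier M \<Longrightarrow> f (x \<oplus>\<^bsub>M\<^esub> y) = f x \<oplus>\<^bsub>N\<^esub> f y"
    and "\<And>a x. x \<in> carrier M \<Longrightarrow> f (a \<odot>\<^bsub>M\<^esub> x) = a \<odot>\<^bsub>N\<^esub> f x"
  shows "clin M N f"
  using assms by (auto simp: clin_def)

lemma clin_closed: "clin M N f \<Longrightarrow> x \<in> carrier M \<Longrightarrow> f x \<in> carrier N"
  and clin_add: "clin M N f \<Longrightarrow> x \<in> carrier M \<Longrightarrow> y \<in> carrier M \<Longrightarrow> f (x \<oplus>\<^bsub>M\<^esub> y) = f x \<oplus>\<^bsub>N\<^esub> f y"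
  and clin_smult: "clin M N f \<Longrightarrow> x \<in> carrier M \<Longrightarrow> f (a \<odot>\<^bsub>M\<^esub> x) = a \<odot>\<^bsub>N\<^esub> f x"
  by (auto simp: clin_def)

lemma clin_zero:
  assumes "cmod M" "cmod N" "clin M N f" shows "f \<zero>\<^bsub>M\<^esub> = \<zero>\<^bsub>N\<^esub>"
proof -
  interpret M: cmod M by fact
  interpret N: cmod N by fact
  have "f (0 \<odot>\<^bsub>M\<^esub> \<zero>\<^bsub>M\<^esub>) = 0 \<odot>\<^bsub>N\<^esub> f \<zero>\<^bsub>M\<^esub>" using assms(3) by (intro clin_smult) auto
  then show ?thesis using clin_closed[OF assms(3), of "\<zero>\<^bsub>M\<^esub>"] by simp
qed

lemma clin_uminus:
  assumes "cmod M" "cmod N" "clin M N f" "x \<in> carrier M" shows "f (\<ominus>\<^bsub>M\<^esub> x) = \<ominus>\<^bsub>N\<^esub> f x"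
  using assms by (metis clin_closed clin_smult cmod.smult_minus_one)

lemma clin_comp: "clin M N f \<Longrightarrow> clin N P g \<Longrightarrow> clin M P (\<lambda>x. g (f x))"
  by (auto simp: clin_def)

lemma clin_id: "clin M M (\<lambda>x. x)"
  by (auto simp: clin_def)

lemma clin_plus:
  assumes "cmod N" "clin M N f" "clin M N g"
  shows "clin M N (\<lambda>x. f x \<oplus>\<^bsub>N\<^esub> g x)"
proof -
  interpret N: cmod N by fact
  show ?thesis using assms(2,3)
    by (auto simp: clin_def N.smult_r_distr N.a_ac)
qed

lemma clin_scale:
  assumes "cmod N" "clin M N f"
  shows "clin M N (\<lambda>x. a \<odot>\<^bsub>N\<^esub> f x)"
proof -
  interpret N: cmod N by fact
  show ?thesis using assms(2)
    by (auto simp: clin_def N.smult_r_distr N.smult_assoc mult.commute)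
qed

text \<open>
  Bilinearity is linearity in each argument, so that compositions of bilinear and linear maps are
  obtained by composing linear maps.
\<close>

definition cbilin :: "(complex, 'm, 'r) module_scheme \<Rightarrow> (complex, 'n, 's) module_scheme \<Rightarrow>
   (complex, 't, 'u) module_scheme \<Rightarrow> ('m \<Rightarrow> 'n \<Rightarrow> 't) \<Rightarrow> bool" where
  "cbilin M N T f \<longleftrightarrow> (\<forall>m\<in>carrier M. clin N T (f m)) \<and> (\<forall>n\<in>carrier N. clin M T (\<lambda>m. f m n))"

lemma cbilinI:
  assumes "\<And>m. m \<in> carrier M \<Longrightarrow> clin N T (f m)" "\<And>n. n \<in> carrier N \<Longrightarrow> clin M T (\<lambda>m. f m n)"
  shows "cbilin M N T f"
  using assms by (auto simp: cbilin_def)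

lemma cbilinD1: "cbilin M N T f \<Longrightarrow> m \<in> carrier M \<Longrightarrow> clin N T (f m)"
  and cbilinD2: "cbilin M N T f \<Longrightarrow> n \<in> carrier N \<Longrightarrow> clin M T (\<lambda>m. f m n)"
  by (auto simp: cbilin_def)

lemma cbilin_closed: "cbilin M N T f \<Longrightarrow> m \<in> carrier M \<Longrightarrow> n \<in> carrier N \<Longrightarrow> f m n \<in> carrier T"
  by (auto simp: cbilin_def clin_def)

lemma cbilin_comp:
  assumes "cbilin M' N' T f" "clin M M' g" "clin N N' h"
  shows "cbilin M N T (\<lambda>m n. f (g m) (h n))"
  using assms by (auto simp: cbilin_def clin_def)

lemma cbilin_comp_left: "cbilin M' N T f \<Longrightarrow> clin M M' g \<Longrightarrow> cbilin M N T (\<lambda>m n. f (g m) n)"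
  by (auto simp: cbilin_def clin_def)

lemma cbilin_comp_right: "cbilin M N' T f \<Longrightarrow> clin N N' h \<Longrightarrow> cbilin M N T (\<lambda>m n. f m (h n))"
  by (auto simp: cbilin_def clin_def)

lemma cbilin_plus:
  assumes "cmod T" "cbilin M N T f" "cbilin M N T g"
  shows "cbilin M N T (\<lambda>m n. f m n \<oplus>\<^bsub>T\<^esub> g m n)"
  using assms by (auto simp: cbilin_def intro: clin_plus)

lemma cbilin_scale:
  assumes "cmod T" "cbilin M N T f"
  shows "cbilin M N T (\<lambda>m n. a \<odot>\<^bsub>T\<^esub> f m n)"
  using assms by (auto simp: cbilin_def intro: clin_scale)


section \<open>Free vector spaces and their linear extensions\<close>

lemma lookup_scaleC [simp]:
  "Poly_Mapping.lookup (a *\<^sub>C x) k = a *\<^sub>C Poly_Mapping.lookup x k"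
  by (simp add: scaleC_poly_mapping_def Poly_Mapping.map.rep_eq when_def)

lemma scaleC_complex_eq [simp]: "(a::complex) *\<^sub>C b = a * b"
  by (simp add: scaleC_complex_def)

lemma keys_scaleC: "Poly_Mapping.keys (a *\<^sub>C x) \<subseteq> Poly_Mapping.keys x"
  by (auto simp: in_keys_iff)

lemma scaleC_single: "a *\<^sub>C Poly_Mapping.single k b = Poly_Mapping.single k (a *\<^sub>C b)"
  by (rule poly_mapping_eqI) (simp add: lookup_single when_def)

lemma csubspace_free_on: "csubspace (free_on G)"
proof (rule complex_vector.subspaceI)
  show "0 \<in> free_on G" by (simp add: free_on_def)
next
  fix x y :: "'a \<Rightarrow>\<^sub>0 complex" assume "x \<in> free_on G" "y \<in> free_on G"
  then show "x + y \<in> free_on G" using keys_add[of x y] by (auto simp: free_on_def)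
next
  fix a and x :: "'a \<Rightarrow>\<^sub>0 complex" assume "x \<in> free_on G"
  then show "a *\<^sub>C x \<in> free_on G" using keys_scaleC[of a x] by (auto simp: free_on_def)
qed

lemma single_in_free_on [simp]: "Poly_Mapping.single g a \<in> free_on G \<longleftrightarrow> g \<in> G \<or> a = 0"
  by (auto simp: free_on_def)

lemma free_on_UNIV [simp]: "free_on UNIV = UNIV"
  by (auto simp: free_on_def)

lemma poly_mapping_expand:
  fixes x :: "'g \<Rightarrow>\<^sub>0 complex"
  shows "x = (\<Sum>g\<in>Poly_Mapping.keys x. Poly_Mapping.lookup x g *\<^sub>C Poly_Mapping.single g 1)"
proof -
  have lk: "Poly_Mapping.lookup (sum f A) k = (\<Sum>g\<in>A. Poly_Mapping.lookup (f g) k)"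
    for f :: "'g \<Rightarrow> 'g \<Rightarrow>\<^sub>0 complex" and A k
    by (induction A rule: infinite_finite_induct) (auto simp: lookup_add)
  show ?thesis
    by (rule poly_mapping_eqI) (simp add: lk lookup_single when_def if_distrib in_keys_iff cong: if_cong)
qed

lemma free_on_induct [consumes 1, case_names zero add scale gen]:
  fixes x :: "'g \<Rightarrow>\<^sub>0 complex"
  assumes x: "x \<in> free_on G" and 0: "P 0"
    and add: "\<And>x y. x \<in> free_on G \<Longrightarrow> y \<in> free_on G \<Longrightarrow> P x \<Longrightarrow> P y \<Longrightarrow> P (x + y)"
    and scale: "\<And>a x. x \<in> free_on G \<Longrightarrow> P x \<Longrightarrow> P (a *\<^sub>C x)"
    and gen: "\<And>g. g \<in> G \<Longrightarrow> P (Poly_Mapping.single g 1)"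
  shows "P x"
proof -
  have *: "(\<Sum>g\<in>A. c g *\<^sub>C Poly_Mapping.single g 1) \<in> free_on G \<and>
      P (\<Sum>g\<in>A. c g *\<^sub>C Poly_Mapping.single g 1)" if "finite A" "A \<subseteq> G" for A and c :: "'g \<Rightarrow> complex"
    using that
  proof (induction A)
    case empty
    show ?case using 0 by (simp add: free_on_def)
  next
    case (insert g A)
    have 1: "c g *\<^sub>C Poly_Mapping.single g 1 \<in> free_on G"
      using insert by (simp add: scaleC_single)
    have 2: "P (c g *\<^sub>C Poly_Mapping.single g 1)"
      using insert by (intro scale gen) auto
    show ?case using insert 1 2 add complex_vector.subspace_add[OF csubspace_free_on 1]
      by simp
  qed
  show ?thesis
    using *[of "Poly_Mapping.keys x" "Poly_Mapping.lookup x"] x poly_mapping_expand[of x]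
    by (auto simp: free_on_def)
qed

lemma lin_ext_superset:
  assumes "finite A" "Poly_Mapping.keys x \<subseteq> A"
  shows "lin_ext f x = (\<Sum>g\<in>A. Poly_Mapping.lookup x g *\<^sub>C f g)"
  unfolding lin_ext_def
  by (rule sum.mono_neutral_left) (use assms in \<open>auto simp: in_keys_iff\<close>)

lemma lin_ext_add: "lin_ext f (x + y) = lin_ext f x + lin_ext f y"
proof -
  let ?A = "Poly_Mapping.keys x \<union> Poly_Mapping.keys y"
  have "lin_ext f z = (\<Sum>g\<in>?A. Poly_Mapping.lookup z g *\<^sub>C f g)" if "z \<in> {x, y, x + y}" for z
    using that keys_add[of x y] by (intro lin_ext_superset) auto
  then show ?thesis
    by (simp add: lookup_add scaleC_add_left sum.distrib)
qed

lemma lin_ext_scale: "lin_ext f (a *\<^sub>C x) = a *\<^sub>C lin_ext f x"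
  using lin_ext_superset[OF finite_keys keys_scaleC, of f a x]
  by (simp add: lin_ext_def complex_vector.scale_sum_right)

lemma lin_ext_single [simp]: "lin_ext f (Poly_Mapping.single g a) = a *\<^sub>C f g"
  by (simp add: lin_ext_def)

lemma lin_ext_zero [simp]: "lin_ext f 0 = 0"
  by (simp add: lin_ext_def)

lemma lin_ext_minus: "lin_ext f (x - y) = lin_ext f x - lin_ext f y"
  using lin_ext_add[of f "x - y" y] by (simp add: algebra_simps)

lemma lin_ext_in_subspace:
  assumes "csubspace S" "\<And>g. g \<in> G \<Longrightarrow> f g \<in> S" "x \<in> free_on G"
  shows "lin_ext f x \<in> S"
  unfolding lin_ext_def
  by (rule complex_vector.subspace_sum) (use assms in \<open>auto simp: free_on_def intro: complex_vector.subspace_scale\<close>)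

context cmod begin

lemma mod_ext_superset:
  assumes "finite A" "Poly_Mapping.keys x \<subseteq> A" "A \<subseteq> G" "f \<in> G \<rightarrow> carrier M"
  shows "mod_ext M f x = (\<Oplus>g\<in>A. Poly_Mapping.lookup x g \<odot> f g)"
  unfolding mod_ext_def
  by (rule add.finprod_mono_neutral_cong_left)
    (use assms in \<open>auto simp: in_keys_iff Pi_iff subset_iff\<close>)

lemma mod_ext_closed:
  assumes "x \<in> free_on G" "f \<in> G \<rightarrow> carrier M"
  shows "mod_ext M f x \<in> carrier M"
  unfolding mod_ext_def
  by (rule finsum_closed) (use assms in \<open>auto simp: free_on_def\<close>)

lemma mod_ext_zero [simp]: "mod_ext M f 0 = \<zero>"
  by (simp add: mod_ext_def)

lemma mod_ext_single [simp]: "f g \<in> carrier M \<Longrightarrow> mod_ext M f (Poly_Mapping.single g a) = a \<odot> f g"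
  by (cases "a = 0") (simp_all add: mod_ext_def)

lemma mod_ext_add:
  assumes "x \<in> free_on G" "y \<in> free_on G" "f \<in> G \<rightarrow> carrier M"
  shows "mod_ext M f (x + y) = mod_ext M f x \<oplus> mod_ext M f y"
proof -
  let ?A = "Poly_Mapping.keys x \<union> Poly_Mapping.keys y"
  have *: "mod_ext M f z = (\<Oplus>g\<in>?A. Poly_Mapping.lookup z g \<odot> f g)" if "z \<in> {x, y, x + y}" for z
    using that keys_add[of x y] assms by (intro mod_ext_superset[where G = G]) (auto simp: free_on_def)
  have cl: "f g \<in> carrier M" if "g \<in> ?A" for g using that assms by (auto simp: free_on_def)
  have "(\<Oplus>g\<in>?A. Poly_Mapping.lookup (x + y) g \<odot> f g) =
     (\<Oplus>g\<in>?A. Poly_Mapping.lookup x g \<odot> f g \<oplus> Poly_Mapping.lookup y g \<odot> f g)"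
    by (rule finsum_cong') (use cl in \<open>auto simp: lookup_add smult_l_distr\<close>)
  also have "\<dots> = (\<Oplus>g\<in>?A. Poly_Mapping.lookup x g \<odot> f g) \<oplus> (\<Oplus>g\<in>?A. Poly_Mapping.lookup y g \<odot> f g)"
    by (rule finsum_addf) (use cl in auto)
  finally show ?thesis by (simp add: *)
qed

lemma finsum_smult':
  assumes "finite A" "\<And>g. g \<in> A \<Longrightarrow> h g \<in> carrier M"
  shows "a \<odot> (\<Oplus>g\<in>A. h g) = (\<Oplus>g\<in>A. a \<odot> h g)"
  using assms
  by (induction A) (auto simp: smult_r_distr Pi_iff)

lemma mod_ext_scale:
  assumes "x \<in> free_on G" "f \<in> G \<rightarrow> carrier M"
  shows "mod_ext M f (a *\<^sub>C x) = a \<odot> mod_ext M f x"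
proof -
  have cl: "f g \<in> carrier M" if "g \<in> Poly_Mapping.keys x" for g using that assms by (auto simp: free_on_def)
  have "mod_ext M f (a *\<^sub>C x) = (\<Oplus>g\<in>Poly_Mapping.keys x. Poly_Mapping.lookup (a *\<^sub>C x) g \<odot> f g)"
    using assms keys_scaleC[of a x] by (intro mod_ext_superset[where G = G]) (auto simp: free_on_def)
  also have "\<dots> = (\<Oplus>g\<in>Poly_Mapping.keys x. a \<odot> (Poly_Mapping.lookup x g \<odot> f g))"
    by (rule finsum_cong') (use cl in \<open>auto simp: smult_assoc\<close>)
  also have "\<dots> = a \<odot> mod_ext M f x"
    unfolding mod_ext_def by (rule finsum_smult'[symmetric]) (use cl in auto)
  finally show ?thesis .
qed

lemma mod_ext_minus:
  assumes "x \<in> free_on G" "y \<in> free_on G" "f \<in> G \<rightarrow> carrier M"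
  shows "mod_ext M f (x - y) = mod_ext M f x \<ominus> mod_ext M f y"
proof -
  have "(-1) *\<^sub>C y \<in> free_on G"
    using assms(2) by (rule complex_vector.subspace_scale[OF csubspace_free_on])
  then have "mod_ext M f (x + (-1) *\<^sub>C y) = mod_ext M f x \<oplus> mod_ext M f ((-1) *\<^sub>C y)"
    using assms by (intro mod_ext_add[where G = G])
  also have "mod_ext M f ((-1) *\<^sub>C y) = (-1) \<odot> mod_ext M f y"
    using assms by (intro mod_ext_scale[where G = G])
  also have "\<dots> = \<ominus> mod_ext M f y"
    using assms by (intro smult_minus_one mod_ext_closed)
  finally show ?thesis by (simp add: a_minus_def)
qed

text \<open>
  A linear extension is a module homomorphism, so its kernel is a subspace and contains the span of any
  set of relators that it kills.
\<close>

lemma mod_ext_null_span: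
  assumes "R \<subseteq> free_on G" "f \<in> G \<rightarrow> carrier M" "\<And>r. r \<in> R \<Longrightarrow> mod_ext M f r = \<zero>" "x \<in> cspan R"
  shows "mod_ext M f x = \<zero>"
proof -
  have "csubspace {x \<in> free_on G. mod_ext M f x = \<zero>}"
    using complex_vector.subspace_0[OF csubspace_free_on] complex_vector.subspace_add[OF csubspace_free_on]
       complex_vector.subspace_scale[OF csubspace_free_on] assms(2)
    by (auto simp: complex_vector.subspace_def mod_ext_add[where G = G] mod_ext_scale[where G = G])
  then have "cspan R \<subseteq> {x \<in> free_on G. mod_ext M f x = \<zero>}"
    using assms by (intro complex_vector.span_minimal) auto
  then show ?thesis using assms by auto
qed

end

section \<open>Quotient spaces\<close>

lemma coset_eq_iff:
  assumes "csubspace N" shows "coset N x = coset N y \<longleftrightarrow> x - y \<in> N"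
proof
  assume "coset N x = coset N y"
  then have "x \<in> coset N y" using complex_vector.subspace_0[OF assms] by (metis (lifting) coset_def diff_self mem_Collect_eq)
  then show "x - y \<in> N" by (simp add: coset_def)
next
  assume a: "x - y \<in> N"
  have "(z - x \<in> N) = (z - y \<in> N)" for z
    using complex_vector.subspace_add[OF assms a, of "z - x"]
      complex_vector.subspace_diff[OF assms _ a, of "z - y"] by auto
  then show "coset N x = coset N y" by (simp add: coset_def)
qed

lemma repr_coset:
  assumes "csubspace N" shows "repr (coset N x) - x \<in> N"
proof -
  have "x \<in> coset N x" using complex_vector.subspace_0[OF assms] by (simp add: coset_def)
  then have "repr (coset N x) \<in> coset N x" unfolding repr_def by (rule someI)
  then show ?thesis by (simp add: coset_def)
qed

lemma repr_coset_in:
  assumes "csubspace N" "csubspace C" "N \<subseteq> C" "x \<in> C" shows "repr (coset N x) \<in> C"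
  using complex_vector.subspace_add[OF assms(2) _ assms(4), of "repr (coset N x) - x"]
    repr_coset[OF assms(1), of x] assms(3) by auto

lemma induced_coset:
  assumes "csubspace N" "csubspace N'" "csubspace C" "N \<subseteq> C" "x \<in> C"
    and "\<And>y z. f (y - z) = f y - f z" "\<And>y. y \<in> N \<Longrightarrow> f y \<in> N'"
  shows "induced N' f (coset N x) = coset N' (f x)"
  using assms repr_coset[OF assms(1), of x]
  by (simp add: induced_def coset_eq_iff flip: assms(6))

lemma quot_space_simps [simp]:
  "carrier (quot_space C N) = coset N ` C" "zero (quot_space C N) = coset N 0"
  by (simp_all add: quot_space_def)

lemma quot_add [simp]:
  assumes "csubspace N" shows "coset N x \<oplus>\<^bsub>quot_space C N\<^esub> coset N y = coset N (x + y)"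
proof -
  have "repr (coset N x) + repr (coset N y) - (x + y) = (repr (coset N x) - x) + (repr (coset N y) - y)"
    by simp
  then show ?thesis
    using repr_coset[OF assms, of x] repr_coset[OF assms, of y] complex_vector.subspace_add[OF assms]
    by (simp only: quot_space_def coset_eq_iff[OF assms] ring.simps)
qed

lemma quot_smult [simp]:
  assumes "csubspace N" shows "a \<odot>\<^bsub>quot_space C N\<^esub> coset N x = coset N (a *\<^sub>C x)"
proof -
  have "a *\<^sub>C repr (coset N x) - a *\<^sub>C x = a *\<^sub>C (repr (coset N x) - x)"
    by (simp add: complex_vector.scale_right_diff_distrib)
  then show ?thesis
    using repr_coset[OF assms] complex_vector.subspace_scale[OF assms]
    by (simp add: quot_space_def coset_eq_iff[OF assms])
qed

lemma cmod_quot_space: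
  assumes N: "csubspace N" and C: "csubspace C"
  shows "cmod (quot_space C N)"
proof -
  note [simp] = quot_add[OF N] quot_smult[OF N]
  note C' = complex_vector.subspace_add[OF C] complex_vector.subspace_scale[OF C]
    complex_vector.subspace_0[OF C]
  have "abelian_group (quot_space C N)"
  proof (rule abelian_groupI)
    fix x assume "x \<in> carrier (quot_space C N)"
    then obtain p where p: "p \<in> C" "x = coset N p" by auto
    then show "\<exists>y\<in>carrier (quot_space C N). y \<oplus>\<^bsub>quot_space C N\<^esub> x = \<zero>\<^bsub>quot_space C N\<^esub>"
      using complex_vector.subspace_neg[OF C p(1)] by (intro bexI[of _ "coset N (- p)"]) auto
  qed (auto simp: C' algebra_simps)
  then interpret abelian_group "quot_space C N" .
  show ?thesis
    by unfold_locales
      (auto simp: C' scaleC_add_left scaleC_add_right scaleC_scaleC scaleC_one)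
qed

text \<open>
  A linear extension that kills the relators does not depend on the representative of a coset. This is
  the universal property from which all maps out of tensor products are obtained.
\<close>

lemma quot_lift_coset:
  assumes T: "cmod T" and R: "R \<subseteq> free_on G" and f: "f \<in> G \<rightarrow> carrier T"
    and null: "\<And>r. r \<in> R \<Longrightarrow> mod_ext T f r = \<zero>\<^bsub>T\<^esub>" and x: "x \<in> free_on G"
  shows "mod_ext T f (repr (coset (cspan R) x)) = mod_ext T f x"
proof -
  interpret cmod T by fact
  have S: "cspan R \<subseteq> free_on G"
    using R csubspace_free_on by (rule complex_vector.span_minimal)
  let ?y = "repr (coset (cspan R) x)"
  have y: "?y - x \<in> cspan R" by (rule repr_coset) simp
  then have y': "?y - x \<in> free_on G" using S by auto
  have "mod_ext T f ((?y - x) + x) = mod_ext T f (?y - x) \<oplus>\<^bsub>T\<^esub> mod_ext T f x"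
    by (rule mod_ext_add[OF y' x f])
  also have "mod_ext T f (?y - x) = \<zero>\<^bsub>T\<^esub>"
    by (rule mod_ext_null_span[OF R f null y])
  finally show ?thesis using mod_ext_closed[OF x f] by simp
qed

lemma quot_lift_clin:
  assumes T: "cmod T" and R: "R \<subseteq> free_on G" and f: "f \<in> G \<rightarrow> carrier T"
    and null: "\<And>r. r \<in> R \<Longrightarrow> mod_ext T f r = \<zero>\<^bsub>T\<^esub>"
  shows "clin (quot_space (free_on G) (cspan R)) T (\<lambda>A. mod_ext T f (repr A))"
proof -
  interpret cmod T by fact
  note * = quot_lift_coset[OF assms]
  note F = complex_vector.subspace_add[OF csubspace_free_on] complex_vector.subspace_scale[OF csubspace_free_on]
  have N: "csubspace (cspan R)" by simp
  show ?thesis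
  proof (rule clinI)
    fix x assume "x \<in> carrier (quot_space (free_on G) (cspan R))"
    then obtain p where p: "p \<in> free_on G" "x = coset (cspan R) p" by auto
    then show "mod_ext T f (repr x) \<in> carrier T"
      using f by (simp add: * mod_ext_closed)
    fix a
    show "mod_ext T f (repr (a \<odot>\<^bsub>quot_space (free_on G) (cspan R)\<^esub> x)) = a \<odot>\<^bsub>T\<^esub> mod_ext T f (repr x)"
      using p by (simp add: quot_smult[OF N] * F mod_ext_scale[OF _ f])
  next
    fix x y assume "x \<in> carrier (quot_space (free_on G) (cspan R))" "y \<in> carrier (quot_space (free_on G) (cspan R))"
    then obtain p q where p: "p \<in> free_on G" "x = coset (cspan R) p" "q \<in> free_on G" "y = coset (cspan R) q"
      by auto
    then show "mod_ext T f (repr (x \<oplus>\<^bsub>quot_space (free_on G) (cspan R)\<^esub> y)) =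
        mod_ext T f (repr x) \<oplus>\<^bsub>T\<^esub> mod_ext T f (repr y)"
      by (simp add: quot_add[OF N] * F mod_ext_add[OF _ _ f])
  qed
qed

lemma quot_free_induct [consumes 2, case_names zero add scale gen]:
  assumes N: "csubspace N" and A: "A \<in> coset N ` free_on G" 
    and zero: "P (coset N 0)"
    and add: "\<And>x y. x \<in> coset N ` free_on G \<Longrightarrow> y \<in> coset N ` free_on G \<Longrightarrow> P x \<Longrightarrow> P y \<Longrightarrow>
        P (x \<oplus>\<^bsub>quot_space (free_on G) N\<^esub> y)"
    and scale: "\<And>a x. x \<in> coset N ` free_on G \<Longrightarrow> P x \<Longrightarrow> P (a \<odot>\<^bsub>quot_space (free_on G) N\<^esub> x)"
    and gen: "\<And>g. g \<in> G \<Longrightarrow> P (coset N (Poly_Mapping.single g 1))"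
  shows "P A"
proof -
  obtain x where x: "x \<in> free_on G" "A = coset N x" using A by auto
  from x(1) have "P (coset N x)"
  proof (induction rule: free_on_induct)
    case (add x y)
    then show ?case using assms(4)[of "coset N x" "coset N y"] by (auto simp: N)
  next
    case (scale a x)
    then show ?case using assms(5)[of "coset N x" a] by (auto simp: N)
  qed (use zero gen in auto)
  with x show ?thesis by simp
qed


section \<open>Tensor products over the complex numbers\<close>

lemma words_on_UNIV [simp]: "words_on UNIV = UNIV"
  by (auto simp: words_on_def)

lemma (in cmod) add_minus_minus:
  assumes "x \<in> carrier M" "y \<in> carrier M" shows "x \<oplus> y \<ominus> x \<ominus> y = \<zero>"
proof -
  have "x \<oplus> y \<ominus> x \<ominus> y = (x \<oplus> y) \<oplus> (\<ominus> x \<oplus> \<ominus> y)"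
    using assms by (simp add: minus_eq a_assoc)
  also have "\<dots> = (x \<oplus> y) \<oplus> \<ominus> (x \<oplus> y)" using assms by (simp only: minus_add)
  finally show ?thesis using assms by (simp add: r_neg)
qed

lemma bilinear_relators_free:
  assumes "cmod M" "cmod N"
  shows "bilinear_relators M N \<subseteq> free_on (carrier M \<times> carrier N)"
proof -
  interpret M: cmod M by fact
  interpret N: cmod N by fact
  note F = complex_vector.subspace_diff[OF csubspace_free_on] complex_vector.subspace_scale[OF csubspace_free_on]
  show ?thesis
    unfolding bilinear_relators_def Let_def by (auto intro!: F)
qed

lemma bilinear_relators_null:
  assumes "cmod M" "cmod N" "cmod T" and f: "cbilin M N T f" and r: "r \<in> bilinear_relators M N"
  shows "mod_ext T (\<lambda>(m, n). f m n) r = \<zero>\<^bsub>T\<^esub>"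
proof -
  interpret M: cmod M by fact
  interpret N: cmod N by fact
  interpret T: cmod T by fact
  let ?e = "\<lambda>m n. Poly_Mapping.single (m, n) (1::complex)"
  have G: "(\<lambda>(m, n). f m n) \<in> carrier M \<times> carrier N \<rightarrow> carrier T"
    using cbilin_closed[OF f] by auto
  note F = complex_vector.subspace_diff[OF csubspace_free_on] complex_vector.subspace_scale[OF csubspace_free_on]
  have E: "?e m n \<in> free_on (carrier M \<times> carrier N)" if "m \<in> carrier M" "n \<in> carrier N" for m n
    using that by simp
  have V: "mod_ext T (\<lambda>(m, n). f m n) (?e m n) = f m n" if "m \<in> carrier M" "n \<in> carrier N" for m n
    using that cbilin_closed[OF f] by (simp add: T.smult_one)
  have D: "mod_ext T (\<lambda>(m, n). f m n) (?e m n - ?e m' n' - ?e m'' n'') =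
      f m n \<ominus>\<^bsub>T\<^esub> f m' n' \<ominus>\<^bsub>T\<^esub> f m'' n''"
    if "m \<in> carrier M" "n \<in> carrier N" "m' \<in> carrier M" "n' \<in> carrier N" "m'' \<in> carrier M" "n'' \<in> carrier N"
    for m n m' n' m'' n''
    using that by (subst T.mod_ext_minus[OF _ _ G] | simp add: E F V)+
  have S: "mod_ext T (\<lambda>(m, n). f m n) (?e m n - a *\<^sub>C ?e m' n') = f m n \<ominus>\<^bsub>T\<^esub> a \<odot>\<^bsub>T\<^esub> f m' n'"
    if "m \<in> carrier M" "n \<in> carrier N" "m' \<in> carrier M" "n' \<in> carrier N" for a m n m' n'
    using that E[of m n] E[of m' n'] F(2)[OF E[of m' n'], of a]
    by (simp only: T.mod_ext_minus[OF _ _ G] T.mod_ext_scale[OF _ G] V)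
  note C = cbilin_closed[OF f]
  note A = T.add_minus_minus
  from r consider
      (1) m m' n where "r = ?e (m \<oplus>\<^bsub>M\<^esub> m') n - ?e m n - ?e m' n" "m \<in> carrier M" "m' \<in> carrier M" "n \<in> carrier N"
    | (2) m n n' where "r = ?e m (n \<oplus>\<^bsub>N\<^esub> n') - ?e m n - ?e m n'" "m \<in> carrier M" "n \<in> carrier N" "n' \<in> carrier N"
    | (3) a m n where "r = ?e (a \<odot>\<^bsub>M\<^esub> m) n - a *\<^sub>C ?e m n" "m \<in> carrier M" "n \<in> carrier N"
    | (4) a m n where "r = ?e m (a \<odot>\<^bsub>N\<^esub> n) - a *\<^sub>C ?e m n" "m \<in> carrier M" "n \<in> carrier N"
    unfolding bilinear_relators_def Let_def by blast
  then show ?thesis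
  proof cases
    case 1
    then show ?thesis using clin_add[OF cbilinD2[OF f]] by (simp add: D C A)
  next
    case 2
    then show ?thesis using clin_add[OF cbilinD1[OF f]] by (simp add: D C A)
  next
    case 3
    then show ?thesis using clin_smult[OF cbilinD2[OF f]] by (simp add: S C T.minus_eq T.r_neg)
  next
    case 4
    then show ?thesis using clin_smult[OF cbilinD1[OF f]] by (simp add: S C T.minus_eq T.r_neg)
  qed
qed

lemma csubspace_tens_null [simp]: "csubspace (tens_null M N)"
  by (simp add: tens_null_def)

lemma cmod_tens: "cmod (tens M N)"
  unfolding tens_def by (rule cmod_quot_space) (simp_all add: csubspace_free_on)

lemma
  assumes "cmod M" "cmod N" "cmod T" "cbilin M N T f"
  shows tens_lift_clin: "clin (tens M N) T (tens_lift T f)"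
    and tens_lift_pure: "m \<in> carrier M \<Longrightarrow> n \<in> carrier N \<Longrightarrow> tens_lift T f (pure M N m n) = f m n"
proof -
  interpret T: cmod T by fact
  have G: "(\<lambda>(m, n). f m n) \<in> carrier M \<times> carrier N \<rightarrow> carrier T"
    using cbilin_closed[OF assms(4)] by auto
  show "clin (tens M N) T (tens_lift T f)"
    unfolding tens_def tens_null_def tens_lift_def
    using bilinear_relators_free[OF assms(1,2)] bilinear_relators_null[OF assms]
    by (intro quot_lift_clin[OF assms(3) _ G])
  show "m \<in> carrier M \<Longrightarrow> n \<in> carrier N \<Longrightarrow> tens_lift T f (pure M N m n) = f m n"
    unfolding tens_lift_def pure_def tens_null_def
    using bilinear_relators_free[OF assms(1,2)] bilinear_relators_null[OF assms] cbilin_closed[OF assms(4)]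
    by (subst quot_lift_coset[OF assms(3) _ G]) (simp_all add: T.smult_one)
qed

text \<open>
  The bilinear relators are exactly what makes the canonical map from pairs bilinear. Only their
  membership in \<open>N0\<close> matters, so one proof serves the tensor product over the complex numbers and the
  one over a Clifford algebra.
\<close>

lemma cbilin_coset_single:
  assumes N: "csubspace N0" and R: "bilinear_relators M N \<subseteq> N0" and "cmod M" "cmod N"
  shows "cbilin M N (quot_space (free_on (carrier M \<times> carrier N)) N0)
     (\<lambda>m n. coset N0 (Poly_Mapping.single (m, n) 1))"
proof -
  interpret M: cmod M by fact
  interpret N: cmod N by fact
  let ?e = "\<lambda>m n. Poly_Mapping.single (m, n) (1::complex)"
  have 1: "?e (m \<oplus>\<^bsub>M\<^esub> m') n - (?e m n + ?e m' n) \<in> N0"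
    if "m \<in> carrier M" "m' \<in> carrier M" "n \<in> carrier N" for m m' n
    unfolding diff_diff_eq[symmetric]
    by (rule subsetD[OF R]) (unfold bilinear_relators_def Let_def, use that in blast)
  have 2: "?e m (n \<oplus>\<^bsub>N\<^esub> n') - (?e m n + ?e m n') \<in> N0"
    if "m \<in> carrier M" "n \<in> carrier N" "n' \<in> carrier N" for m n n'
    unfolding diff_diff_eq[symmetric]
    by (rule subsetD[OF R]) (unfold bilinear_relators_def Let_def, use that in blast)
  have 3: "?e (a \<odot>\<^bsub>M\<^esub> m) n - a *\<^sub>C ?e m n \<in> N0" if "m \<in> carrier M" "n \<in> carrier N" for a m n
    by (rule subsetD[OF R]) (unfold bilinear_relators_def Let_def, use that in blast)
  have 4: "?e m (a \<odot>\<^bsub>N\<^esub> n) - a *\<^sub>C ?e m n \<in> N0" if "m \<in> carrier M" "n \<in> carrier N" for a m n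
    by (rule subsetD[OF R]) (unfold bilinear_relators_def Let_def, use that in blast)
  have c: "coset N0 (?e m n) \<in> carrier (quot_space (free_on (carrier M \<times> carrier N)) N0)"
    if "m \<in> carrier M" "n \<in> carrier N" for m n
    using that by simp
  show ?thesis
  proof (intro cbilinI clinI)
  qed (simp_all only: c quot_add[OF N] quot_smult[OF N] coset_eq_iff[OF N] 1 2 3 4)
qed

lemma pure_cbilin:
  assumes "cmod M" "cmod N" shows "cbilin M N (tens M N) (pure M N)"
proof -
  have "bilinear_relators M N \<subseteq> tens_null M N"
    unfolding tens_null_def by (rule complex_vector.span_superset)
  from cbilin_coset_single[OF csubspace_tens_null this assms] show ?thesis
    by (simp add: tens_def pure_def[abs_def])
qed

lemmas pure_closed = cbilin_closed[OF pure_cbilin]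

lemma tens_induct [consumes 3, case_names add scale pure]:
  assumes x: "x \<in> carrier (tens M N)" and "cmod M" "cmod N"
    and add: "\<And>x y. x \<in> carrier (tens M N) \<Longrightarrow> y \<in> carrier (tens M N) \<Longrightarrow> P x \<Longrightarrow> P y \<Longrightarrow> P (x \<oplus>\<^bsub>tens M N\<^esub> y)"
    and scale: "\<And>a x. x \<in> carrier (tens M N) \<Longrightarrow> P x \<Longrightarrow> P (a \<odot>\<^bsub>tens M N\<^esub> x)"
    and pure: "\<And>m n. m \<in> carrier M \<Longrightarrow> n \<in> carrier N \<Longrightarrow> P (pure M N m n)"
  shows "P x"
proof -
  interpret M: cmod M by fact
  interpret N: cmod N by fact
  interpret T: cmod "tens M N" by (rule cmod_tens)
  let ?N = "tens_null M N"
  have x': "x \<in> coset ?N ` free_on (carrier M \<times> carrier N)" using x by (simp add: tens_def)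
  have "P (0 \<odot>\<^bsub>tens M N\<^esub> pure M N \<zero>\<^bsub>M\<^esub> \<zero>\<^bsub>N\<^esub>)"
    by (intro scale pure pure_closed assms) auto
  then have z: "P \<zero>\<^bsub>tens M N\<^esub>"
    using pure_closed[OF assms(2,3), of "\<zero>\<^bsub>M\<^esub>" "\<zero>\<^bsub>N\<^esub>"] by simp
  show ?thesis
    by (rule quot_free_induct[OF csubspace_tens_null x'])
      (use z add scale pure in \<open>auto simp: tens_def pure_def\<close>)
qed

lemma tens_clin_eq:
  assumes "cmod M" "cmod N" "clin (tens M N) T f" "clin (tens M N) T g"
    and "\<And>m n. m \<in> carrier M \<Longrightarrow> n \<in> carrier N \<Longrightarrow> f (pure M N m n) = g (pure M N m n)"
    and x: "x \<in> carrier (tens M N)"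
  shows "f x = g x"
  using x assms(1,2)
  by (induction rule: tens_induct)
    (simp_all add: assms(5) clin_add[OF assms(3)] clin_add[OF assms(4)] clin_smult[OF assms(3)] clin_smult[OF assms(4)])


section \<open>Modules over Clifford algebras\<close>

lemma single_0_mult: "Poly_Mapping.single 0 (a::complex) * p = a *\<^sub>C (p :: 'w::monoid_add \<Rightarrow>\<^sub>0 complex)"
  and mult_single_0: "p * Poly_Mapping.single 0 a = a *\<^sub>C p"
proof -
  have "p \<in> free_on UNIV" by simp
  then have *: "Poly_Mapping.single 0 a * p = a *\<^sub>C p \<and> p * Poly_Mapping.single 0 a = a *\<^sub>C p"
  proof (induction arbitrary: a rule: free_on_induct)
    case (add x y)
    then show ?case by (simp add: distrib_left distrib_right scaleC_add_right)
  next
    case (scale b x)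
    let ?s = "Poly_Mapping.single 0 :: complex \<Rightarrow> 'w \<Rightarrow>\<^sub>0 complex"
    from scale.IH have IH: "?s a * x = a *\<^sub>C x" "x * ?s a = a *\<^sub>C x" for a using scale.IH by auto
    have ss: "?s a * (?s b * x) = (a * b) *\<^sub>C x" for a b
      by (subst mult.assoc[symmetric]) (simp only: mult_single add_0 IH)
    have "?s a * (b *\<^sub>C x) = (a * b) *\<^sub>C x" by (subst IH(1)[of b, symmetric]) (rule ss)
    moreover have "(b *\<^sub>C x) * ?s a = ?s b * (x * ?s a)" by (simp only: IH(1)[of b, symmetric] mult.assoc)
    then have "(b *\<^sub>C x) * ?s a = (b * a) *\<^sub>C x" by (simp only: IH(2)) (simp only: IH(1)[of a, symmetric] ss)
    ultimately show ?case by (simp only: scaleC_scaleC mult.commute[of a b])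
  qed (auto simp: mult_single scaleC_single)
  then show "Poly_Mapping.single 0 a * p = a *\<^sub>C p" "p * Poly_Mapping.single 0 a = a *\<^sub>C p" by auto
qed

lemma scaleC_mult_left: "(a *\<^sub>C p) * q = a *\<^sub>C (p * (q :: 'w::monoid_add \<Rightarrow>\<^sub>0 complex))"
  by (metis mult.assoc single_0_mult)

lemma scaleC_mult_right: "p * (a *\<^sub>C q) = a *\<^sub>C (p * (q :: 'w::monoid_add \<Rightarrow>\<^sub>0 complex))"
  by (metis mult.assoc mult_single_0)

lemma Word_add [simp]: "Word u + Word v = Word (u @ v)"
  by (simp add: plus_word_def)

lemma one_free_alg: "(1 :: 'v free_alg) = Poly_Mapping.single (Word []) 1"
  by (simp flip: zero_word_def)

text \<open>
  An action of the free algebra descends to a quotient by an ideal once the relators act by zero on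
  every vector. The function \<open>h ws m\<close> is the action of the word \<open>ws\<close> on \<open>m\<close>, and it may multiply
  the letters from the left or from the right: all that matters is that the part of a word in the middle acts
  on some vector \<open>m'\<close> and that the remaining letters then act by a linear map.
\<close>

lemma ideal_acts_by_zero:
  assumes M: "cmod M" and m: "m \<in> carrier M"
    and h: "\<And>ws m. m \<in> carrier M \<Longrightarrow> h ws m \<in> carrier M"
    and K: "\<And>u v m. m \<in> carrier M \<Longrightarrow>
       \<exists>K m'. clin M M K \<and> m' \<in> carrier M \<and> (\<forall>w. h (u @ w @ v) m = K (h w m'))"
    and rel: "\<And>m r. m \<in> carrier M \<Longrightarrow> r \<in> R \<Longrightarrow> mod_ext M (\<lambda>w. h (letters w) m) r = \<zero>\<^bsub>M\<^esub>"
    and p: "p \<in> ideal_on UNIV R"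
  shows "mod_ext M (\<lambda>w. h (letters w) m) p = \<zero>\<^bsub>M\<^esub>"
proof -
  interpret cmod M by fact
  let ?H = "\<lambda>w. h (letters w) m"
  have H: "(\<lambda>w. h (letters w) m') \<in> UNIV \<rightarrow> carrier M" if "m' \<in> carrier M" for m' using h that by auto
  note adds = mod_ext_add[OF _ _ H, simplified] and scales = mod_ext_scale[OF _ H, simplified]
    and cl = mod_ext_closed[OF _ H, simplified]
  have mid: "\<exists>K m'. clin M M K \<and> m' \<in> carrier M \<and>
     (\<forall>r. mod_ext M ?H (Poly_Mapping.single (Word u) 1 * r * Poly_Mapping.single (Word v) 1) =
      K (mod_ext M (\<lambda>w. h (letters w) m') r))" for u v
  proof -
    obtain K m' where K: "clin M M K" "m' \<in> carrier M" "\<And>w. h (u @ w @ v) m = K (h w m')"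
      using K[OF m, of u v] by blast
    have "mod_ext M ?H (Poly_Mapping.single (Word u) 1 * r * Poly_Mapping.single (Word v) 1) =
      K (mod_ext M (\<lambda>w. h (letters w) m') r)" for r
    proof -
      have "r \<in> free_on UNIV" by simp
      then show ?thesis
      proof (induction rule: free_on_induct)
        case zero
        then show ?case using clin_zero[OF M M K(1)] by simp
      next
        case (add x y)
        then show ?case
          by (simp add: distrib_left distrib_right adds m K(2) clin_add[OF K(1)] cl)
      next
        case (scale a x)
        then show ?case
          by (simp add: scaleC_mult_left scaleC_mult_right scales m K(2) clin_smult[OF K(1)] cl)
      next
        case (gen g)
        obtain w where "g = Word w" by (cases g)
        then show ?case using K h m by (simp add: mult_single smult_one clin_closed[OF K(1)])
      qed
    qed
    then show ?thesis using K by blast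
  qed
  have main: "mod_ext M ?H (p * r * q) = \<zero>\<^bsub>M\<^esub>" if r: "r \<in> R" for p q r
  proof -
    have "p \<in> free_on UNIV" by simp
    then show ?thesis
    proof (induction rule: free_on_induct)
      case (gen g)
      obtain u where u: "g = Word u" by (cases g)
      have "q \<in> free_on UNIV" by simp
      then show ?case
      proof (induction rule: free_on_induct)
        case (gen g)
        obtain v where v: "g = Word v" by (cases g)
        obtain K m' where K: "clin M M K" "m' \<in> carrier M"
          "mod_ext M ?H (Poly_Mapping.single (Word u) 1 * r * Poly_Mapping.single (Word v) 1) =
            K (mod_ext M (\<lambda>w. h (letters w) m') r)" using mid by blast
        then show ?case using rel[OF K(2) r] clin_zero[OF M M K(1)] by (simp add: u v)
      qed (simp_all add: distrib_left adds scales scaleC_mult_right m)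
    qed (simp_all add: distrib_right adds scales scaleC_mult_left m)
  qed
  show ?thesis
    by (rule mod_ext_null_span[of "{p * r * q |p r q. r \<in> R}" UNIV])
      (use H[OF m] main p in \<open>auto simp: ideal_on_def\<close>)
qed

text \<open>
  A Clifford action is given by the action of vectors; the relations are those of generators.
\<close>

definition cl_act :: "('v::hermitian_space \<Rightarrow> 'v) \<Rightarrow> (complex, 'm, 'r) module_scheme \<Rightarrow> ('v \<Rightarrow> 'm \<Rightarrow> 'm) \<Rightarrow> bool" where
  "cl_act c M act \<longleftrightarrow> (\<forall>w. clin M M (act w)) \<and>
     (\<forall>m\<in>carrier M. (\<forall>v w. act (v + w) m = act v m \<oplus>\<^bsub>M\<^esub> act w m) \<and>
       (\<forall>a w. act (a *\<^sub>C w) m = a \<odot>\<^bsub>M\<^esub> act w m) \<and>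
       (\<forall>v w. act v (act w m) \<oplus>\<^bsub>M\<^esub> act w (act v m) = cinner (c v) w \<odot>\<^bsub>M\<^esub> m))"

text \<open>
  Both orders are allowed in \<open>h2\<close> because the anticommutator is symmetric in the two vectors. So left and
  right actions are treated alike.
\<close>

lemma cl_act_relators:
  assumes M: "cmod M" and act: "cl_act c M act" and m: "m \<in> carrier M"
    and h: "\<And>ws. h ws m \<in> carrier M"
    and h0: "h [] m = m" and h1: "\<And>v. h [v] m = act v m"
    and h2: "(\<forall>v w. h [v, w] m = act v (act w m)) \<or> (\<forall>v w. h [v, w] m = act w (act v m))"
    and r: "r \<in> linear_relators UNIV \<union>
      {letter v * letter w + letter w * letter v - cinner (c v) w *\<^sub>C 1 | v w. True}"
  shows "mod_ext M (\<lambda>w. h (letters w) m) r = \<zero>\<^bsub>M\<^esub>"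
proof -
  interpret cmod M by fact
  have H: "(\<lambda>w. h (letters w) m) \<in> UNIV \<rightarrow> carrier M" using h by auto
  note add = mod_ext_add[OF _ _ H, simplified] and scale = mod_ext_scale[OF _ H, simplified]
    and minus = mod_ext_minus[OF _ _ H, simplified]
  have L: "mod_ext M (\<lambda>w. h (letters w) m) (letter v) = act v m" for v
    using h[of "[v]"] by (simp add: letter_def smult_one h1)
  have O: "mod_ext M (\<lambda>w. h (letters w) m) 1 = m"
    by (simp only: one_free_alg) (simp add: h0 m smult_one)
  have W: "mod_ext M (\<lambda>w. h (letters w) m) (letter v * letter w) = h [v, w] m" for v w
    using h[of "[v, w]"] by (simp add: letter_def mult_single smult_one)
  have cl: "act v m \<in> carrier M" "act v (act w m) \<in> carrier M" for v w
    using act m by (auto simp: cl_act_def clin_def)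
  note A = add_minus_minus
  have "mod_ext M (\<lambda>w. h (letters w) m) (letter v * letter w + letter w * letter v - cinner (c v) w *\<^sub>C 1) = \<zero>\<^bsub>M\<^esub>"
    for v w
  proof -
    have "h [v, w] m \<oplus>\<^bsub>M\<^esub> h [w, v] m = cinner (c v) w \<odot>\<^bsub>M\<^esub> m"
      using h2 act m cl a_comm by (auto simp: cl_act_def)
    then show ?thesis by (simp add: add minus scale W O m minus_eq r_neg)
  qed
  moreover have "mod_ext M (\<lambda>w. h (letters w) m) (letter (v + w) - letter v - letter w) = \<zero>\<^bsub>M\<^esub>" for v w
    using act m by (simp add: minus L cl_act_def) (simp add: A cl)
  moreover have "mod_ext M (\<lambda>w. h (letters w) m) (letter (a *\<^sub>C v) - a *\<^sub>C letter v) = \<zero>\<^bsub>M\<^esub>" for a v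
    using act m by (simp add: minus scale L cl_act_def) (simp add: minus_eq r_neg cl)
  ultimately show ?thesis using r by (auto simp: linear_relators_def)
qed

text \<open>
  A bimodule over two Clifford algebras, in terms of the actions of vectors. That these actions extend to
  the Clifford algebras is a consequence (\<open>cl_left_coset\<close>, \<open>cl_right_coset\<close>).
\<close>

locale cbimod = cmod M for cp :: "'p::hermitian_space \<Rightarrow> 'p" and cq :: "'q::hermitian_space \<Rightarrow> 'q"
    and M :: "('p, 'q, 'm) bimod" (structure) +
  assumes left: "cl_act cp M (lact M)" and right: "cl_act cq M (\<lambda>w m. ract M m w)"
    and lr_comm: "m \<in> carrier M \<Longrightarrow> lact M v (ract M m w) = ract M (lact M v m) w"
begin

lemma lact_clin: "clin M M (lact M w)" and ract_clin: "clin M M (\<lambda>m. ract M m v)"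
  using left right by (auto simp: cl_act_def)

lemma lact_closed [simp]: "m \<in> carrier M \<Longrightarrow> lact M w m \<in> carrier M"
  and ract_closed [simp]: "m \<in> carrier M \<Longrightarrow> ract M m v \<in> carrier M"
  using lact_clin ract_clin by (auto simp: clin_def)

lemma foldr_lact_clin: "clin M M (foldr (lact M) ws)"
  by (induction ws) (auto simp: clin_def clin_add[OF lact_clin] clin_smult[OF lact_clin])

lemma foldl_ract_clin: "clin M M (\<lambda>m. foldl (ract M) m ws)"
proof (induction ws rule: rev_induct)
  case (snoc x xs)
  then show ?case using clin_comp[OF snoc.IH ract_clin] by simp
qed (auto simp: clin_def)

lemma foldr_lact_closed [simp]: "m \<in> carrier M \<Longrightarrow> foldr (lact M) ws m \<in> carrier M"
  and foldl_ract_closed [simp]: "m \<in> carrier M \<Longrightarrow> foldl (ract M) m us \<in> carrier M"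
  using foldr_lact_clin foldl_ract_clin by (auto simp: clin_def)

lemma cl_left_coset:
  assumes m: "m \<in> carrier M"
  shows "cl_left M (coset (clifford_ideal cp) p) m = mod_ext M (\<lambda>w. foldr (lact M) (letters w) m) p"
proof -
  have N: "csubspace (clifford_ideal cp)" by (simp add: clifford_ideal_def ideal_on_def)
  let ?q = "repr (coset (clifford_ideal cp) p)"
  have H: "(\<lambda>w. foldr (lact M) (letters w) m) \<in> UNIV \<rightarrow> carrier M" using m by auto
  have "mod_ext M (\<lambda>w. foldr (lact M) (letters w) m) (?q - p) = \<zero>"
  proof (rule ideal_acts_by_zero[where h = "\<lambda>ws m. foldr (lact M) ws m", OF cmod_axioms m])
    show "?q - p \<in> ideal_on UNIV (linear_relators UNIV \<union>
      {letter v * letter w + letter w * letter v - cinner (cp v) w *\<^sub>C 1 | v w. True})"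
      using repr_coset[OF N, of p] by (simp add: clifford_ideal_def)
    fix u v :: "'p list" and m :: 'm assume "m \<in> carrier M"
    then show "\<exists>K m'. clin M M K \<and> m' \<in> carrier M \<and>
        (\<forall>w. foldr (lact M) (u @ w @ v) m = K (foldr (lact M) w m'))"
      by (intro exI[of _ "foldr (lact M) u"] exI[of _ "foldr (lact M) v m"])
        (auto simp: foldr_lact_clin)
  next
    fix m r assume "m \<in> carrier M" and r: "r \<in> linear_relators UNIV \<union>
      {letter v * letter w + letter w * letter v - cinner (cp v) w *\<^sub>C 1 | v w. True}"
    then show "mod_ext M (\<lambda>w. foldr (lact M) (letters w) m) r = \<zero>"
      by (intro cl_act_relators[where h = "\<lambda>ws m. foldr (lact M) ws m", OF cmod_axioms left]) auto
  qed auto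
  then have "mod_ext M (\<lambda>w. foldr (lact M) (letters w) m) ?q = mod_ext M (\<lambda>w. foldr (lact M) (letters w) m) p"
    using mod_ext_add[OF _ _ H, of "?q - p" p] mod_ext_closed[OF _ H, of p] by simp
  then show ?thesis by (simp add: cl_left_def)
qed

lemma cl_right_coset:
  assumes m: "m \<in> carrier M"
  shows "cl_right M m (coset (clifford_ideal cq) p) = mod_ext M (\<lambda>w. foldl (ract M) m (letters w)) p"
proof -
  have N: "csubspace (clifford_ideal cq)" by (simp add: clifford_ideal_def ideal_on_def)
  let ?q = "repr (coset (clifford_ideal cq) p)"
  have H: "(\<lambda>w. foldl (ract M) m (letters w)) \<in> UNIV \<rightarrow> carrier M" using m by auto
  have "mod_ext M (\<lambda>w. foldl (ract M) m (letters w)) (?q - p) = \<zero>"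
  proof (rule ideal_acts_by_zero[where h = "\<lambda>ws m. foldl (ract M) m ws", OF cmod_axioms m])
    show "?q - p \<in> ideal_on UNIV (linear_relators UNIV \<union>
      {letter v * letter w + letter w * letter v - cinner (cq v) w *\<^sub>C 1 | v w. True})"
      using repr_coset[OF N, of p] by (simp add: clifford_ideal_def)
    fix u v :: "'q list" and m :: 'm assume "m \<in> carrier M"
    then show "\<exists>K m'. clin M M K \<and> m' \<in> carrier M \<and>
        (\<forall>w. foldl (ract M) m (u @ w @ v) = K (foldl (ract M) m' w))"
      by (intro exI[of _ "\<lambda>m. foldl (ract M) m v"] exI[of _ "foldl (ract M) m u"])
        (auto simp: foldl_ract_clin)
  next
    fix m r assume "m \<in> carrier M" and r: "r \<in> linear_relators UNIV \<union>
      {letter v * letter w + letter w * letter v - cinner (cq v) w *\<^sub>C 1 | v w. True}"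
    then show "mod_ext M (\<lambda>w. foldl (ract M) m (letters w)) r = \<zero>"
      by (intro cl_act_relators[where h = "\<lambda>ws m. foldl (ract M) m ws", OF cmod_axioms right]) auto
  qed auto
  then have "mod_ext M (\<lambda>w. foldl (ract M) m (letters w)) ?q = mod_ext M (\<lambda>w. foldl (ract M) m (letters w)) p"
    using mod_ext_add[OF _ _ H, of "?q - p" p] mod_ext_closed[OF _ H, of p] by simp
  then show ?thesis by (simp add: cl_right_def)
qed

lemma cl_left_letter: "m \<in> carrier M \<Longrightarrow> cl_left M (coset (clifford_ideal cp) (letter w)) m = lact M w m"
  by (simp add: cl_left_coset letter_def smult_one)

lemma cl_right_letter: "m \<in> carrier M \<Longrightarrow> cl_right M m (coset (clifford_ideal cq) (letter w)) = ract M m w"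
  by (simp add: cl_right_coset letter_def smult_one)

lemma cl_right_closed:
  assumes "m \<in> carrier M" "a \<in> carrier (clifford cq)" shows "cl_right M m a \<in> carrier M"
proof -
  obtain p where "a = coset (clifford_ideal cq) p"
    using assms(2) by (auto simp: clifford_def quot_alg_def)
  then show ?thesis using assms(1) mod_ext_closed[of p UNIV] by (simp add: cl_right_coset)
qed

lemma cl_left_closed:
  assumes "m \<in> carrier M" "a \<in> carrier (clifford cp)" shows "cl_left M a m \<in> carrier M"
proof -
  obtain p where "a = coset (clifford_ideal cp) p"
    using assms(2) by (auto simp: clifford_def quot_alg_def)
  then show ?thesis using assms(1) mod_ext_closed[of p UNIV] by (simp add: cl_left_coset)
qed

end

lemma coset_in_clifford: "coset (clifford_ideal c) p \<in> carrier (clifford c)"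
  by (simp add: clifford_def quot_alg_def)

lemma bimod_iso_acts:
  assumes "cbimod cp cq M" "cbimod cp cq N" and f: "bimod_iso cp cq M N f"
  shows "clin M N f"
    and "x \<in> carrier M \<Longrightarrow> f (lact M w x) = lact N w (f x)"
    and "x \<in> carrier M \<Longrightarrow> f (ract M x v) = ract N (f x) v"
proof -
  interpret M: cbimod cp cq M by fact
  interpret N: cbimod cp cq N by fact
  show cl: "clin M N f" using f by (auto simp: bimod_iso_def bij_betw_def intro!: clinI)
  show "f (lact M w x) = lact N w (f x)" if x: "x \<in> carrier M"
    using f x coset_in_clifford[of cp "letter w"] clin_closed[OF cl x]
    unfolding bimod_iso_def by (metis M.cl_left_letter N.cl_left_letter)
  show "f (ract M x v) = ract N (f x) v" if x: "x \<in> carrier M"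
    using f x coset_in_clifford[of cq "letter v"] clin_closed[OF cl x]
    unfolding bimod_iso_def by (metis M.cl_right_letter N.cl_right_letter)
qed

lemma clin_mod_ext:
  assumes "cmod M" "cmod N" "clin M N K" "g \<in> G \<rightarrow> carrier M" "x \<in> free_on G"
  shows "K (mod_ext M g x) = mod_ext N (\<lambda>w. K (g w)) x"
proof -
  interpret M: cmod M by fact
  interpret N: cmod N by fact
  have g': "(\<lambda>w. K (g w)) \<in> G \<rightarrow> carrier N" using assms(3,4) by (auto simp: clin_def)
  show ?thesis using assms(5)
    by (induction rule: free_on_induct)
      (use assms g' in \<open>auto simp: clin_zero M.mod_ext_add N.mod_ext_add M.mod_ext_scale N.mod_ext_scale
         M.mod_ext_closed clin_add[OF assms(3)] clin_smult[OF assms(3)] Pi_iff\<close>)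
qed


section \<open>Tensor products over Clifford algebras\<close>

definition balanced :: "('p, 'q, 'm) bimod \<Rightarrow> ('q, 'r, 'n) bimod \<Rightarrow> ('m \<Rightarrow> 'n \<Rightarrow> 't) \<Rightarrow> bool" where
  "balanced M N f \<longleftrightarrow> (\<forall>m\<in>carrier M. \<forall>n\<in>carrier N. \<forall>w. f (ract M m w) n = f m (lact N w n))"

text \<open>
  A Clifford algebra is generated by vectors, so it suffices to be balanced for vectors: in a word, the
  letters are moved from one side to the other one at a time.
\<close>

lemma balanced_clifford:
  assumes "cbimod cp c M" "cbimod c cr N" "cmod T" and f: "cbilin M N T f" and b: "balanced M N f"
    and m: "m \<in> carrier M" and n: "n \<in> carrier N" and a: "a \<in> carrier (clifford c)"
  shows "f (cl_right M m a) n = f m (cl_left N a n)"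
proof -
  interpret M: cbimod cp c M by fact
  interpret N: cbimod c cr N by fact
  interpret T: cmod T by fact
  obtain p where p: "a = coset (clifford_ideal c) p"
    using a by (auto simp: clifford_def quot_alg_def)
  have w: "f (foldl (ract M) m ws) n = f m (foldr (lact N) ws n)" if "m \<in> carrier M" for ws m
    using that
  proof (induction ws arbitrary: m)
    case (Cons v ws)
    then show ?case using b n by (auto simp: balanced_def)
  qed simp
  show ?thesis
    unfolding p
    using clin_mod_ext[OF M.cmod_axioms assms(3) cbilinD2[OF f n], of "\<lambda>w. foldl (ract M) m (letters w)" UNIV p]
      clin_mod_ext[OF N.cmod_axioms assms(3) cbilinD1[OF f m], of "\<lambda>w. foldr (lact N) (letters w) n" UNIV p]
    by (simp add: M.cl_right_coset N.cl_left_coset m n w)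
qed

lemma csubspace_cl_tens_null [simp]: "csubspace (cl_tens_null c M N)"
  by (simp add: cl_tens_null_def)

text \<open>
  The vector space that underlies \<open>cl_tens\<close>. The two actions on \<open>cl_tens\<close> are lifts with values in this space, so
  they can be unfolded without meeting the bimodule itself again.
\<close>

definition cl_tens_space where
  "cl_tens_space c M N = quot_space (free_on (carrier M \<times> carrier N)) (cl_tens_null c M N)"

lemma cl_tens_simps [simp]:
  "carrier (cl_tens c M N) = carrier (cl_tens_space c M N)"
  "zero (cl_tens c M N) = zero (cl_tens_space c M N)"
  "add (cl_tens c M N) = add (cl_tens_space c M N)"
  "smult (cl_tens c M N) = smult (cl_tens_space c M N)"
  "lact (cl_tens c M N) = (\<lambda>w. tens_lift (cl_tens_space c M N) (\<lambda>m n. cl_pure c M N (lact M w m) n))"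
  "ract (cl_tens c M N) = (\<lambda>x w. tens_lift (cl_tens_space c M N) (\<lambda>m n. cl_pure c M N m (ract N n w)) x)"
  by (simp_all add: cl_tens_def cl_tens_space_def Let_def module.defs bimod.defs)

lemma clin_cl_tens_iff [simp]:
  "clin (cl_tens c M N) = clin (cl_tens_space c M N)"
  "clin T (cl_tens c M N) = clin T (cl_tens_space c M N)"
  "cbilin T T' (cl_tens c M N) = cbilin T T' (cl_tens_space c M N)"
  by (simp_all add: clin_def cbilin_def fun_eq_iff)

lemma cmod_cl_tens_space: "cmod (cl_tens_space c M N)"
  unfolding cl_tens_space_def by (rule cmod_quot_space) (simp_all add: csubspace_free_on)

lemma cmod_cl_tens: "cmod (cl_tens c M N)"
  by (rule cmod_cong[OF cmod_cl_tens_space]) simp_all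

lemma
  assumes "cbimod cp c M" "cbimod c cr N" "cmod T" and f: "cbilin M N T f" and b: "balanced M N f"
  shows cl_tens_lift_clin: "clin (cl_tens c M N) T (tens_lift T f)"
    and cl_tens_lift_pure: "m \<in> carrier M \<Longrightarrow> n \<in> carrier N \<Longrightarrow> tens_lift T f (cl_pure c M N m n) = f m n"
proof -
  interpret M: cbimod cp c M by fact
  interpret N: cbimod c cr N by fact
  interpret T: cmod T by fact
  have G: "(\<lambda>(m, n). f m n) \<in> carrier M \<times> carrier N \<rightarrow> carrier T"
    using cbilin_closed[OF f] by auto
  let ?R = "bilinear_relators M N \<union> balanced_relators c M N"
  have R: "?R \<subseteq> free_on (carrier M \<times> carrier N)"
    using bilinear_relators_free[OF M.cmod_axioms N.cmod_axioms]
    by (auto simp: balanced_relators_def M.cl_right_closed N.cl_left_closed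
         intro!: complex_vector.subspace_diff[OF csubspace_free_on])
  have null: "mod_ext T (\<lambda>(m, n). f m n) r = \<zero>\<^bsub>T\<^esub>" if r: "r \<in> ?R" for r
  proof (cases "r \<in> bilinear_relators M N")
    case True
    then show ?thesis by (rule bilinear_relators_null[OF M.cmod_axioms N.cmod_axioms assms(3) f])
  next
    case False
    then obtain m a n where r: "r = Poly_Mapping.single (cl_right M m a, n) 1 - Poly_Mapping.single (m, cl_left N a n) 1"
      and *: "m \<in> carrier M" "a \<in> carrier (clifford c)" "n \<in> carrier N"
      using r by (auto simp: balanced_relators_def)
    show ?thesis
      unfolding r using * cbilin_closed[OF f] balanced_clifford[OF assms *(1,3,2)]
      by (subst T.mod_ext_minus[OF _ _ G])
        (simp_all add: M.cl_right_closed N.cl_left_closed T.smult_one T.minus_eq T.r_neg)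
  qed
  show "clin (cl_tens c M N) T (tens_lift T f)"
    unfolding clin_cl_tens_iff cl_tens_space_def cl_tens_null_def tens_lift_def
    using R null by (intro quot_lift_clin[OF assms(3) _ G])
  show "m \<in> carrier M \<Longrightarrow> n \<in> carrier N \<Longrightarrow> tens_lift T f (cl_pure c M N m n) = f m n"
    unfolding tens_lift_def cl_pure_def cl_tens_null_def
    using R null cbilin_closed[OF f]
    by (subst quot_lift_coset[OF assms(3) _ G]) (simp_all add: T.smult_one)
qed

lemma cl_pure_cbilin:
  assumes "cmod M" "cmod N" shows "cbilin M N (cl_tens c M N) (cl_pure c M N)"
proof -
  have "bilinear_relators M N \<subseteq> cl_tens_null c M N"
    unfolding cl_tens_null_def using complex_vector.span_superset by blast
  from cbilin_coset_single[OF csubspace_cl_tens_null this assms] show ?thesis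
    by (simp add: cl_tens_space_def cl_pure_def[abs_def])
qed

lemmas cl_pure_closed = cbilin_closed[OF cl_pure_cbilin]

lemma cl_pure_balanced:
  assumes "cbimod cp c M" "cbimod c cr N" shows "balanced M N (cl_pure c M N)"
proof -
  interpret M: cbimod cp c M by fact
  interpret N: cbimod c cr N by fact
  have "Poly_Mapping.single (cl_right M m (coset (clifford_ideal c) (letter w)), n) 1 -
      Poly_Mapping.single (m, cl_left N (coset (clifford_ideal c) (letter w)) n) 1 \<in> cl_tens_null c M N"
    if "m \<in> carrier M" "n \<in> carrier N" for m n w
    unfolding cl_tens_null_def
    by (intro complex_vector.span_base UnI2)
      (unfold balanced_relators_def, use that coset_in_clifford in blast)
  then show ?thesis
    by (auto simp: balanced_def cl_pure_def coset_eq_iff M.cl_right_letter N.cl_left_letter)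
qed

lemma cl_pure_swap:
  assumes "cbimod cp c M" "cbimod c cr N" "m \<in> carrier M" "n \<in> carrier N"
  shows "cl_pure c M N (ract M m w) n = cl_pure c M N m (lact N w n)"
  using cl_pure_balanced[OF assms(1,2)] assms(3,4) by (simp add: balanced_def)

lemma cl_tens_induct [consumes 3, case_names add scale pure]:
  assumes x: "x \<in> carrier (cl_tens c M N)" and "cmod M" "cmod N"
    and add: "\<And>x y. x \<in> carrier (cl_tens c M N) \<Longrightarrow> y \<in> carrier (cl_tens c M N) \<Longrightarrow> P x \<Longrightarrow> P y \<Longrightarrow> P (x \<oplus>\<^bsub>cl_tens c M N\<^esub> y)"
    and scale: "\<And>a x. x \<in> carrier (cl_tens c M N) \<Longrightarrow> P x \<Longrightarrow> P (a \<odot>\<^bsub>cl_tens c M N\<^esub> x)"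
    and pure: "\<And>m n. m \<in> carrier M \<Longrightarrow> n \<in> carrier N \<Longrightarrow> P (cl_pure c M N m n)"
  shows "P x"
proof -
  interpret M: cmod M by fact
  interpret N: cmod N by fact
  interpret T: cmod "cl_tens c M N" by (rule cmod_cl_tens)
  let ?N = "cl_tens_null c M N"
  have x': "x \<in> coset ?N ` free_on (carrier M \<times> carrier N)" using x by (simp add: cl_tens_space_def)
  have "P (0 \<odot>\<^bsub>cl_tens c M N\<^esub> cl_pure c M N \<zero>\<^bsub>M\<^esub> \<zero>\<^bsub>N\<^esub>)"
    by (intro scale pure cl_pure_closed assms) auto
  then have z: "P \<zero>\<^bsub>cl_tens c M N\<^esub>"
    by (simp only: T.smult_zero_left[OF cl_pure_closed[OF assms(2,3) M.zero_closed N.zero_closed]])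
  show ?thesis
    by (rule quot_free_induct[OF csubspace_cl_tens_null x'])
      (use z add scale pure in \<open>auto simp: cl_tens_space_def cl_pure_def\<close>)
qed

lemma cl_tens_clin_eq:
  assumes "cmod M" "cmod N" "clin (cl_tens c M N) T f" "clin (cl_tens c M N) T g"
    and "\<And>m n. m \<in> carrier M \<Longrightarrow> n \<in> carrier N \<Longrightarrow> f (cl_pure c M N m n) = g (cl_pure c M N m n)"
    and x: "x \<in> carrier (cl_tens c M N)"
  shows "f x = g x"
  using x assms(1,2)
  by (induction rule: cl_tens_induct)
    (simp_all only: assms(5) clin_add[OF assms(3)] clin_add[OF assms(4)] clin_smult[OF assms(3)] clin_smult[OF assms(4)])


section \<open>Exterior algebras\<close>

abbreviation alg_on :: "'v set \<Rightarrow> 'v free_alg set" where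
  "alg_on X \<equiv> free_on (words_on X)"

lemma csubspace_alg_on [simp]: "csubspace (alg_on X)"
  by (rule csubspace_free_on)

lemmas alg_on_add = complex_vector.subspace_add[OF csubspace_alg_on]
  and alg_on_diff = complex_vector.subspace_diff[OF csubspace_alg_on]
  and alg_on_scale = complex_vector.subspace_scale[OF csubspace_alg_on]

lemma Word_in_words_on [simp]: "Word ws \<in> words_on X \<longleftrightarrow> set ws \<subseteq> X"
  by (simp add: words_on_def)

lemma in_words_on: "w \<in> words_on X \<longleftrightarrow> set (letters w) \<subseteq> X"
  by (simp add: words_on_def)

lemma alg_on_induct [consumes 1, case_names zero add scale word]:
  assumes "p \<in> alg_on X" and "P 0"
    and "\<And>x y. x \<in> alg_on X \<Longrightarrow> y \<in> alg_on X \<Longrightarrow> P x \<Longrightarrow> P y \<Longrightarrow> P (x + y)"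
    and "\<And>a x. x \<in> alg_on X \<Longrightarrow> P x \<Longrightarrow> P (a *\<^sub>C x)"
    and "\<And>ws. set ws \<subseteq> X \<Longrightarrow> P (Poly_Mapping.single (Word ws) 1)"
  shows "P p"
  using assms(1)
proof (induction rule: free_on_induct)
  case (gen g)
  then show ?case using assms(5) by (cases g) auto
qed (use assms in auto)

lemma free_alg_induct [case_names zero add scale word]:
  assumes "P 0" "\<And>x y. P x \<Longrightarrow> P y \<Longrightarrow> P (x + y)" "\<And>a x. P x \<Longrightarrow> P (a *\<^sub>C x)"
    and "\<And>ws. P (Poly_Mapping.single (Word ws) 1)"
  shows "P (p :: 'v free_alg)"
  by (rule alg_on_induct[of p UNIV]) (use assms in auto)

lemma alg_on_one [simp]: "1 \<in> alg_on X"
  unfolding one_free_alg by simp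

lemma letter_alg_on [simp]: "letter v \<in> alg_on X \<longleftrightarrow> v \<in> X"
  by (simp add: letter_def)

lemma alg_on_mult:
  assumes "p \<in> alg_on X" "q \<in> alg_on X" shows "p * q \<in> alg_on X"
  using assms(1)
proof (induction rule: alg_on_induct)
  case (word ws)
  show ?case using assms(2)
    by (induction rule: alg_on_induct)
      (use word in \<open>auto simp: distrib_left mult_single scaleC_mult_right complex_vector.subspace_0
          intro: alg_on_add alg_on_scale\<close>)
qed (auto simp: distrib_right scaleC_mult_left intro: alg_on_add alg_on_scale complex_vector.subspace_0)

lemma csubspace_ideal_on [simp]: "csubspace (ideal_on X R)"
  by (simp add: ideal_on_def)

text \<open>
  The ideal is a span, so a linear map sends it into a subspace as soon as it does so on the products
  \<open>p * r * q\<close>.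
\<close>

lemma ideal_on_map:
  assumes add: "\<And>x y. F (x + y) = F x + F y" and scale: "\<And>a x. F (a *\<^sub>C x) = a *\<^sub>C F x"
    and S: "csubspace S" and gen: "\<And>p r q. p \<in> alg_on X \<Longrightarrow> r \<in> R \<Longrightarrow> q \<in> alg_on X \<Longrightarrow> F (p * r * q) \<in> S"
    and x: "x \<in> ideal_on X R"
  shows "F x \<in> S"
proof -
  have "F 0 = 0" using scale[of 0 0] by simp
  then have "csubspace {x. F x \<in> S}"
    using complex_vector.subspace_0[OF S] complex_vector.subspace_add[OF S] complex_vector.subspace_scale[OF S]
    by (auto intro!: complex_vector.subspaceI simp: add scale)
  then have "cspan {p * r * q | p r q. p \<in> alg_on X \<and> r \<in> R \<and> q \<in> alg_on X} \<subseteq> {x. F x \<in> S}"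
    using gen by (intro complex_vector.span_minimal) auto
  then show ?thesis using x by (auto simp: ideal_on_def)
qed

lemma ideal_on_gen: "p \<in> alg_on X \<Longrightarrow> r \<in> R \<Longrightarrow> q \<in> alg_on X \<Longrightarrow> p * r * q \<in> ideal_on X R"
  unfolding ideal_on_def by (rule complex_vector.span_base) blast

lemma ideal_on_rel: "r \<in> R \<Longrightarrow> r \<in> ideal_on X R"
  using ideal_on_gen[of 1 X r R 1] by simp

lemma ideal_on_mult_left:
  assumes "p \<in> alg_on X" "x \<in> ideal_on X R" shows "p * x \<in> ideal_on X R"
proof (rule ideal_on_map[where F = "\<lambda>x. p * x", OF _ _ _ _ assms(2)])
  fix p' r q assume "p' \<in> alg_on X" "r \<in> R" "q \<in> alg_on X"
  then have "(p * p') * r * q \<in> ideal_on X R"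
    by (intro ideal_on_gen alg_on_mult assms(1))
  then show "p * (p' * r * q) \<in> ideal_on X R" by (simp add: mult.assoc)
qed (auto simp: distrib_left scaleC_mult_right)

lemma ideal_on_mult_right:
  assumes "p \<in> alg_on X" "x \<in> ideal_on X R" shows "x * p \<in> ideal_on X R"
proof (rule ideal_on_map[where F = "\<lambda>x. x * p", OF _ _ _ _ assms(2)])
  fix p' r q assume "p' \<in> alg_on X" "r \<in> R" "q \<in> alg_on X"
  then have "p' * r * (q * p) \<in> ideal_on X R"
    by (intro ideal_on_gen alg_on_mult assms(1))
  then show "p' * r * q * p \<in> ideal_on X R" by (simp add: mult.assoc)
qed (auto simp: distrib_right scaleC_mult_left)

lemma ideal_on_sub:
  assumes "R \<subseteq> alg_on X" shows "ideal_on X R \<subseteq> alg_on X"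
proof
  fix x assume "x \<in> ideal_on X R"
  then show "x \<in> alg_on X"
    by (rule ideal_on_map[where F = "\<lambda>x. x", rotated 4]) (use assms in \<open>auto intro!: alg_on_mult\<close>)
qed

definition ext_rel :: "'v::hermitian_space set \<Rightarrow> 'v free_alg set" where
  "ext_rel L = linear_relators L \<union> {letter v * letter v | v. v \<in> L}"

lemma ext_ideal_eq: "ext_ideal L = ideal_on L (ext_rel L)"
  by (simp add: ext_ideal_def ext_rel_def)

lemma csubspace_ext_ideal [simp]: "csubspace (ext_ideal L)"
  by (simp add: ext_ideal_eq)

lemma ext_rel_cases:
  assumes "r \<in> ext_rel L"
  obtains (add) v w where "v \<in> L" "w \<in> L" "r = letter (v + w) - letter v - letter w"
    | (scale) a v where "v \<in> L" "r = letter (a *\<^sub>C v) - a *\<^sub>C letter v"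
    | (square) v where "v \<in> L" "r = letter v * letter v"
  using assms unfolding ext_rel_def linear_relators_def by blast

lemma ext_rel_sub:
  assumes L: "csubspace L" shows "ext_rel L \<subseteq> alg_on L"
proof
  fix r assume "r \<in> ext_rel L"
  then show "r \<in> alg_on L"
    by (cases rule: ext_rel_cases)
      (simp_all add: alg_on_diff alg_on_scale alg_on_mult complex_vector.subspace_add[OF L]
        complex_vector.subspace_scale[OF L])
qed

lemma ext_ideal_sub: "csubspace L \<Longrightarrow> ext_ideal L \<subseteq> alg_on L"
  unfolding ext_ideal_eq by (intro ideal_on_sub ext_rel_sub)

abbreviation ecl :: "'v::hermitian_space set \<Rightarrow> 'v free_alg \<Rightarrow> 'v ext" where
  "ecl L \<equiv> coset (ext_ideal L)"

lemma exterior_simps [simp]: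
  "carrier (exterior L) = ecl L ` alg_on L" "zero (exterior L) = ecl L 0" "one (exterior L) = ecl L 1"
  "add (exterior L) = add (quot_space (alg_on L) (ext_ideal L))"
  "smult (exterior L) = smult (quot_space (alg_on L) (ext_ideal L))"
  by (simp_all add: exterior_def quot_alg_def)

lemma cmod_exterior: "cmod (exterior L)"
  by (rule cmod_cong[OF cmod_quot_space[OF csubspace_ext_ideal csubspace_alg_on]]) simp_all

lemma ecl_add: "ecl L p \<oplus>\<^bsub>exterior L\<^esub> ecl L q = ecl L (p + q)"
  and ecl_smult: "a \<odot>\<^bsub>exterior L\<^esub> ecl L p = ecl L (a *\<^sub>C p)"
  by simp_all

lemma ecl_closed: "p \<in> alg_on L \<Longrightarrow> ecl L p \<in> carrier (exterior L)"
  by simp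

lemma ecl_mult:
  assumes "csubspace L" "p \<in> alg_on L" "q \<in> alg_on L"
  shows "ecl L p \<otimes>\<^bsub>exterior L\<^esub> ecl L q = ecl L (p * q)"
proof -
  let ?p = "repr (ecl L p)" and ?q = "repr (ecl L q)"
  have p: "?p - p \<in> ext_ideal L" "?q - q \<in> ext_ideal L" by (auto intro!: repr_coset)
  have "?q \<in> alg_on L" using ext_ideal_sub[OF assms(1)] assms by (intro repr_coset_in) auto
  then have "(?p - p) * ?q \<in> ext_ideal L" "p * (?q - q) \<in> ext_ideal L"
    using p assms unfolding ext_ideal_eq by (auto intro: ideal_on_mult_left ideal_on_mult_right)
  then have "(?p - p) * ?q + p * (?q - q) \<in> ext_ideal L"
    by (rule complex_vector.subspace_add[OF csubspace_ext_ideal])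
  then have "?p * ?q - p * q \<in> ext_ideal L" by (simp add: algebra_simps)
  then show ?thesis
    by (simp add: exterior_def quot_alg_def coset_eq_iff)
qed

lemma exterior_induct [consumes 1, case_names add scale word]:
  assumes x: "x \<in> carrier (exterior L)"
    and add: "\<And>x y. x \<in> carrier (exterior L) \<Longrightarrow> y \<in> carrier (exterior L) \<Longrightarrow> P x \<Longrightarrow> P y \<Longrightarrow> P (x \<oplus>\<^bsub>exterior L\<^esub> y)"
    and scale: "\<And>a x. x \<in> carrier (exterior L) \<Longrightarrow> P x \<Longrightarrow> P (a \<odot>\<^bsub>exterior L\<^esub> x)"
    and word: "\<And>ws. set ws \<subseteq> L \<Longrightarrow> P (ecl L (Poly_Mapping.single (Word ws) 1))"
  shows "P x"
proof -
  obtain p where p: "p \<in> alg_on L" "x = ecl L p" using x by auto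
  from p(1) have "P (ecl L p)"
  proof (induction rule: alg_on_induct)
    case zero
    have "P (0 \<odot>\<^bsub>exterior L\<^esub> ecl L (Poly_Mapping.single (Word []) 1))"
      by (rule scale) (auto intro: word)
    then show ?case by (simp only: ecl_smult complex_vector.scale_zero_left)
  next
    case (add x y)
    then show ?case using assms(2)[of "ecl L x" "ecl L y"] by (simp only: ecl_add ecl_closed)
  next
    case (scale a x)
    then show ?case using assms(3)[of "ecl L x" a] by (simp only: ecl_smult ecl_closed)
  qed (rule word)
  with p show ?thesis by simp
qed

lemma
  assumes add: "\<And>x y. F (x + y) = F x + F y" and scale: "\<And>a x. F (a *\<^sub>C x) = a *\<^sub>C F x"
    and L: "csubspace L" and F: "\<And>p. p \<in> alg_on L \<Longrightarrow> F p \<in> alg_on L'"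
    and I: "\<And>p r q. p \<in> alg_on L \<Longrightarrow> r \<in> ext_rel L \<Longrightarrow> q \<in> alg_on L \<Longrightarrow> F (p * r * q) \<in> ext_ideal L'"
  shows induced_ecl: "p \<in> alg_on L \<Longrightarrow> induced (ext_ideal L') F (ecl L p) = ecl L' (F p)"
    and induced_clin: "clin (exterior L) (exterior L') (induced (ext_ideal L') F)"
proof -
  have diff: "F (x - y) = F x - F y" for x y
    using add[of "x - y" y] by (simp add: algebra_simps)
  show *: "induced (ext_ideal L') F (ecl L p) = ecl L' (F p)" if p: "p \<in> alg_on L" for p
  proof (rule induced_coset[OF _ _ csubspace_alg_on _ p])
    fix y assume "y \<in> ext_ideal L"
    then show "F y \<in> ext_ideal L'"
      unfolding ext_ideal_eq[of L] by (rule ideal_on_map[rotated 4]) (use add scale I in auto)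
  qed (use diff ext_ideal_sub[OF L] in auto)
  show "clin (exterior L) (exterior L') (induced (ext_ideal L') F)"
  proof (rule clinI)
    fix x assume "x \<in> carrier (exterior L)"
    then obtain p where p: "x = ecl L p" "p \<in> alg_on L" by auto
    show "induced (ext_ideal L') F x \<in> carrier (exterior L')" using p F by (auto simp: *)
    fix a show "induced (ext_ideal L') F (a \<odot>\<^bsub>exterior L\<^esub> x) = a \<odot>\<^bsub>exterior L'\<^esub> induced (ext_ideal L') F x"
      using p by (simp only: ecl_smult * scale alg_on_scale)
  next
    fix x y assume "x \<in> carrier (exterior L)" "y \<in> carrier (exterior L)"
    then obtain p q where "x = ecl L p" "p \<in> alg_on L" "y = ecl L q" "q \<in> alg_on L" by auto
    then show "induced (ext_ideal L') F (x \<oplus>\<^bsub>exterior L\<^esub> y) =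
        induced (ext_ideal L') F x \<oplus>\<^bsub>exterior L'\<^esub> induced (ext_ideal L') F y"
      by (simp only: ecl_add * add alg_on_add)
  qed
qed

lemma ext_gen_mult_clin:
  assumes "csubspace L" "v \<in> L"
  shows "clin (exterior L) (exterior L) (\<lambda>x. ext_gen L v \<otimes>\<^bsub>exterior L\<^esub> x)"
proof (rule clinI)
  fix x assume "x \<in> carrier (exterior L)"
  then obtain p where p: "x = ecl L p" "p \<in> alg_on L" by auto
  show "ext_gen L v \<otimes>\<^bsub>exterior L\<^esub> x \<in> carrier (exterior L)"
    using p assms by (simp add: ext_gen_def ecl_mult alg_on_mult)
  fix a show "ext_gen L v \<otimes>\<^bsub>exterior L\<^esub> (a \<odot>\<^bsub>exterior L\<^esub> x) = a \<odot>\<^bsub>exterior L\<^esub> (ext_gen L v \<otimes>\<^bsub>exterior L\<^esub> x)"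
    using p assms by (simp only: ecl_smult ext_gen_def ecl_mult alg_on_scale letter_alg_on scaleC_mult_right)
next
  fix x y assume "x \<in> carrier (exterior L)" "y \<in> carrier (exterior L)"
  then obtain p q where "x = ecl L p" "p \<in> alg_on L" "y = ecl L q" "q \<in> alg_on L" by auto
  then show "ext_gen L v \<otimes>\<^bsub>exterior L\<^esub> (x \<oplus>\<^bsub>exterior L\<^esub> y) =
      (ext_gen L v \<otimes>\<^bsub>exterior L\<^esub> x) \<oplus>\<^bsub>exterior L\<^esub> (ext_gen L v \<otimes>\<^bsub>exterior L\<^esub> y)"
    using assms by (simp only: ecl_add ext_gen_def ecl_mult alg_on_add letter_alg_on distrib_left)
qed

lemma letter_word: "letter v * Poly_Mapping.single (Word ws) a = Poly_Mapping.single (Word (v # ws)) a"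
  by (simp add: letter_def mult_single)

lemma ext_gen_word:
  assumes "csubspace L" "v \<in> L" "set ws \<subseteq> L"
  shows "ext_gen L v \<otimes>\<^bsub>exterior L\<^esub> ecl L (Poly_Mapping.single (Word ws) 1) = ecl L (Poly_Mapping.single (Word (v # ws)) 1)"
  using assms by (simp add: ext_gen_def ecl_mult letter_word)

lemma ext_gen_mult_add:
  assumes L: "csubspace L" "v \<in> L" "w \<in> L" "x \<in> carrier (exterior L)"
  shows "ext_gen L (v + w) \<otimes>\<^bsub>exterior L\<^esub> x = (ext_gen L v \<otimes>\<^bsub>exterior L\<^esub> x) \<oplus>\<^bsub>exterior L\<^esub> (ext_gen L w \<otimes>\<^bsub>exterior L\<^esub> x)"
proof -
  obtain p where p: "x = ecl L p" "p \<in> alg_on L" using L by auto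
  have "letter (v + w) - letter v - letter w \<in> ext_rel L"
    using L unfolding ext_rel_def linear_relators_def by blast
  then have "(letter (v + w) - letter v - letter w) * p \<in> ext_ideal L"
    unfolding ext_ideal_eq by (intro ideal_on_mult_right p ideal_on_rel)
  then have "ecl L (letter (v + w) * p) = ecl L (letter v * p + letter w * p)"
    by (simp add: coset_eq_iff algebra_simps)
  then show ?thesis
    using p L complex_vector.subspace_add[OF L(1-3)]
    by (simp only: ext_gen_def ecl_mult letter_alg_on ecl_add)
qed

lemma ext_gen_square:
  assumes L: "csubspace L" "v \<in> L" "x \<in> carrier (exterior L)"
  shows "ext_gen L v \<otimes>\<^bsub>exterior L\<^esub> (ext_gen L v \<otimes>\<^bsub>exterior L\<^esub> x) = \<zero>\<^bsub>exterior L\<^esub>"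
proof -
  obtain p where p: "x = ecl L p" "p \<in> alg_on L" using L by auto
  have "letter v * letter v \<in> ext_rel L" using L unfolding ext_rel_def by blast
  then have "letter v * letter v * p \<in> ext_ideal L"
    unfolding ext_ideal_eq by (intro ideal_on_mult_right p ideal_on_rel)
  then have "ecl L (letter v * (letter v * p)) = ecl L 0"
    by (simp add: coset_eq_iff mult.assoc)
  then show ?thesis
    using p L by (simp only: ext_gen_def ecl_mult letter_alg_on alg_on_mult exterior_simps)
qed

lemma ext_gen_mult_closed:
  assumes "csubspace L" "v \<in> L" "x \<in> carrier (exterior L)"
  shows "ext_gen L v \<otimes>\<^bsub>exterior L\<^esub> x \<in> carrier (exterior L)"
  using clin_closed[OF ext_gen_mult_clin] assms by blast

text \<open>
  Polarisation of \<open>(v + w) \<and> (v + w) = 0\<close>.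
\<close>

lemma ext_gen_anticommute:
  assumes L: "csubspace L" "v \<in> L" "w \<in> L" "x \<in> carrier (exterior L)"
  shows "(ext_gen L v \<otimes>\<^bsub>exterior L\<^esub> (ext_gen L w \<otimes>\<^bsub>exterior L\<^esub> x)) \<oplus>\<^bsub>exterior L\<^esub>
     (ext_gen L w \<otimes>\<^bsub>exterior L\<^esub> (ext_gen L v \<otimes>\<^bsub>exterior L\<^esub> x)) = \<zero>\<^bsub>exterior L\<^esub>"
proof -
  interpret E: cmod "exterior L" by (rule cmod_exterior)
  note cl = ext_gen_mult_closed[OF L(1)] and add = clin_add[OF ext_gen_mult_clin[OF L(1)]]
  have s: "v + w \<in> L" using L by (simp add: complex_vector.subspace_add)
  have "ext_gen L (v + w) \<otimes>\<^bsub>exterior L\<^esub> (ext_gen L (v + w) \<otimes>\<^bsub>exterior L\<^esub> x) = \<zero>\<^bsub>exterior L\<^esub>"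
    by (rule ext_gen_square[OF L(1) s L(4)])
  then show ?thesis
    using ext_gen_square[OF L(1,2,4)] ext_gen_square[OF L(1,3,4)]
    by (simp only: ext_gen_mult_add[OF L(1-3) cl[OF s L(4)]])
      (simp only: ext_gen_mult_add[OF L] add[OF L(2)] add[OF L(3)] cl[OF L(2)] cl[OF L(3)] L(4)
        E.l_zero E.r_zero E.add.m_closed)
qed


section \<open>Parity and contractions\<close>

definition parf :: "'v free_alg \<Rightarrow> 'v free_alg" where
  "parf = lin_ext (\<lambda>w. (-1) ^ length (letters w) *\<^sub>C Poly_Mapping.single w 1)"

text \<open>
  Contraction with an arbitrary functional \<open>\<phi>\<close> instead of \<open>\<langle>v, \<cdot>\<rangle>\<close>: the spaces need not be complete, so
  the functionals that separate a vector from a subspace need not be given by vectors.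
\<close>

primrec clist :: "('v \<Rightarrow> complex) \<Rightarrow> 'v list \<Rightarrow> 'v free_alg" where
  "clist \<phi> [] = 0"
| "clist \<phi> (w # ws) = \<phi> w *\<^sub>C Poly_Mapping.single (Word ws) 1 - letter w * clist \<phi> ws"

definition ctrf :: "('v \<Rightarrow> complex) \<Rightarrow> 'v free_alg \<Rightarrow> 'v free_alg" where
  "ctrf \<phi> = lin_ext (\<lambda>w. clist \<phi> (letters w))"

definition ctr :: "'v::hermitian_space set \<Rightarrow> ('v \<Rightarrow> complex) \<Rightarrow> 'v ext \<Rightarrow> 'v ext" where
  "ctr L \<phi> = induced (ext_ideal L) (ctrf \<phi>)"

lemma contract_list_clist: "contract_list v ws = clist (cinner v) ws"
  by (induction ws) auto

lemma contract_eq_ctr: "contract L v = ctr L (cinner v)"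
  by (simp add: contract_def ctr_def ctrf_def contract_list_clist)

lemma ext_parity_parf: "ext_parity L = induced (ext_ideal L) parf"
  by (simp add: ext_parity_def parf_def)

lemma parf_add: "parf (p + q) = parf p + parf q" and parf_scale: "parf (a *\<^sub>C p) = a *\<^sub>C parf p"
  and parf_diff: "parf (p - q) = parf p - parf q"
  and parf_word: "parf (Poly_Mapping.single (Word ws) 1) = (-1) ^ length ws *\<^sub>C Poly_Mapping.single (Word ws) 1"
  and parf_0 [simp]: "parf 0 = 0"
  by (simp_all add: parf_def lin_ext_add lin_ext_scale lin_ext_minus)

lemma ctrf_add: "ctrf \<phi> (p + q) = ctrf \<phi> p + ctrf \<phi> q" and ctrf_scale: "ctrf \<phi> (a *\<^sub>C p) = a *\<^sub>C ctrf \<phi> p"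
  and ctrf_diff: "ctrf \<phi> (p - q) = ctrf \<phi> p - ctrf \<phi> q"
  and ctrf_word: "ctrf \<phi> (Poly_Mapping.single (Word ws) 1) = clist \<phi> ws"
  and ctrf_0 [simp]: "ctrf \<phi> 0 = 0"
  by (simp_all add: ctrf_def lin_ext_add lin_ext_scale lin_ext_minus)

lemma parf_mult: "parf (p * q) = parf p * parf q"
proof (induction p rule: free_alg_induct)
  case (word ws)
  show ?case
    by (induction q rule: free_alg_induct)
      (simp_all add: parf_add parf_scale parf_word distrib_left scaleC_mult_left scaleC_mult_right
        mult_single power_add)
qed (simp_all add: parf_add parf_scale distrib_right scaleC_mult_left)

lemma parf_parf: "parf (parf p) = p"
  by (induction p rule: free_alg_induct)
    (simp_all add: parf_add parf_scale parf_word power_add[symmetric] scaleC_one flip: mult_2)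

lemma parf_letter: "parf (letter v) = - letter v"
  using parf_word[of "[v]"] by (simp add: letter_def)

lemma ctrf_letter_mult: "ctrf \<phi> (letter v * q) = \<phi> v *\<^sub>C q - letter v * ctrf \<phi> q"
  by (induction q rule: free_alg_induct)
    (simp_all add: ctrf_add ctrf_scale ctrf_word distrib_left scaleC_add_right scaleC_mult_right
      letter_word complex_vector.scale_right_diff_distrib mult.commute)

lemma ctrf_letter: "ctrf \<phi> (letter v) = \<phi> v *\<^sub>C 1"
  using ctrf_word[of \<phi> "[v]"] by (simp add: letter_def one_free_alg)

lemma ctrf_mult: "ctrf \<phi> (p * q) = ctrf \<phi> p * q + parf p * ctrf \<phi> q"
proof (induction p rule: free_alg_induct)
  case (word ws)
  show ?case
  proof (induction ws)
    case Nil
    have "parf (1 :: 'a free_alg) = 1" "ctrf \<phi> 1 = 0"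
      using parf_word[of "[]"] ctrf_word[of \<phi> "[]"] by (simp_all add: scaleC_one flip: one_free_alg)
    then show ?case by (simp flip: one_free_alg)
  next
    case (Cons v ws)
    let ?w = "Poly_Mapping.single (Word ws) (1::complex)"
    have "Poly_Mapping.single (Word (v # ws)) 1 = letter v * ?w" by (simp add: letter_word)
    then show ?case
      by (simp only: mult.assoc ctrf_letter_mult Cons.IH parf_mult parf_letter)
        (simp add: algebra_simps scaleC_mult_left)
  qed
qed (simp_all add: ctrf_add ctrf_scale parf_add parf_scale algebra_simps scaleC_mult_left scaleC_add_right)

lemma parf_ctrf: "parf (ctrf \<phi> p) = - ctrf \<phi> (parf p)"
proof (induction p rule: free_alg_induct)
  case (word ws)
  show ?case
  proof (induction ws)
    case (Cons v ws)
    let ?w = "Poly_Mapping.single (Word ws) (1::complex)"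
    have "Poly_Mapping.single (Word (v # ws)) 1 = letter v * ?w" by (simp add: letter_word)
    then show ?case
      by (simp only: ctrf_letter_mult parf_mult parf_letter parf_diff parf_scale Cons.IH)
        (simp add: ctrf_letter_mult ctrf_diff[of _ 0, simplified])
  qed (simp add: parf_word ctrf_word scaleC_one)
qed (simp_all add: ctrf_add ctrf_scale parf_add parf_scale)

lemma ctrf_ctrf: "ctrf \<phi> (ctrf \<psi> p) = - ctrf \<psi> (ctrf \<phi> p)"
proof (induction p rule: free_alg_induct)
  case (word ws)
  show ?case
  proof (induction ws)
    case (Cons v ws)
    let ?w = "Poly_Mapping.single (Word ws) (1::complex)"
    have "Poly_Mapping.single (Word (v # ws)) 1 = letter v * ?w" by (simp add: letter_word)
    then show ?case
      by (simp only: ctrf_letter_mult ctrf_diff ctrf_scale Cons.IH) simp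
  qed (simp add: ctrf_word)
qed (simp_all add: ctrf_add ctrf_scale)

lemma parf_alg_on: "p \<in> alg_on L \<Longrightarrow> parf p \<in> alg_on L"
  unfolding parf_def
  by (rule lin_ext_in_subspace[of _ "words_on L"]) (auto intro: alg_on_scale)

lemma clist_alg_on: "set ws \<subseteq> L \<Longrightarrow> clist \<phi> ws \<in> alg_on L"
  by (induction ws)
    (simp_all add: complex_vector.subspace_0 alg_on_diff alg_on_scale alg_on_mult)

lemma ctrf_alg_on: "p \<in> alg_on L \<Longrightarrow> ctrf \<phi> p \<in> alg_on L"
  unfolding ctrf_def
  by (rule lin_ext_in_subspace[of _ "words_on L"]) (auto intro: clist_alg_on simp: in_words_on)

definition lin_on :: "'v::complex_vector set \<Rightarrow> ('v \<Rightarrow> 'w::complex_vector) \<Rightarrow> bool" where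
  "lin_on L f \<longleftrightarrow> (\<forall>v\<in>L. \<forall>w\<in>L. f (v + w) = f v + f w) \<and> (\<forall>a. \<forall>v\<in>L. f (a *\<^sub>C v) = a *\<^sub>C f v)"

lemma parf_ext_rel: "r \<in> ext_rel L \<Longrightarrow> parf r = r \<or> parf r = - r"
  by (cases rule: ext_rel_cases, assumption)
    (simp_all add: parf_diff parf_letter parf_mult parf_scale)

lemma ctrf_ext_rel:
  assumes "lin_on L \<phi>" "r \<in> ext_rel L" shows "ctrf \<phi> r = 0"
  using assms(2)
proof (cases rule: ext_rel_cases)
  case (add v w)
  then have "\<phi> (v + w) = \<phi> v + \<phi> w" using assms(1) by (simp add: lin_on_def)
  then show ?thesis by (simp add: add(3) ctrf_diff ctrf_letter scaleC_add_left)
next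
  case (scale a v)
  then have "\<phi> (a *\<^sub>C v) = a * \<phi> v" using assms(1) by (simp add: lin_on_def)
  then show ?thesis by (simp add: scale(2) ctrf_diff ctrf_letter ctrf_scale)
next
  case (square v)
  then show ?thesis by (simp add: ctrf_letter_mult ctrf_letter scaleC_mult_right)
qed

lemma parf_ideal_step:
  assumes "p \<in> alg_on L" "r \<in> ext_rel L" "q \<in> alg_on L"
  shows "parf (p * r * q) \<in> ext_ideal L"
proof -
  have "parf p * r * parf q \<in> ext_ideal L"
    using assms parf_alg_on unfolding ext_ideal_eq by (intro ideal_on_gen)
  then show ?thesis
    using parf_ext_rel[OF assms(2)] complex_vector.subspace_neg[OF csubspace_ext_ideal]
    by (auto simp: parf_mult)
qed

text \<open>
  A contraction is an odd derivation, it kills every relator, and relators are even or odd. So only the terms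
  in which \<open>p\<close> or \<open>q\<close> is contracted remain, and they lie in the ideal.
\<close>

lemma ctrf_ideal_step:
  assumes "lin_on L \<phi>" "p \<in> alg_on L" "r \<in> ext_rel L" "q \<in> alg_on L"
  shows "ctrf \<phi> (p * r * q) \<in> ext_ideal L"
proof -
  have "ctrf \<phi> p * r * q \<in> ext_ideal L" "parf p * r * ctrf \<phi> q \<in> ext_ideal L"
    using assms parf_alg_on ctrf_alg_on unfolding ext_ideal_eq by (auto intro!: ideal_on_gen)
  then have "ctrf \<phi> p * r * q + parf p * r * ctrf \<phi> q \<in> ext_ideal L"
    "ctrf \<phi> p * r * q - parf p * r * ctrf \<phi> q \<in> ext_ideal L"
    by (auto intro: complex_vector.subspace_add complex_vector.subspace_diff)
  then show ?thesis
    using parf_ext_rel[OF assms(3)] ctrf_ext_rel[OF assms(1,3)]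
    by (auto simp: ctrf_mult parf_mult)
qed

lemma
  assumes L: "csubspace L"
  shows ext_parity_ecl: "p \<in> alg_on L \<Longrightarrow> ext_parity L (ecl L p) = ecl L (parf p)"
    and ext_parity_clin: "clin (exterior L) (exterior L) (ext_parity L)"
  unfolding ext_parity_parf
  by (rule induced_ecl[OF parf_add parf_scale L parf_alg_on parf_ideal_step]
      induced_clin[OF parf_add parf_scale L parf_alg_on parf_ideal_step]; assumption)+

lemma
  assumes L: "csubspace L" and \<phi>: "lin_on L \<phi>"
  shows ctr_ecl: "p \<in> alg_on L \<Longrightarrow> ctr L \<phi> (ecl L p) = ecl L (ctrf \<phi> p)"
    and ctr_clin: "clin (exterior L) (exterior L) (ctr L \<phi>)"
  unfolding ctr_def
  by (rule induced_ecl[OF ctrf_add ctrf_scale L ctrf_alg_on ctrf_ideal_step[OF \<phi>]]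
      induced_clin[OF ctrf_add ctrf_scale L ctrf_alg_on ctrf_ideal_step[OF \<phi>]]; assumption)+

lemma ecl_minus: "\<ominus>\<^bsub>exterior L\<^esub> ecl L p = ecl L (- p)" if "p \<in> alg_on L"
  using cmod.smult_minus_one[OF cmod_exterior ecl_closed[OF that]]
  by (simp only: ecl_smult) simp

lemma ext_parity_ctr:
  assumes L: "csubspace L" and \<phi>: "lin_on L \<phi>" and x: "x \<in> carrier (exterior L)"
  shows "ext_parity L (ctr L \<phi> x) = \<ominus>\<^bsub>exterior L\<^esub> ctr L \<phi> (ext_parity L x)"
proof -
  obtain p where p: "x = ecl L p" "p \<in> alg_on L" using x by auto
  show ?thesis
    unfolding p using p(2)
    by (simp only: ext_parity_ecl[OF L] ctr_ecl[OF L \<phi>] ctrf_alg_on parf_alg_on ecl_minus parf_ctrf)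
qed

lemma ext_parity_ext_parity:
  assumes L: "csubspace L" and x: "x \<in> carrier (exterior L)"
  shows "ext_parity L (ext_parity L x) = x"
proof -
  obtain p where p: "x = ecl L p" "p \<in> alg_on L" using x by auto
  show ?thesis
    unfolding p using p(2)
    by (simp only: ext_parity_ecl[OF L] parf_alg_on parf_parf)
qed

lemma ctr_one:
  assumes L: "csubspace L" and \<phi>: "lin_on L \<phi>" shows "ctr L \<phi> \<one>\<^bsub>exterior L\<^esub> = \<zero>\<^bsub>exterior L\<^esub>"
  unfolding exterior_simps using ctr_ecl[OF L \<phi> alg_on_one] ctrf_word[of \<phi> "[]"]
  by (simp flip: one_free_alg)

lemma ext_parity_one:
  assumes L: "csubspace L" shows "ext_parity L \<one>\<^bsub>exterior L\<^esub> = \<one>\<^bsub>exterior L\<^esub>"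
proof -
  have "parf (1 :: 'a free_alg) = 1"
    using parf_word[of "[]"] by (simp add: scaleC_one flip: one_free_alg)
  then show ?thesis by (simp add: ext_parity_ecl[OF L])
qed


section \<open>The constant term and functoriality\<close>

text \<open>
  The augmentation extracts the coefficient of the empty word. It is multiplicative and kills the relators, so it
  is defined on the exterior algebra, where it detects that the vacuum is not zero.
\<close>

definition augf :: "'v free_alg \<Rightarrow> complex" where
  "augf = lin_ext (\<lambda>w. if letters w = [] then 1 else 0)"

lemma augf_add: "augf (p + q) = augf p + augf q" and augf_scale: "augf (a *\<^sub>C p) = a * augf p"
  and augf_diff: "augf (p - q) = augf p - augf q"
  and augf_word: "augf (Poly_Mapping.single (Word ws) 1) = (if ws = [] then 1 else 0)"
  by (simp_all add: augf_def lin_ext_add lin_ext_scale lin_ext_minus)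

lemma augf_one: "augf 1 = 1"
  by (simp add: one_free_alg augf_word)

lemma augf_mult: "augf (p * q) = augf p * augf q"
proof (induction p rule: free_alg_induct)
  case (word ws)
  show ?case
    by (induction q rule: free_alg_induct)
      (auto simp: augf_add augf_scale augf_word distrib_left scaleC_mult_right mult_single augf_diff[of 0 0, simplified])
qed (simp_all add: augf_add augf_scale distrib_right scaleC_mult_left augf_diff[of 0 0, simplified])

lemma augf_ideal: "x \<in> ext_ideal L \<Longrightarrow> augf x = 0"
proof -
  assume x: "x \<in> ext_ideal L"
  have l: "augf (letter v) = 0" for v using augf_word[of "[v]"] by (simp add: letter_def)
  have "augf r = 0" if "r \<in> ext_rel L" for r
    using that by (cases rule: ext_rel_cases) (simp_all add: augf_diff augf_scale augf_mult l)
  then have "augf x \<in> {0}"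
    using x unfolding ext_ideal_eq
    by (intro ideal_on_map[of augf "{0}" L "ext_rel L" x])
      (simp_all add: augf_add augf_scale augf_mult)
  then show ?thesis by simp
qed

definition aug :: "'v ext \<Rightarrow> complex" where
  "aug x = augf (repr x)"

lemma aug_ecl: "aug (ecl L p) = augf p"
  using augf_ideal[OF repr_coset[OF csubspace_ext_ideal[of L], of p]]
  by (simp add: aug_def augf_diff)

definition mapf :: "('v \<Rightarrow> 'w) \<Rightarrow> 'v free_alg \<Rightarrow> 'w free_alg" where
  "mapf f = lin_ext (\<lambda>w. Poly_Mapping.single (Word (map f (letters w))) 1)"

lemma mapf_add: "mapf f (p + q) = mapf f p + mapf f q" and mapf_scale: "mapf f (a *\<^sub>C p) = a *\<^sub>C mapf f p"
  and mapf_diff: "mapf f (p - q) = mapf f p - mapf f q"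
  and mapf_word: "mapf f (Poly_Mapping.single (Word ws) 1) = Poly_Mapping.single (Word (map f ws)) 1"
  and mapf_0 [simp]: "mapf f 0 = 0"
  by (simp_all add: mapf_def lin_ext_add lin_ext_scale lin_ext_minus scaleC_one)

lemma mapf_letter: "mapf f (letter v) = letter (f v)"
  using mapf_word[of f "[v]"] by (simp add: letter_def)

lemma mapf_mult: "mapf f (p * q) = mapf f p * mapf f q"
proof (induction p rule: free_alg_induct)
  case (word ws)
  show ?case
    by (induction q rule: free_alg_induct)
      (simp_all add: mapf_add mapf_scale mapf_word distrib_left scaleC_mult_right mult_single)
qed (simp_all add: mapf_add mapf_scale distrib_right scaleC_mult_left)

lemma mapf_alg_on: "f ` L \<subseteq> L' \<Longrightarrow> p \<in> alg_on L \<Longrightarrow> mapf f p \<in> alg_on L'"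
  unfolding mapf_def
  by (rule lin_ext_in_subspace[of _ "words_on L"]) (auto simp: in_words_on)

lemma mapf_ideal_step:
  assumes f: "lin_on L f" "f ` L \<subseteq> L'" and "p \<in> alg_on L" "r \<in> ext_rel L" "q \<in> alg_on L"
  shows "mapf f (p * r * q) \<in> ext_ideal L'"
proof -
  have "mapf f r \<in> ext_rel L'"
    using assms(4)
  proof (cases rule: ext_rel_cases)
    case (add v w)
    then have "mapf f r = letter (f v + f w) - letter (f v) - letter (f w)"
      using f(1) by (simp add: mapf_diff mapf_letter lin_on_def)
    moreover have "f v \<in> L'" "f w \<in> L'" using add f(2) by auto
    ultimately show ?thesis unfolding ext_rel_def linear_relators_def by blast
  next
    case (scale a v)
    then have "mapf f r = letter (a *\<^sub>C f v) - a *\<^sub>C letter (f v)"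
      using f(1) by (simp add: mapf_diff mapf_letter mapf_scale lin_on_def)
    moreover have "f v \<in> L'" using scale f(2) by auto
    ultimately show ?thesis unfolding ext_rel_def linear_relators_def by blast
  next
    case (square v)
    then have "mapf f r = letter (f v) * letter (f v)" "f v \<in> L'"
      using f(2) by (auto simp: mapf_mult mapf_letter)
    then show ?thesis unfolding ext_rel_def by blast
  qed
  then show ?thesis
    using assms mapf_alg_on[OF f(2)] unfolding ext_ideal_eq mapf_mult by (intro ideal_on_gen)
qed

lemma
  assumes L: "csubspace L" and f: "lin_on L f" "f ` L \<subseteq> L'"
  shows ext_map_ecl: "p \<in> alg_on L \<Longrightarrow> ext_map L' f (ecl L p) = ecl L' (mapf f p)"
    and ext_map_clin: "clin (exterior L) (exterior L') (ext_map L' f)"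
  unfolding ext_map_def mapf_def[symmetric]
  by (rule induced_ecl[OF mapf_add mapf_scale L mapf_alg_on[OF f(2)] mapf_ideal_step[OF f]]
      induced_clin[OF mapf_add mapf_scale L mapf_alg_on[OF f(2)] mapf_ideal_step[OF f]]; assumption)+


section \<open>Hermitian forms and Lagrangians\<close>

lemma cinner_add_left: "cinner (x + y) z = cinner x z + cinner y z"
  by (metis cinner_add_right cinner_commute complex_cnj_add)

lemma cinner_scaleC_left: "cinner (a *\<^sub>C x) y = cnj a * cinner x y"
  by (metis cinner_commute cinner_scaleC_right complex_cnj_mult)

lemma cinner_zero_right [simp]: "cinner x 0 = 0"
  using cinner_scaleC_right[of x 0 0] by simp

lemma cinner_zero_left [simp]: "cinner 0 x = 0"
  using cinner_scaleC_left[of 0 0 x] by simp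

lemma cinner_uminus_right [simp]: "cinner x (- y) = - cinner x y"
  using cinner_scaleC_right[of x "-1" y] by simp

lemma cinner_uminus_left [simp]: "cinner (- x) y = - cinner x y"
  using cinner_scaleC_left[of "-1" x y] by simp

lemma cinner_diff_right: "cinner x (y - z) = cinner x y - cinner x z"
  using cinner_add_right[of x y "- z"] by simp

lemma cinner_diff_left: "cinner (x - y) z = cinner x z - cinner y z"
  using cinner_add_left[of x "- y" z] by simp

lemma cinner_self: "cinner x x = complex_of_real (inner x x)"
  using cinner_commute[of x x] by (simp add: complex_eq_iff inner_eq_Re_cinner)

lemma cinner_self_eq_0 [simp]: "cinner x x = 0 \<longleftrightarrow> x = 0"
  by (simp add: cinner_self)

lemma cinner_eq_0_sym: "cinner x y = 0 \<longleftrightarrow> cinner y x = 0"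
  by (metis cinner_commute complex_cnj_zero)

lemma cinner_Pair [simp]: "cinner (a, b) (a', b') = cinner a a' + cinner b b'"
  by (simp add: cinner_prod_def)

lemma scaleC_Pair [simp]: "r *\<^sub>C (a, b) = (r *\<^sub>C a, r *\<^sub>C b)"
  by (simp add: scaleC_prod_def)

lemma lin_on_cinner [simp]: "lin_on L (cinner u)"
  by (simp add: lin_on_def cinner_add_right cinner_scaleC_right)

lemma real_structure_pair_conj:
  assumes i: "real_structure ci" and j: "real_structure cj" shows "real_structure (pair_conj ci cj)"
proof -
  have "cj ((-1) *\<^sub>C v) = cnj (-1) *\<^sub>C cj v" for v using j by (simp only: real_structure_def simp_thms)
  then have n: "cj (- v) = - cj v" for v by simp
  show ?thesis
    using i j by (simp add: real_structure_def pair_conj_def neg_conj_def cinner_prod_def scaleC_prod_def n)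
qed

lemma orth_iff: "v \<in> orth S \<longleftrightarrow> (\<forall>s\<in>S. cinner s v = 0)"
  by (simp add: orth_def)

lemma csubspace_orth: "csubspace (orth S)"
  by (rule complex_vector.subspaceI) (auto simp: orth_iff cinner_add_right cinner_scaleC_right)

lemma proj_eqI:
  assumes S: "csubspace S" and s: "s \<in> S" "v - s \<in> orth S" shows "proj S v = s"
  unfolding proj_def
proof (rule the_equality)
  fix t assume t: "t \<in> S \<and> v - t \<in> orth S"
  have 1: "t - s \<in> S" using t s S by (simp add: complex_vector.subspace_diff)
  have "(v - s) - (v - t) \<in> orth S"
    by (rule complex_vector.subspace_diff[OF csubspace_orth]) (use t s in auto)
  moreover have "(v - s) - (v - t) = t - s" by simp
  ultimately have "t - s \<in> orth S" by metis
  then have "cinner (t - s) (t - s) = 0" using 1 unfolding orth_iff by blast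
  then show "t = s" by simp
qed (use s in auto)

locale lagr =
  fixes c :: "'v::hermitian_space \<Rightarrow> 'v" and L
  assumes rs: "real_structure c" and lag: "lagrangian c L"
begin

lemma sub: "csubspace L" and conj_eq: "c ` L = orth L"
  and split: "\<exists>l\<in>L. \<exists>l'\<in>L. v = l + c l'"
  using lag by (auto simp: lagrangian_def)

lemma conj_conj [simp]: "c (c v) = v" and conj_add: "c (v + w) = c v + c w"
  and conj_scale: "c (a *\<^sub>C v) = cnj a *\<^sub>C c v" and conj_cinner: "cinner (c v) (c w) = cinner w v"
  using rs by (auto simp: real_structure_def)

lemma conj_0 [simp]: "c 0 = 0"
  using conj_scale[of 0 0] by simp

lemma conj_uminus: "c (- v) = - c v"
  using conj_scale[of "-1" v] by simp

lemma conj_diff: "c (v - w) = c v - c w"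
  using conj_add[of v "- w"] by (simp add: conj_uminus)

lemma isotropic: "l \<in> L \<Longrightarrow> l' \<in> L \<Longrightarrow> cinner l (c l') = 0"
proof -
  assume "l \<in> L" "l' \<in> L"
  then have "c l' \<in> orth L" using conj_eq by blast
  then show ?thesis using \<open>l \<in> L\<close> by (simp add: orth_iff)
qed

abbreviation P where "P \<equiv> proj L"

lemma proj_split: "l \<in> L \<Longrightarrow> l' \<in> L \<Longrightarrow> P (l + c l') = l"
  using conj_eq by (intro proj_eqI sub) auto

lemma proj_in: "P v \<in> L" and coproj_in: "c (v - P v) \<in> L"
proof -
  obtain l l' where l: "l \<in> L" "l' \<in> L" "v = l + c l'" using split by blast
  then have "P v = l" by (simp add: proj_split)
  with l show "P v \<in> L" "c (v - P v) \<in> L" by auto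
qed

lemma proj_add: "P (v + w) = P v + P w"
proof -
  have "(v + w) - (P v + P w) = c (c (v - P v) + c (w - P w))" by (simp add: conj_add)
  then have "(v + w) - (P v + P w) \<in> orth L"
    using complex_vector.subspace_add[OF sub coproj_in[of v] coproj_in[of w]] conj_eq by auto
  then show ?thesis
    by (intro proj_eqI sub complex_vector.subspace_add[OF sub] proj_in)
qed

lemma proj_scale: "P (a *\<^sub>C v) = a *\<^sub>C P v"
proof -
  have "a *\<^sub>C v - a *\<^sub>C P v = c (cnj a *\<^sub>C c (v - P v))"
    by (simp add: conj_scale complex_vector.scale_right_diff_distrib)
  then have "a *\<^sub>C v - a *\<^sub>C P v \<in> orth L"
    using complex_vector.subspace_scale[OF sub coproj_in[of v]] conj_eq by auto
  then show ?thesis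
    by (intro proj_eqI sub complex_vector.subspace_scale[OF sub] proj_in)
qed

lemma proj_of_in [simp]: "l \<in> L \<Longrightarrow> P l = l"
  using proj_split[of l 0] complex_vector.subspace_0[OF sub] by simp

lemma proj_of_conj: "v \<in> c ` L \<Longrightarrow> P v = 0"
  using proj_split[of 0] complex_vector.subspace_0[OF sub] by auto

text \<open>
  Both \<open>L\<close> and its conjugate are isotropic for the bilinear form \<open>\<langle>c v, w\<rangle>\<close>, so only the two mixed
  terms survive. They are the terms that arise when the exterior and the interior part of the
  action on \<open>\<Lambda>L\<close> are commuted.
\<close>

lemma cinner_conj_split:
  "cinner (c v) w = cinner (c (v - P v)) (P w) + cinner (c (w - P w)) (P v)"
proof -
  have 1: "c v = c (P v) + c (v - P v)" by (simp flip: conj_add)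
  have 2: "w = P w + c (c (w - P w))" by simp
  have "cinner (c v) w = cinner (c (P v) + c (v - P v)) (P w + c (c (w - P w)))"
    using 1 2 by metis
  also have "\<dots> = cinner (c (P v)) (P w) + cinner (c (P v)) (c (c (w - P w)))
      + cinner (c (v - P v)) (P w) + cinner (c (v - P v)) (c (c (w - P w)))"
    by (simp only: cinner_add_left cinner_add_right) simp
  also have "cinner (c (P v)) (P w) = 0"
    using isotropic[OF proj_in proj_in] by (simp add: cinner_eq_0_sym)
  also have "cinner (c (v - P v)) (c (c (w - P w))) = 0"
    by (rule isotropic[OF coproj_in coproj_in])
  also have "cinner (c (P v)) (c (c (w - P w))) = cinner (c (w - P w)) (P v)"
    by (rule conj_cinner)
  finally show ?thesis by simp
qed


section \<open>The spin module of a Lagrangian\<close>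

text \<open>
  The action of \<open>v\<close> lifted to the free algebra. There it is a sum of a multiplication and a derivation, which can
  be computed with; the Clifford relation holds modulo the ideal.
\<close>

definition spf :: "'v \<Rightarrow> 'v free_alg \<Rightarrow> 'v free_alg" where
  "spf v p = letter (P v) * p + ctrf (cinner (c (v - P v))) p"

lemma spf_alg_on: "p \<in> alg_on L \<Longrightarrow> spf v p \<in> alg_on L"
  by (simp add: spf_def alg_on_add alg_on_mult ctrf_alg_on proj_in)

lemma spin_ecl: "p \<in> alg_on L \<Longrightarrow> spin_act c L v (ecl L p) = ecl L (spf v p)"
  unfolding spin_act_def spf_def ext_gen_def contract_eq_ctr
  by (simp only: ecl_mult[OF sub] letter_alg_on proj_in ctr_ecl[OF sub lin_on_cinner] ecl_add)

lemma parf_spf: "parf (spf v p) = - spf v (parf p)"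
  by (simp add: spf_def parf_add parf_mult parf_letter parf_ctrf)

lemma ctrf_spf: "ctrf \<phi> (spf v p) = \<phi> (P v) *\<^sub>C p - spf v (ctrf \<phi> p)"
  by (simp add: spf_def ctrf_add ctrf_letter_mult ctrf_ctrf[of \<phi>])

lemma spin_clin: "clin (exterior L) (exterior L) (spin_act c L v)"
  unfolding spin_act_def contract_eq_ctr
  by (intro clin_plus cmod_exterior ext_gen_mult_clin ctr_clin sub proj_in lin_on_cinner)

lemma letter_ideal:
  assumes "p \<in> alg_on L"
  shows "v \<in> L \<Longrightarrow> w \<in> L \<Longrightarrow> letter (v + w) * p - letter v * p - letter w * p \<in> ext_ideal L"
    and "v \<in> L \<Longrightarrow> letter (a *\<^sub>C v) * p - a *\<^sub>C (letter v * p) \<in> ext_ideal L"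
proof -
  assume "v \<in> L" "w \<in> L"
  then have "letter (v + w) - letter v - letter w \<in> ext_rel L"
    unfolding ext_rel_def linear_relators_def by blast
  then have "(letter (v + w) - letter v - letter w) * p \<in> ext_ideal L"
    unfolding ext_ideal_eq by (intro ideal_on_mult_right assms ideal_on_rel)
  then show "letter (v + w) * p - letter v * p - letter w * p \<in> ext_ideal L"
    by (simp add: algebra_simps)
next
  assume "v \<in> L"
  then have "letter (a *\<^sub>C v) - a *\<^sub>C letter v \<in> ext_rel L"
    unfolding ext_rel_def linear_relators_def by blast
  then have "(letter (a *\<^sub>C v) - a *\<^sub>C letter v) * p \<in> ext_ideal L"
    unfolding ext_ideal_eq by (intro ideal_on_mult_right assms ideal_on_rel)
  then show "letter (a *\<^sub>C v) * p - a *\<^sub>C (letter v * p) \<in> ext_ideal L"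
    by (simp add: algebra_simps scaleC_mult_left)
qed

lemma ctrf_plus: "ctrf (\<lambda>v. \<phi> v + \<psi> v) p = ctrf \<phi> p + ctrf \<psi> p"
  and ctrf_times: "ctrf (\<lambda>v. a * \<phi> v) p = a *\<^sub>C ctrf \<phi> p"
proof -
  have "clist (\<lambda>v. \<phi> v + \<psi> v) ws = clist \<phi> ws + clist \<psi> ws" for ws
    by (induction ws) (simp_all add: scaleC_add_left algebra_simps)
  then show "ctrf (\<lambda>v. \<phi> v + \<psi> v) p = ctrf \<phi> p + ctrf \<psi> p"
    by (induction p rule: free_alg_induct) (simp_all add: ctrf_add ctrf_scale ctrf_word scaleC_add_right)
  have "clist (\<lambda>v. a * \<phi> v) ws = a *\<^sub>C clist \<phi> ws" for ws
    by (induction ws) (simp_all add: complex_vector.scale_right_diff_distrib scaleC_mult_right scaleC_scaleC)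
  then show "ctrf (\<lambda>v. a * \<phi> v) p = a *\<^sub>C ctrf \<phi> p"
    by (induction p rule: free_alg_induct)
      (simp_all add: ctrf_add ctrf_scale ctrf_word scaleC_add_right scaleC_scaleC mult.commute)
qed

lemma spf_add_vec: "p \<in> alg_on L \<Longrightarrow> ecl L (spf (v + w) p) = ecl L (spf v p + spf w p)"
proof -
  assume p: "p \<in> alg_on L"
  have "cinner (c (v + w - P (v + w))) = (\<lambda>u. cinner (c (v - P v)) u + cinner (c (w - P w)) u)"
    by (simp add: proj_add conj_add conj_diff cinner_add_left cinner_diff_left fun_eq_iff)
  then have "spf (v + w) p - (spf v p + spf w p) = letter (P v + P w) * p - letter (P v) * p - letter (P w) * p"
    by (simp add: spf_def proj_add ctrf_plus)
  then show ?thesis using letter_ideal(1)[OF p proj_in proj_in, of v w]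
    by (simp add: coset_eq_iff)
qed

lemma spf_scale_vec: "p \<in> alg_on L \<Longrightarrow> ecl L (spf (a *\<^sub>C v) p) = ecl L (a *\<^sub>C spf v p)"
proof -
  assume p: "p \<in> alg_on L"
  have "cinner (c (a *\<^sub>C v - P (a *\<^sub>C v))) = (\<lambda>u. a * cinner (c (v - P v)) u)"
    by (simp add: proj_scale conj_scale cinner_scaleC_left fun_eq_iff
        flip: complex_vector.scale_right_diff_distrib)
  then have "spf (a *\<^sub>C v) p - a *\<^sub>C spf v p = letter (a *\<^sub>C P v) * p - a *\<^sub>C (letter (P v) * p)"
    by (simp add: spf_def proj_scale ctrf_times scaleC_add_right)
  then show ?thesis using letter_ideal(2)[OF p proj_in, of a v]
    by (simp add: coset_eq_iff)
qed

lemma spf_clifford: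
  assumes p: "p \<in> alg_on L"
  shows "ecl L (spf v (spf w p) + spf w (spf v p)) = ecl L (cinner (c v) w *\<^sub>C p)"
proof -
  have "letter (P v) * (letter (P w) * p) + letter (P w) * (letter (P v) * p) \<in> ext_ideal L"
  proof -
    have "ecl L (letter (P v) * (letter (P w) * p) + letter (P w) * (letter (P v) * p)) = ecl L 0"
      using ext_gen_anticommute[OF sub proj_in[of v] proj_in[of w] ecl_closed[OF p]] p
      by (simp only: ext_gen_def ecl_mult[OF sub] letter_alg_on proj_in alg_on_mult ecl_add exterior_simps(2))
    then show ?thesis by (simp add: coset_eq_iff)
  qed
  moreover have "spf v (spf w p) + spf w (spf v p) - cinner (c v) w *\<^sub>C p =
     letter (P v) * (letter (P w) * p) + letter (P w) * (letter (P v) * p)"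
    by (simp add: cinner_conj_split[of v w])
       (simp add: spf_def ctrf_add ctrf_letter_mult distrib_left scaleC_add_left
        ctrf_ctrf[of "cinner (c (v - P v))" "cinner (c (w - P w))"])
  ultimately show ?thesis by (simp add: coset_eq_iff)
qed

lemma spin_cl_act: "cl_act c (exterior L) (spin_act c L)"
  unfolding cl_act_def
proof (intro conjI allI ballI spin_clin)
  fix m v w a assume "m \<in> carrier (exterior L)"
  then obtain p where p: "m = ecl L p" "p \<in> alg_on L" by auto
  note s = spin_ecl spf_alg_on p ecl_add ecl_smult
  show "spin_act c L (v + w) m = spin_act c L v m \<oplus>\<^bsub>exterior L\<^esub> spin_act c L w m"
    using spf_add_vec[OF p(2)] by (simp only: s)
  show "spin_act c L (a *\<^sub>C v) m = a \<odot>\<^bsub>exterior L\<^esub> spin_act c L v m"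
    using spf_scale_vec[OF p(2)] by (simp only: s)
  show "spin_act c L v (spin_act c L w m) \<oplus>\<^bsub>exterior L\<^esub> spin_act c L w (spin_act c L v m) =
    cinner (c v) w \<odot>\<^bsub>exterior L\<^esub> m"
    using spf_clifford[OF p(2)] by (simp only: s)
qed

lemma ext_parity_spin:
  assumes "x \<in> carrier (exterior L)"
  shows "ext_parity L (spin_act c L v x) = \<ominus>\<^bsub>exterior L\<^esub> spin_act c L v (ext_parity L x)"
proof -
  obtain p where p: "x = ecl L p" "p \<in> alg_on L" using assms by auto
  then show ?thesis
    by (simp only: spin_ecl spf_alg_on ext_parity_ecl[OF sub] parf_alg_on parf_spf ecl_minus)
qed

text \<open>
  Since \<open>\<phi>\<close> annihilates \<open>c L\<close>, the value \<open>\<phi> v\<close> is that on the component of \<open>v\<close> in \<open>L\<close>, which is the one that is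
  wedged. Contractions anticommute with each other, so the other component contributes nothing.
\<close>

lemma ctr_spin:
  assumes \<phi>: "lin_on UNIV \<phi>" "\<And>l. l \<in> L \<Longrightarrow> \<phi> (c l) = 0" and "x \<in> carrier (exterior L)"
  shows "ctr L \<phi> (spin_act c L v x) = (\<phi> v \<odot>\<^bsub>exterior L\<^esub> x) \<ominus>\<^bsub>exterior L\<^esub> spin_act c L v (ctr L \<phi> x)"
proof -
  obtain p where p: "x = ecl L p" "p \<in> alg_on L" using assms by auto
  have l: "lin_on L \<phi>" using \<phi>(1) by (simp add: lin_on_def)
  have "\<phi> v = \<phi> (P v + c (c (v - P v)))" by simp
  also have "\<dots> = \<phi> (P v)" using \<phi> coproj_in[of v] by (simp only: lin_on_def UNIV_I simp_thms) simp
  finally have "\<phi> v = \<phi> (P v)" .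
  with p show ?thesis
    by (simp only: spin_ecl spf_alg_on ctr_ecl[OF sub l] ctrf_alg_on ctrf_spf ecl_smult a_minus_def
        ecl_minus ecl_add) simp
qed

lemma ext_gen_zero: "ecl L (letter 0) = ecl L 0"
proof -
  have "letter (0 *\<^sub>C 0) * 1 - 0 *\<^sub>C (letter 0 * 1) \<in> ext_ideal L"
    by (rule letter_ideal(2)[OF alg_on_one complex_vector.subspace_0[OF sub]])
  then show ?thesis by (simp add: coset_eq_iff)
qed

lemma spin_vacuum:
  assumes "v \<in> c ` L" shows "spin_act c L v \<one>\<^bsub>exterior L\<^esub> = \<zero>\<^bsub>exterior L\<^esub>"
proof -
  have "ctrf \<phi> 1 = 0" for \<phi> :: "'v \<Rightarrow> complex" using ctrf_word[of \<phi> "[]"] by (simp flip: one_free_alg)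
  then have "spf v 1 = letter 0" by (simp add: spf_def proj_of_conj[OF assms])
  then show ?thesis unfolding exterior_simps using ext_gen_zero by (simp only: spin_ecl alg_on_one)
qed

lemma spin_word:
  assumes "v \<in> L" "set ws \<subseteq> L"
  shows "spin_act c L v (ecl L (Poly_Mapping.single (Word ws) 1)) = ecl L (Poly_Mapping.single (Word (v # ws)) 1)"
proof -
  have "cinner (0::'v) = (\<lambda>v. 0 * cinner (0::'v) v)" by (simp add: fun_eq_iff)
  then have "ctrf (cinner (0::'v)) p = 0" for p
    using ctrf_times[of 0 "cinner (0::'v)" p] by (metis complex_vector.scale_zero_left)
  then show ?thesis using assms by (simp add: spin_ecl spf_def letter_word)
qed

end


section \<open>Bimodules of Lagrangians in a sum\<close>

lemma ext_bimod_simps [simp]: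
  "carrier (ext_bimod ci cj L) = carrier (exterior L)"
  "zero (ext_bimod ci cj L) = zero (exterior L)"
  "add (ext_bimod ci cj L) = add (exterior L)"
  "smult (ext_bimod ci cj L) = smult (exterior L)"
  "lact (ext_bimod ci cj L) = (\<lambda>w \<xi>. spin_act (pair_conj ci cj) L (w, 0) \<xi>)"
  "ract (ext_bimod ci cj L) = (\<lambda>\<xi> w. spin_act (pair_conj ci cj) L (0, w) (ext_parity L \<xi>))"
  by (simp_all add: ext_bimod_def module.defs bimod.defs)

lemma cmod_ext_bimod: "cmod (ext_bimod ci cj L)"
  by (rule cmod_cong[OF cmod_exterior]) (simp_all del: exterior_simps)

lemma clin_ext_bimod_iff [simp]:
  "clin (ext_bimod ci cj L) = clin (exterior L)"
  "clin T (ext_bimod ci cj L) = clin T (exterior L)"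
  by (simp_all add: clin_def fun_eq_iff del: exterior_simps)

lemma ext_bimod_minus:
  "x \<in> carrier (exterior L) \<Longrightarrow> \<ominus>\<^bsub>ext_bimod ci cj L\<^esub> x = \<ominus>\<^bsub>exterior L\<^esub> x"
  using cmod.smult_minus_one[OF cmod_ext_bimod, of x ci cj L] cmod.smult_minus_one[OF cmod_exterior, of x L]
  by (simp del: exterior_simps)

locale lagr_pair = 
  fixes ci :: "'a::hermitian_space \<Rightarrow> 'a" and cj :: "'b::hermitian_space \<Rightarrow> 'b" and L
  assumes rsi: "real_structure ci" and rsj: "real_structure cj" 
    and lagp: "lagrangian (pair_conj ci cj) L"
begin

sublocale lagr "pair_conj ci cj" L
  by unfold_locales (auto simp: lagp real_structure_pair_conj rsi rsj)

abbreviation "F \<equiv> ext_bimod ci cj L"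
abbreviation "sp \<equiv> spin_act (pair_conj ci cj) L"
abbreviation "vac \<equiv> \<one>\<^bsub>exterior L\<^esub>"

lemma sp_closed: "x \<in> carrier (exterior L) \<Longrightarrow> sp v x \<in> carrier (exterior L)"
  using clin_closed[OF spin_clin] by auto

lemma par_closed: "x \<in> carrier (exterior L) \<Longrightarrow> ext_parity L x \<in> carrier (exterior L)"
  by (rule clin_closed[OF ext_parity_clin[OF sub]])

lemma vac_closed: "vac \<in> carrier (exterior L)"
  by simp

lemma sp_minus: "x \<in> carrier (exterior L) \<Longrightarrow> sp v (\<ominus>\<^bsub>exterior L\<^esub> x) = \<ominus>\<^bsub>exterior L\<^esub> sp v x"
  by (rule clin_uminus[OF cmod_exterior cmod_exterior spin_clin])

lemma sp_clifford: "x \<in> carrier (exterior L) \<Longrightarrow> sp v (sp w x) \<oplus>\<^bsub>exterior L\<^esub> sp w (sp v x) =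
    cinner (pair_conj ci cj v) w \<odot>\<^bsub>exterior L\<^esub> x"
  and sp_add: "x \<in> carrier (exterior L) \<Longrightarrow> sp (v + w) x = sp v x \<oplus>\<^bsub>exterior L\<^esub> sp w x"
  and sp_scale: "x \<in> carrier (exterior L) \<Longrightarrow> sp (a *\<^sub>C w) x = a \<odot>\<^bsub>exterior L\<^esub> sp w x"
  using spin_cl_act unfolding cl_act_def by blast+

lemma pair_conj_simp: "pair_conj ci cj (v, w) = (ci v, - cj w)"
  by (simp add: pair_conj_def neg_conj_def)

lemma ci_0 [simp]: "ci 0 = 0" and cj_0 [simp]: "cj 0 = 0"
  using conj_0 by (simp_all add: pair_conj_simp zero_prod_def)

lemma cbimod_F: "cbimod ci cj F"
proof -
  interpret E: cmod "exterior L" by (rule cmod_exterior)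
  note [simp del] = exterior_simps
  note [simp] = sp_closed par_closed
  show ?thesis
  proof (intro cbimod.intro cbimod_axioms.intro cmod_ext_bimod)
    show "cl_act ci F (lact F)"
      unfolding cl_act_def
    proof (intro conjI allI ballI)
      fix m v w a assume m: "m \<in> carrier F"
      show "lact F (v + w) m = lact F v m \<oplus>\<^bsub>F\<^esub> lact F w m"
        using sp_add[of m "(v, 0)" "(w, 0)"] m by simp
      show "lact F (a *\<^sub>C v) m = a \<odot>\<^bsub>F\<^esub> lact F v m"
        using sp_scale[of m a "(v, 0)"] m by simp
      show "lact F v (lact F w m) \<oplus>\<^bsub>F\<^esub> lact F w (lact F v m) = cinner (ci v) w \<odot>\<^bsub>F\<^esub> m"
        using sp_clifford[of m "(v, 0)" "(w, 0)"] m by (simp add: pair_conj_simp)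
    qed (simp add: spin_clin)
    show "cl_act cj F (\<lambda>w m. ract F m w)"
      unfolding cl_act_def
    proof (intro conjI allI ballI)
      fix m v w a assume m: "m \<in> carrier F"
      show "ract F m (v + w) = ract F m v \<oplus>\<^bsub>F\<^esub> ract F m w"
        using sp_add[of "ext_parity L m" "(0, v)" "(0, w)"] m by simp
      show "ract F m (a *\<^sub>C v) = a \<odot>\<^bsub>F\<^esub> ract F m v"
        using sp_scale[of "ext_parity L m" a "(0, v)"] m by simp
      have *: "ract F (ract F m w) v = \<ominus>\<^bsub>exterior L\<^esub> sp (0, v) (sp (0, w) m)" for v w
        using m by (simp add: ext_parity_spin ext_parity_ext_parity[OF sub] sp_minus)
      have "ract F (ract F m w) v \<oplus>\<^bsub>F\<^esub> ract F (ract F m v) w =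
          \<ominus>\<^bsub>exterior L\<^esub> (sp (0, v) (sp (0, w) m) \<oplus>\<^bsub>exterior L\<^esub> sp (0, w) (sp (0, v) m))"
        unfolding * using m by (simp add: E.minus_add)
      also have "\<dots> = cinner (cj v) w \<odot>\<^bsub>exterior L\<^esub> m"
        using m by (simp add: sp_clifford pair_conj_simp E.smult_minus_left)
      finally show "ract F (ract F m w) v \<oplus>\<^bsub>F\<^esub> ract F (ract F m v) w = cinner (cj v) w \<odot>\<^bsub>F\<^esub> m"
        by simp
    qed (use clin_comp[OF ext_parity_clin[OF sub] spin_clin] in simp)
    fix m v w assume m: "m \<in> carrier F"
    let ?m = "ext_parity L m"
    have "sp (v, 0) (sp (0, w) ?m) \<oplus>\<^bsub>exterior L\<^esub> sp (0, w) (sp (v, 0) ?m) = \<zero>\<^bsub>exterior L\<^esub>"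
      using m by (simp add: sp_clifford pair_conj_simp)
    then show "lact F v (ract F m w) = ract F (lact F v m) w"
      using m by (simp add: ext_parity_spin sp_minus E.add_eq_zero_iff)
  qed
qed

text \<open>
  The vacuum generates the bimodule. A word \<open>l # ws\<close> with \<open>l = (v, w)\<close> arises from \<open>ws\<close> by the left action of
  \<open>v\<close> and the action of \<open>(0, w)\<close>, and the latter is the right action of \<open>w\<close> up to the sign
  \<open>(-1)\<^bsup>length ws\<^esup>\<close>.
\<close>

lemma F_induct [consumes 1, case_names add scale vac lact ract]:
  assumes x: "x \<in> carrier (exterior L)"
    and add: "\<And>x y. x \<in> carrier (exterior L) \<Longrightarrow> y \<in> carrier (exterior L) \<Longrightarrow> Q x \<Longrightarrow> Q y \<Longrightarrow> Q (x \<oplus>\<^bsub>exterior L\<^esub> y)"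
    and scale: "\<And>a x. x \<in> carrier (exterior L) \<Longrightarrow> Q x \<Longrightarrow> Q (a \<odot>\<^bsub>exterior L\<^esub> x)"
    and vac: "Q vac"
    and lact: "\<And>w x. x \<in> carrier (exterior L) \<Longrightarrow> Q x \<Longrightarrow> Q (lact F w x)"
    and ract: "\<And>w x. x \<in> carrier (exterior L) \<Longrightarrow> Q x \<Longrightarrow> Q (ract F x w)"
  shows "Q x"
  using x
proof (induction rule: exterior_induct)
  case (word ws)
  then show ?case
  proof (induction ws)
    case Nil
    then show ?case using vac by (simp add: one_free_alg)
  next
    case (Cons l ws)
    let ?w = "Poly_Mapping.single (Word ws) (1::complex)"
    let ?s = "(-1) ^ length ws :: complex"
    obtain v w where l: "l = (v, w)" by (cases l)
    have w: "?w \<in> alg_on L" using Cons by simp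
    have c: "ecl L ?w \<in> carrier (exterior L)" by (rule ecl_closed[OF w])
    have s: "?s * ?s = 1" by (simp flip: power_add mult_2)
    have p: "ext_parity L (ecl L ?w) = ?s \<odot>\<^bsub>exterior L\<^esub> ecl L ?w"
      by (simp only: ext_parity_ecl[OF sub w] parf_word ecl_smult)
    have r: "?s \<odot>\<^bsub>exterior L\<^esub> ract F (ecl L ?w) w = sp (0, w) (ecl L ?w)"
      by (simp only: ext_bimod_simps p clin_smult[OF spin_clin c])
        (simp only: cmod.smult_assoc[OF cmod_exterior sp_closed[OF c]]
          cmod.smult_one[OF cmod_exterior sp_closed[OF c]] s)
    have Qw: "Q (ecl L ?w)" using Cons by auto
    have "Q (lact F v (ecl L ?w) \<oplus>\<^bsub>exterior L\<^esub> ?s \<odot>\<^bsub>exterior L\<^esub> ract F (ecl L ?w) w)"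
    proof (intro add scale lact ract Qw c)
      show r': "ract F (ecl L ?w) w \<in> carrier (exterior L)"
        unfolding ext_bimod_simps by (intro sp_closed par_closed c)
      show "?s \<odot>\<^bsub>exterior L\<^esub> ract F (ecl L ?w) w \<in> carrier (exterior L)"
        by (rule cmod.smult_closed[OF cmod_exterior r'])
      show "lact F v (ecl L ?w) \<in> carrier (exterior L)"
        unfolding ext_bimod_simps by (intro sp_closed c)
    qed
    also have "lact F v (ecl L ?w) \<oplus>\<^bsub>exterior L\<^esub> ?s \<odot>\<^bsub>exterior L\<^esub> ract F (ecl L ?w) w =
        sp l (ecl L ?w)"
      unfolding r using sp_add[OF c, of "(v, 0)" "(0, w)"] by (simp add: l del: exterior_simps)
    also have "\<dots> = ecl L (Poly_Mapping.single (Word (l # ws)) 1)"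
      using Cons by (intro spin_word) auto
    finally show ?case .
  qed
qed (use assms in auto)

text \<open>
  The conjugate of \<open>L\<close> annihilates the vacuum. Read as a relation between the two actions, this lets
  a vector change sides at the vacuum.
\<close>

lemma vac_conj:
  assumes "(z, x) \<in> pair_conj ci cj ` L"
  shows "lact F z vac = \<ominus>\<^bsub>exterior L\<^esub> ract F vac x"
proof -
  have "sp ((z, 0) + (0, x)) vac = \<zero>\<^bsub>exterior L\<^esub>"
    using spin_vacuum[OF assms] by (simp del: exterior_simps)
  then have "sp (z, 0) vac \<oplus>\<^bsub>exterior L\<^esub> sp (0, x) vac = \<zero>\<^bsub>exterior L\<^esub>"
    by (simp only: sp_add[OF vac_closed])
  then show ?thesis
    by (simp only: ext_bimod_simps ext_parity_one[OF sub]
        cmod.add_eq_zero_iff[OF cmod_exterior sp_closed[OF vac_closed] sp_closed[OF vac_closed]])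
qed

end


section \<open>Dual bases of finite-dimensional subspaces\<close>

text \<open>
  Lists in which corresponding entries pair to \<open>1\<close> and all other pairs to \<open>0\<close>. With lists, vectors can be
  contracted or removed one by one by recursion.
\<close>

fun biorth :: "'v::hermitian_space list \<Rightarrow> 'v list \<Rightarrow> bool" where
  "biorth [] [] = True"
| "biorth (u # us) (b # bs) = (cinner u b = 1 \<and> (\<forall>b'\<in>set bs. cinner u b' = 0) \<and>
     (\<forall>u'\<in>set us. cinner u' b = 0) \<and> biorth us bs)"
| "biorth _ _ = False"

lemma biorth_length: "biorth us bs \<Longrightarrow> length us = length bs"
  by (induction us bs rule: biorth.induct) auto

lemma biorth_append:
  assumes "length us = length bs"
  shows "biorth (us @ us') (bs @ bs') \<longleftrightarrow> biorth us bs \<and> biorth us' bs' \<and>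
    (\<forall>u\<in>set us. \<forall>b\<in>set bs'. cinner u b = 0) \<and> (\<forall>u\<in>set us'. \<forall>b\<in>set bs. cinner u b = 0)"
  using assms by (induction us bs rule: list_induct2) auto

lemma biorth_map:
  assumes "\<And>u b. cinner (f u) (g b) = cinner u b"
  shows "biorth (map f us) (map g bs) = biorth us bs"
  by (induction us bs rule: biorth.induct) (auto simp: assms)

lemma biorth_independent: "biorth us bs \<Longrightarrow> distinct bs \<and> \<not> cdependent (set bs)"
proof (induction us bs rule: biorth.induct)
  case (2 u us b bs)
  have "csubspace {v. cinner u v = 0}"
    by (rule complex_vector.subspaceI) (auto simp: cinner_add_right cinner_scaleC_right)
  then have "cspan (set bs) \<subseteq> {v. cinner u v = 0}"
    using 2 by (intro complex_vector.span_minimal) auto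
  then have "b \<notin> cspan (set bs)" using 2 by auto
  then show ?case using 2 complex_vector.span_base[of b "set bs"]
    by (auto simp: complex_vector.independent_insert)
qed (auto simp: complex_vector.independent_empty)

text \<open>
  The list \<open>bs\<close> is a basis of \<open>K\<close>, as witnessed by the dual vectors \<open>us\<close>. These may lie outside \<open>K\<close>.
\<close>

definition dual_basis :: "'v::hermitian_space list \<Rightarrow> 'v list \<Rightarrow> 'v set \<Rightarrow> bool" where
  "dual_basis us bs K \<longleftrightarrow> biorth us bs \<and> csubspace K \<and> set bs \<subseteq> K \<and> K \<subseteq> cspan (set bs)"

definition basis_list :: "'v::hermitian_space list \<Rightarrow> 'v set \<Rightarrow> bool" where
  "basis_list bs K \<longleftrightarrow> csubspace K \<and> distinct bs \<and> set bs \<subseteq> K \<and> K \<subseteq> cspan (set bs) \<and> length bs = cdim K"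

lemma dual_basis_cdim: "dual_basis us bs K \<Longrightarrow> cdim K = length bs"
  using biorth_independent[of us bs] complex_vector.basis_card_eq_dim[of "set bs" K]
  by (auto simp: dual_basis_def distinct_card)

text \<open>
  The Gram-Schmidt step: the coefficients are corrected from the last vector to the first, and duality
  ensures that earlier corrections are not spoilt.
\<close>

lemma biorth_approx:
  assumes "biorth us bs" obtains s where "s \<in> cspan (set bs)" "\<forall>u\<in>set us. cinner u (v - s) = 0"
proof -
  have "\<exists>s\<in>cspan (set bs). \<forall>u\<in>set us. cinner u (v - s) = 0"
    using assms
  proof (induction us bs rule: biorth.induct)
    case (2 u us b bs)
    then obtain s where s: "s \<in> cspan (set bs)" "\<forall>u\<in>set us. cinner u (v - s) = 0" by auto
    let ?s = "s + cinner u (v - s) *\<^sub>C b"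
    have "cspan (set bs) \<subseteq> cspan (set (b # bs))" by (rule complex_vector.span_mono) auto
    then have "?s \<in> cspan (set (b # bs))"
      using s(1) by (intro complex_vector.span_add[OF _ complex_vector.span_scale[OF complex_vector.span_base]]) auto
    moreover have "\<forall>u'\<in>set (u # us). cinner u' (v - ?s) = 0"
      using s(2) 2 by (auto simp: cinner_diff_right cinner_add_right cinner_scaleC_right)
    ultimately show ?case by blast
  qed (auto simp: complex_vector.span_zero)
  then show ?thesis using that by blast
qed

lemma dual_basis_list: "dual_basis us bs K \<Longrightarrow> basis_list bs K"
  using biorth_independent[of us bs] dual_basis_cdim[of us bs K] by (auto simp: dual_basis_def basis_list_def)

lemma biorth_nth: "biorth us vs \<Longrightarrow> i < length us \<Longrightarrow> j < length us \<Longrightarrow> cinner (us ! i) (vs ! j) = (if i = j then 1 else 0)"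
proof (induction us vs arbitrary: i j rule: biorth.induct)
  case (2 u us b bs)
  then show ?case using biorth_length[of us bs] by (cases i; cases j) (auto simp: nth_mem)
qed auto

lemma biorth_nthI:
  assumes "length us = length vs" "\<And>i j. i < length us \<Longrightarrow> j < length us \<Longrightarrow> cinner (us ! i) (vs ! j) = (if i = j then 1 else 0)"
  shows "biorth us vs"
  using assms
proof (induction us vs rule: list_induct2)
  case (Cons u us b bs)
  have "biorth us bs"
  proof (rule Cons.IH)
    fix i j assume "i < length us" "j < length us"
    then show "cinner (us ! i) (bs ! j) = (if i = j then 1 else 0)" using Cons.prems[of "Suc i" "Suc j"] by simp
  qed
  moreover have "cinner u b = 1" using Cons.prems[of 0 0] by simp
  moreover have "\<forall>b'\<in>set bs. cinner u b' = 0"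
    using Cons.prems[of 0 "Suc _"] Cons.hyps by (auto simp: in_set_conv_nth)
  moreover have "\<forall>u'\<in>set us. cinner u' b = 0"
    using Cons.prems[of "Suc _" 0] Cons.hyps by (auto simp: in_set_conv_nth)
  ultimately show ?case by simp
qed simp

text \<open>
  A vector outside the span has a nonzero orthogonal component, which is normalised.
\<close>

lemma orthonormal_step:
  assumes K: "csubspace K" and es: "biorth es es" "set es \<subseteq> K" and k: "k \<in> K" "k \<notin> cspan (set es)"
  obtains e where "biorth (e # es) (e # es)" "e \<in> K"
proof -
  obtain s where s: "s \<in> cspan (set es)" "\<forall>e\<in>set es. cinner e (k - s) = 0"
    using biorth_approx[OF es(1)] by blast
  let ?v = "k - s"
  have v: "?v \<noteq> 0" using s k by auto
  have "s \<in> K" using s(1) es(2) K complex_vector.span_minimal by blast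
  then have vK: "?v \<in> K" using k K by (simp add: complex_vector.subspace_diff)
  define n where "n = sqrt (inner ?v ?v)"
  have n: "n \<noteq> 0" "n * n = inner ?v ?v" using v by (simp_all add: n_def)
  define r where "r = complex_of_real (1 / n)"
  have "cinner (r *\<^sub>C ?v) (r *\<^sub>C ?v) = cnj r * (r * cinner ?v ?v)"
    by (simp only: cinner_scaleC_left cinner_scaleC_right mult.left_commute)
  also have "cinner ?v ?v = complex_of_real (n * n)" by (simp only: cinner_self n(2))
  finally have 1: "cinner (r *\<^sub>C ?v) (r *\<^sub>C ?v) = 1" using n(1) by (simp add: r_def)
  have 2: "\<forall>e\<in>set es. cinner e (r *\<^sub>C ?v) = 0"
    using s(2) by (simp add: cinner_scaleC_right)
  then have 3: "\<forall>e\<in>set es. cinner (r *\<^sub>C ?v) e = 0" by (metis cinner_eq_0_sym)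
  show ?thesis
    by (rule that[of "r *\<^sub>C ?v"]) (use 1 2 3 es vK K in \<open>auto simp: complex_vector.subspace_scale\<close>)
qed

text \<open>
  Orthonormal lists are independent, so their length is bounded; a longest one spans because it could be
  extended otherwise.
\<close>

lemma orthonormal_basis_exists:
  assumes K: "csubspace K" and fin: "cfinite_dim K"
  obtains es where "dual_basis es es K"
proof -
  obtain B where B: "finite B" "K \<subseteq> cspan B" using fin by (auto simp: cfinite_dim_def)
  have bound: "length es \<le> card B" if "biorth es es" "set es \<subseteq> K" for es
    using biorth_independent[OF that(1)] complex_vector.independent_span_bound[OF B(1), of "set es"] that B
    by (auto simp: distinct_card)
  let ?Q = "\<lambda>n. \<exists>es. biorth es es \<and> set es \<subseteq> K \<and> length es = n"
  have "?Q 0" by (rule exI[of _ "[]"]) auto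
  moreover have Qb: "\<And>m. ?Q m \<Longrightarrow> m \<le> card B" using bound by blast
  ultimately have "?Q (Greatest ?Q)" by (rule GreatestI_nat)
  then obtain es where es: "biorth es es" "set es \<subseteq> K" "length es = Greatest ?Q" by auto
  have "k \<in> cspan (set es)" if k: "k \<in> K" for k
  proof (rule ccontr)
    assume "k \<notin> cspan (set es)"
    then obtain e where e: "biorth (e # es) (e # es)" "e \<in> K"
      using orthonormal_step[OF K es(1,2) k] by blast
    have "?Q (Suc (Greatest ?Q))" by (rule exI[of _ "e # es"]) (use e es in auto)
    then have "Suc (Greatest ?Q) \<le> Greatest ?Q" using Qb by (rule Greatest_le_nat)
    then show False by simp
  qed
  then show ?thesis using that[of es] es K by (auto simp: dual_basis_def)
qed

text \<open>
  In a space that is not complete, orthogonal projections exist at least onto finite-dimensional subspaces.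
\<close>

lemma proj_exists:
  assumes K: "csubspace K" and fin: "cfinite_dim K"
  shows "proj K v \<in> K" "v - proj K v \<in> orth K"
proof -
  obtain es where es: "dual_basis es es K" using orthonormal_basis_exists[OF assms] by blast
  obtain s where s: "s \<in> cspan (set es)" "\<forall>e\<in>set es. cinner e (v - s) = 0"
    using biorth_approx[of es es v] es by (auto simp: dual_basis_def)
  have "s \<in> K" using s es by (metis complex_vector.span_minimal dual_basis_def subsetD)
  moreover have "csubspace {k. cinner k (v - s) = 0}"
    by (rule complex_vector.subspaceI) (auto simp: cinner_add_left cinner_scaleC_left)
  then have "cspan (set es) \<subseteq> {k. cinner k (v - s) = 0}"
    using s(2) by (intro complex_vector.span_minimal) auto
  then have "v - s \<in> orth K" using es by (auto simp: orth_iff dual_basis_def)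
  ultimately show "proj K v \<in> K" "v - proj K v \<in> orth K" using proj_eqI[OF K] by auto
qed


section \<open>Wedge products and top exterior powers\<close>

abbreviation word :: "'v list \<Rightarrow> 'v free_alg" where
  "word ws \<equiv> Poly_Mapping.single (Word ws) 1"

abbreviation wdg :: "'v::hermitian_space set \<Rightarrow> 'v list \<Rightarrow> 'v ext" where
  "wdg K ws \<equiv> ecl K (word ws)"

lemma foldr_ext_gen:
  assumes "csubspace K" "set us \<subseteq> K"
  shows "foldr (\<lambda>u x. ext_gen K u \<otimes>\<^bsub>exterior K\<^esub> x) us \<one>\<^bsub>exterior K\<^esub> = wdg K us"
  using assms(2)
proof (induction us)
  case Nil
  show ?case by (simp add: one_free_alg)
next
  case (Cons a us)
  then show ?case using ext_gen_word[OF assms(1), of a us] by simp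
qed

lemma ideal_sandwich:
  assumes "x \<in> ext_ideal K" "set us \<subseteq> K" "set vs \<subseteq> K"
  shows "word us * x * word vs \<in> ext_ideal K"
  using assms unfolding ext_ideal_eq by (intro ideal_on_mult_left ideal_on_mult_right) auto

lemma letter_sum_ideal:
  assumes K: "csubspace K" and "finite A" "A \<subseteq> K"
  shows "letter (\<Sum>x\<in>A. f x *\<^sub>C x) - (\<Sum>x\<in>A. f x *\<^sub>C letter x) \<in> ext_ideal K"
  using assms(2,3)
proof (induction A)
  case empty
  have "letter (0 *\<^sub>C 0) - 0 *\<^sub>C letter 0 \<in> ext_rel K"
    using complex_vector.subspace_0[OF K] unfolding ext_rel_def linear_relators_def by blast
  then show ?case using ideal_on_rel unfolding ext_ideal_eq by force
next
  case (insert x A)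
  let ?s = "\<Sum>x\<in>A. f x *\<^sub>C x"
  have s: "?s \<in> K" using insert K by (auto intro!: complex_vector.subspace_sum complex_vector.subspace_scale)
  have x: "x \<in> K" "f x *\<^sub>C x \<in> K" using insert K by (auto intro: complex_vector.subspace_scale)
  have "letter (f x *\<^sub>C x + ?s) - letter (f x *\<^sub>C x) - letter ?s \<in> ext_rel K"
    using s x unfolding ext_rel_def linear_relators_def by blast
  moreover have "letter (f x *\<^sub>C x) - f x *\<^sub>C letter x \<in> ext_rel K"
    using x unfolding ext_rel_def linear_relators_def by blast
  ultimately have "(letter (f x *\<^sub>C x + ?s) - letter (f x *\<^sub>C x) - letter ?s) +
     ((letter (f x *\<^sub>C x) - f x *\<^sub>C letter x) + (letter ?s - (\<Sum>x\<in>A. f x *\<^sub>C letter x))) \<in> ext_ideal K"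
    using insert ideal_on_rel by (intro complex_vector.subspace_add) (auto simp: ext_ideal_eq)
  moreover have "(letter (f x *\<^sub>C x + ?s) - letter (f x *\<^sub>C x) - letter ?s) +
     ((letter (f x *\<^sub>C x) - f x *\<^sub>C letter x) + (letter ?s - (\<Sum>x\<in>A. f x *\<^sub>C letter x))) =
     letter (f x *\<^sub>C x + ?s) - (f x *\<^sub>C letter x + (\<Sum>x\<in>A. f x *\<^sub>C letter x))" by simp
  ultimately show ?case using insert by simp
qed

lemma letter_anticommute:
  assumes K: "csubspace K" and "x \<in> K" "y \<in> K"
  shows "letter x * letter y + letter y * letter x \<in> ext_ideal K"
proof -
  have "ecl K (letter x * (letter y * 1) + letter y * (letter x * 1)) = ecl K 0"
    using ext_gen_anticommute[OF K assms(2,3) ecl_closed[OF alg_on_one]] assms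
    by (simp only: ext_gen_def ecl_mult[OF K] letter_alg_on alg_on_one alg_on_mult ecl_add exterior_simps(2))
  then show ?thesis by (simp add: coset_eq_iff)
qed

lemma letter_word_letter:
  assumes K: "csubspace K" and x: "x \<in> K" and vs: "set vs \<subseteq> K"
  shows "letter x * word vs * letter x \<in> ext_ideal K"
  using vs
proof (induction vs)
  case Nil
  have "letter x * letter x \<in> ext_rel K" using x unfolding ext_rel_def by blast
  then show ?case using ideal_on_rel by (simp add: ext_ideal_eq flip: one_free_alg)
next
  case (Cons v vs)
  have v: "word (v # vs) = letter v * word vs" by (simp add: letter_word)
  have "(letter x * letter v + letter v * letter x) * (word vs * letter x) \<in> ext_ideal K"
    unfolding ext_ideal_eq using letter_anticommute[OF K x, of v] Cons x
    by (intro ideal_on_mult_right alg_on_mult) (auto simp: ext_ideal_eq)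
  moreover have "letter v * (letter x * word vs * letter x) \<in> ext_ideal K"
    unfolding ext_ideal_eq by (rule ideal_on_mult_left) (use Cons in \<open>auto simp: ext_ideal_eq\<close>)
  ultimately have "(letter x * letter v + letter v * letter x) * (word vs * letter x) -
      letter v * (letter x * word vs * letter x) \<in> ext_ideal K"
    by (rule complex_vector.subspace_diff[OF csubspace_ext_ideal])
  then show ?case unfolding v by (simp add: algebra_simps)
qed

lemma word_repeat_ideal:
  assumes K: "csubspace K" and cs: "set cs \<subseteq> K" "\<not> distinct cs"
  shows "word cs \<in> ext_ideal K"
proof -
  obtain us x vs ws where c: "cs = us @ [x] @ vs @ [x] @ ws" using not_distinct_decomp[OF cs(2)] by blast
  have "word us * (letter x * word vs * letter x) * word ws \<in> ext_ideal K"
    using cs unfolding c by (intro ideal_sandwich letter_word_letter K) auto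
  moreover have "word us * (letter x * word vs * letter x) * word ws = word cs"
    by (simp add: c letter_def mult_single)
  ultimately show ?thesis by simp
qed

lemma word_mid_add:
  assumes K: "csubspace K" and "set us \<subseteq> K" "set vs \<subseteq> K" "x \<in> K" "y \<in> K"
  shows "word (us @ (x + y) # vs) - word (us @ x # vs) - word (us @ y # vs) \<in> ext_ideal K"
proof -
  have "letter (x + y) - letter x - letter y \<in> ext_rel K"
    using assms unfolding ext_rel_def linear_relators_def by blast
  then have "word us * (letter (x + y) - letter x - letter y) * word vs \<in> ext_ideal K"
    using assms ideal_on_rel by (intro ideal_sandwich) (auto simp: ext_ideal_eq)
  moreover have "word us * (letter (x + y) - letter x - letter y) * word vs =
      word (us @ (x + y) # vs) - word (us @ x # vs) - word (us @ y # vs)"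
    by (simp add: left_diff_distrib right_diff_distrib letter_def mult_single)
  ultimately show ?thesis by simp
qed

lemma word_mid_scale:
  assumes K: "csubspace K" and "set us \<subseteq> K" "set vs \<subseteq> K" "x \<in> K"
  shows "word (us @ (a *\<^sub>C x) # vs) - a *\<^sub>C word (us @ x # vs) \<in> ext_ideal K"
proof -
  have "letter (a *\<^sub>C x) - a *\<^sub>C letter x \<in> ext_rel K"
    using assms unfolding ext_rel_def linear_relators_def by blast
  then have "word us * (letter (a *\<^sub>C x) - a *\<^sub>C letter x) * word vs \<in> ext_ideal K"
    using assms ideal_on_rel by (intro ideal_sandwich) (auto simp: ext_ideal_eq)
  moreover have "word us * (letter (a *\<^sub>C x) - a *\<^sub>C letter x) * word vs =
      word (us @ (a *\<^sub>C x) # vs) - a *\<^sub>C word (us @ x # vs)"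
    by (simp add: left_diff_distrib right_diff_distrib letter_def mult_single scaleC_mult_left scaleC_mult_right)
  ultimately show ?thesis by simp
qed

lemma word_swap_ideal:
  assumes K: "csubspace K" and s: "set us \<subseteq> K" "set vs \<subseteq> K" "set ws \<subseteq> K" "x \<in> K" "y \<in> K"
  shows "word (us @ x # vs @ y # ws) + word (us @ y # vs @ x # ws) \<in> ext_ideal K"
proof -
  let ?W = "\<lambda>a b. word (us @ a # vs @ b # ws)"
  have xy: "x + y \<in> K" using s K by (simp add: complex_vector.subspace_add)
  \<comment> \<open>Polarisation of the vanishing of words with a repeated letter.\<close>
  have A: "?W a (x + y) - ?W a x - ?W a y \<in> ext_ideal K" if "a \<in> K" for a
    using word_mid_add[OF K, of "us @ a # vs" ws x y] s that by simp
  have B: "?W (x + y) b - ?W x b - ?W y b \<in> ext_ideal K" if "b \<in> K" for b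
    using word_mid_add[OF K, of us "vs @ b # ws" x y] s that by simp
  have R: "?W a a \<in> ext_ideal K" if "a \<in> K" for a
    using word_repeat_ideal[OF K, of "us @ a # vs @ a # ws"] s that by auto
  note d = complex_vector.subspace_diff[OF csubspace_ext_ideal]
  from d[OF d[OF d[OF d[OF d[OF R[OF xy] A[OF xy]] B[OF s(4)]] B[OF s(5)]] R[OF s(4)]] R[OF s(5)]]
  show ?thesis by (simp add: algebra_simps)
qed

text \<open>
  Induction over transpositions, each of which exchanges two letters and changes the sign
  (\<open>word_swap_ideal\<close>).
\<close>

lemma word_permute_ideal:
  assumes K: "csubspace K" and bs: "distinct bs" "set bs \<subseteq> K" and p: "p permutes set bs"
  shows "word (map p bs) - of_int (sign p) *\<^sub>C word bs \<in> ext_ideal K"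
  using p finite_set
proof (induction rule: permutes_induct)
  case id
  show ?case by (simp add: complex_vector.subspace_0 scaleC_one)
next
  case (swap a b p)
  let ?xs = "map p bs"
  have p: "p permutes set bs" "permutation p" using swap permutation_permutes by blast+
  have xs: "distinct ?xs" "set ?xs = set bs"
    using bs permutes_inj_on[OF p(1)] permutes_image[OF p(1)] by (auto simp: distinct_map)
  have key: "word (map (Transposition.transpose a b \<circ> p) bs) + word ?xs \<in> ext_ideal K"
    if "?xs = us @ x # vs @ y # ws" "Transposition.transpose a b = Transposition.transpose x y" for us x vs y ws
  proof -
    have n: "x \<notin> set us \<union> set vs \<union> set ws" "y \<notin> set us \<union> set vs \<union> set ws" "x \<noteq> y"
      using xs(1) unfolding that(1) by auto
    have fix': "map (Transposition.transpose x y) zs = zs" if "x \<notin> set zs" "y \<notin> set zs" for zs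
      using that by (intro map_idI) (metis transpose_apply_other)
    have "map (Transposition.transpose a b \<circ> p) bs = map (Transposition.transpose x y) ?xs"
      by (simp add: that(2))
    also have "\<dots> = us @ y # vs @ x # ws"
      unfolding that(1) using n by (simp add: fix')
    finally show ?thesis
      using word_swap_ideal[OF K, of us vs ws y x] xs(2) bs(2) unfolding that(1) by (auto simp: that(1))
  qed
  have "\<exists>us x vs y ws. ?xs = us @ x # vs @ y # ws \<and> Transposition.transpose a b = Transposition.transpose x y"
  proof -
    have "a \<in> set ?xs" using swap xs by auto
    then obtain us r where r: "?xs = us @ a # r" by (meson split_list)
    have "b \<in> set ?xs" using swap xs by auto
    then consider "b \<in> set us" | "b \<in> set r" using r swap by auto
    then show ?thesis
    proof cases
      case 1
      then obtain u1 u2 where "us = u1 @ b # u2" by (meson split_list)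
      then show ?thesis using r by (intro exI[of _ u1] exI[of _ b] exI[of _ u2] exI[of _ a] exI[of _ r])
          (simp add: transpose_commute)
    next
      case 2
      then obtain u1 u2 where "r = u1 @ b # u2" by (meson split_list)
      then show ?thesis using r by (intro exI[of _ us] exI[of _ a] exI[of _ u1] exI[of _ b] exI[of _ u2]) simp
    qed
  qed
  then have "word (map (Transposition.transpose a b \<circ> p) bs) + word ?xs \<in> ext_ideal K" using key by blast
  then have "(word (map (Transposition.transpose a b \<circ> p) bs) + word ?xs) - (word ?xs - of_int (sign p) *\<^sub>C word bs) \<in> ext_ideal K"
    by (rule complex_vector.subspace_diff[OF csubspace_ext_ideal]) (use swap in auto)
  moreover have "sign (Transposition.transpose a b \<circ> p) = - sign p"
    using swap p by (simp add: sign_compose permutation_swap_id sign_swap_id)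
  ultimately show ?case by (simp add: comp_def)
qed


lemma word_perm_span:
  assumes K: "csubspace K" and "mset cs = mset bs" "set bs \<subseteq> K"
  shows "\<exists>a. word cs - a *\<^sub>C word bs \<in> ext_ideal K"
  using assms(2,3)
proof (induction bs arbitrary: cs)
  case Nil
  then show ?case by (intro exI[of _ 1]) (simp add: complex_vector.subspace_0 scaleC_one)
next
  case (Cons b bs)
  have front: "\<exists>a. word (c1 @ b # c2) - a *\<^sub>C word (b # c1 @ c2) \<in> ext_ideal K"
    if "set (c1 @ c2) \<subseteq> K" for c1 c2
    using that
  proof (induction c1)
    case Nil
    then show ?case by (intro exI[of _ 1]) (simp add: complex_vector.subspace_0 scaleC_one)
  next
    case (Cons x c1)
    then obtain a where a: "word (c1 @ b # c2) - a *\<^sub>C word (b # c1 @ c2) \<in> ext_ideal K" by auto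
    have "word [x] * (word (c1 @ b # c2) - a *\<^sub>C word (b # c1 @ c2)) * word [] \<in> ext_ideal K"
      using Cons by (intro ideal_sandwich a) auto
    then have 1: "word ((x # c1) @ b # c2) - a *\<^sub>C word (x # b # c1 @ c2) \<in> ext_ideal K"
      by (simp add: right_diff_distrib left_diff_distrib scaleC_mult_left scaleC_mult_right mult_single)
    have "word ([] @ x # [] @ b # c1 @ c2) + word ([] @ b # [] @ x # c1 @ c2) \<in> ext_ideal K"
      using Cons \<open>set (b # bs) \<subseteq> K\<close> by (intro word_swap_ideal K) auto
    then have 2: "a *\<^sub>C (word (x # b # c1 @ c2) + word (b # x # c1 @ c2)) \<in> ext_ideal K"
      by (simp add: complex_vector.subspace_scale)
    have "word ((x # c1) @ b # c2) - (- a) *\<^sub>C word (b # (x # c1) @ c2) \<in> ext_ideal K"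
      using complex_vector.subspace_add[OF csubspace_ext_ideal 1 2] by (simp add: scaleC_add_right)
    then show ?case by blast
  qed
  have "b \<in> set cs" using Cons.prems(1) by (metis list.set_intros(1) set_mset_mset)
  then obtain c1 c2 where c: "cs = c1 @ b # c2" by (meson split_list)
  have m: "mset (c1 @ c2) = mset bs" using Cons.prems(1) unfolding c by simp
  then obtain a where a: "word (c1 @ c2) - a *\<^sub>C word bs \<in> ext_ideal K"
    using Cons.IH[OF m] Cons.prems(2) by auto
  have sK: "set (c1 @ c2) \<subseteq> K" using m Cons.prems(2) by (metis insert_subset list.simps(15) set_mset_mset)
  obtain a' where a': "word (c1 @ b # c2) - a' *\<^sub>C word (b # c1 @ c2) \<in> ext_ideal K"
    using front[OF sK] by blast
  have "word [b] * (word (c1 @ c2) - a *\<^sub>C word bs) * word [] \<in> ext_ideal K"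
    using Cons.prems by (intro ideal_sandwich a) auto
  then have "word (b # c1 @ c2) - a *\<^sub>C word (b # bs) \<in> ext_ideal K"
    by (simp add: right_diff_distrib left_diff_distrib scaleC_mult_left scaleC_mult_right mult_single)
  then have "a' *\<^sub>C (word (b # c1 @ c2) - a *\<^sub>C word (b # bs)) \<in> ext_ideal K"
    by (simp add: complex_vector.subspace_scale)
  from complex_vector.subspace_add[OF csubspace_ext_ideal a' this]
  have "word cs - (a' * a) *\<^sub>C word (b # bs) \<in> ext_ideal K"
    by (simp add: c complex_vector.scale_right_diff_distrib)
  then show ?case by blast
qed

text \<open>
  The letters are replaced by basis vectors from left to right, by linearity in each letter. Words in basis
  vectors have a repeated letter, or else they are permutations of the basis.
\<close>

lemma word_top_span:
  assumes bs: "basis_list bs K" and ws: "set ws \<subseteq> K" "length ws = length bs"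
  shows "\<exists>a. word ws - a *\<^sub>C word bs \<in> ext_ideal K"
proof -
  have K: "csubspace K" "set bs \<subseteq> K" "K \<subseteq> cspan (set bs)" and d: "distinct bs"
    using bs by (auto simp: basis_list_def)
  have "\<exists>a. word (pre @ rest) - a *\<^sub>C word bs \<in> ext_ideal K"
    if "set pre \<subseteq> set bs" "set rest \<subseteq> K" "length (pre @ rest) = length bs" for pre rest
    using that
  proof (induction rest arbitrary: pre)
    case Nil
    show ?case
    proof (cases "distinct pre")
      case True
      have "card (set pre) = card (set bs)" using True d Nil by (simp add: distinct_card)
      then have "set pre = set bs" using Nil by (intro card_subset_eq) auto
      then have "mset pre = mset bs" using True d set_eq_iff_mset_eq_distinct by blast
      then show ?thesis using word_perm_span[OF K(1) _ K(2), of pre] by simp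
    next
      case False
      then have "word pre \<in> ext_ideal K" using Nil K by (intro word_repeat_ideal) auto
      then show ?thesis by (intro exI[of _ 0]) simp
    qed
  next
    case (Cons v rest)
    let ?S = "{v \<in> K. \<exists>a. word (pre @ v # rest) - a *\<^sub>C word bs \<in> ext_ideal K}"
    have pre: "set pre \<subseteq> K" "set rest \<subseteq> K" using Cons K by auto
    have "csubspace ?S"
    proof (rule complex_vector.subspaceI)
      have "word (pre @ (0 *\<^sub>C 0) # rest) - 0 *\<^sub>C word (pre @ 0 # rest) \<in> ext_ideal K"
        using pre K by (intro word_mid_scale complex_vector.subspace_0)
      then have "word (pre @ 0 # rest) - 0 *\<^sub>C word bs \<in> ext_ideal K" by simp
      then show "0 \<in> ?S" using complex_vector.subspace_0[OF K(1)] by blast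
    next
      fix x y assume "x \<in> ?S" "y \<in> ?S"
      then obtain a b where a: "x \<in> K" "word (pre @ x # rest) - a *\<^sub>C word bs \<in> ext_ideal K"
        and b: "y \<in> K" "word (pre @ y # rest) - b *\<^sub>C word bs \<in> ext_ideal K" by auto
      note s = complex_vector.subspace_add[OF csubspace_ext_ideal]
      from s[OF s[OF word_mid_add[OF K(1) pre a(1) b(1)] a(2)] b(2)]
      have "word (pre @ (x + y) # rest) - (a + b) *\<^sub>C word bs \<in> ext_ideal K"
        by (simp add: scaleC_add_left algebra_simps)
      then show "x + y \<in> ?S" using complex_vector.subspace_add[OF K(1) a(1) b(1)] by blast
    next
      fix r x assume "x \<in> ?S"
      then obtain a where a: "x \<in> K" "word (pre @ x # rest) - a *\<^sub>C word bs \<in> ext_ideal K" by auto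
      note s = complex_vector.subspace_add[OF csubspace_ext_ideal]
      have "r *\<^sub>C (word (pre @ x # rest) - a *\<^sub>C word bs) \<in> ext_ideal K"
        using a by (simp add: complex_vector.subspace_scale)
      from s[OF word_mid_scale[OF K(1) pre a(1), of r] this]
      have "word (pre @ (r *\<^sub>C x) # rest) - (r * a) *\<^sub>C word bs \<in> ext_ideal K"
        by (simp add: complex_vector.scale_right_diff_distrib)
      then show "r *\<^sub>C x \<in> ?S" using complex_vector.subspace_scale[OF K(1) a(1)] by blast
    qed
    moreover have "set bs \<subseteq> ?S"
    proof
      fix b assume b: "b \<in> set bs"
      have "\<exists>a. word ((pre @ [b]) @ rest) - a *\<^sub>C word bs \<in> ext_ideal K"
        using Cons.prems b by (intro Cons.IH) auto
      then show "b \<in> ?S" using b K by auto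
    qed
    ultimately have "cspan (set bs) \<subseteq> ?S" by (intro complex_vector.span_minimal)
    then show ?case using Cons K by auto
  qed
  from this[of "[]" ws] ws show ?thesis by simp
qed

lemma ext_top_simps [simp]:
  "carrier (ext_top K) = ecl K ` free_on {w \<in> words_on K. length (letters w) = cdim K}"
  "zero (ext_top K) = zero (exterior K)" "add (ext_top K) = add (exterior K)"
  "smult (ext_top K) = smult (exterior K)"
proof -
  have "free_on {w \<in> words_on K. length (letters w) = cdim K} =
     {x \<in> alg_on K. \<forall>w\<in>Poly_Mapping.keys x. length (letters w) = cdim K}"
    by (auto simp: free_on_def)
  then show "carrier (ext_top K) = ecl K ` free_on {w \<in> words_on K. length (letters w) = cdim K}"
    by (simp add: ext_top_def)
qed (simp_all add: ext_top_def del: exterior_simps)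

lemma cmod_ext_top: "cmod (ext_top K)"
proof (rule cmod_cong[OF cmod_quot_space[OF csubspace_ext_ideal csubspace_free_on]])
  show "carrier (ext_top K) = carrier (quot_space (free_on {w \<in> words_on K. length (letters w) = cdim K}) (ext_ideal K))"
    by simp
qed (simp_all add: quot_space_def)

lemma ext_top_sub: "carrier (ext_top K) \<subseteq> carrier (exterior K)"
  by (auto simp: free_on_def)

lemma wdg_in_top: "set bs \<subseteq> K \<Longrightarrow> length bs = cdim K \<Longrightarrow> wdg K bs \<in> carrier (ext_top K)"
  by simp

lemma ext_top_span:
  assumes bs: "basis_list bs K" and x: "x \<in> carrier (ext_top K)"
  obtains a where "x = a \<odot>\<^bsub>ext_top K\<^esub> wdg K bs"
proof -
  obtain p where p: "x = ecl K p" "p \<in> free_on {w \<in> words_on K. length (letters w) = cdim K}" using x by auto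
  note s = complex_vector.subspace_add[OF csubspace_ext_ideal]
  from p(2) have "\<exists>a. p - a *\<^sub>C word bs \<in> ext_ideal K"
  proof (induction rule: free_on_induct)
    case zero
    show ?case by (intro exI[of _ 0]) (simp add: complex_vector.subspace_0)
  next
    case (add x y)
    then obtain a b where ab: "x - a *\<^sub>C word bs \<in> ext_ideal K" "y - b *\<^sub>C word bs \<in> ext_ideal K" by blast
    from s[OF ab] have "x + y - (a + b) *\<^sub>C word bs \<in> ext_ideal K"
      by (simp add: scaleC_add_left algebra_simps)
    then show ?case by blast
  next
    case (scale r x)
    then obtain a where "x - a *\<^sub>C word bs \<in> ext_ideal K" by blast
    then have "r *\<^sub>C (x - a *\<^sub>C word bs) \<in> ext_ideal K" by (simp add: complex_vector.subspace_scale)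
    then have "r *\<^sub>C x - (r * a) *\<^sub>C word bs \<in> ext_ideal K"
      by (simp add: complex_vector.scale_right_diff_distrib)
    then show ?case by blast
  next
    case (gen g)
    then show ?case
      using word_top_span[OF bs, of "letters g"] bs by (cases g) (auto simp: basis_list_def)
  qed
  then obtain a where "p - a *\<^sub>C word bs \<in> ext_ideal K" by blast
  then have "ecl K p = ecl K (a *\<^sub>C word bs)" by (simp add: coset_eq_iff)
  then show ?thesis using that[of a] p by simp
qed

text \<open>
  Contraction with the dual vectors strips off the factors one by one. In the end the empty word remains,
  which the augmentation detects.
\<close>

lemma wdg_nonzero:
  assumes K: "csubspace K" and "biorth us bs" "set bs \<subseteq> K"
  shows "word bs \<notin> ext_ideal K"
  using assms(2,3)
proof (induction us bs rule: biorth.induct)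
  case 1
  then show ?case using augf_ideal[of "word []" K] by (auto simp: augf_word)
next
  case (2 u us b bs)
  show ?case
  proof
    assume a: "word (b # bs) \<in> ext_ideal K"
    have "clist (cinner u) bs = 0"
    proof -
      have "\<forall>b'\<in>set bs. cinner u b' = 0" using 2 by auto
      then show ?thesis by (induction bs) auto
    qed
    then have c: "ctrf (cinner u) (word (b # bs)) = word bs"
      using 2 by (simp add: ctrf_word scaleC_one)
    have "ctrf (cinner u) (word (b # bs)) \<in> ext_ideal K"
      using a unfolding ext_ideal_eq
      by (rule ideal_on_map[rotated 4])
        (simp_all add: ctrf_add ctrf_scale ctrf_ideal_step flip: ext_ideal_eq)
    with c 2 show False by auto
  qed
qed auto


section \<open>Determinants and top exterior powers\<close>

lemma word_expand_ideal:
  assumes K: "csubspace K" and B: "finite B" "B \<subseteq> K" and xs: "distinct xs" "set xs \<subseteq> B"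
    and T: "\<And>x. x \<in> set xs \<Longrightarrow> T x = (\<Sum>y\<in>B. r x y *\<^sub>C y)"
  shows "word (map T xs) - (\<Sum>g\<in>(set xs \<rightarrow>\<^sub>E B). (\<Prod>x\<in>set xs. r x (g x)) *\<^sub>C word (map g xs)) \<in> ext_ideal K"
  using xs T
proof (induction xs)
  case Nil
  show ?case by (simp add: complex_vector.subspace_0 scaleC_one)
next
  case (Cons x xs)
  let ?E = "set xs \<rightarrow>\<^sub>E B"
  let ?c = "\<lambda>g. \<Prod>x\<in>set xs. r x (g x)"
  let ?S = "\<Sum>g\<in>?E. ?c g *\<^sub>C word (map g xs)"
  let ?l = "\<Sum>y\<in>B. r x y *\<^sub>C letter y"
  have IH: "word (map T xs) - ?S \<in> ext_ideal K" using Cons by auto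
  have TK: "T z \<in> K" if "z \<in> set (x # xs)" for z
    unfolding Cons.prems(3)[OF that] using B K
    by (auto intro!: complex_vector.subspace_sum complex_vector.subspace_scale)
  have fin: "finite ?E" using B by (intro finite_PiE) auto
  have S: "?S \<in> alg_on K"
    using B by (intro complex_vector.subspace_sum csubspace_alg_on alg_on_scale) (auto simp: PiE_iff)
  have 1: "(letter (T x) - ?l) * ?S \<in> ext_ideal K"
    using letter_sum_ideal[OF K B, of "r x"] Cons.prems(3)[of x] S unfolding ext_ideal_eq
    by (intro ideal_on_mult_right) auto
  have 2: "letter (T x) * (word (map T xs) - ?S) \<in> ext_ideal K"
    using IH TK[of x] unfolding ext_ideal_eq by (intro ideal_on_mult_left) auto
  have x: "x \<notin> set xs" using Cons.prems by auto
  have "(\<Sum>g\<in>(set (x # xs) \<rightarrow>\<^sub>E B). (\<Prod>z\<in>set (x # xs). r z (g z)) *\<^sub>C word (map g (x # xs))) =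
     (\<Sum>(y, g)\<in>B \<times> ?E. (r x y * ?c g) *\<^sub>C (letter y * word (map g xs)))"
  proof -
    have "(\<Sum>g\<in>(set (x # xs) \<rightarrow>\<^sub>E B). (\<Prod>z\<in>set (x # xs). r z (g z)) *\<^sub>C word (map g (x # xs))) =
      (\<Sum>(y, g)\<in>B \<times> ?E. (\<Prod>z\<in>set (x # xs). r z ((g(x := y)) z)) *\<^sub>C word (map (g(x := y)) (x # xs)))"
      unfolding list.set(2) PiE_insert_eq
      by (subst sum.reindex) (use x inj_combinator[of x "set xs" "\<lambda>_. B"] in \<open>auto simp: case_prod_unfold intro!: sum.cong\<close>)
    also have "\<dots> = (\<Sum>(y, g)\<in>B \<times> ?E. (r x y * ?c g) *\<^sub>C (letter y * word (map g xs)))"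
    proof (rule sum.cong[OF refl], clarify)
      fix y g
      have "(\<Prod>z\<in>set (x # xs). r z ((g(x := y)) z)) = r x y * ?c g"
        using x by (auto intro!: prod.cong)
      moreover have "map (g(x := y)) (x # xs) = y # map g xs" using x by auto
      ultimately show "(\<Prod>z\<in>set (x # xs). r z ((g(x := y)) z)) *\<^sub>C word (map (g(x := y)) (x # xs)) =
          (r x y * ?c g) *\<^sub>C (letter y * word (map g xs))"
        by (simp only: letter_word)
    qed
    finally show ?thesis .
  qed
  also have "\<dots> = ?l * ?S"
    unfolding sum_product sum.cartesian_product
    by (intro sum.cong) (auto simp: scaleC_mult_left scaleC_mult_right mult.commute)
  finally have e: "(\<Sum>g\<in>(set (x # xs) \<rightarrow>\<^sub>E B). (\<Prod>z\<in>set (x # xs). r z (g z)) *\<^sub>C word (map g (x # xs))) = ?l * ?S" .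
  from complex_vector.subspace_add[OF csubspace_ext_ideal 1 2]
  have "letter (T x) * word (map T xs) - ?l * ?S \<in> ext_ideal K" by (simp add: algebra_simps)
  then show ?case unfolding e by (simp add: letter_word)
qed

text \<open>
  All letters of the image word are expanded in the basis. The functions that are not injective give a repeated letter
  and vanish; the others are the permutations, and each contributes its sign. The sum is the Leibniz formula.
\<close>

lemma wdg_det:
  assumes K: "csubspace K" and bs: "distinct bs" "set bs \<subseteq> K"
    and T: "\<And>x. x \<in> set bs \<Longrightarrow> T x = (\<Sum>y\<in>set bs. r x y *\<^sub>C y)"
  shows "word (map T bs) -
     (\<Sum>p | p permutes set bs. of_int (sign p) * (\<Prod>b\<in>set bs. r b (p b))) *\<^sub>C word bs \<in> ext_ideal K"
proof -
  let ?B = "set bs"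
  let ?c = "\<lambda>g. \<Prod>x\<in>?B. r x (g x)"
  let ?E = "?B \<rightarrow>\<^sub>E ?B"
  let ?I = "{g \<in> ?E. inj_on g ?B}"
  have fin: "finite ?E" by (intro finite_PiE) auto
  have 1: "word (map T bs) - (\<Sum>g\<in>?E. ?c g *\<^sub>C word (map g bs)) \<in> ext_ideal K"
    using bs T by (intro word_expand_ideal[OF K]) auto
  have 2: "(\<Sum>g\<in>?E - ?I. ?c g *\<^sub>C word (map g bs)) \<in> ext_ideal K"
  proof (rule complex_vector.subspace_sum[OF csubspace_ext_ideal])
    fix g assume g: "g \<in> ?E - ?I"
    then have "word (map g bs) \<in> ext_ideal K"
      using bs by (intro word_repeat_ideal[OF K]) (auto simp: distinct_map)
    then show "?c g *\<^sub>C word (map g bs) \<in> ext_ideal K" by (simp add: complex_vector.subspace_scale)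
  qed
  have bij: "bij_betw (\<lambda>p. restrict p ?B) {p. p permutes ?B} ?I"
  proof (rule bij_betwI[where g = "\<lambda>g x. if x \<in> ?B then g x else x"])
    show "(\<lambda>p. restrict p ?B) \<in> {p. p permutes ?B} \<rightarrow> ?I"
      using permutes_inj_on permutes_in_image by (fastforce simp: inj_on_def)
    show "(\<lambda>g x. if x \<in> ?B then g x else x) \<in> ?I \<rightarrow> {p. p permutes ?B}"
    proof
      fix g assume g: "g \<in> ?I"
      then have "g ` ?B = ?B" by (intro endo_inj_surj) (auto simp: PiE_iff)
      then have "bij_betw g ?B ?B" using g by (simp add: bij_betw_def)
      then have "bij_betw (\<lambda>x. if x \<in> ?B then g x else x) ?B ?B"
        by (rule bij_betw_cong[THEN iffD1, rotated]) simp
      then show "(\<lambda>x. if x \<in> ?B then g x else x) \<in> {p. p permutes ?B}"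
        by (auto intro!: bij_imp_permutes)
    qed
    show "(\<lambda>x. if x \<in> ?B then restrict p ?B x else x) = p" if "p \<in> {p. p permutes ?B}" for p
      using that by (auto simp: permutes_not_in)
    show "restrict (\<lambda>x. if x \<in> ?B then g x else x) ?B = g" if "g \<in> ?I" for g
      using that by (auto simp: PiE_iff extensional_def)
  qed
  have "(\<Sum>g\<in>?I. ?c g *\<^sub>C word (map g bs)) = (\<Sum>p | p permutes ?B. ?c (restrict p ?B) *\<^sub>C word (map (restrict p ?B) bs))"
    by (rule sum.reindex_bij_betw[OF bij, symmetric])
  also have "\<dots> = (\<Sum>p | p permutes ?B. ?c p *\<^sub>C word (map p bs))"
  proof (rule sum.cong[OF refl])
    fix p :: "'a \<Rightarrow> 'a"
    have "map (restrict p ?B) bs = map p bs" by (intro map_cong) auto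
    then have "word (map (restrict p ?B) bs) = word (map p bs)" by (rule arg_cong)
    moreover have "?c (restrict p ?B) = ?c p" by (intro prod.cong) auto
    ultimately show "?c (restrict p ?B) *\<^sub>C word (map (restrict p ?B) bs) = ?c p *\<^sub>C word (map p bs)" by (simp only:)
  qed
  finally have 3: "(\<Sum>g\<in>?I. ?c g *\<^sub>C word (map g bs)) = (\<Sum>p | p permutes ?B. ?c p *\<^sub>C word (map p bs))" .
  have 4: "(\<Sum>p | p permutes ?B. ?c p *\<^sub>C (word (map p bs) - of_int (sign p) *\<^sub>C word bs)) \<in> ext_ideal K"
    using word_permute_ideal[OF K bs]
    by (intro complex_vector.subspace_sum[OF csubspace_ext_ideal] complex_vector.subspace_scale[OF csubspace_ext_ideal]) auto
  have 5: "(\<Sum>g\<in>?E. ?c g *\<^sub>C word (map g bs)) =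
      (\<Sum>g\<in>?E - ?I. ?c g *\<^sub>C word (map g bs)) + (\<Sum>g\<in>?I. ?c g *\<^sub>C word (map g bs))"
    by (rule sum.subset_diff) (use fin in auto)
  have 6: "(\<Sum>p | p permutes ?B. ?c p *\<^sub>C (word (map p bs) - of_int (sign p) *\<^sub>C word bs)) =
      (\<Sum>p | p permutes ?B. ?c p *\<^sub>C word (map p bs)) -
      (\<Sum>p | p permutes ?B. of_int (sign p) * ?c p) *\<^sub>C word bs"
    by (simp add: complex_vector.scale_right_diff_distrib sum_subtractf complex_vector.scale_sum_left mult.commute)
  note s = complex_vector.subspace_add[OF csubspace_ext_ideal]
  from s[OF s[OF 1 2] 4] show ?thesis unfolding 5 6 3 by (simp add: algebra_simps)
qed

text \<open>
  Since \<open>endo_det\<close> refers to a chosen basis, the wedge product of that basis is taken as generator of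
  the line; there the coefficient is given by \<open>wdg_det\<close>.
\<close>

lemma ext_map_top_det:
  assumes "basis_list bs K" and T: "lin_on K T" "T ` K \<subseteq> K" and x: "x \<in> carrier (ext_top K)"
  shows "ext_map K T x = endo_det K T \<odot>\<^bsub>exterior K\<^esub> x"
proof -
  have K: "csubspace K" "set bs \<subseteq> K" "K \<subseteq> cspan (set bs)" "length bs = cdim K"
    using assms(1) by (auto simp: basis_list_def)
  define B where "B = (SOME B. \<not> cdependent B \<and> cspan B = K)"
  obtain B' where "B' \<subseteq> K" "\<not> cdependent B'" "K \<subseteq> cspan B'"
    using complex_vector.basis_exists[of K] by metis
  then have "\<not> cdependent B' \<and> cspan B' = K" using K complex_vector.span_minimal by blast
  then have B: "\<not> cdependent B" "cspan B = K" unfolding B_def by (rule someI2, blast)+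
  have BK: "B \<subseteq> K" using B complex_vector.span_superset by blast
  have finB: "finite B" using complex_vector.independent_span_bound[of "set bs" B] K B BK by auto
  obtain cs where cs: "set cs = B" "distinct cs" using finite_distinct_list[OF finB] by blast
  have "card B = cdim K" using B BK by (intro complex_vector.basis_card_eq_dim) auto
  then have bl: "basis_list cs K" using cs B BK K by (auto simp: basis_list_def distinct_card)
  have rep: "T b = (\<Sum>y\<in>B. crepresentation B (T b) y *\<^sub>C y)" if "b \<in> B" for b
  proof -
    have "T b \<in> cspan B" using T(2) that BK B by auto
    then show ?thesis using complex_vector.sum_representation_eq[OF B(1) _ finB, of "T b"] by simp
  qed
  have det: "endo_det K T = (\<Sum>p | p permutes B. of_int (sign p) * (\<Prod>b\<in>B. crepresentation B (T b) (p b)))"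
    by (simp add: endo_det_def B_def[symmetric] Let_def)
  have w: "word (map T cs) - endo_det K T *\<^sub>C word cs \<in> ext_ideal K"
    unfolding det cs(1)[symmetric] using rep cs BK by (intro wdg_det K) auto
  obtain a where a: "x = a \<odot>\<^bsub>ext_top K\<^esub> wdg K cs" using ext_top_span[OF bl x] by blast
  have csK: "word cs \<in> alg_on K" using cs BK by simp
  have "ext_map K T (ecl K (a *\<^sub>C word cs)) = ecl K (mapf T (a *\<^sub>C word cs))"
    by (rule ext_map_ecl[OF K(1) T alg_on_scale[OF csK]])
  also have "\<dots> = ecl K (a *\<^sub>C word (map T cs))" by (simp add: mapf_scale mapf_word)
  also have "\<dots> = ecl K (endo_det K T *\<^sub>C a *\<^sub>C word cs)"
    using complex_vector.subspace_scale[OF csubspace_ext_ideal w, of a]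
    by (simp add: coset_eq_iff complex_vector.scale_right_diff_distrib mult.commute)
  finally show ?thesis unfolding a by simp
qed


section \<open>Bimodule structures on tensor products\<close>

text \<open>
  This is spanning, in the form in which it is used: to extend identities from generators.
\<close>

definition generates :: "'m set \<Rightarrow> (complex, 'm, 'r) module_scheme \<Rightarrow> bool" where
  "generates G T \<longleftrightarrow> (\<forall>f g. clin T T f \<longrightarrow> clin T T g \<longrightarrow> (\<forall>x\<in>G. f x = g x) \<longrightarrow> (\<forall>x\<in>carrier T. f x = g x))"

lemma generatesD:
  "generates G T \<Longrightarrow> clin T T f \<Longrightarrow> clin T T g \<Longrightarrow> (\<And>x. x \<in> G \<Longrightarrow> f x = g x) \<Longrightarrow> x \<in> carrier T \<Longrightarrow> f x = g x"
  unfolding generates_def by blast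

lemma cl_act_generators:
  assumes T: "cmod T" and G: "generates G T" and lin: "\<And>w. clin T T (act w)"
    and add: "\<And>x v w. x \<in> G \<Longrightarrow> act (v + w) x = act v x \<oplus>\<^bsub>T\<^esub> act w x"
    and scale: "\<And>x a v. x \<in> G \<Longrightarrow> act (a *\<^sub>C v) x = a \<odot>\<^bsub>T\<^esub> act v x"
    and cl: "\<And>x v w. x \<in> G \<Longrightarrow> act v (act w x) \<oplus>\<^bsub>T\<^esub> act w (act v x) = cinner (c v) w \<odot>\<^bsub>T\<^esub> x"
  shows "cl_act c T act"
  unfolding cl_act_def
proof (intro conjI allI ballI lin)
  fix m v w a assume m: "m \<in> carrier T"
  show "act (v + w) m = act v m \<oplus>\<^bsub>T\<^esub> act w m"
    by (rule generatesD[OF G lin clin_plus[OF T lin lin] add m])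
  show "act (a *\<^sub>C v) m = a \<odot>\<^bsub>T\<^esub> act v m"
    by (rule generatesD[OF G lin clin_scale[OF T lin] scale m])
  show "act v (act w m) \<oplus>\<^bsub>T\<^esub> act w (act v m) = cinner (c v) w \<odot>\<^bsub>T\<^esub> m"
    by (rule generatesD[OF G clin_plus[OF T clin_comp[OF lin lin] clin_comp[OF lin lin]]
          clin_scale[OF T clin_id] cl m])
qed

lemma cbimod_cl_act:
  assumes "cbimod cp cq M" "m \<in> carrier M"
  shows "lact M (v + w) m = lact M v m \<oplus>\<^bsub>M\<^esub> lact M w m"
    and "lact M (a *\<^sub>C v) m = a \<odot>\<^bsub>M\<^esub> lact M v m"
    and "lact M v (lact M w m) \<oplus>\<^bsub>M\<^esub> lact M w (lact M v m) = cinner (cp v) w \<odot>\<^bsub>M\<^esub> m"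
    and "ract M m (x + y) = ract M m x \<oplus>\<^bsub>M\<^esub> ract M m y"
    and "ract M m (a *\<^sub>C x) = a \<odot>\<^bsub>M\<^esub> ract M m x"
    and "ract M (ract M m y) x \<oplus>\<^bsub>M\<^esub> ract M (ract M m x) y = cinner (cq x) y \<odot>\<^bsub>M\<^esub> m"
  using cbimod.left[OF assms(1)] cbimod.right[OF assms(1)] assms(2) unfolding cl_act_def by blast+

lemma generates_cl_pure:
  assumes "cmod M" "cmod N"
  shows "generates {cl_pure c M N m n | m n. m \<in> carrier M \<and> n \<in> carrier N} (cl_tens c M N)"
  unfolding generates_def
proof (intro allI impI ballI)
  fix f g x assume fg: "clin (cl_tens c M N) (cl_tens c M N) f" "clin (cl_tens c M N) (cl_tens c M N) g"
    and eq: "\<forall>x\<in>{cl_pure c M N m n | m n. m \<in> carrier M \<and> n \<in> carrier N}. f x = g x"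
    and x: "x \<in> carrier (cl_tens c M N)"
  show "f x = g x" by (rule cl_tens_clin_eq[OF assms fg _ x]) (use eq in blast)
qed

context
  fixes cp :: "'p::hermitian_space \<Rightarrow> 'p" and c :: "'q::hermitian_space \<Rightarrow> 'q" and cr :: "'r::hermitian_space \<Rightarrow> 'r"
    and M :: "('p, 'q, 'm) bimod" and N :: "('q, 'r, 'n) bimod"
  assumes M: "cbimod cp c M" and N: "cbimod c cr N"
begin

interpretation M: cbimod cp c M by (rule M)
interpretation N: cbimod c cr N by (rule N)
interpretation T: cmod "cl_tens c M N" by (rule cmod_cl_tens)

lemma cl_tens_map_lift:
  fixes T' :: "(complex, 't, 'u) module_scheme"
  assumes "cmod T'" "cbilin M N T' f" "balanced M N f"
  shows "clin (cl_tens c M N) T' (tens_lift T' f)"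
    and "m \<in> carrier M \<Longrightarrow> n \<in> carrier N \<Longrightarrow> tens_lift T' f (cl_pure c M N m n) = f m n"
  using cl_tens_lift_clin[OF M N assms] cl_tens_lift_pure[OF M N assms] by auto

lemma cl_lact_bilin:
  "cbilin M N (cl_tens_space c M N) (\<lambda>m n. cl_pure c M N (lact M w m) n)"
  "balanced M N (\<lambda>m n. cl_pure c M N (lact M w m) n)"
  using cbilin_comp_left[OF cl_pure_cbilin[OF M.cmod_axioms N.cmod_axioms] M.lact_clin]
   cl_pure_swap[OF M N] by (auto simp: balanced_def M.lr_comm)

lemma cl_ract_bilin:
  "cbilin M N (cl_tens_space c M N) (\<lambda>m n. cl_pure c M N m (ract N n v))"
  "balanced M N (\<lambda>m n. cl_pure c M N m (ract N n v))"
  using cbilin_comp_right[OF cl_pure_cbilin[OF M.cmod_axioms N.cmod_axioms] N.ract_clin]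
   cl_pure_swap[OF M N] by (auto simp: balanced_def N.lr_comm[symmetric])

lemma cl_tens_lact_clin: "clin (cl_tens c M N) (cl_tens c M N) (lact (cl_tens c M N) w)"
  and cl_tens_lact_pure: "m \<in> carrier M \<Longrightarrow> n \<in> carrier N \<Longrightarrow>
    lact (cl_tens c M N) w (cl_pure c M N m n) = cl_pure c M N (lact M w m) n"
  using cl_tens_map_lift[OF cmod_cl_tens_space cl_lact_bilin] by simp_all

lemma cl_tens_ract_clin: "clin (cl_tens c M N) (cl_tens c M N) (\<lambda>x. ract (cl_tens c M N) x v)"
  and cl_tens_ract_pure: "m \<in> carrier M \<Longrightarrow> n \<in> carrier N \<Longrightarrow>
    ract (cl_tens c M N) (cl_pure c M N m n) v = cl_pure c M N m (ract N n v)"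
  using cl_tens_map_lift[OF cmod_cl_tens_space cl_ract_bilin] by simp_all

lemma cbimod_cl_tens: "cbimod cp cr (cl_tens c M N)"
proof -
  note P = cl_pure_cbilin[OF M.cmod_axioms N.cmod_axioms, of c]
  note simps = cl_tens_lact_pure cl_tens_ract_pure M.lact_closed N.ract_closed
  note G = generates_cl_pure[OF M.cmod_axioms N.cmod_axioms, of c]
  note add1 = clin_add[OF cbilinD2[OF P], symmetric] and add2 = clin_add[OF cbilinD1[OF P], symmetric]
    and sc1 = clin_smult[OF cbilinD2[OF P], symmetric] and sc2 = clin_smult[OF cbilinD1[OF P], symmetric]
  show ?thesis
  proof (intro cbimod.intro cbimod_axioms.intro cmod_cl_tens)
    show "cl_act cp (cl_tens c M N) (lact (cl_tens c M N))"
      by (rule cl_act_generators[OF cmod_cl_tens G cl_tens_lact_clin]; clarify)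
        (simp_all only: simps add1 sc1 cbimod_cl_act[OF M])
    show "cl_act cr (cl_tens c M N) (\<lambda>w x. ract (cl_tens c M N) x w)"
      by (rule cl_act_generators[OF cmod_cl_tens G cl_tens_ract_clin]; clarify)
        (simp_all only: simps add2 sc2 cbimod_cl_act[OF N])
    fix x v w assume x: "x \<in> carrier (cl_tens c M N)"
    show "lact (cl_tens c M N) v (ract (cl_tens c M N) x w) = ract (cl_tens c M N) (lact (cl_tens c M N) v x) w"
      by (rule generatesD[OF G clin_comp[OF cl_tens_ract_clin cl_tens_lact_clin]
           clin_comp[OF cl_tens_lact_clin cl_tens_ract_clin] _ x]; clarify)
        (simp only: simps)
  qed
qed

end

subsection \<open>Twisting by a top exterior power\<close>

lemma top_twist_simps [simp]:
  "carrier (top_twist M K) = carrier (tens M (ext_top K))"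
  "zero (top_twist M K) = zero (tens M (ext_top K))"
  "add (top_twist M K) = add (tens M (ext_top K))"
  "smult (top_twist M K) = smult (tens M (ext_top K))"
  "lact (top_twist M K) = (\<lambda>w. tens_lift (tens M (ext_top K)) (\<lambda>\<xi> \<kappa>. pure M (ext_top K) (lact M w \<xi>) \<kappa>))"
  "ract (top_twist M K) = (\<lambda>x w. tens_lift (tens M (ext_top K))
     (\<lambda>\<xi> \<kappa>. (-1) ^ cdim K \<odot>\<^bsub>tens M (ext_top K)\<^esub> pure M (ext_top K) (ract M \<xi> w) \<kappa>) x)"
  by (simp_all add: top_twist_def Let_def module.defs bimod.defs)

lemma cmod_top_twist: "cmod (top_twist M K)"
  by (rule cmod_cong[OF cmod_tens]) simp_all

lemma clin_top_twist_iff [simp]: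
  "clin (top_twist M K) = clin (tens M (ext_top K))"
  "clin T (top_twist M K) = clin T (tens M (ext_top K))"
  "cbilin T T' (top_twist M K) = cbilin T T' (tens M (ext_top K))"
  by (simp_all add: clin_def cbilin_def fun_eq_iff)

lemma generates_pure:
  assumes "cmod M" "cmod N"
  shows "generates {pure M N m n | m n. m \<in> carrier M \<and> n \<in> carrier N} (tens M N)"
  unfolding generates_def
proof (intro allI impI ballI)
  fix f g x assume fg: "clin (tens M N) (tens M N) f" "clin (tens M N) (tens M N) g"
    and eq: "\<forall>x\<in>{pure M N m n | m n. m \<in> carrier M \<and> n \<in> carrier N}. f x = g x"
    and x: "x \<in> carrier (tens M N)"
  show "f x = g x" by (rule tens_clin_eq[OF assms fg _ x]) (use eq in blast)
qed

context
  fixes cp :: "'p::hermitian_space \<Rightarrow> 'p" and cq :: "'q::hermitian_space \<Rightarrow> 'q"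
    and M :: "('p, 'q, 'm) bimod" and K :: "'k::hermitian_space set"
  assumes M: "cbimod cp cq M"
begin

interpretation M: cbimod cp cq M by (rule M)

lemma twist_pure_cbilin: "cbilin M (ext_top K) (tens M (ext_top K)) (pure M (ext_top K))"
  by (rule pure_cbilin[OF M.cmod_axioms cmod_ext_top])

lemma top_twist_lact_clin: "clin (top_twist M K) (top_twist M K) (lact (top_twist M K) w)"
  and top_twist_lact_pure: "m \<in> carrier M \<Longrightarrow> n \<in> carrier (ext_top K) \<Longrightarrow>
    lact (top_twist M K) w (pure M (ext_top K) m n) = pure M (ext_top K) (lact M w m) n"
  using tens_lift_clin[OF M.cmod_axioms cmod_ext_top cmod_tens cbilin_comp_left[OF twist_pure_cbilin M.lact_clin]]
    tens_lift_pure[OF M.cmod_axioms cmod_ext_top cmod_tens cbilin_comp_left[OF twist_pure_cbilin M.lact_clin]]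
  by (simp_all del: ext_top_simps)

lemma top_twist_ract_clin: "clin (top_twist M K) (top_twist M K) (\<lambda>x. ract (top_twist M K) x v)"
  and top_twist_ract_pure: "m \<in> carrier M \<Longrightarrow> n \<in> carrier (ext_top K) \<Longrightarrow>
    ract (top_twist M K) (pure M (ext_top K) m n) v =
      (-1) ^ cdim K \<odot>\<^bsub>tens M (ext_top K)\<^esub> pure M (ext_top K) (ract M m v) n"
  using tens_lift_clin[OF M.cmod_axioms cmod_ext_top cmod_tens
      cbilin_scale[OF cmod_tens cbilin_comp_left[OF twist_pure_cbilin M.ract_clin]]]
    tens_lift_pure[OF M.cmod_axioms cmod_ext_top cmod_tens
      cbilin_scale[OF cmod_tens cbilin_comp_left[OF twist_pure_cbilin M.ract_clin]]]
  by (simp_all del: ext_top_simps)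

lemma cbimod_top_twist: "cbimod cp cq (top_twist M K)"
proof -
  interpret T: cmod "tens M (ext_top K)" by (rule cmod_tens)
  note P = twist_pure_cbilin
  note L = top_twist_lact_clin and R = top_twist_ract_clin
  note G0 = generates_pure[OF M.cmod_axioms cmod_ext_top, of K]
  have G: "generates {pure M (ext_top K) m n | m n. m \<in> carrier M \<and> n \<in> carrier (ext_top K)} (top_twist M K)"
    using G0 by (simp only: generates_def clin_top_twist_iff top_twist_simps)
  note add1 = clin_add[OF cbilinD2[OF P], symmetric] and sc1 = clin_smult[OF cbilinD2[OF P], symmetric]
  have s: "(-1) ^ n * (-1) ^ n = (1::complex)" for n by (simp flip: power_add mult_2)
  have rl: "ract (top_twist M K) (a \<odot>\<^bsub>tens M (ext_top K)\<^esub> x) v = a \<odot>\<^bsub>tens M (ext_top K)\<^esub> ract (top_twist M K) x v"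
    if "x \<in> carrier (tens M (ext_top K))" for a x v
    using clin_smult[OF R[of v], where x = x and a = a] that by (simp only: top_twist_simps)
  have ll: "lact (top_twist M K) v (a \<odot>\<^bsub>tens M (ext_top K)\<^esub> x) = a \<odot>\<^bsub>tens M (ext_top K)\<^esub> lact (top_twist M K) v x"
    if "x \<in> carrier (tens M (ext_top K))" for a x v
    using clin_smult[OF L[of v], where x = x and a = a] that by (simp only: top_twist_simps)
  note pc = cbilin_closed[OF P]
  note simps = top_twist_lact_pure top_twist_ract_pure top_twist_simps(1-4) rl ll pc
     M.lact_closed M.ract_closed T.smult_assoc T.smult_closed s
  show ?thesis
  proof (intro cbimod.intro cbimod_axioms.intro cmod_top_twist)
    show "cl_act cp (top_twist M K) (lact (top_twist M K))"
    proof (rule cl_act_generators[OF cmod_top_twist G L]; clarify)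
      fix m n v w assume mn: "m \<in> carrier M" "n \<in> carrier (ext_top K)"
      then show "lact (top_twist M K) (v + w) (pure M (ext_top K) m n) =
          lact (top_twist M K) v (pure M (ext_top K) m n) \<oplus>\<^bsub>top_twist M K\<^esub> lact (top_twist M K) w (pure M (ext_top K) m n)"
        by (simp only: simps add1 cbimod_cl_act[OF M])
      show "lact (top_twist M K) v (lact (top_twist M K) w (pure M (ext_top K) m n)) \<oplus>\<^bsub>top_twist M K\<^esub>
          lact (top_twist M K) w (lact (top_twist M K) v (pure M (ext_top K) m n)) =
          cinner (cp v) w \<odot>\<^bsub>top_twist M K\<^esub> pure M (ext_top K) m n"
        using mn by (simp only: simps add1 sc1 cbimod_cl_act[OF M])
    next
      fix m n v a assume mn: "m \<in> carrier M" "n \<in> carrier (ext_top K)"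
      then show "lact (top_twist M K) (a *\<^sub>C v) (pure M (ext_top K) m n) =
          a \<odot>\<^bsub>top_twist M K\<^esub> lact (top_twist M K) v (pure M (ext_top K) m n)"
        by (simp only: simps sc1 cbimod_cl_act[OF M])
    qed
    show "cl_act cq (top_twist M K) (\<lambda>w x. ract (top_twist M K) x w)"
    proof (rule cl_act_generators[OF cmod_top_twist G R]; clarify)
      fix m n v w assume mn: "m \<in> carrier M" "n \<in> carrier (ext_top K)"
      then show "ract (top_twist M K) (pure M (ext_top K) m n) (v + w) =
          ract (top_twist M K) (pure M (ext_top K) m n) v \<oplus>\<^bsub>top_twist M K\<^esub> ract (top_twist M K) (pure M (ext_top K) m n) w"
        by (simp only: simps cbimod_cl_act[OF M] clin_add[OF cbilinD2[OF P]] T.smult_r_distr)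
      show "ract (top_twist M K) (ract (top_twist M K) (pure M (ext_top K) m n) w) v \<oplus>\<^bsub>top_twist M K\<^esub>
          ract (top_twist M K) (ract (top_twist M K) (pure M (ext_top K) m n) v) w =
          cinner (cq v) w \<odot>\<^bsub>top_twist M K\<^esub> pure M (ext_top K) m n"
        using mn by (simp only: simps T.smult_one) (simp only: simps add1 sc1 cbimod_cl_act[OF M])
    next
      fix m n v a assume mn: "m \<in> carrier M" "n \<in> carrier (ext_top K)"
      then show "ract (top_twist M K) (pure M (ext_top K) m n) (a *\<^sub>C v) =
          a \<odot>\<^bsub>top_twist M K\<^esub> ract (top_twist M K) (pure M (ext_top K) m n) v"
        by (simp only: simps clin_smult[OF cbilinD2[OF P]] cbimod_cl_act[OF M] mult.commute)
    qed
    fix x v w assume x: "x \<in> carrier (top_twist M K)"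
    show "lact (top_twist M K) v (ract (top_twist M K) x w) = ract (top_twist M K) (lact (top_twist M K) v x) w"
      by (rule generatesD[OF G clin_comp[OF R L] clin_comp[OF L R] _ x]; clarify)
        (simp only: simps M.lr_comm)
  qed
qed

end


section \<open>Moving vectors through a threefold tensor product\<close>

(* From here on the records are used through the locale cbimod only, so their equations are no longer simplification rules. *)
declare exterior_simps [simp del] ext_bimod_simps [simp del] cl_tens_simps [simp del]
  top_twist_simps [simp del] ext_top_simps [simp del] clin_cl_tens_iff [simp del]
  clin_top_twist_iff [simp del] clin_ext_bimod_iff [simp del]

context cbimod begin

lemma lact_zero_vec: "m \<in> carrier M \<Longrightarrow> lact M 0 m = \<zero>"
  using cbimod_cl_act(2)[OF cbimod_axioms, of m 0 0] by simp

lemma ract_zero_vec: "m \<in> carrier M \<Longrightarrow> ract M m 0 = \<zero>"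
  using cbimod_cl_act(5)[OF cbimod_axioms, of m 0 0] by simp

lemma ract_uminus_vec: "m \<in> carrier M \<Longrightarrow> ract M m (- v) = \<ominus> ract M m v"
  using cbimod_cl_act(5)[OF cbimod_axioms, of m "-1" v] by (simp add: smult_minus_one)

lemmas foldl_ract_minus = clin_uminus[OF cmod_axioms cmod_axioms foldl_ract_clin]
  and foldl_ract_zero = clin_zero[OF cmod_axioms cmod_axioms foldl_ract_clin]
  and ract_zero = clin_zero[OF cmod_axioms cmod_axioms ract_clin]
  and lact_zero = clin_zero[OF cmod_axioms cmod_axioms lact_clin]

lemma ract_exchange:
  assumes "m \<in> carrier M"
  shows "ract M (ract M m y) x = (cinner (cq x) y \<odot> m) \<ominus> ract M (ract M m x) y"
  using cbimod_cl_act(6)[OF cbimod_axioms assms, of y x] assms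
  by (metis add.inv_closed add.m_assoc a_minus_def r_neg r_zero ract_closed)

lemma ract_foldl_anticommute:
  assumes "m \<in> carrier M" "\<forall>a\<in>set A. cinner (cq w) a = 0"
  shows "ract M (foldl (ract M) m A) w = (-1) ^ length A \<odot> foldl (ract M) (ract M m w) A"
  using assms
proof (induction A arbitrary: m)
  case Nil
  then show ?case by (simp add: smult_one)
next
  case (Cons a A)
  have "ract M (ract M m a) w = \<ominus> ract M (ract M m w) a"
    using Cons.prems ract_exchange[of m a w] by (simp add: minus_eq)
  then have "ract M (foldl (ract M) m (a # A)) w = (-1) ^ length A \<odot> foldl (ract M) (\<ominus> ract M (ract M m w) a) A"
    using Cons by simp
  also have "\<dots> = (-1) ^ length (a # A) \<odot> foldl (ract M) (ract M m w) (a # A)"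
    using Cons.prems by (simp add: foldl_ract_minus smult_minus_right smult_minus_left)
  finally show ?case .
qed

lemma lact_foldl: "m \<in> carrier M \<Longrightarrow> lact M v (foldl (ract M) m A) = foldl (ract M) (lact M v m) A"
  by (induction A arbitrary: m) (auto simp: lr_comm)

end

text \<open>
  Three bimodules with vectors that behave like the vacua of \<open>L01\<close>, \<open>L12\<close>, \<open>L23\<close>. The last three
  assumptions say that the conjugates of the Lagrangians annihilate the vacua; vectors are moved by these relations and by
  the Clifford relations.
\<close>

locale vacuum_chain =
  F: cbimod c0 c1 F01 + G: cbimod c1 c2 F12 + H: cbimod c2 c3 F23
  for c0 :: "'w0::hermitian_space \<Rightarrow> 'w0" and c1 :: "'w1::hermitian_space \<Rightarrow> 'w1"
    and c2 :: "'w2::hermitian_space \<Rightarrow> 'w2" and c3 :: "'w3::hermitian_space \<Rightarrow> 'w3"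
    and F01 :: "('w0, 'w1, 'm) bimod" and F12 :: "('w1, 'w2, 'n) bimod" and F23 :: "('w2, 'w3, 'k) bimod" +
  fixes o01 o12 o23 L01 L12 L23
  assumes o: "o01 \<in> carrier F01" "o12 \<in> carrier F12" "o23 \<in> carrier F23"
    and rs1: "real_structure c1" and rs2: "real_structure c2" and c00: "c0 0 = 0" and c30: "c3 0 = 0"
    and v01: "(z, x) \<in> pair_conj c0 c1 ` L01 \<Longrightarrow> lact F01 z o01 = \<ominus>\<^bsub>F01\<^esub> ract F01 o01 x"
    and v12: "(x', y) \<in> pair_conj c1 c2 ` L12 \<Longrightarrow> lact F12 x' o12 = \<ominus>\<^bsub>F12\<^esub> ract F12 o12 y"
    and v23: "(y', v) \<in> pair_conj c2 c3 ` L23 \<Longrightarrow> lact F23 y' o23 = \<ominus>\<^bsub>F23\<^esub> ract F23 o23 v"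
begin

abbreviation "S \<equiv> cl_tens c2 F12 F23"
abbreviation "T \<equiv> cl_tens c1 F01 S"

sublocale S: cbimod c1 c3 S by (rule cbimod_cl_tens[OF G.cbimod_axioms H.cbimod_axioms])
sublocale T: cbimod c0 c3 T by (rule cbimod_cl_tens[OF F.cbimod_axioms S.cbimod_axioms])

definition inserted_right where "inserted_right B = cl_pure c2 F12 F23 (foldl (ract F12) o12 B) o23"
definition inserted where "inserted A B = cl_pure c1 F01 S (foldl (ract F01) o01 A) (inserted_right B)"

lemmas pS = cl_pure_cbilin[OF G.cmod_axioms H.cmod_axioms, of c2]
  and pT = cl_pure_cbilin[OF F.cmod_axioms S.cmod_axioms, of c1]
  and swS = cl_pure_swap[OF G.cbimod_axioms H.cbimod_axioms]
  and swT = cl_pure_swap[OF F.cbimod_axioms S.cbimod_axioms]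
  and lS = cl_tens_lact_pure[OF G.cbimod_axioms H.cbimod_axioms]
  and lT = cl_tens_lact_pure[OF F.cbimod_axioms S.cbimod_axioms]
  and rS = cl_tens_ract_pure[OF G.cbimod_axioms H.cbimod_axioms]
  and rT = cl_tens_ract_pure[OF F.cbimod_axioms S.cbimod_axioms]

lemmas pS_closed [simp] = cbilin_closed[OF pS] and pT_closed [simp] = cbilin_closed[OF pT]

lemma inserted_right_closed [simp]: "inserted_right B \<in> carrier S"
  by (simp add: inserted_right_def o)

lemma pT_zero_right: "m \<in> carrier F01 \<Longrightarrow> cl_pure c1 F01 S m \<zero>\<^bsub>S\<^esub> = \<zero>\<^bsub>T\<^esub>"
  by (rule clin_zero[OF S.cmod_axioms T.cmod_axioms cbilinD1[OF pT]])

lemma pS_zero_right: "m \<in> carrier F12 \<Longrightarrow> cl_pure c2 F12 F23 m \<zero>\<^bsub>F23\<^esub> = \<zero>\<^bsub>S\<^esub>"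
  by (rule clin_zero[OF H.cmod_axioms S.cmod_axioms cbilinD1[OF pS]])

lemma conj1: "c1 (c1 v) = v" "c2 (c2 w) = w" "c1 0 = 0" "c2 0 = 0"
  using rs1 rs2 unfolding real_structure_def
  by (metis, metis, metis complex_vector.scale_zero_left complex_cnj_zero,
      metis complex_vector.scale_zero_left complex_cnj_zero)

lemma pair_conj_image: "(v, w) \<in> X \<Longrightarrow> (cp v, - cq w) \<in> pair_conj cp cq ` X"
  by (force simp: pair_conj_def neg_conj_def)

text \<open>
  Write \<open>|u|\<^sup>2\<close> as the anticommutator of \<open>u\<close> and \<open>c(u)\<close>, for a nonzero one of \<open>u1\<close>, \<open>u2\<close>, and insert it. The words
  are orthogonal to \<open>u1\<close> and \<open>u2\<close>, so \<open>c(u)\<close> anticommutes with all letters. It reaches the first vacuum, which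
  it annihilates because \<open>(0, u1) \<in> L01\<close>; in the other direction it turns into \<open>c2 u2\<close> at the second vacuum and
  is annihilated by the third. For \<open>u2\<close> the second and third vacua play these parts.
\<close>

lemma incomplete_word_vanishes:
  assumes u: "(0, u1) \<in> L01" "(u1, u2) \<in> L12" "(u2, 0) \<in> L23" "u1 \<noteq> 0 \<or> u2 \<noteq> 0"
    and A: "\<forall>a\<in>set A. cinner u1 a = 0" and B: "\<forall>b\<in>set B. cinner u2 b = 0"
  shows "inserted A B = \<zero>\<^bsub>T\<^esub>"
proof -
  let ?k1 = "c1 u1" and ?k2 = "c2 u2"
  let ?m = "foldl (ract F01) o01 A" and ?n = "foldl (ract F12) o12 B"
  have m: "?m \<in> carrier F01" and n: "?n \<in> carrier F12" using o by simp_all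
  have "lact F01 (c0 0) o01 = \<ominus>\<^bsub>F01\<^esub> ract F01 o01 (- ?k1)"
    by (intro v01 pair_conj_image u)
  then have e01: "ract F01 o01 ?k1 = \<zero>\<^bsub>F01\<^esub>"
    using o by (simp add: c00 F.lact_zero_vec F.ract_uminus_vec)
  have "lact F12 ?k1 o12 = \<ominus>\<^bsub>F12\<^esub> ract F12 o12 (- ?k2)"
    by (intro v12 pair_conj_image u)
  then have e12: "lact F12 ?k1 o12 = ract F12 o12 ?k2"
    using o by (simp add: G.ract_uminus_vec)
  have "lact F23 ?k2 o23 = \<ominus>\<^bsub>F23\<^esub> ract F23 o23 (- c3 0)"
    by (intro v23 pair_conj_image u)
  then have e23: "lact F23 ?k2 o23 = \<zero>\<^bsub>F23\<^esub>"
    using o by (simp add: c30 H.ract_zero_vec)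
  have mk: "ract F01 ?m ?k1 = \<zero>\<^bsub>F01\<^esub>"
    using F.ract_foldl_anticommute[of o01 A ?k1] o A e01 by (simp add: conj1 F.foldl_ract_zero)
  have nk: "ract F12 ?n ?k2 = (-1) ^ length B \<odot>\<^bsub>F12\<^esub> foldl (ract F12) (ract F12 o12 ?k2) B"
    using G.ract_foldl_anticommute[of o12 B ?k2] o B by (simp add: conj1)
  show ?thesis
  proof (cases "u1 = 0")
    case False
    have "ract F01 (ract F01 ?m u1) ?k1 = cinner u1 u1 \<odot>\<^bsub>F01\<^esub> ?m"
      using F.ract_exchange[OF m, of u1 ?k1] m by (simp add: mk conj1 F.ract_zero F.minus_eq)
    then have "cinner u1 u1 \<odot>\<^bsub>T\<^esub> inserted A B = cl_pure c1 F01 S (ract F01 (ract F01 ?m u1) ?k1) (inserted_right B)"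
      using clin_smult[OF cbilinD2[OF pT inserted_right_closed] m] by (simp add: inserted_def)
    also have "\<dots> = cl_pure c1 F01 S (ract F01 ?m u1) (lact S ?k1 (inserted_right B))"
      using m by (simp add: swT)
    also have "lact S ?k1 (inserted_right B) = cl_pure c2 F12 F23 (foldl (ract F12) (ract F12 o12 ?k2) B) o23"
      using o by (simp add: inserted_right_def lS G.lact_foldl e12)
    also have "foldl (ract F12) (ract F12 o12 ?k2) B = (-1) ^ length B \<odot>\<^bsub>F12\<^esub> ract F12 ?n ?k2"
      using o unfolding nk by (simp add: G.smult_assoc G.smult_one flip: power_add mult_2)
    also have "cl_pure c2 F12 F23 ((-1) ^ length B \<odot>\<^bsub>F12\<^esub> ract F12 ?n ?k2) o23 =
        (-1) ^ length B \<odot>\<^bsub>S\<^esub> cl_pure c2 F12 F23 (ract F12 ?n ?k2) o23"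
      using n by (intro clin_smult[OF cbilinD2[OF pS o(3)]]) simp
    also have "cl_pure c2 F12 F23 (ract F12 ?n ?k2) o23 = \<zero>\<^bsub>S\<^esub>"
      using n o by (simp add: swS e23 pS_zero_right)
    finally have "cinner u1 u1 \<odot>\<^bsub>T\<^esub> inserted A B = \<zero>\<^bsub>T\<^esub>" using m by (simp add: pT_zero_right)
    then show ?thesis using False m by (intro T.smult_eq_zero[of "inserted A B" "cinner u1 u1"]) (simp_all add: inserted_def)
  next
    case True
    have "ract F12 o12 ?k2 = \<zero>\<^bsub>F12\<^esub>" using e12 o True by (simp add: conj1 G.lact_zero_vec)
    then have nk0: "ract F12 ?n ?k2 = \<zero>\<^bsub>F12\<^esub>" unfolding nk by (simp add: G.foldl_ract_zero)
    have "ract F12 (ract F12 ?n u2) ?k2 = cinner u2 u2 \<odot>\<^bsub>F12\<^esub> ?n"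
      using G.ract_exchange[OF n, of u2 ?k2] n by (simp add: nk0 conj1 G.ract_zero G.minus_eq)
    then have "cinner u2 u2 \<odot>\<^bsub>S\<^esub> inserted_right B = cl_pure c2 F12 F23 (ract F12 (ract F12 ?n u2) ?k2) o23"
      using clin_smult[OF cbilinD2[OF pS o(3)] n] by (simp add: inserted_right_def)
    also have "\<dots> = \<zero>\<^bsub>S\<^esub>" using n o by (simp add: swS e23 pS_zero_right)
    finally have "inserted_right B = \<zero>\<^bsub>S\<^esub>" using True u(4) by (intro S.smult_eq_zero[of "inserted_right B" "cinner u2 u2"]) simp_all
    then show ?thesis using m by (simp add: inserted_def pT_zero_right)
  qed
qed

text \<open>
  The summand \<open>x\<close> is moved to the left until it turns into an action of \<open>z\<close> from outside, and
  \<open>y'\<close> is moved to the right likewise; at the middle vacuum \<open>x'\<close> becomes \<open>- y\<close>. Each step costs an anticommutator, whose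
  term has one letter less. Such terms, and the ones with the outer action, contain no
  letter that pairs with \<open>u1\<close> or \<open>u2\<close>, so they vanish by the assumption \<open>V\<close>.
\<close>

lemma vector_passes_middle:
  assumes V: "\<And>A B. \<forall>a\<in>set A. cinner u1 a = 0 \<Longrightarrow> \<forall>b\<in>set B. cinner u2 b = 0 \<Longrightarrow> inserted A B = \<zero>\<^bsub>T\<^esub>"
    and r: "(z, x) \<in> pair_conj c0 c1 ` L01" "(x', y) \<in> pair_conj c1 c2 ` L12" "(y', v) \<in> pair_conj c2 c3 ` L23"
    and A: "\<forall>a\<in>set A. cinner u1 a = 0" and B: "\<forall>b\<in>set B. cinner u2 b = 0"
  shows "inserted (A @ [x + x']) B = inserted A ((y' - y) # B)"
proof -
  let ?w = "foldl (ract F01)" and ?w' = "foldl (ract F12)"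
  define \<Phi> where "\<Phi> A' m = cl_pure c1 F01 S (?w m A') (inserted_right B)" for A' m
  have \<Phi>: "clin F01 T (\<Phi> A')" for A'
    unfolding \<Phi>_def by (rule clin_comp[OF F.foldl_ract_clin cbilinD2[OF pT inserted_right_closed]])
  have left: "\<forall>A'. (\<forall>a\<in>set A'. cinner u1 a = 0) \<longrightarrow> \<Phi> A' (ract F01 (?w o01 A) x) = \<zero>\<^bsub>T\<^esub>"
    using A
  proof (induction A rule: rev_induct)
    case Nil
    show ?case
    proof (intro allI impI)
      fix A' assume A': "\<forall>a\<in>set A'. cinner u1 a = 0"
      have "ract F01 o01 x = \<ominus>\<^bsub>F01\<^esub> lact F01 z o01" using v01[OF r(1)] o by simp
      then have "\<Phi> A' (ract F01 o01 x) = \<ominus>\<^bsub>T\<^esub> \<Phi> A' (lact F01 z o01)"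
        using clin_uminus[OF F.cmod_axioms T.cmod_axioms \<Phi>] o by simp
      also have "\<Phi> A' (lact F01 z o01) = lact T z (inserted A' B)"
        using o by (simp add: \<Phi>_def inserted_def lT F.lact_foldl)
      finally show "\<Phi> A' (ract F01 (?w o01 []) x) = \<zero>\<^bsub>T\<^esub>" using V[OF A' B] by (simp add: T.lact_zero)
    qed
  next
    case (snoc a A)
    show ?case
    proof (intro allI impI)
      fix A' assume A': "\<forall>a\<in>set A'. cinner u1 a = 0"
      let ?m = "?w o01 A"
      have m: "?m \<in> carrier F01" using o by simp
      have "ract F01 (ract F01 ?m a) x = cinner (c1 x) a \<odot>\<^bsub>F01\<^esub> ?m \<oplus>\<^bsub>F01\<^esub> \<ominus>\<^bsub>F01\<^esub> ract F01 (ract F01 ?m x) a"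
        unfolding F.minus_eq[symmetric] by (rule F.ract_exchange[OF m])
      then have "\<Phi> A' (ract F01 (ract F01 ?m a) x) =
          cinner (c1 x) a \<odot>\<^bsub>T\<^esub> \<Phi> A' ?m \<oplus>\<^bsub>T\<^esub> \<ominus>\<^bsub>T\<^esub> \<Phi> A' (ract F01 (ract F01 ?m x) a)"
        using m by (simp add: clin_add[OF \<Phi>] clin_smult[OF \<Phi>] clin_uminus[OF F.cmod_axioms T.cmod_axioms \<Phi>])
      moreover have "\<Phi> A' ?m = \<zero>\<^bsub>T\<^esub>"
        using V[of "A @ A'" B] snoc.prems A' B by (auto simp: \<Phi>_def inserted_def)
      moreover have "\<Phi> A' (ract F01 (ract F01 ?m x) a) = \<Phi> (a # A') (ract F01 ?m x)"
        by (simp add: \<Phi>_def)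
      moreover have "\<Phi> (a # A') (ract F01 ?m x) = \<zero>\<^bsub>T\<^esub>" using snoc A' by auto
      ultimately show "\<Phi> A' (ract F01 (?w o01 (A @ [a])) x) = \<zero>\<^bsub>T\<^esub>" by simp
    qed
  qed
  define \<Psi> where "\<Psi> B' n = cl_pure c1 F01 S (?w o01 A) (cl_pure c2 F12 F23 (?w' n B') o23)" for B' n
  have \<Psi>: "clin F12 T (\<Psi> B')" for B'
    unfolding \<Psi>_def using o
    by (intro clin_comp[OF clin_comp[OF G.foldl_ract_clin cbilinD2[OF pS]] cbilinD1[OF pT]]) auto
  have right: "\<Psi> B' (ract F12 n y') = \<zero>\<^bsub>T\<^esub>"
    if "n \<in> carrier F12" "\<And>B''. \<forall>b\<in>set B''. cinner u2 b = 0 \<Longrightarrow> \<Psi> B'' n = \<zero>\<^bsub>T\<^esub>" "\<forall>b\<in>set B'. cinner u2 b = 0" for n B'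
    using that
  proof (induction B' arbitrary: n)
    case Nil
    have "cl_pure c2 F12 F23 (ract F12 n y') o23 = cl_pure c2 F12 F23 n (\<ominus>\<^bsub>F23\<^esub> ract F23 o23 v)"
      using Nil o by (simp add: swS v23[OF r(3)])
    also have "\<dots> = \<ominus>\<^bsub>S\<^esub> ract S (cl_pure c2 F12 F23 n o23) v"
      using clin_uminus[OF H.cmod_axioms S.cmod_axioms cbilinD1[OF pS]] Nil o by (simp add: rS)
    finally have "\<Psi> [] (ract F12 n y') = \<ominus>\<^bsub>T\<^esub> ract T (\<Psi> [] n) v"
      using clin_uminus[OF S.cmod_axioms T.cmod_axioms cbilinD1[OF pT]] Nil o by (simp add: \<Psi>_def rT)
    then show ?case using Nil(2)[of "[]"] by (simp add: T.ract_zero)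
  next
    case (Cons b B')
    have "\<Psi> (b # B') (ract F12 n y') = \<Psi> B' (ract F12 (ract F12 n y') b)" by (simp add: \<Psi>_def)
    also have "ract F12 (ract F12 n y') b = cinner (c2 b) y' \<odot>\<^bsub>F12\<^esub> n \<oplus>\<^bsub>F12\<^esub> \<ominus>\<^bsub>F12\<^esub> ract F12 (ract F12 n b) y'"
      unfolding G.minus_eq[symmetric] by (rule G.ract_exchange[OF Cons.prems(1)])
    also have "\<Psi> B' \<dots> = cinner (c2 b) y' \<odot>\<^bsub>T\<^esub> \<Psi> B' n \<oplus>\<^bsub>T\<^esub> \<ominus>\<^bsub>T\<^esub> \<Psi> B' (ract F12 (ract F12 n b) y')"
      using Cons.prems(1) by (simp add: clin_add[OF \<Psi>] clin_smult[OF \<Psi>] clin_uminus[OF G.cmod_axioms T.cmod_axioms \<Psi>])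
    also have "\<Psi> B' n = \<zero>\<^bsub>T\<^esub>" using Cons.prems by auto
    also have "\<Psi> B' (ract F12 (ract F12 n b) y') = \<zero>\<^bsub>T\<^esub>"
    proof (rule Cons.IH)
      fix B'' assume "\<forall>b\<in>set B''. cinner u2 b = 0"
      then show "\<Psi> B'' (ract F12 n b) = \<zero>\<^bsub>T\<^esub>"
        using Cons.prems(2)[of "b # B''"] Cons.prems(3) by (simp add: \<Psi>_def)
    qed (use Cons.prems in auto)
    finally show ?case by simp
  qed
  let ?m = "?w o01 A"
  have m: "?m \<in> carrier F01" using o by simp
  have "inserted (A @ [x + x']) B = cl_pure c1 F01 S (ract F01 ?m x \<oplus>\<^bsub>F01\<^esub> ract F01 ?m x') (inserted_right B)"
    using m by (simp add: inserted_def cbimod_cl_act(4)[OF F.cbimod_axioms])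
  also have "\<dots> = \<Phi> [] (ract F01 ?m x) \<oplus>\<^bsub>T\<^esub> cl_pure c1 F01 S (ract F01 ?m x') (inserted_right B)"
    using m by (simp add: clin_add[OF cbilinD2[OF pT inserted_right_closed]] \<Phi>_def)
  also have "\<Phi> [] (ract F01 ?m x) = \<zero>\<^bsub>T\<^esub>" using left by auto
  also have "cl_pure c1 F01 S (ract F01 ?m x') (inserted_right B) = cl_pure c1 F01 S ?m (lact S x' (inserted_right B))"
    using m by (simp add: swT)
  also have "lact S x' (inserted_right B) = cl_pure c2 F12 F23 (?w' (lact F12 x' o12) B) o23"
    using o by (simp add: inserted_right_def lS G.lact_foldl)
  finally have 1: "inserted (A @ [x + x']) B = \<Psi> B (lact F12 x' o12)"
    using m o by (simp add: \<Psi>_def)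
  have "ract F12 o12 ((y' - y) + - y') = ract F12 o12 (y' - y) \<oplus>\<^bsub>F12\<^esub> \<ominus>\<^bsub>F12\<^esub> ract F12 o12 y'"
    using o by (simp only: cbimod_cl_act(4)[OF G.cbimod_axioms] G.ract_uminus_vec)
  moreover have "(y' - y) + - y' = - y" by simp
  ultimately have "lact F12 x' o12 = ract F12 o12 (y' - y) \<oplus>\<^bsub>F12\<^esub> \<ominus>\<^bsub>F12\<^esub> ract F12 o12 y'"
    using v12[OF r(2)] o by (simp only: G.ract_uminus_vec)
  then have 2: "\<Psi> B (lact F12 x' o12) = \<Psi> B (ract F12 o12 (y' - y)) \<oplus>\<^bsub>T\<^esub> \<ominus>\<^bsub>T\<^esub> \<Psi> B (ract F12 o12 y')"
    using o by (simp add: clin_add[OF \<Psi>] clin_uminus[OF G.cmod_axioms T.cmod_axioms \<Psi>])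
  have "\<Psi> B (ract F12 o12 y') = \<zero>\<^bsub>T\<^esub>"
    using o B V[OF A] by (intro right) (auto simp: \<Psi>_def inserted_def inserted_right_def)
  moreover have "\<Psi> B (ract F12 o12 (y' - y)) = inserted A ((y' - y) # B)"
    by (simp add: \<Psi>_def inserted_def inserted_right_def)
  moreover have "inserted A ((y' - y) # B) \<in> carrier T" using o by (simp add: inserted_def)
  ultimately show ?thesis using 1 2 by simp
qed

text \<open>
  The vectors \<open>cs\<close> are traded from the last to the first. At each step all other inserted letters are orthogonal to
  the null pair \<open>(us ! i, vs ! i)\<close> that belongs to the one being traded, by duality.
\<close>

lemma vectors_pass_middle:
  assumes "length cs = q" "length us = q" "length \<beta>s = q" "length vs = q"
    and u: "\<And>i. i < q \<Longrightarrow> (0, us ! i) \<in> L01 \<and> (us ! i, vs ! i) \<in> L12 \<and> (vs ! i, 0) \<in> L23 \<and>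
       (us ! i \<noteq> 0 \<or> vs ! i \<noteq> 0)"
    and A: "\<And>i a. i < q \<Longrightarrow> a \<in> set A \<Longrightarrow> cinner (us ! i) a = 0"
    and B: "\<And>i b. i < q \<Longrightarrow> b \<in> set B \<Longrightarrow> cinner (vs ! i) b = 0"
    and dual: "\<And>i j. i < q \<Longrightarrow> j < q \<Longrightarrow> i \<noteq> j \<Longrightarrow> cinner (us ! i) (cs ! j) = 0 \<and> cinner (vs ! i) (\<beta>s ! j) = 0"
    and r: "\<And>i. i < q \<Longrightarrow> \<exists>z x x' y y' v. cs ! i = x + x' \<and> \<beta>s ! i = y' - y \<and>
       (z, x) \<in> pair_conj c0 c1 ` L01 \<and> (x', y) \<in> pair_conj c1 c2 ` L12 \<and> (y', v) \<in> pair_conj c2 c3 ` L23"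
  shows "inserted (A @ cs) B = inserted A (\<beta>s @ B)"
proof -
  have "k \<le> q \<Longrightarrow> inserted (A @ cs) B = inserted (A @ take (q - k) cs) (drop (q - k) \<beta>s @ B)" for k
  proof (induction k)
    case 0
    then show ?case using assms(1,3) by simp
  next
    case (Suc k)
    let ?i = "q - Suc k"
    have i: "?i < q" "q - k = Suc ?i" using Suc.prems by auto
    obtain z x x' y y' v where e: "cs ! ?i = x + x'" "\<beta>s ! ?i = y' - y"
       and r': "(z, x) \<in> pair_conj c0 c1 ` L01" "(x', y) \<in> pair_conj c1 c2 ` L12" "(y', v) \<in> pair_conj c2 c3 ` L23"
      using r[OF i(1)] by blast
    let ?A = "A @ take ?i cs" and ?B = "drop (Suc ?i) \<beta>s @ B"
    have A': "\<forall>a\<in>set ?A. cinner (us ! ?i) a = 0"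
      using A[OF i(1)] dual[OF i(1)] assms(1) i(1) by (auto simp: in_set_conv_nth)
    have B': "\<forall>b\<in>set ?B. cinner (vs ! ?i) b = 0"
      using B[OF i(1)] dual[OF i(1)] assms(3) i(1) by (auto simp: in_set_conv_nth)
    have "inserted (?A @ [x + x']) ?B = inserted ?A ((y' - y) # ?B)"
      using u[OF i(1)] incomplete_word_vanishes by (intro vector_passes_middle[OF _ r' A' B']) blast
    moreover have "?A @ [x + x'] = A @ take (q - k) cs"
      using i assms(1) by (simp add: take_Suc_conv_app_nth e)
    moreover have "(y' - y) # ?B = drop ?i \<beta>s @ B"
      using i assms(3) by (metis Cons_nth_drop_Suc append_Cons e(2))
    ultimately show ?case using Suc by (simp add: i(2))
  qed
  from this[of q] show ?thesis by simp
qed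

end


section \<open>What the existence of a gluing isomorphism implies\<close>

context lagr_pair begin

lemmas F_simps = ext_bimod_simps(1-4)[where ci = ci and cj = cj and L = L]

sublocale F: cbimod ci cj F by (rule cbimod_F)

lemma vac_in: "vac \<in> carrier F"
  using vac_closed by (simp add: F_simps)

lemma F_minus: "x \<in> carrier F \<Longrightarrow> \<ominus>\<^bsub>exterior L\<^esub> x = \<ominus>\<^bsub>F\<^esub> x"
  using ext_bimod_minus[of x L ci cj] by (simp add: F_simps)

lemma par_clin: "clin F F (ext_parity L)"
  using ext_parity_clin[OF sub] by (simp add: clin_ext_bimod_iff)

lemma par_in: "x \<in> carrier F \<Longrightarrow> ext_parity L x \<in> carrier F"
  by (rule clin_closed[OF par_clin])

lemma par_vac: "ext_parity L vac = vac"
  by (rule ext_parity_one[OF sub])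

lemma par_lact: "x \<in> carrier F \<Longrightarrow> ext_parity L (lact F w x) = \<ominus>\<^bsub>F\<^esub> lact F w (ext_parity L x)"
  using ext_parity_spin[of x] F_minus[of "lact F w (ext_parity L x)"] par_in[of x]
    sp_closed[of "ext_parity L x"]
  by (simp add: ext_bimod_simps)

lemma par_ract: "x \<in> carrier F \<Longrightarrow> ext_parity L (ract F x v) = \<ominus>\<^bsub>F\<^esub> ract F (ext_parity L x) v"
  using ext_parity_spin[of "ext_parity L x"] F_minus[of "ract F (ext_parity L x) v"] par_in[of x]
    par_in[of "ext_parity L x"] sp_closed[of "ext_parity L (ext_parity L x)"]
  by (simp add: ext_bimod_simps)

lemma par_foldl: 
  "ext_parity L (foldl (ract F) vac us) = (-1) ^ length us \<odot>\<^bsub>F\<^esub> foldl (ract F) vac us"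
proof (induction us rule: rev_induct)
  case Nil
  then show ?case by (simp add: par_vac F.smult_one vac_in)
next
  case (snoc u us)
  have c: "foldl (ract F) vac us \<in> carrier F" by (simp add: vac_in)
  then show ?case
    using snoc by (simp add: par_ract clin_smult[OF F.ract_clin] F.smult_minus_left)
qed

context
  fixes \<phi> :: "'a \<times> 'b \<Rightarrow> complex"
  assumes \<phi>: "lin_on UNIV \<phi>" "\<forall>l\<in>pair_conj ci cj ` L. \<phi> l = 0"
begin

lemma lin_on_L: "lin_on L \<phi>"
  using \<phi>(1) unfolding lin_on_def by blast

lemma ctr_F_clin: "clin F F (ctr L \<phi>)"
  using ctr_clin[OF sub lin_on_L] by (simp add: clin_ext_bimod_iff)

lemma ctr_in: "x \<in> carrier F \<Longrightarrow> ctr L \<phi> x \<in> carrier F"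
  by (rule clin_closed[OF ctr_F_clin])

lemma ctr_vac: "ctr L \<phi> vac = \<zero>\<^bsub>F\<^esub>"
  using ctr_one[OF sub lin_on_L] by (simp add: F_simps)

lemma ctr_sp:
  "x \<in> carrier F \<Longrightarrow> ctr L \<phi> (sp v x) = (\<phi> v \<odot>\<^bsub>F\<^esub> x) \<oplus>\<^bsub>F\<^esub> \<ominus>\<^bsub>F\<^esub> sp v (ctr L \<phi> x)"
proof -
  assume x: "x \<in> carrier F"
  then have "sp v (ctr L \<phi> x) \<in> carrier F"
    using ctr_in[OF x] sp_closed by (simp add: F_simps)
  moreover have "ctr L \<phi> (sp v x) = (\<phi> v \<odot>\<^bsub>exterior L\<^esub> x) \<ominus>\<^bsub>exterior L\<^esub> sp v (ctr L \<phi> x)"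
    using x \<phi> by (intro ctr_spin) (auto simp: F_simps)
  ultimately show ?thesis by (simp add: F_simps a_minus_def F_minus)
qed

lemma ctr_lact:
  "x \<in> carrier F \<Longrightarrow> ctr L \<phi> (lact F w x) = (\<phi> (w, 0) \<odot>\<^bsub>F\<^esub> x) \<oplus>\<^bsub>F\<^esub> \<ominus>\<^bsub>F\<^esub> lact F w (ctr L \<phi> x)"
  using ctr_sp[of x "(w, 0)"] by (simp add: ext_bimod_simps(5))

lemma ctr_par: "x \<in> carrier F \<Longrightarrow> ctr L \<phi> (ext_parity L x) = \<ominus>\<^bsub>F\<^esub> ext_parity L (ctr L \<phi> x)"
proof -
  assume x: "x \<in> carrier F"
  have "ext_parity L (ctr L \<phi> x) = \<ominus>\<^bsub>F\<^esub> ctr L \<phi> (ext_parity L x)"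
    using ext_parity_ctr[OF sub lin_on_L, of x] F_minus[OF ctr_in[OF par_in[OF x]]] x by (simp add: F_simps)
  then show ?thesis using ctr_in[OF par_in[OF x]] by simp
qed

lemma ctr_ract:
  assumes x: "x \<in> carrier F"
  shows "ctr L \<phi> (ract F x v) = (\<phi> (0, v) \<odot>\<^bsub>F\<^esub> ext_parity L x) \<oplus>\<^bsub>F\<^esub> ract F (ctr L \<phi> x) v"
proof -
  have c: "ext_parity L (ctr L \<phi> x) \<in> carrier F" by (intro par_in ctr_in x)
  have "sp (0, v) (\<ominus>\<^bsub>F\<^esub> ext_parity L (ctr L \<phi> x)) = \<ominus>\<^bsub>F\<^esub> sp (0, v) (ext_parity L (ctr L \<phi> x))"
    using sp_minus[of "ext_parity L (ctr L \<phi> x)"] c sp_closed[of "ext_parity L (ctr L \<phi> x)"]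
    by (simp add: F_simps flip: F_minus)
  moreover have "sp (0, v) (ext_parity L (ctr L \<phi> x)) \<in> carrier F"
    using c sp_closed by (simp add: F_simps)
  ultimately show ?thesis
    using ctr_sp[OF par_in[OF x], of "(0, v)"] x by (simp add: ext_bimod_simps(6) ctr_par)
qed

lemma ctr_foldl: "(\<And>u. u \<in> set us \<Longrightarrow> \<phi> (0, u) = 0) \<Longrightarrow> ctr L \<phi> (foldl (ract F) vac us) = \<zero>\<^bsub>F\<^esub>"
proof (induction us rule: rev_induct)
  case Nil
  then show ?case by (simp add: ctr_vac)
next
  case (snoc u us)
  have c: "foldl (ract F) vac us \<in> carrier F" by (simp add: vac_in)
  then show ?case using snoc by (simp add: ctr_ract par_in F.ract_zero)
qed

end

end

lemma aug_clin_smult: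
  "cbilin (exterior L) (exterior K) (exterior K) (\<lambda>\<xi> \<kappa>. aug \<xi> \<odot>\<^bsub>exterior K\<^esub> \<kappa>)"
proof -
  interpret E: cmod "exterior K" by (rule cmod_exterior)
  have aug: "aug (x \<oplus>\<^bsub>exterior L\<^esub> y) = aug x + aug y" "aug (a \<odot>\<^bsub>exterior L\<^esub> x) = a * aug x"
    if xy: "x \<in> carrier (exterior L)" "y \<in> carrier (exterior L)" for x y a
  proof -
    obtain p q where "x = ecl L p" "y = ecl L q"
      using xy unfolding exterior_simps(1) by blast
    then show "aug (x \<oplus>\<^bsub>exterior L\<^esub> y) = aug x + aug y" "aug (a \<odot>\<^bsub>exterior L\<^esub> x) = a * aug x"
      by (simp_all add: exterior_simps aug_ecl augf_add augf_scale)
  qed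
  show ?thesis
  proof (intro cbilinI clinI)
    fix a \<xi> \<kappa> assume "\<xi> \<in> carrier (exterior L)" "\<kappa> \<in> carrier (exterior K)"
    then show "aug (a \<odot>\<^bsub>exterior L\<^esub> \<xi>) \<odot>\<^bsub>exterior K\<^esub> \<kappa> = a \<odot>\<^bsub>exterior K\<^esub> (aug \<xi> \<odot>\<^bsub>exterior K\<^esub> \<kappa>)"
      using aug(2)[of \<xi> \<xi> a] by (simp add: E.smult_assoc)
  qed (auto simp: aug E.smult_l_distr E.smult_r_distr E.smult_assoc mult.commute)
qed

lemma clin_restrict:
  assumes "clin M N f" "carrier M' \<subseteq> carrier M" "add M' = add M" "smult M' = smult M"
  shows "clin M' N f"
  using assms by (simp add: clin_def subset_iff)

lemma cbilin_ext_top: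
  assumes "cbilin M (exterior K) T f" shows "cbilin M (ext_top K) T f"
proof (rule cbilinI)
  fix m assume "m \<in> carrier M"
  then show "clin (ext_top K) T (f m)"
    using clin_restrict[OF cbilinD1[OF assms] ext_top_sub] by (simp add: ext_top_simps(3,4))
next
  fix n assume "n \<in> carrier (ext_top K)"
  then show "clin M T (\<lambda>m. f m n)" using ext_top_sub by (intro cbilinD2[OF assms]) blast
qed

text \<open>
  The augmentation of the first factor maps this element to the wedge product of a basis.
\<close>

lemma pure_vac_nonzero:
  assumes "dual_basis us bs K"
  shows "pure (ext_bimod ci cj L) (ext_top K) \<one>\<^bsub>exterior L\<^esub> (wdg K bs) \<noteq> \<zero>\<^bsub>tens (ext_bimod ci cj L) (ext_top K)\<^esub>"
proof
  let ?F = "ext_bimod ci cj L"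
  let ?T = "tens ?F (ext_top K)"
  assume a: "pure ?F (ext_top K) \<one>\<^bsub>exterior L\<^esub> (wdg K bs) = \<zero>\<^bsub>?T\<^esub>"
  have K: "csubspace K" "biorth us bs" "set bs \<subseteq> K" "length bs = cdim K"
    using assms dual_basis_cdim[OF assms] by (auto simp: dual_basis_def)
  have b: "cbilin ?F (ext_top K) (exterior K) (\<lambda>\<xi> \<kappa>. aug \<xi> \<odot>\<^bsub>exterior K\<^esub> \<kappa>)"
    using cbilin_ext_top[OF aug_clin_smult[of L K]]
    by (simp add: cbilin_def clin_ext_bimod_iff ext_bimod_simps(1))
  let ?l = "tens_lift (exterior K) (\<lambda>\<xi> \<kappa>. aug \<xi> \<odot>\<^bsub>exterior K\<^esub> \<kappa>)"
  have "?l \<zero>\<^bsub>?T\<^esub> = \<zero>\<^bsub>exterior K\<^esub>"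
    by (rule clin_zero[OF cmod_tens cmod_exterior tens_lift_clin[OF cmod_ext_bimod cmod_ext_top cmod_exterior b]])
  moreover have "?l (pure ?F (ext_top K) \<one>\<^bsub>exterior L\<^esub> (wdg K bs)) = aug \<one>\<^bsub>exterior L\<^esub> \<odot>\<^bsub>exterior K\<^esub> wdg K bs"
    using K wdg_in_top[of bs K]
    by (intro tens_lift_pure[OF cmod_ext_bimod cmod_ext_top cmod_exterior b])
      (simp_all add: ext_bimod_simps exterior_simps)
  moreover have "aug \<one>\<^bsub>exterior L\<^esub> \<odot>\<^bsub>exterior K\<^esub> wdg K bs = wdg K bs"
    by (simp add: exterior_simps aug_ecl augf_one scaleC_one)
  ultimately have "wdg K bs = ecl K 0" using a by (simp add: exterior_simps)
  then show False using wdg_nonzero[OF K(1-3)] by (simp add: coset_eq_iff)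
qed

text \<open>
  A basis of \<open>S\<close> together with \<open>w\<close> is independent, and a functional may be prescribed on it.
\<close>

lemma separating_functional:
  fixes S :: "'b::complex_vector set"
  assumes S: "csubspace S" and w: "w \<notin> S"
  obtains f :: "'b \<Rightarrow> complex" where "lin_on UNIV f" "\<forall>x\<in>S. f x = 0" "f w = 1"
proof -
  interpret vp: vector_space_pair "scaleC :: complex \<Rightarrow> 'b \<Rightarrow> 'b" "scaleC :: complex \<Rightarrow> complex \<Rightarrow> complex"
    by unfold_locales
  obtain B where B: "B \<subseteq> S" "\<not> cdependent B" "S \<subseteq> cspan B"
    using complex_vector.basis_exists[of S] by metis
  have sp: "cspan B = S" using B S complex_vector.span_minimal by blast
  have "\<not> cdependent (insert w B)" using B w sp by (simp add: complex_vector.independent_insert)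
  then obtain g :: "'b \<Rightarrow> complex" where g: "Vector_Spaces.linear scaleC scaleC g" "\<forall>x\<in>insert w B. g x = (if x = w then 1 else 0)"
    using vp.linear_independent_extend[of "insert w B" "\<lambda>x. if x = w then 1 else 0"]
    unfolding cdependent_def by blast
  have l: "lin_on UNIV g"
    using g(1) by (simp add: lin_on_def Vector_Spaces.linear_def module_hom_def module_hom_axioms_def)
  have "g x = 0" if "x \<in> S" for x
  proof -
    have "csubspace {x. g x = 0}"
      using l by (intro complex_vector.subspaceI)
        (auto simp: lin_on_def, metis complex_vector.scale_zero_left scaleC_complex_eq mult_zero_left)
    moreover have "B \<subseteq> {x. g x = 0}" using g(2) B w by auto
    ultimately show ?thesis using that sp complex_vector.span_minimal by blast
  qed
  then show ?thesis using that[of g] l g(2) by auto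
qed

lemma csubspace_Kspace:
  assumes "csubspace Lij" "csubspace Ljk" shows "csubspace (Kspace Lij Ljk)"
proof (rule complex_vector.subspaceI)
  show "0 \<in> Kspace Lij Ljk"
    using complex_vector.subspace_0[OF assms(1)] complex_vector.subspace_0[OF assms(2)]
    by (simp add: Kspace_def zero_prod_def)
next
  fix x y assume "x \<in> Kspace Lij Ljk" "y \<in> Kspace Lij Ljk"
  then show "x + y \<in> Kspace Lij Ljk"
    using complex_vector.subspace_add[OF assms(1), of "(0, x)" "(0, y)"]
      complex_vector.subspace_add[OF assms(2), of "(x, 0)" "(y, 0)"] by (simp add: Kspace_def)
next
  fix a x assume "x \<in> Kspace Lij Ljk"
  then show "a *\<^sub>C x \<in> Kspace Lij Ljk"
    using complex_vector.subspace_scale[OF assms(1), of "(0, x)" a]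
      complex_vector.subspace_scale[OF assms(2), of "(x, 0)" a] by (simp add: Kspace_def)
qed

locale gluing_pair =
  A: lagr_pair ci cj Lij + B: lagr_pair cj ck Ljk + C: lagr_pair ci ck Lik
  for ci :: "'a::hermitian_space \<Rightarrow> 'a" and cj :: "'b::hermitian_space \<Rightarrow> 'b" and ck :: "'c::hermitian_space \<Rightarrow> 'c"
    and Lij Ljk Lik +
  fixes \<alpha>
  assumes comp: "Lik = Lij O Ljk" and glue: "gluing_iso ci cj ck Lij Ljk \<alpha>"
    and fin: "cfinite_dim (Kspace Lij Ljk)"
begin

abbreviation "K \<equiv> Kspace Lij Ljk"
abbreviation "T \<equiv> cl_tens cj A.F B.F"

lemma K_sub: "csubspace K"
  by (rule csubspace_Kspace[OF A.sub B.sub])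

sublocale T: cbimod ci ck T by (rule cbimod_cl_tens[OF A.cbimod_F B.cbimod_F])
sublocale X: cbimod ci ck "top_twist C.F K" by (rule cbimod_top_twist[OF C.cbimod_F])

lemma iso: "bimod_iso ci ck (top_twist C.F K) T \<alpha>"
  using glue by (simp add: gluing_iso_def Let_def comp)

lemmas \<alpha>_clin = bimod_iso_acts(1)[OF X.cbimod_axioms T.cbimod_axioms iso]
  and \<alpha>_lact = bimod_iso_acts(2)[OF X.cbimod_axioms T.cbimod_axioms iso]
  and \<alpha>_ract = bimod_iso_acts(3)[OF X.cbimod_axioms T.cbimod_axioms iso]

lemma \<alpha>_vac:
  assumes "set us \<subseteq> K" "length us = cdim K"
  shows "\<alpha> (pure C.F (ext_top K) C.vac (wdg K us)) = cl_pure cj A.F B.F (foldl (ract A.F) A.vac us) B.vac"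
proof -
  have "\<forall>us. set us \<subseteq> K \<and> length us = cdim K \<longrightarrow>
      \<alpha> (pure C.F (ext_top K) C.vac (foldr (\<lambda>u x. ext_gen K u \<otimes>\<^bsub>exterior K\<^esub> x) us \<one>\<^bsub>exterior K\<^esub>)) =
      cl_pure cj A.F B.F (foldl (ract A.F) A.vac us) B.vac"
    using glue by (simp add: gluing_iso_def Let_def comp)
  from this[rule_format, of us] show ?thesis
    using assms by (simp only: foldr_ext_gen[OF K_sub assms(1)] simp_thms)
qed

lemma \<alpha>_lact_pure:
  assumes "\<xi> \<in> carrier C.F" "\<kappa> \<in> carrier (ext_top K)"
  shows "\<alpha> (pure C.F (ext_top K) (lact C.F w \<xi>) \<kappa>) = lact T w (\<alpha> (pure C.F (ext_top K) \<xi> \<kappa>))"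
  using \<alpha>_lact[of "pure C.F (ext_top K) \<xi> \<kappa>" w] top_twist_lact_pure[OF C.cbimod_F assms, of w]
    pure_closed[OF C.F.cmod_axioms cmod_ext_top assms] by (simp add: top_twist_simps(1))

lemma \<alpha>_ract_pure:
  assumes "\<xi> \<in> carrier C.F" "\<kappa> \<in> carrier (ext_top K)"
  shows "\<alpha> (pure C.F (ext_top K) (ract C.F \<xi> v) \<kappa>) = (-1) ^ cdim K \<odot>\<^bsub>T\<^esub> ract T (\<alpha> (pure C.F (ext_top K) \<xi> \<kappa>)) v"
proof -
  let ?p = "\<lambda>\<xi>. pure C.F (ext_top K) \<xi> \<kappa>"
  let ?s = "(-1) ^ cdim K :: complex"
  have c: "?p \<xi>' \<in> carrier (top_twist C.F K)" if "\<xi>' \<in> carrier C.F" for \<xi>'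
    using pure_closed[OF C.F.cmod_axioms cmod_ext_top that assms(2)] by (simp add: top_twist_simps(1))
  have s: "?s * ?s = 1" by (simp flip: power_add mult_2)
  have r: "ract (top_twist C.F K) (?p \<xi>) v = ?s \<odot>\<^bsub>top_twist C.F K\<^esub> ?p (ract C.F \<xi> v)"
    using top_twist_ract_pure[OF C.cbimod_F assms, of v] by (simp add: top_twist_simps(4))
  have "ract T (\<alpha> (?p \<xi>)) v = \<alpha> (?s \<odot>\<^bsub>top_twist C.F K\<^esub> ?p (ract C.F \<xi> v))"
    unfolding r[symmetric] by (rule \<alpha>_ract[OF c[OF assms(1)], symmetric])
  also have "\<dots> = ?s \<odot>\<^bsub>T\<^esub> \<alpha> (?p (ract C.F \<xi> v))"
    using c assms by (intro clin_smult[OF \<alpha>_clin]) simp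
  finally show ?thesis
    using clin_closed[OF \<alpha>_clin c[of "ract C.F \<xi> v"]] assms by (simp add: T.smult_assoc T.smult_one s)
qed

lemma \<alpha>_inj: "x \<in> carrier (top_twist C.F K) \<Longrightarrow> \<alpha> x = \<zero>\<^bsub>T\<^esub> \<Longrightarrow> x = \<zero>\<^bsub>top_twist C.F K\<^esub>"
  using iso clin_zero[OF X.cmod_axioms T.cmod_axioms \<alpha>_clin]
  unfolding bimod_iso_def bij_betw_def inj_on_def by (metis X.zero_closed)

text \<open>
  The functional \<open>f\<close> on \<open>W\<^sub>j\<close> defines contractions on both exterior algebras, and together they give an odd derivation
  \<open>D\<close> of the tensor product over \<open>Cl(W\<^sub>j)\<close>; the assumptions \<open>fA\<close> and \<open>fB\<close> make the contractions compatible with the actions.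
  By \<open>fK\<close>, it kills the generator \<open>\<Omega>\<^sub>i\<^sub>j\<cdot>K \<otimes> \<Omega>\<^sub>j\<^sub>k\<close>, so it kills everything, as \<open>\<alpha>\<close> is surjective. But after inserting
  \<open>w\<close> next to the generator, it gives \<open>\<plusminus>f w\<close> times the generator, and this is nonzero by injectivity of
  \<open>\<alpha>\<close> unless \<open>f w = 0\<close>.
\<close>

lemma functional_zero:
  fixes f :: "'b \<Rightarrow> complex"
  assumes f: "lin_on UNIV f"
    and fA: "\<And>z x. (z, x) \<in> pair_conj ci cj ` Lij \<Longrightarrow> f x = 0"
    and fB: "\<And>x v. (x, v) \<in> pair_conj cj ck ` Ljk \<Longrightarrow> f x = 0"
    and fK: "\<And>k. k \<in> K \<Longrightarrow> f k = 0"
  shows "f w = 0"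
proof -
  have f0: "f 0 = 0" using f unfolding lin_on_def by (metis UNIV_I complex_vector.scale_zero_left)
  define \<phi> where "\<phi> = (\<lambda>v::'a \<times> 'b. f (snd v))"
  define \<psi> where "\<psi> = (\<lambda>v::'b \<times> 'c. f (fst v))"
  have \<phi>: "lin_on UNIV \<phi>" "\<forall>l\<in>pair_conj ci cj ` Lij. \<phi> l = 0"
    subgoal using f by (simp add: \<phi>_def lin_on_def scaleC_prod_def)
    subgoal using fA unfolding \<phi>_def by (metis prod.collapse)
    done
  have \<psi>: "lin_on UNIV \<psi>" "\<forall>l\<in>pair_conj cj ck ` Ljk. \<psi> l = 0"
    subgoal using f by (simp add: \<psi>_def lin_on_def scaleC_prod_def)
    subgoal using fB unfolding \<psi>_def by (metis prod.collapse)
    done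
  define D1 where "D1 = ctr Lij \<phi>"
  define D2 where "D2 = ctr Ljk \<psi>"
  define par where "par = ext_parity Lij"
  note D1 = A.ctr_F_clin[OF \<phi>, folded D1_def] and D2 = B.ctr_F_clin[OF \<psi>, folded D2_def]
    and pc = A.par_clin[folded par_def]
  note D1_in = clin_closed[OF D1] and D2_in = clin_closed[OF D2] and par_in = clin_closed[OF pc]
  have D1l: "D1 (lact A.F z x) = \<ominus>\<^bsub>A.F\<^esub> lact A.F z (D1 x)"
    and D1r: "D1 (ract A.F x u) = f u \<odot>\<^bsub>A.F\<^esub> par x \<oplus>\<^bsub>A.F\<^esub> ract A.F (D1 x) u"
    and pl: "par (lact A.F z x) = \<ominus>\<^bsub>A.F\<^esub> lact A.F z (par x)"
    and pr: "par (ract A.F x u) = \<ominus>\<^bsub>A.F\<^esub> ract A.F (par x) u"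
    if "x \<in> carrier A.F" for x z u
    using A.ctr_lact[OF \<phi> that] A.ctr_ract[OF \<phi> that] A.par_lact[OF that] A.par_ract[OF that] that D1_in[OF that]
    by (simp_all add: D1_def[symmetric] par_def[symmetric]) (simp_all add: \<phi>_def f0)
  have D2l: "D2 (lact B.F u x) = f u \<odot>\<^bsub>B.F\<^esub> x \<oplus>\<^bsub>B.F\<^esub> \<ominus>\<^bsub>B.F\<^esub> lact B.F u (D2 x)"
    and D2r: "D2 (ract B.F x v) = ract B.F (D2 x) v" if "x \<in> carrier B.F" for x u v
    using B.ctr_lact[OF \<psi> that] B.ctr_ract[OF \<psi> that] that D2_in[OF that] B.par_in[OF that]
    by (simp_all add: D2_def[symmetric]) (simp_all add: \<psi>_def f0)
  note P = cl_pure_cbilin[OF A.F.cmod_axioms B.F.cmod_axioms, of cj]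
  let ?p = "cl_pure cj A.F B.F"
  note P_in [simp] = cbilin_closed[OF P]
  note [simp] = D1_in D2_in par_in
  note sw = cl_pure_swap[OF A.cbimod_F B.cbimod_F]
  note la = cl_tens_lact_pure[OF A.cbimod_F B.cbimod_F] and ra = cl_tens_ract_pure[OF A.cbimod_F B.cbimod_F]
  note la_clin = T.lact_clin and ra_clin = T.ract_clin
  note P1 = clin_add[OF cbilinD2[OF P]] clin_smult[OF cbilinD2[OF P]]
       clin_uminus[OF A.F.cmod_axioms T.cmod_axioms cbilinD2[OF P]]
    and P2 = clin_add[OF cbilinD1[OF P]] clin_smult[OF cbilinD1[OF P]]
       clin_uminus[OF B.F.cmod_axioms T.cmod_axioms cbilinD1[OF P]]
  \<comment> \<open>The Leibniz rule with the Koszul sign.\<close>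
  define d where "d = (\<lambda>\<xi> \<eta>. ?p (D1 \<xi>) \<eta> \<oplus>\<^bsub>T\<^esub> ?p (par \<xi>) (D2 \<eta>))"
  have d_bil: "cbilin A.F B.F T d"
    unfolding d_def
    by (intro cbilin_plus T.cmod_axioms cbilin_comp_left[OF P D1] cbilin_comp[OF P pc D2])
  have d_bal: "balanced A.F B.F d"
    unfolding balanced_def d_def
    by (auto simp: D1r pr D2l P1 P2 sw T.a_ac)
  define D where "D = tens_lift T d"
  have D: "clin T T D" and D_pure: "\<xi> \<in> carrier A.F \<Longrightarrow> \<eta> \<in> carrier B.F \<Longrightarrow> D (?p \<xi> \<eta>) = d \<xi> \<eta>" for \<xi> \<eta>
    using cl_tens_map_lift[OF A.cbimod_F B.cbimod_F T.cmod_axioms d_bil d_bal] by (auto simp: D_def)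
  have D_lact: "D (lact T z t) = (-1) \<odot>\<^bsub>T\<^esub> lact T z (D t)" if t: "t \<in> carrier T" for z t
    by (rule cl_tens_clin_eq[OF A.F.cmod_axioms B.F.cmod_axioms clin_comp[OF la_clin D]
         clin_scale[OF T.cmod_axioms clin_comp[OF D la_clin]] _ t])
      (simp add: la D_pure d_def D1l pl P1 clin_add[OF la_clin] T.smult_minus_one T.minus_add)
  have D_ract: "D (ract T t v) = ract T (D t) v" if t: "t \<in> carrier T" for v t
    by (rule cl_tens_clin_eq[OF A.F.cmod_axioms B.F.cmod_axioms clin_comp[OF ra_clin D]
         clin_comp[OF D ra_clin] _ t])
      (simp add: ra D_pure d_def D2r clin_add[OF ra_clin])
  obtain es where es: "dual_basis es es K" using orthonormal_basis_exists[OF K_sub fin] by blast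
  have esK: "set es \<subseteq> K" "length es = cdim K" using es dual_basis_cdim[OF es] by (auto simp: dual_basis_def)
  let ?k = "wdg K es"
  have k: "?k \<in> carrier (ext_top K)" by (rule wdg_in_top[OF esK])
  let ?q = "pure C.F (ext_top K)"
  note Q = pure_cbilin[OF C.F.cmod_axioms cmod_ext_top, of K]
  have q_clin: "clin C.F (top_twist C.F K) (\<lambda>\<xi>. ?q \<xi> ?k)"
    using cbilinD2[OF Q k] by (simp add: clin_top_twist_iff)
  note DA = clin_comp[OF clin_comp[OF q_clin \<alpha>_clin] D]
  note A_in = clin_closed[OF clin_comp[OF q_clin \<alpha>_clin]]
  have dv: "D1 (foldl (ract A.F) A.vac es) = \<zero>\<^bsub>A.F\<^esub>"
    unfolding D1_def using fK esK by (intro A.ctr_foldl[OF \<phi>]) (auto simp: \<phi>_def)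
  have dv2: "D2 B.vac = \<zero>\<^bsub>B.F\<^esub>" unfolding D2_def by (rule B.ctr_vac[OF \<psi>])
  have pz1: "\<eta> \<in> carrier B.F \<Longrightarrow> ?p \<zero>\<^bsub>A.F\<^esub> \<eta> = \<zero>\<^bsub>T\<^esub>" for \<eta>
    by (rule clin_zero[OF A.F.cmod_axioms T.cmod_axioms cbilinD2[OF P]])
  have pz2: "\<xi> \<in> carrier A.F \<Longrightarrow> ?p \<xi> \<zero>\<^bsub>B.F\<^esub> = \<zero>\<^bsub>T\<^esub>" for \<xi>
    by (rule clin_zero[OF B.F.cmod_axioms T.cmod_axioms cbilinD1[OF P]])
  let ?m = "foldl (ract A.F) A.vac es"
  have m: "?m \<in> carrier A.F" by (simp add: A.vac_in)
  have zero: "D (\<alpha> (?q \<xi> ?k)) = \<zero>\<^bsub>T\<^esub>" if "\<xi> \<in> carrier C.F" for \<xi>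
  proof -
    have "\<xi> \<in> carrier (exterior Lik)" using that by (simp add: C.F_simps)
    then show ?thesis
    proof (induction rule: C.F_induct)
      case (add x y)
      then show ?case using clin_add[OF DA, of x y] by (simp add: C.F_simps)
    next
      case (scale a x)
      then show ?case using clin_smult[OF DA, of x a] by (simp add: C.F_simps)
    next
      case vac
      show ?case unfolding \<alpha>_vac[OF esK]
        using m by (simp add: D_pure d_def dv dv2 B.vac_in pz1 pz2)
    next
      case (lact w x)
      then have x: "x \<in> carrier C.F" by (simp add: C.F_simps)
      show ?case using lact x A_in[OF x] by (simp add: \<alpha>_lact_pure[OF x k] D_lact T.lact_zero)
    next
      case (ract w x)
      then have x: "x \<in> carrier C.F" by (simp add: C.F_simps)
      show ?case using ract x A_in[OF x]
        by (simp add: \<alpha>_ract_pure[OF x k] clin_smult[OF D] D_ract T.ract_zero)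
    qed
  qed
  have all: "D t = \<zero>\<^bsub>T\<^esub>" if t: "t \<in> carrier T" for t
  proof -
    have "bij_betw \<alpha> (carrier (top_twist C.F K)) (carrier T)"
      using iso unfolding bimod_iso_def by (rule conjunct1)
    then have "t \<in> \<alpha> ` carrier (top_twist C.F K)" using t by (simp only: bij_betw_imp_surj_on)
    then obtain y where y: "y \<in> carrier (top_twist C.F K)" "t = \<alpha> y" by (rule imageE)
    have "y \<in> carrier (tens C.F (ext_top K))" using y by (simp add: top_twist_simps(1))
    then have "y \<in> carrier (top_twist C.F K) \<and> D (\<alpha> y) = \<zero>\<^bsub>T\<^esub>"
      using C.F.cmod_axioms cmod_ext_top
    proof (induction rule: tens_induct)
      case (add x y)
      then show ?case
        using clin_add[OF clin_comp[OF \<alpha>_clin D], of x y] X.a_closed[of x y] by (simp add: top_twist_simps(1,3))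
    next
      case (scale a x)
      then show ?case
        using clin_smult[OF clin_comp[OF \<alpha>_clin D], of x a] X.smult_closed[of x a] by (simp add: top_twist_simps(1,4))
    next
      case (pure \<xi> \<kappa>)
      obtain a where a: "\<kappa> = a \<odot>\<^bsub>ext_top K\<^esub> ?k" using ext_top_span[OF dual_basis_list[OF es] pure(2)] by blast
      have c: "?q \<xi> \<kappa> \<in> carrier (top_twist C.F K)"
        using cbilin_closed[OF Q] pure by (simp add: top_twist_simps(1))
      have ck: "?q \<xi> ?k \<in> carrier (top_twist C.F K)"
        using cbilin_closed[OF Q] pure k by (simp add: top_twist_simps(1))
      have "?q \<xi> \<kappa> = a \<odot>\<^bsub>top_twist C.F K\<^esub> ?q \<xi> ?k"
        unfolding a using clin_smult[OF cbilinD1[OF Q pure(1)] k] by (simp add: top_twist_simps(4))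
      then show ?case
        using clin_smult[OF clin_comp[OF \<alpha>_clin D] ck, of a] zero[OF pure(1)] c by simp
    qed
    then show ?thesis using y by simp
  qed
  have "D (?p (ract A.F ?m w) B.vac) = f w \<odot>\<^bsub>T\<^esub> ((-1) ^ length es \<odot>\<^bsub>T\<^esub> ?p ?m B.vac)"
    using m B.vac_in A.par_foldl[of es, folded par_def]
    by (simp add: D_pure d_def D1r dv dv2 pz2 P1 A.F.ract_zero)
  moreover have "D (?p (ract A.F ?m w) B.vac) = \<zero>\<^bsub>T\<^esub>"
    using m B.vac_in by (intro all) simp
  ultimately have e: "f w \<odot>\<^bsub>T\<^esub> ((-1) ^ length es \<odot>\<^bsub>T\<^esub> ?p ?m B.vac) = \<zero>\<^bsub>T\<^esub>" by simp
  show ?thesis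
  proof (rule ccontr)
    assume "f w \<noteq> 0"
    have pc': "?p ?m B.vac \<in> carrier T" using m B.vac_in by simp
    have "(-1) ^ length es \<odot>\<^bsub>T\<^esub> ?p ?m B.vac = \<zero>\<^bsub>T\<^esub>"
      using T.smult_eq_zero[OF _ \<open>f w \<noteq> 0\<close> e] pc' by simp
    then have "?p ?m B.vac = \<zero>\<^bsub>T\<^esub>"
      by (intro T.smult_eq_zero[OF pc', of "(-1) ^ length es"]) simp_all
    then have "\<alpha> (?q C.vac ?k) = \<zero>\<^bsub>T\<^esub>" by (simp add: \<alpha>_vac[OF esK])
    then have "?q C.vac ?k = \<zero>\<^bsub>top_twist C.F K\<^esub>"
      using clin_closed[OF q_clin C.vac_in] by (intro \<alpha>_inj)
    then have "?q C.vac ?k = \<zero>\<^bsub>tens C.F (ext_top K)\<^esub>" by (simp only: top_twist_simps(2))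
    then show False using pure_vac_nonzero[OF es, where ci = ci and cj = ck and L = Lik] by (simp only: simp_thms)
  qed
qed

text \<open>
  Otherwise a linear functional would separate \<open>w\<close> from the subspace of all such sums, contrary to
  \<open>functional_zero\<close>.
\<close>

lemma middle_space_spanned:
  obtains z x x' v k where "w = x + x' + k" "(z, x) \<in> pair_conj ci cj ` Lij" "(x', v) \<in> pair_conj cj ck ` Ljk" "k \<in> K"
proof -
  let ?S = "{x + x' + k | x x' k. (\<exists>z. (z, x) \<in> orth Lij) \<and> (\<exists>v. (x', v) \<in> orth Ljk) \<and> k \<in> K}"
  have 0: "(0, 0) \<in> orth Lij" "(0, 0) \<in> orth Ljk" "0 \<in> K"
    using complex_vector.subspace_0[OF csubspace_orth[of Lij]] complex_vector.subspace_0[OF csubspace_orth[of Ljk]]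
      complex_vector.subspace_0[OF K_sub] by (simp_all add: zero_prod_def)
  have SI: "u \<in> ?S" if "u = x + x' + k" "(z, x) \<in> orth Lij" "(x', v) \<in> orth Ljk" "k \<in> K" for u x x' k z v
    unfolding that(1) using that(2-4) by blast
  have SE: "\<exists>z x x' v k. u = x + x' + k \<and> (z, x) \<in> orth Lij \<and> (x', v) \<in> orth Ljk \<and> k \<in> K" if "u \<in> ?S" for u
    using that by blast
  have S: "csubspace ?S"
  proof (rule complex_vector.subspaceI)
    show "0 \<in> ?S" by (rule SI[OF _ 0]) simp
  next
    fix s t assume s: "s \<in> ?S" and t: "t \<in> ?S"
    obtain z x x' v k where 1: "s = x + x' + k" "(z, x) \<in> orth Lij" "(x', v) \<in> orth Ljk" "k \<in> K"
      using SE[OF s] by (elim exE conjE)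
    obtain z1 x1 x1' v1 k1 where 2: "t = x1 + x1' + k1" "(z1, x1) \<in> orth Lij" "(x1', v1) \<in> orth Ljk" "k1 \<in> K"
      using SE[OF t] by (elim exE conjE)
    show "s + t \<in> ?S"
    proof (rule SI)
      show "s + t = (x + x1) + (x' + x1') + (k + k1)" by (simp add: 1 2)
      show "(z + z1, x + x1) \<in> orth Lij" "(x' + x1', v + v1) \<in> orth Ljk" "k + k1 \<in> K"
        using complex_vector.subspace_add[OF csubspace_orth 1(2) 2(2)]
          complex_vector.subspace_add[OF csubspace_orth 1(3) 2(3)] complex_vector.subspace_add[OF K_sub 1(4) 2(4)] by simp_all
    qed
  next
    fix a s assume s: "s \<in> ?S"
    obtain z x x' v k where 1: "s = x + x' + k" "(z, x) \<in> orth Lij" "(x', v) \<in> orth Ljk" "k \<in> K"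
      using SE[OF s] by (elim exE conjE)
    show "a *\<^sub>C s \<in> ?S"
    proof (rule SI)
      show "a *\<^sub>C s = a *\<^sub>C x + a *\<^sub>C x' + a *\<^sub>C k" by (simp add: 1 scaleC_add_right)
      show "(a *\<^sub>C z, a *\<^sub>C x) \<in> orth Lij" "(a *\<^sub>C x', a *\<^sub>C v) \<in> orth Ljk" "a *\<^sub>C k \<in> K"
        using complex_vector.subspace_scale[OF csubspace_orth 1(2), of a]
          complex_vector.subspace_scale[OF csubspace_orth 1(3), of a] complex_vector.subspace_scale[OF K_sub 1(4)] by simp_all
    qed
  qed
  have "w \<in> ?S"
  proof (rule ccontr)
    assume "w \<notin> ?S"
    then obtain f :: "'b \<Rightarrow> complex" where f: "lin_on UNIV f" "\<forall>x\<in>?S. f x = 0" "f w = 1"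
      by (rule separating_functional[OF S])
    have "f w = 0"
    proof (rule functional_zero[OF f(1)])
      fix z x assume "(z, x) \<in> pair_conj ci cj ` Lij"
      then have "(z, x) \<in> orth Lij" by (simp add: A.conj_eq)
      then show "f x = 0" by (intro f(2)[rule_format] SI[OF _ _ 0(2,3)]) simp_all
    next
      fix x v assume "(x, v) \<in> pair_conj cj ck ` Ljk"
      then have "(x, v) \<in> orth Ljk" by (simp add: B.conj_eq)
      then show "f x = 0" by (intro f(2)[rule_format] SI[OF _ 0(1) _ 0(3)]) simp_all
    next
      fix k assume "k \<in> K"
      then show "f k = 0" by (intro f(2)[rule_format] SI[OF _ 0(1,2)]) simp_all
    qed
    with f(3) show False by simp
  qed
  from SE[OF this] show ?thesis using that unfolding A.conj_eq B.conj_eq by (elim exE conjE)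
qed

end


section \<open>Canonical maps on generators\<close>

lemma tens_map_lift:
  assumes "cmod M" "cmod N" "cmod M'" "cmod N'" "clin M M' f" "clin N N' g"
  shows tens_map_clin: "clin (tens M N) (tens M' N') (tens_map M' N' f g)"
    and tens_map_pure: "m \<in> carrier M \<Longrightarrow> n \<in> carrier N \<Longrightarrow>
      tens_map M' N' f g (pure M N m n) = pure M' N' (f m) (g n)"
proof -
  note b = cbilin_comp[OF pure_cbilin[OF assms(3,4)] assms(5,6)]
  show "clin (tens M N) (tens M' N') (tens_map M' N' f g)"
    unfolding tens_map_def by (rule tens_lift_clin[OF assms(1,2) cmod_tens b])
  show "m \<in> carrier M \<Longrightarrow> n \<in> carrier N \<Longrightarrow> tens_map M' N' f g (pure M N m n) = pure M' N' (f m) (g n)"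
    unfolding tens_map_def by (rule tens_lift_pure[OF assms(1,2) cmod_tens b])
qed

lemma cl_tens_map_props:
  assumes M: "cbimod cp c M" and N: "cbimod c cr N" and M': "cbimod cp c M'" and N': "cbimod c cr N'"
    and f: "clin M M' f" and g: "clin N N' g"
    and fr: "\<And>m w. m \<in> carrier M \<Longrightarrow> f (ract M m w) = ract M' (f m) w"
    and gl: "\<And>n w. n \<in> carrier N \<Longrightarrow> g (lact N w n) = lact N' w (g n)"
  shows cl_tens_map_clin: "clin (cl_tens c M N) (cl_tens c M' N') (cl_tens_map c M' N' f g)"
    and cl_tens_map_pure: "m \<in> carrier M \<Longrightarrow> n \<in> carrier N \<Longrightarrow>
      cl_tens_map c M' N' f g (cl_pure c M N m n) = cl_pure c M' N' (f m) (g n)"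
proof -
  interpret M: cbimod cp c M by fact
  interpret N: cbimod c cr N by fact
  interpret M': cbimod cp c M' by fact
  interpret N': cbimod c cr N' by fact
  note b = cbilin_comp[OF cl_pure_cbilin[OF M'.cmod_axioms N'.cmod_axioms, of c] f g]
  have bal: "balanced M N (\<lambda>m n. cl_pure c M' N' (f m) (g n))"
    using clin_closed[OF f] clin_closed[OF g] by (simp add: balanced_def fr gl cl_pure_swap[OF M' N'])
  show "clin (cl_tens c M N) (cl_tens c M' N') (cl_tens_map c M' N' f g)"
    unfolding cl_tens_map_def by (rule cl_tens_map_lift(1)[OF M N cmod_cl_tens b bal])
  show "m \<in> carrier M \<Longrightarrow> n \<in> carrier N \<Longrightarrow>
      cl_tens_map c M' N' f g (cl_pure c M N m n) = cl_pure c M' N' (f m) (g n)"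
    unfolding cl_tens_map_def by (rule cl_tens_map_lift(2)[OF M N cmod_cl_tens b bal])
qed

text \<open>
  The lift of a family of bilinear maps depends linearly on the parameter, since it does so on pure tensors. This makes
  nested lifts, such as associators, bilinear.
\<close>

lemma tens_lift_param:
  assumes "cmod A" "cmod B" "cmod T" and h: "\<And>m. m \<in> carrier M \<Longrightarrow> cbilin A B T (h m)"
    and hm: "\<And>a b. a \<in> carrier A \<Longrightarrow> b \<in> carrier B \<Longrightarrow> clin M T (\<lambda>m. h m a b)" and M: "cmod M"
  shows "cbilin M (tens A B) T (\<lambda>m. tens_lift T (h m))"
proof (intro cbilinI)
  interpret M: cmod M by fact
  interpret T: cmod T by fact
  note L = tens_lift_clin[OF assms(1-3) h] and P = tens_lift_pure[OF assms(1-3) h]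
  show "clin (tens A B) T (tens_lift T (h m))" if "m \<in> carrier M" for m by (rule L[OF that])
  fix y assume y: "y \<in> carrier (tens A B)"
  show "clin M T (\<lambda>m. tens_lift T (h m) y)"
  proof (rule clinI)
    show "tens_lift T (h m) y \<in> carrier T" if "m \<in> carrier M" for m
      by (rule clin_closed[OF L[OF that] y])
    show "tens_lift T (h (m \<oplus>\<^bsub>M\<^esub> m')) y = tens_lift T (h m) y \<oplus>\<^bsub>T\<^esub> tens_lift T (h m') y"
      if "m \<in> carrier M" "m' \<in> carrier M" for m m'
      using that by (intro tens_clin_eq[OF assms(1,2) L clin_plus[OF assms(3) L L] _ y])
        (simp_all add: P clin_add[OF hm])
    show "tens_lift T (h (a \<odot>\<^bsub>M\<^esub> m)) y = a \<odot>\<^bsub>T\<^esub> tens_lift T (h m) y" if "m \<in> carrier M" for a m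
      using that by (intro tens_clin_eq[OF assms(1,2) L clin_scale[OF assms(3) L] _ y])
        (simp_all add: P clin_smult[OF hm])
  qed
qed

lemma cl_tens_lift_param:
  assumes A: "cbimod cp c A" and B: "cbimod c cr B" and T: "cmod T"
    and h: "\<And>m. m \<in> carrier M \<Longrightarrow> cbilin A B T (h m)" "\<And>m. m \<in> carrier M \<Longrightarrow> balanced A B (h m)"
    and hm: "\<And>a b. a \<in> carrier A \<Longrightarrow> b \<in> carrier B \<Longrightarrow> clin M T (\<lambda>m. h m a b)" and M: "cmod M"
  shows "cbilin (cl_tens c A B) M T (\<lambda>y m. tens_lift T (h m) y)"
proof (intro cbilinI)
  interpret M: cmod M by fact
  interpret T: cmod T by fact
  interpret A: cbimod cp c A by fact
  interpret B: cbimod c cr B by fact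
  note AB = A.cmod_axioms B.cmod_axioms
  note L = cl_tens_map_lift(1)[OF A B T h] and P = cl_tens_map_lift(2)[OF A B T h]
  show "clin (cl_tens c A B) T (\<lambda>y. tens_lift T (h m) y)" if "m \<in> carrier M" for m by (rule L[OF that that])
  fix y assume y: "y \<in> carrier (cl_tens c A B)"
  show "clin M T (\<lambda>m. tens_lift T (h m) y)"
  proof (rule clinI)
    show "tens_lift T (h m) y \<in> carrier T" if "m \<in> carrier M" for m
      by (rule clin_closed[OF L[OF that that] y])
    show "tens_lift T (h (m \<oplus>\<^bsub>M\<^esub> m')) y = tens_lift T (h m) y \<oplus>\<^bsub>T\<^esub> tens_lift T (h m') y"
      if "m \<in> carrier M" "m' \<in> carrier M" for m m'
      using that by (intro cl_tens_clin_eq[OF AB L clin_plus[OF T L L] _ y])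
        (simp_all add: P clin_add[OF hm])
    show "tens_lift T (h (a \<odot>\<^bsub>M\<^esub> m)) y = a \<odot>\<^bsub>T\<^esub> tens_lift T (h m) y" if "m \<in> carrier M" for a m
      using that by (intro cl_tens_clin_eq[OF AB L clin_scale[OF T L] _ y])
        (simp_all add: P clin_smult[OF hm])
  qed
qed

lemma assoc_top_props:
  assumes M: "cmod M"
  shows assoc_top_clin: "clin (tens M (tens (ext_top A) (ext_top B))) (tens (top_twist M A) (ext_top B)) (assoc_top M A B)"
    and assoc_top_pure: "\<xi> \<in> carrier M \<Longrightarrow> a \<in> carrier (ext_top A) \<Longrightarrow> b \<in> carrier (ext_top B) \<Longrightarrow>
      assoc_top M A B (pure M (tens (ext_top A) (ext_top B)) \<xi> (pure (ext_top A) (ext_top B) a b)) =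
      pure (top_twist M A) (ext_top B) (pure M (ext_top A) \<xi> a) b"
proof -
  let ?T = "tens (top_twist M A) (ext_top B)"
  let ?h = "\<lambda>\<xi> a b. pure (top_twist M A) (ext_top B) (pure M (ext_top A) \<xi> a) b"
  note p = pure_cbilin[OF M cmod_ext_top[of A]] and q = pure_cbilin[OF cmod_top_twist[of M A] cmod_ext_top[of B]]
  have 1: "\<xi> \<in> carrier M \<Longrightarrow> clin (ext_top A) (top_twist M A) (pure M (ext_top A) \<xi>)" for \<xi>
    using cbilinD1[OF p] by (simp add: clin_top_twist_iff)
  have 2: "a \<in> carrier (ext_top A) \<Longrightarrow> clin M (top_twist M A) (\<lambda>\<xi>. pure M (ext_top A) \<xi> a)" for a
    using cbilinD2[OF p] by (simp add: clin_top_twist_iff)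
  have h1: "cbilin (ext_top A) (ext_top B) ?T (?h \<xi>)" if "\<xi> \<in> carrier M" for \<xi>
    by (rule cbilin_comp_left[OF q 1[OF that]])
  have h2: "clin M ?T (\<lambda>\<xi>. ?h \<xi> a b)" if "a \<in> carrier (ext_top A)" "b \<in> carrier (ext_top B)" for a b
    by (rule clin_comp[OF 2[OF that(1)] cbilinD2[OF q that(2)]])
  note c = tens_lift_param[where h = ?h and M = M, OF cmod_ext_top[of A] cmod_ext_top[of B] cmod_tens h1 h2 M]
  show "clin (tens M (tens (ext_top A) (ext_top B))) ?T (assoc_top M A B)"
    unfolding assoc_top_def Let_def by (rule tens_lift_clin[OF M cmod_tens cmod_tens c])
  assume x: "\<xi> \<in> carrier M" "a \<in> carrier (ext_top A)" "b \<in> carrier (ext_top B)"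
  show "assoc_top M A B (pure M (tens (ext_top A) (ext_top B)) \<xi> (pure (ext_top A) (ext_top B) a b)) = ?h \<xi> a b"
    unfolding assoc_top_def Let_def
    using x by (subst tens_lift_pure[OF M cmod_tens cmod_tens c])
      (auto simp: pure_closed[OF cmod_ext_top cmod_ext_top] tens_lift_pure[OF cmod_ext_top cmod_ext_top cmod_tens h1])
qed

subsection \<open>Splitting and interchanging top exterior powers\<close>

lemma ext_mult_cbilin:
  assumes L: "csubspace L"
  shows "cbilin (exterior L) (exterior L) (exterior L) (\<lambda>x y. x \<otimes>\<^bsub>exterior L\<^esub> y)"
proof -
  have r: "\<exists>p\<in>alg_on L. x = ecl L p" if "x \<in> carrier (exterior L)" for x
    using that by (auto simp: exterior_simps)
  show ?thesis
  proof (intro cbilinI clinI)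
    fix x y z a assume "x \<in> carrier (exterior L)" "y \<in> carrier (exterior L)" "z \<in> carrier (exterior L)"
    then obtain p q s where p: "p \<in> alg_on L" "x = ecl L p" "q \<in> alg_on L" "y = ecl L q" "s \<in> alg_on L" "z = ecl L s"
      using r by metis
    then show "x \<otimes>\<^bsub>exterior L\<^esub> (y \<oplus>\<^bsub>exterior L\<^esub> z) = (x \<otimes>\<^bsub>exterior L\<^esub> y) \<oplus>\<^bsub>exterior L\<^esub> (x \<otimes>\<^bsub>exterior L\<^esub> z)"
      "(y \<oplus>\<^bsub>exterior L\<^esub> z) \<otimes>\<^bsub>exterior L\<^esub> x = (y \<otimes>\<^bsub>exterior L\<^esub> x) \<oplus>\<^bsub>exterior L\<^esub> (z \<otimes>\<^bsub>exterior L\<^esub> x)"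
      by (simp_all only: ecl_add ecl_mult[OF L] alg_on_add distrib_left distrib_right)
  next
    fix x y a assume "x \<in> carrier (exterior L)" "y \<in> carrier (exterior L)"
    then obtain p q where p: "p \<in> alg_on L" "x = ecl L p" "q \<in> alg_on L" "y = ecl L q"
      using r by metis
    then show "x \<otimes>\<^bsub>exterior L\<^esub> y \<in> carrier (exterior L)" 
      by (simp add: ecl_mult[OF L] ecl_closed alg_on_mult)
    show "x \<otimes>\<^bsub>exterior L\<^esub> (a \<odot>\<^bsub>exterior L\<^esub> y) = a \<odot>\<^bsub>exterior L\<^esub> (x \<otimes>\<^bsub>exterior L\<^esub> y)"
      "(a \<odot>\<^bsub>exterior L\<^esub> y) \<otimes>\<^bsub>exterior L\<^esub> x = a \<odot>\<^bsub>exterior L\<^esub> (y \<otimes>\<^bsub>exterior L\<^esub> x)"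
      using p by (simp_all only: ecl_smult ecl_mult[OF L] alg_on_scale scaleC_mult_left scaleC_mult_right)
    show "x \<otimes>\<^bsub>exterior L\<^esub> y \<in> carrier (exterior L)"
      using p by (simp add: ecl_mult[OF L] ecl_closed alg_on_mult)
  qed
qed

lemma ext_map_wdg:
  assumes "csubspace L" "lin_on L f" "f ` L \<subseteq> L'" "set us \<subseteq> L"
  shows "ext_map L' f (wdg L us) = wdg L' (map f us)"
  using ext_map_ecl[OF assms(1-3), of "word us"] assms(4) by (simp add: mapf_word)

lemma csubspace_Times:
  assumes "csubspace A" "csubspace B" shows "csubspace (A \<times> B)"
  using assms by (auto simp: complex_vector.subspace_def zero_prod_def)

lemma csubspace_slices:
  fixes Z :: "('a::complex_vector \<times> 'b::complex_vector) set"
  assumes Z: "csubspace Z" shows "csubspace {a. (a, 0) \<in> Z}" and "csubspace {b. (0, b) \<in> Z}"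
proof -
  note s = complex_vector.subspace_0[OF Z] complex_vector.subspace_add[OF Z] complex_vector.subspace_scale[OF Z]
  have sc: "r *\<^sub>C (a, b) = (r *\<^sub>C a, r *\<^sub>C b)" for r and a :: 'a and b :: 'b by (simp add: scaleC_prod_def)
  show "csubspace {a. (a, 0) \<in> Z}"
  proof (rule complex_vector.subspaceI)
    show "0 \<in> {a. (a, 0) \<in> Z}" using s(1) by (simp add: zero_prod_def)
    show "x + y \<in> {a. (a, 0) \<in> Z}" if "x \<in> {a. (a, 0) \<in> Z}" "y \<in> {a. (a, 0) \<in> Z}" for x y
      using s(2)[of "(x, 0)" "(y, 0)"] that by simp
    show "r *\<^sub>C x \<in> {a. (a, 0) \<in> Z}" if "x \<in> {a. (a, 0) \<in> Z}" for r x
      using s(3)[of "(x, 0)" r] that by (simp add: sc)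
  qed
  show "csubspace {b. (0, b) \<in> Z}"
  proof (rule complex_vector.subspaceI)
    show "0 \<in> {b. (0, b) \<in> Z}" using s(1) by (simp add: zero_prod_def)
    show "x + y \<in> {b. (0, b) \<in> Z}" if "x \<in> {b. (0, b) \<in> Z}" "y \<in> {b. (0, b) \<in> Z}" for x y
      using s(2)[of "(0, x)" "(0, y)"] that by simp
    show "r *\<^sub>C x \<in> {b. (0, b) \<in> Z}" if "x \<in> {b. (0, b) \<in> Z}" for r x
      using s(3)[of "(0, x)" r] that by (simp add: sc)
  qed
qed

lemma dual_basis_Times:
  assumes A: "dual_basis us as A" and B: "dual_basis vs bs B"
  shows "dual_basis (map (\<lambda>u. (u, 0)) us @ map (\<lambda>v. (0, v)) vs) (map (\<lambda>a. (a, 0)) as @ map (\<lambda>b. (0, b)) bs) (A \<times> B)"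
proof -
  have sub: "csubspace A" "csubspace B" and bi: "biorth us as" "biorth vs bs"
    and in': "set as \<subseteq> A" "set bs \<subseteq> B" and sp: "A \<subseteq> cspan (set as)" "B \<subseteq> cspan (set bs)"
    using A B by (auto simp: dual_basis_def)
  let ?L = "map (\<lambda>a. (a, 0)) as @ map (\<lambda>b. (0, b)) bs"
  have "biorth (map (\<lambda>u. (u, 0::'b)) us @ map (\<lambda>v. (0::'a, v)) vs) ?L"
    using bi biorth_length[OF bi(1)]
    by (subst biorth_append) (auto simp: biorth_map)
  moreover have "set ?L \<subseteq> A \<times> B"
    using in' complex_vector.subspace_0[OF sub(1)] complex_vector.subspace_0[OF sub(2)] by auto
  moreover have "A \<times> B \<subseteq> cspan (set ?L)"
  proof
    fix x assume x: "x \<in> A \<times> B"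
    have "csubspace {a. (a, 0) \<in> cspan (set ?L)}" "csubspace {b. (0, b) \<in> cspan (set ?L)}"
      by (rule csubspace_slices, simp)+
    moreover have "set as \<subseteq> {a. (a, 0) \<in> cspan (set ?L)}" "set bs \<subseteq> {b. (0, b) \<in> cspan (set ?L)}"
      by (auto intro!: complex_vector.span_base)
    ultimately have "A \<subseteq> {a. (a, 0) \<in> cspan (set ?L)}" "B \<subseteq> {b. (0, b) \<in> cspan (set ?L)}"
      using sp complex_vector.span_minimal by blast+
    then have "(fst x, 0) + (0, snd x) \<in> cspan (set ?L)"
      using x by (intro complex_vector.span_add) auto
    then show "x \<in> cspan (set ?L)" by simp
  qed
  ultimately show ?thesis using csubspace_Times[OF sub] by (simp add: dual_basis_def)
qed

text \<open>
  Both sides are lines and the wedge map sends a generator to a generator, so it is a bijection and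
  \<open>inv_into\<close> is its inverse.
\<close>

lemma top_split_props:
  assumes A: "dual_basis us as A" and B: "dual_basis vs bs B"
  shows top_split_clin: "clin (ext_top (A \<times> B)) (tens (ext_top A) (ext_top B)) (top_split A B)"
    and top_split_wdg: "top_split A B (wdg (A \<times> B) (map (\<lambda>a. (a, 0)) as @ map (\<lambda>b. (0, b)) bs)) =
      pure (ext_top A) (ext_top B) (wdg A as) (wdg B bs)"
proof -
  note AB = dual_basis_Times[OF A B]
  let ?E = "exterior (A \<times> B)" and ?T = "tens (ext_top A) (ext_top B)"
  let ?l = "map (\<lambda>a. (a, 0)) as @ map (\<lambda>b. (0, b)) bs"
  interpret E: cmod ?E by (rule cmod_exterior)
  interpret T: cmod ?T by (rule cmod_tens)
  have K: "csubspace A" "csubspace B" "csubspace (A \<times> B)" "set as \<subseteq> A" "set bs \<subseteq> B" "set ?l \<subseteq> A \<times> B"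
    using A B AB by (auto simp: dual_basis_def)
  have i1: "lin_on A (\<lambda>v. (v, 0::'b))" "(\<lambda>v. (v, 0::'b)) ` A \<subseteq> A \<times> B"
    and i2: "lin_on B (\<lambda>w. (0::'a, w))" "(\<lambda>w. (0::'a, w)) ` B \<subseteq> A \<times> B"
    using complex_vector.subspace_0[OF K(1)] complex_vector.subspace_0[OF K(2)] by (auto simp: lin_on_def)
  have m1: "clin (ext_top A) ?E (ext_map (A \<times> B) (\<lambda>v. (v, 0)))"
    by (rule clin_restrict[OF ext_map_clin[OF K(1) i1] ext_top_sub]) (simp_all add: ext_top_simps)
  have m2: "clin (ext_top B) ?E (ext_map (A \<times> B) (\<lambda>w. (0, w)))"
    by (rule clin_restrict[OF ext_map_clin[OF K(2) i2] ext_top_sub]) (simp_all add: ext_top_simps)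
  let ?f = "\<lambda>a b. ext_map (A \<times> B) (\<lambda>v. (v, 0)) a \<otimes>\<^bsub>?E\<^esub> ext_map (A \<times> B) (\<lambda>w. (0, w)) b"
  note fb = cbilin_comp[OF ext_mult_cbilin[OF K(3)] m1 m2]
  define \<mu> where "\<mu> = tens_lift ?E ?f"
  have \<mu>: "clin ?T ?E \<mu>" unfolding \<mu>_def by (rule tens_lift_clin[OF cmod_ext_top cmod_ext_top cmod_exterior fb])
  let ?a = "wdg A as" and ?b = "wdg B bs" and ?W = "wdg (A \<times> B) ?l"
  let ?p = "pure (ext_top A) (ext_top B)"
  have ab: "?a \<in> carrier (ext_top A)" "?b \<in> carrier (ext_top B)"
    using K dual_basis_cdim[OF A] dual_basis_cdim[OF B] by (auto intro!: wdg_in_top)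
  have pc: "?p ?a ?b \<in> carrier ?T" by (rule pure_closed[OF cmod_ext_top cmod_ext_top ab])
  have "\<mu> (?p ?a ?b) = ?f ?a ?b"
    unfolding \<mu>_def by (rule tens_lift_pure[OF cmod_ext_top cmod_ext_top cmod_exterior fb ab])
  also have "\<dots> = wdg (A \<times> B) (map (\<lambda>v. (v, 0)) as) \<otimes>\<^bsub>?E\<^esub> wdg (A \<times> B) (map (\<lambda>w. (0, w)) bs)"
    by (simp only: ext_map_wdg[OF K(1) i1 K(4)] ext_map_wdg[OF K(2) i2 K(5)])
  also have "\<dots> = ?W"
    using K(6) by (subst ecl_mult[OF K(3)]) (auto simp: mult_single)
  finally have \<mu>p: "\<mu> (?p ?a ?b) = ?W" .
  have Wc: "?W \<in> carrier (ext_top (A \<times> B))" "?W \<in> carrier ?E"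
    using wdg_in_top[OF K(6)] dual_basis_cdim[OF AB] ext_top_sub by auto
  have Wn: "?W \<noteq> \<zero>\<^bsub>?E\<^esub>"
    using wdg_nonzero[OF K(3) AB[unfolded dual_basis_def, THEN conjunct1] K(6)]
    by (simp add: exterior_simps coset_eq_iff)
  have span: "\<exists>t. y = t \<odot>\<^bsub>?T\<^esub> ?p ?a ?b" if "y \<in> carrier ?T" for y
    using that cmod_ext_top cmod_ext_top
  proof (induction rule: tens_induct)
    case (add x y)
    then obtain s t where "x = s \<odot>\<^bsub>?T\<^esub> ?p ?a ?b" "y = t \<odot>\<^bsub>?T\<^esub> ?p ?a ?b" by blast
    then have "x \<oplus>\<^bsub>?T\<^esub> y = (s + t) \<odot>\<^bsub>?T\<^esub> ?p ?a ?b" using pc by (simp add: T.smult_l_distr)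
    then show ?case by blast
  next
    case (scale c x)
    then obtain s where "x = s \<odot>\<^bsub>?T\<^esub> ?p ?a ?b" by blast
    then have "c \<odot>\<^bsub>?T\<^esub> x = (c * s) \<odot>\<^bsub>?T\<^esub> ?p ?a ?b" using pc by (simp add: T.smult_assoc)
    then show ?case by blast
  next
    case (pure m n)
    obtain s t where st: "m = s \<odot>\<^bsub>ext_top A\<^esub> ?a" "n = t \<odot>\<^bsub>ext_top B\<^esub> ?b"
      using ext_top_span[OF dual_basis_list[OF A] pure(1)] ext_top_span[OF dual_basis_list[OF B] pure(2)] by metis
    note P = pure_cbilin[OF cmod_ext_top[of A] cmod_ext_top[of B]]
    have "?p m n = s \<odot>\<^bsub>?T\<^esub> ?p ?a n" unfolding st(1) by (rule clin_smult[OF cbilinD2[OF P pure(2)] ab(1)])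
    also have "?p ?a n = t \<odot>\<^bsub>?T\<^esub> ?p ?a ?b" unfolding st(2) by (rule clin_smult[OF cbilinD1[OF P ab(1)] ab(2)])
    finally have "?p m n = (s * t) \<odot>\<^bsub>?T\<^esub> ?p ?a ?b" using pc by (simp add: T.smult_assoc)
    then show ?case by blast
  qed
  have inj: "inj_on \<mu> (carrier ?T)"
  proof (rule inj_onI)
    fix x y assume xy: "x \<in> carrier ?T" "y \<in> carrier ?T" "\<mu> x = \<mu> y"
    obtain s t where st: "x = s \<odot>\<^bsub>?T\<^esub> ?p ?a ?b" "y = t \<odot>\<^bsub>?T\<^esub> ?p ?a ?b" using span xy by metis
    have "s \<odot>\<^bsub>?E\<^esub> ?W = t \<odot>\<^bsub>?E\<^esub> ?W" using xy(3) pc by (simp add: st clin_smult[OF \<mu>] \<mu>p)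
    then have "(s - t) \<odot>\<^bsub>?E\<^esub> ?W = \<zero>\<^bsub>?E\<^esub>"
      using Wc(2) E.smult_l_distr[of ?W s "- t"] by (simp add: E.smult_minus_left E.r_neg)
    then have "s - t = 0" using E.smult_eq_zero[OF Wc(2), of "s - t"] Wn by blast
    then show "x = y" by (simp add: st)
  qed
  have inv: "top_split A B (\<mu> y) = y" if "y \<in> carrier ?T" for y
    unfolding top_split_def \<mu>_def[symmetric] by (rule inv_into_f_f[OF inj that])
  show W: "top_split A B ?W = ?p ?a ?b" using inv[OF pc] by (simp add: \<mu>p)
  have sc: "top_split A B (s \<odot>\<^bsub>ext_top (A \<times> B)\<^esub> ?W) = s \<odot>\<^bsub>?T\<^esub> ?p ?a ?b" for s
    using inv[of "s \<odot>\<^bsub>?T\<^esub> ?p ?a ?b"] pc by (simp add: clin_smult[OF \<mu>] \<mu>p ext_top_simps)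
  interpret X: cmod "ext_top (A \<times> B)" by (rule cmod_ext_top)
  show "clin (ext_top (A \<times> B)) ?T (top_split A B)"
  proof (rule clinI)
    fix x assume x: "x \<in> carrier (ext_top (A \<times> B))"
    obtain s where s: "x = s \<odot>\<^bsub>ext_top (A \<times> B)\<^esub> ?W" using ext_top_span[OF dual_basis_list[OF AB] x] .
    show "top_split A B x \<in> carrier ?T" using pc by (simp add: s sc)
    fix c
    have "c \<odot>\<^bsub>ext_top (A \<times> B)\<^esub> x = (c * s) \<odot>\<^bsub>ext_top (A \<times> B)\<^esub> ?W" using Wc by (simp add: s X.smult_assoc)
    then show "top_split A B (c \<odot>\<^bsub>ext_top (A \<times> B)\<^esub> x) = c \<odot>\<^bsub>?T\<^esub> top_split A B x"
      using pc by (simp only: sc) (simp add: s sc T.smult_assoc)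
  next
    fix x y assume x: "x \<in> carrier (ext_top (A \<times> B))" and y: "y \<in> carrier (ext_top (A \<times> B))"
    obtain s where s: "x = s \<odot>\<^bsub>ext_top (A \<times> B)\<^esub> ?W" using ext_top_span[OF dual_basis_list[OF AB] x] .
    obtain t where t: "y = t \<odot>\<^bsub>ext_top (A \<times> B)\<^esub> ?W" using ext_top_span[OF dual_basis_list[OF AB] y] .
    have "x \<oplus>\<^bsub>ext_top (A \<times> B)\<^esub> y = (s + t) \<odot>\<^bsub>ext_top (A \<times> B)\<^esub> ?W" using Wc by (simp add: s t X.smult_l_distr)
    then show "top_split A B (x \<oplus>\<^bsub>ext_top (A \<times> B)\<^esub> y) = top_split A B x \<oplus>\<^bsub>?T\<^esub> top_split A B y"
      using pc by (simp only: sc) (simp add: s t sc T.smult_l_distr)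
  qed
qed

lemma top_swap_props:
  shows top_swap_clin: "clin (tens (ext_top A) (ext_top B)) (tens (ext_top B) (ext_top A)) (top_swap A B)"
    and top_swap_pure: "a \<in> carrier (ext_top A) \<Longrightarrow> b \<in> carrier (ext_top B) \<Longrightarrow>
      top_swap A B (pure (ext_top A) (ext_top B) a b) =
      (-1) ^ (cdim A * cdim B) \<odot>\<^bsub>tens (ext_top B) (ext_top A)\<^esub> pure (ext_top B) (ext_top A) b a"
proof -
  have b: "cbilin (ext_top A) (ext_top B) (tens (ext_top B) (ext_top A))
     (\<lambda>a b. (-1) ^ (cdim A * cdim B) \<odot>\<^bsub>tens (ext_top B) (ext_top A)\<^esub> pure (ext_top B) (ext_top A) b a)"
    using pure_cbilin[OF cmod_ext_top[of B] cmod_ext_top[of A]]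
    by (intro cbilin_scale cmod_tens) (simp add: cbilin_def)
  show "clin (tens (ext_top A) (ext_top B)) (tens (ext_top B) (ext_top A)) (top_swap A B)"
    unfolding top_swap_def by (rule tens_lift_clin[OF cmod_ext_top cmod_ext_top cmod_tens b])
  show "a \<in> carrier (ext_top A) \<Longrightarrow> b \<in> carrier (ext_top B) \<Longrightarrow>
      top_swap A B (pure (ext_top A) (ext_top B) a b) =
      (-1) ^ (cdim A * cdim B) \<odot>\<^bsub>tens (ext_top B) (ext_top A)\<^esub> pure (ext_top B) (ext_top A) b a"
    unfolding top_swap_def by (rule tens_lift_pure[OF cmod_ext_top cmod_ext_top cmod_tens b])
qed

subsection \<open>Associativity and interchange over Clifford algebras\<close>

lemma assoc_twist_props:
  assumes M: "cbimod cp c M" and N: "cbimod c cr N"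
  shows assoc_twist_clin: "clin (tens (cl_tens c M N) (ext_top K)) (cl_tens c M (top_twist N K)) (assoc_twist c M N K)"
    and assoc_twist_pure: "\<xi> \<in> carrier M \<Longrightarrow> \<eta> \<in> carrier N \<Longrightarrow> \<kappa> \<in> carrier (ext_top K) \<Longrightarrow>
      assoc_twist c M N K (pure (cl_tens c M N) (ext_top K) (cl_pure c M N \<xi> \<eta>) \<kappa>) =
      cl_pure c M (top_twist N K) \<xi> (pure N (ext_top K) \<eta> \<kappa>)"
proof -
  interpret M: cbimod cp c M by fact
  interpret N: cbimod c cr N by fact
  interpret X: cbimod c cr "top_twist N K" by (rule cbimod_top_twist[OF N])
  let ?T = "cl_tens c M (top_twist N K)"
  let ?h = "\<lambda>\<kappa> \<xi> \<eta>. cl_pure c M (top_twist N K) \<xi> (pure N (ext_top K) \<eta> \<kappa>)"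
  note p = pure_cbilin[OF N.cmod_axioms cmod_ext_top, of K] and q = cl_pure_cbilin[OF M.cmod_axioms X.cmod_axioms, of c]
  have 1: "\<kappa> \<in> carrier (ext_top K) \<Longrightarrow> clin N (top_twist N K) (\<lambda>\<eta>. pure N (ext_top K) \<eta> \<kappa>)" for \<kappa>
    using cbilinD2[OF p] by (simp add: clin_top_twist_iff)
  have 2: "\<eta> \<in> carrier N \<Longrightarrow> clin (ext_top K) (top_twist N K) (pure N (ext_top K) \<eta>)" for \<eta>
    using cbilinD1[OF p] by (simp add: clin_top_twist_iff)
  have h1: "cbilin M N ?T (?h \<kappa>)" if "\<kappa> \<in> carrier (ext_top K)" for \<kappa>
    by (rule cbilin_comp_right[OF q 1[OF that]])
  have h2: "balanced M N (?h \<kappa>)" if "\<kappa> \<in> carrier (ext_top K)" for \<kappa>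
    using clin_closed[OF 1[OF that]] that
    by (simp add: balanced_def cl_pure_swap[OF M X.cbimod_axioms] top_twist_lact_pure[OF N])
  have h3: "clin (ext_top K) ?T (\<lambda>\<kappa>. ?h \<kappa> \<xi> \<eta>)" if "\<xi> \<in> carrier M" "\<eta> \<in> carrier N" for \<xi> \<eta>
    by (rule clin_comp[OF 2[OF that(2)] cbilinD1[OF q that(1)]])
  note c = cl_tens_lift_param[where h = ?h and M = "ext_top K", OF M N cmod_cl_tens h1 h2 h3 cmod_ext_top]
  show "clin (tens (cl_tens c M N) (ext_top K)) ?T (assoc_twist c M N K)"
    unfolding assoc_twist_def Let_def by (rule tens_lift_clin[OF cmod_cl_tens cmod_ext_top cmod_cl_tens c])
  assume x: "\<xi> \<in> carrier M" "\<eta> \<in> carrier N" "\<kappa> \<in> carrier (ext_top K)"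
  show "assoc_twist c M N K (pure (cl_tens c M N) (ext_top K) (cl_pure c M N \<xi> \<eta>) \<kappa>) = ?h \<kappa> \<xi> \<eta>"
    unfolding assoc_twist_def Let_def
    using x by (subst tens_lift_pure[OF cmod_cl_tens cmod_ext_top cmod_cl_tens c])
      (auto simp: cl_pure_closed[OF M.cmod_axioms N.cmod_axioms]
        cl_tens_map_lift(2)[OF M N cmod_cl_tens h1 h2])
qed

lemma cl_assoc_props:
  assumes A: "cbimod ca cb A" and B: "cbimod cb cc B" and C: "cbimod cc cd C"
  shows cl_assoc_clin: "clin (cl_tens cc (cl_tens cb A B) C) (cl_tens cb A (cl_tens cc B C)) (cl_assoc cb cc A B C)"
    and cl_assoc_pure: "\<xi> \<in> carrier A \<Longrightarrow> \<eta> \<in> carrier B \<Longrightarrow> \<zeta> \<in> carrier C \<Longrightarrow>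
      cl_assoc cb cc A B C (cl_pure cc (cl_tens cb A B) C (cl_pure cb A B \<xi> \<eta>) \<zeta>) =
      cl_pure cb A (cl_tens cc B C) \<xi> (cl_pure cc B C \<eta> \<zeta>)"
proof -
  interpret A: cbimod ca cb A by fact
  interpret B: cbimod cb cc B by fact
  interpret C: cbimod cc cd C by fact
  interpret AB: cbimod ca cc "cl_tens cb A B" by (rule cbimod_cl_tens[OF A B])
  interpret BC: cbimod cb cd "cl_tens cc B C" by (rule cbimod_cl_tens[OF B C])
  let ?T = "cl_tens cb A (cl_tens cc B C)"
  let ?h = "\<lambda>\<zeta> \<xi> \<eta>. cl_pure cb A (cl_tens cc B C) \<xi> (cl_pure cc B C \<eta> \<zeta>)"
  note p = cl_pure_cbilin[OF B.cmod_axioms C.cmod_axioms, of cc] and q = cl_pure_cbilin[OF A.cmod_axioms BC.cmod_axioms, of cb]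
  have h1: "cbilin A B ?T (?h \<zeta>)" if "\<zeta> \<in> carrier C" for \<zeta>
    by (rule cbilin_comp_right[OF q cbilinD2[OF p that]])
  have h2: "balanced A B (?h \<zeta>)" if "\<zeta> \<in> carrier C" for \<zeta>
    using cbilin_closed[OF p] that
    by (simp add: balanced_def cl_pure_swap[OF A BC.cbimod_axioms] cl_tens_lact_pure[OF B C])
  have h3: "clin C ?T (\<lambda>\<zeta>. ?h \<zeta> \<xi> \<eta>)" if "\<xi> \<in> carrier A" "\<eta> \<in> carrier B" for \<xi> \<eta>
    by (rule clin_comp[OF cbilinD1[OF p that(2)] cbilinD1[OF q that(1)]])
  note c = cl_tens_lift_param[where h = ?h and M = C, OF A B cmod_cl_tens h1 h2 h3 C.cmod_axioms]
  note L = cl_tens_map_lift(1)[OF A B cmod_cl_tens h1 h2] and P = cl_tens_map_lift(2)[OF A B cmod_cl_tens h1 h2]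
  have bal: "balanced (cl_tens cb A B) C (\<lambda>x \<zeta>. tens_lift ?T (?h \<zeta>) x)"
    unfolding balanced_def
  proof (intro ballI allI)
    fix x \<zeta> w assume x: "x \<in> carrier (cl_tens cb A B)" and z: "\<zeta> \<in> carrier C"
    have z': "lact C w \<zeta> \<in> carrier C" using z by simp
    show "tens_lift ?T (?h \<zeta>) (ract (cl_tens cb A B) x w) = tens_lift ?T (?h (lact C w \<zeta>)) x"
      by (rule cl_tens_clin_eq[OF A.cmod_axioms B.cmod_axioms clin_comp[OF AB.ract_clin L[OF z z]] L[OF z' z'] _ x])
        (simp add: cl_tens_ract_pure[OF A B] P z z' cl_pure_swap[OF B C])
  qed
  show "clin (cl_tens cc (cl_tens cb A B) C) ?T (cl_assoc cb cc A B C)"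
    unfolding cl_assoc_def Let_def by (rule cl_tens_map_lift(1)[OF AB.cbimod_axioms C cmod_cl_tens c bal])
  assume x: "\<xi> \<in> carrier A" "\<eta> \<in> carrier B" "\<zeta> \<in> carrier C"
  show "cl_assoc cb cc A B C (cl_pure cc (cl_tens cb A B) C (cl_pure cb A B \<xi> \<eta>) \<zeta>) = ?h \<zeta> \<xi> \<eta>"
    unfolding cl_assoc_def Let_def
    using x by (subst cl_tens_map_lift(2)[OF AB.cbimod_axioms C cmod_cl_tens c bal])
      (auto simp: cl_pure_closed[OF A.cmod_axioms B.cmod_axioms] P)
qed

lemma cl_assoc_acts:
  assumes A: "cbimod ca cb A" and B: "cbimod cb cc B" and C: "cbimod cc cd C"
    and x: "x \<in> carrier (cl_tens cb A B)" and z: "\<zeta> \<in> carrier C"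
  shows cl_assoc_lact: "cl_assoc cb cc A B C (cl_pure cc (cl_tens cb A B) C (lact (cl_tens cb A B) w x) \<zeta>) =
      lact (cl_tens cb A (cl_tens cc B C)) w (cl_assoc cb cc A B C (cl_pure cc (cl_tens cb A B) C x \<zeta>))"
    and cl_assoc_ract: "cl_assoc cb cc A B C (cl_pure cc (cl_tens cb A B) C x (ract C \<zeta> v)) =
      ract (cl_tens cb A (cl_tens cc B C)) (cl_assoc cb cc A B C (cl_pure cc (cl_tens cb A B) C x \<zeta>)) v"
proof -
  interpret A: cbimod ca cb A by fact
  interpret B: cbimod cb cc B by fact
  interpret C: cbimod cc cd C by fact
  interpret AB: cbimod ca cc "cl_tens cb A B" by (rule cbimod_cl_tens[OF A B])
  interpret BC: cbimod cb cd "cl_tens cc B C" by (rule cbimod_cl_tens[OF B C])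
  interpret T: cbimod ca cd "cl_tens cb A (cl_tens cc B C)" by (rule cbimod_cl_tens[OF A BC.cbimod_axioms])
  note q = cl_pure_cbilin[OF AB.cmod_axioms C.cmod_axioms, of cc]
  note L = cl_assoc_clin[OF A B C] and P = cl_assoc_pure[OF A B C]
  have f: "clin (cl_tens cb A B) (cl_tens cb A (cl_tens cc B C)) (\<lambda>x. cl_assoc cb cc A B C (cl_pure cc (cl_tens cb A B) C x \<zeta>))"
    if "\<zeta> \<in> carrier C" for \<zeta>
    by (rule clin_comp[OF cbilinD2[OF q that] L])
  show "cl_assoc cb cc A B C (cl_pure cc (cl_tens cb A B) C (lact (cl_tens cb A B) w x) \<zeta>) =
      lact (cl_tens cb A (cl_tens cc B C)) w (cl_assoc cb cc A B C (cl_pure cc (cl_tens cb A B) C x \<zeta>))"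
    by (rule cl_tens_clin_eq[OF A.cmod_axioms B.cmod_axioms clin_comp[OF AB.lact_clin f[OF z]] clin_comp[OF f[OF z] T.lact_clin] _ x])
      (simp add: cl_tens_lact_pure[OF A B] P z cl_tens_lact_pure[OF A BC.cbimod_axioms] cl_pure_closed[OF B.cmod_axioms C.cmod_axioms])
  have z': "ract C \<zeta> v \<in> carrier C" using z by simp
  show "cl_assoc cb cc A B C (cl_pure cc (cl_tens cb A B) C x (ract C \<zeta> v)) =
      ract (cl_tens cb A (cl_tens cc B C)) (cl_assoc cb cc A B C (cl_pure cc (cl_tens cb A B) C x \<zeta>)) v"
    by (rule cl_tens_clin_eq[OF A.cmod_axioms B.cmod_axioms f[OF z'] clin_comp[OF f[OF z] T.ract_clin] _ x])
      (simp add: P z z' cl_tens_ract_pure[OF A BC.cbimod_axioms] cl_tens_ract_pure[OF B C] cl_pure_closed[OF B.cmod_axioms C.cmod_axioms])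
qed

context lagr_pair begin

lemma par_pow_clin: "clin F F (ext_parity L ^^ n)"
  by (induction n) (auto simp: clin_id[unfolded id_def[symmetric]] comp_def intro: clin_comp[OF _ par_clin] clin_id)

lemma par_pow_in: "x \<in> carrier F \<Longrightarrow> (ext_parity L ^^ n) x \<in> carrier F"
  by (rule clin_closed[OF par_pow_clin])

lemma par_pow_lact: "x \<in> carrier F \<Longrightarrow> (ext_parity L ^^ n) (lact F w x) = (-1) ^ n \<odot>\<^bsub>F\<^esub> lact F w ((ext_parity L ^^ n) x)"
  by (induction n)
    (simp_all add: F.smult_one clin_smult[OF par_clin] par_lact par_pow_in par_in F.smult_minus_left F.smult_minus_right)

lemma par_pow_ract: "x \<in> carrier F \<Longrightarrow> (ext_parity L ^^ n) (ract F x v) = (-1) ^ n \<odot>\<^bsub>F\<^esub> ract F ((ext_parity L ^^ n) x) v"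
  by (induction n)
    (simp_all add: F.smult_one clin_smult[OF par_clin] par_ract par_pow_in par_in F.smult_minus_left F.smult_minus_right)

lemma par_pow_vac: "(ext_parity L ^^ n) vac = vac"
  by (induction n) (simp_all add: par_vac)

text \<open>
  The right action on \<open>M \<otimes> \<Lambda>\<^sup>t\<^sup>o\<^sup>pK\<close> carries the sign \<open>(-1)\<^bsup>dim K\<^esup>\<close>; the power of the parity operator on the other
  factor produces the same sign, which makes the map balanced.
\<close>

lemma interchange_twist_props:
  assumes M: "cbimod cp ci M"
  shows interchange_twist_clin: "clin (tens (cl_tens ci M F) (ext_top K)) (cl_tens ci (top_twist M K) F) (interchange_twist ci cj M L K)"
    and interchange_twist_pure: "\<xi> \<in> carrier M \<Longrightarrow> \<eta> \<in> carrier F \<Longrightarrow> \<kappa> \<in> carrier (ext_top K) \<Longrightarrow>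
      interchange_twist ci cj M L K (pure (cl_tens ci M F) (ext_top K) (cl_pure ci M F \<xi> \<eta>) \<kappa>) =
      cl_pure ci (top_twist M K) F (pure M (ext_top K) \<xi> \<kappa>) ((ext_parity L ^^ cdim K) \<eta>)"
proof -
  interpret M: cbimod cp ci M by fact
  interpret X: cbimod cp ci "top_twist M K" by (rule cbimod_top_twist[OF M])
  let ?T = "cl_tens ci (top_twist M K) F"
  interpret T: cmod ?T by (rule cmod_cl_tens)
  let ?h = "\<lambda>\<kappa> \<xi> \<eta>. cl_pure ci (top_twist M K) F (pure M (ext_top K) \<xi> \<kappa>) ((ext_parity L ^^ cdim K) \<eta>)"
  note p = pure_cbilin[OF M.cmod_axioms cmod_ext_top, of K] and q = cl_pure_cbilin[OF X.cmod_axioms F.cmod_axioms, of ci]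
  have 1: "\<kappa> \<in> carrier (ext_top K) \<Longrightarrow> clin M (top_twist M K) (\<lambda>\<eta>. pure M (ext_top K) \<eta> \<kappa>)" for \<kappa>
    using cbilinD2[OF p] by (simp add: clin_top_twist_iff)
  have 2: "\<eta> \<in> carrier M \<Longrightarrow> clin (ext_top K) (top_twist M K) (pure M (ext_top K) \<eta>)" for \<eta>
    using cbilinD1[OF p] by (simp add: clin_top_twist_iff)
  have h1: "cbilin M F ?T (?h \<kappa>)" if "\<kappa> \<in> carrier (ext_top K)" for \<kappa>
    by (rule cbilin_comp[OF q 1[OF that] par_pow_clin])
  have h2: "balanced M F (?h \<kappa>)" if k: "\<kappa> \<in> carrier (ext_top K)" for \<kappa>
    unfolding balanced_def
  proof (intro ballI allI)
    fix m n w assume m: "m \<in> carrier M" and n: "n \<in> carrier F"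
    let ?s = "(-1) ^ cdim K :: complex"
    let ?n = "(ext_parity L ^^ cdim K) n"
    have n': "?n \<in> carrier F" by (rule par_pow_in[OF n])
    have s: "?s * ?s = 1" by (simp flip: power_add mult_2)
    have mk: "pure M (ext_top K) m \<kappa> \<in> carrier (top_twist M K)" using clin_closed[OF 1[OF k] m] .
    have mk': "pure M (ext_top K) (ract M m w) \<kappa> \<in> carrier (top_twist M K)" using clin_closed[OF 1[OF k]] m by simp
    have "?h \<kappa> m (lact F w n) = ?s \<odot>\<^bsub>?T\<^esub> cl_pure ci (top_twist M K) F (pure M (ext_top K) m \<kappa>) (lact F w ?n)"
      unfolding par_pow_lact[OF n] using n' by (intro clin_smult[OF cbilinD1[OF q mk]]) simp
    also have "cl_pure ci (top_twist M K) F (pure M (ext_top K) m \<kappa>) (lact F w ?n) =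
        cl_pure ci (top_twist M K) F (ract (top_twist M K) (pure M (ext_top K) m \<kappa>) w) ?n"
      using mk n' by (simp add: cl_pure_swap[OF X.cbimod_axioms F.cbimod_axioms])
    also have "ract (top_twist M K) (pure M (ext_top K) m \<kappa>) w = ?s \<odot>\<^bsub>top_twist M K\<^esub> pure M (ext_top K) (ract M m w) \<kappa>"
      using top_twist_ract_pure[OF M m k] by (simp add: top_twist_simps(4))
    also have "cl_pure ci (top_twist M K) F (?s \<odot>\<^bsub>top_twist M K\<^esub> pure M (ext_top K) (ract M m w) \<kappa>) ?n =
        ?s \<odot>\<^bsub>?T\<^esub> ?h \<kappa> (ract M m w) n"
      by (rule clin_smult[OF cbilinD2[OF q n'] mk'])
    finally show "?h \<kappa> (ract M m w) n = ?h \<kappa> m (lact F w n)"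
      using cbilin_closed[OF q mk' n'] by (simp add: T.smult_assoc T.smult_one s)
  qed
  have h3: "clin (ext_top K) ?T (\<lambda>\<kappa>. ?h \<kappa> \<xi> \<eta>)" if "\<xi> \<in> carrier M" "\<eta> \<in> carrier F" for \<xi> \<eta>
    by (rule clin_comp[OF 2[OF that(1)] cbilinD2[OF q par_pow_in[OF that(2)]]])
  note c = cl_tens_lift_param[where h = ?h and M = "ext_top K", OF M F.cbimod_axioms cmod_cl_tens h1 h2 h3 cmod_ext_top]
  show "clin (tens (cl_tens ci M F) (ext_top K)) ?T (interchange_twist ci cj M L K)"
    unfolding interchange_twist_def Let_def by (rule tens_lift_clin[OF cmod_cl_tens cmod_ext_top cmod_cl_tens c])
  assume x: "\<xi> \<in> carrier M" "\<eta> \<in> carrier F" "\<kappa> \<in> carrier (ext_top K)"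
  show "interchange_twist ci cj M L K (pure (cl_tens ci M F) (ext_top K) (cl_pure ci M F \<xi> \<eta>) \<kappa>) = ?h \<kappa> \<xi> \<eta>"
    unfolding interchange_twist_def Let_def
    using x by (subst tens_lift_pure[OF cmod_cl_tens cmod_ext_top cmod_cl_tens c])
      (auto simp: cl_pure_closed[OF M.cmod_axioms F.cmod_axioms]
        cl_tens_map_lift(2)[OF M F.cbimod_axioms cmod_cl_tens h1 h2])
qed

end


section \<open>The comparison map\<close>

lemma riesz_finite:
  assumes es: "dual_basis es es K" and f: "lin_on K f"
  obtains c where "c \<in> K" "\<And>u. u \<in> K \<Longrightarrow> cinner c u = f u"
proof -
  have K: "csubspace K" "set es \<subseteq> K" "K \<subseteq> cspan (set es)" and bi: "biorth es es"
    using es by (auto simp: dual_basis_def)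
  have "\<exists>c\<in>cspan (set es). \<forall>e\<in>set es. cinner c e = f e"
    using bi
  proof (induction es)
    case Nil
    show ?case by (auto simp: complex_vector.span_zero)
  next
    case (Cons e es)
    then obtain c where c: "c \<in> cspan (set es)" "\<forall>e\<in>set es. cinner c e = f e" by auto
    have "csubspace {v. cinner v e = 0}"
      by (rule complex_vector.subspaceI) (auto simp: cinner_add_left cinner_scaleC_left)
    then have "cspan (set es) \<subseteq> {v. cinner v e = 0}"
      using Cons.prems by (intro complex_vector.span_minimal) auto
    then have ce: "cinner c e = 0" using c(1) by auto
    have "cspan (set es) \<subseteq> cspan (set (e # es))" by (rule complex_vector.span_mono) auto
    then have "c + cnj (f e) *\<^sub>C e \<in> cspan (set (e # es))"
      using c(1) by (intro complex_vector.span_add[OF _ complex_vector.span_scale[OF complex_vector.span_base]]) auto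
    moreover have "\<forall>e'\<in>set (e # es). cinner (c + cnj (f e) *\<^sub>C e) e' = f e'"
      using c ce Cons.prems by (auto simp: cinner_add_left cinner_scaleC_left)
    ultimately show ?case by blast
  qed
  then obtain c where c: "c \<in> cspan (set es)" "\<forall>e\<in>set es. cinner c e = f e" by blast
  have cK: "c \<in> K" using c(1) K complex_vector.span_minimal by blast
  have f0: "f 0 = 0"
    using f complex_vector.subspace_0[OF K(1)] unfolding lin_on_def by (metis complex_vector.scale_zero_left)
  have "csubspace {u \<in> K. cinner c u = f u}"
    using f f0 complex_vector.subspace_0[OF K(1)] complex_vector.subspace_add[OF K(1)] complex_vector.subspace_scale[OF K(1)]
    by (intro complex_vector.subspaceI) (auto simp: lin_on_def cinner_add_right cinner_scaleC_right)
  then have "cspan (set es) \<subseteq> {u \<in> K. cinner c u = f u}"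
    using c(2) K(2) by (intro complex_vector.span_minimal) auto
  then show ?thesis using K(3) cK by (intro that[of c]) auto
qed

lemma cfinite_dim_subset: "cfinite_dim K \<Longrightarrow> K' \<subseteq> K \<Longrightarrow> cfinite_dim K'"
  unfolding cfinite_dim_def by blast

lemma dual_basis_flip:
  assumes "dual_basis us bs K" "set us \<subseteq> K" shows "dual_basis bs us K"
proof -
  have K: "csubspace K" "set bs \<subseteq> K" "K \<subseteq> cspan (set bs)" and bi: "biorth us bs"
    using assms(1) by (auto simp: dual_basis_def)
  have fl: "biorth bs us" using bi
  proof (induction us bs rule: biorth.induct)
    case (2 u us b bs)
    have "cinner b u = 1" using 2 cinner_commute[of b u] by simp
    then show ?case using 2 by (auto simp: cinner_eq_0_sym[of b] cinner_eq_0_sym[of _ u])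
  qed auto
  have "v \<in> cspan (set us)" if v: "v \<in> K" for v
  proof -
    obtain s where s: "s \<in> cspan (set us)" "\<forall>b\<in>set bs. cinner b (v - s) = 0"
      using biorth_approx[OF fl] by blast
    have "s \<in> K" using s(1) assms(2) K(1) complex_vector.span_minimal by blast
    then have vs: "v - s \<in> K" using v K(1) by (simp add: complex_vector.subspace_diff)
    have "csubspace {k. cinner k (v - s) = 0}"
      by (rule complex_vector.subspaceI) (auto simp: cinner_add_left cinner_scaleC_left)
    then have "cspan (set bs) \<subseteq> {k. cinner k (v - s) = 0}"
      using s(2) by (intro complex_vector.span_minimal) auto
    then have "cinner (v - s) (v - s) = 0" using vs K(3) by blast
    then show ?thesis using s(1) by simp
  qed
  then show ?thesis using fl K assms(2) by (auto simp: dual_basis_def)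
qed

lemma (in lagr_pair) conj_in_orth: "(p, q) \<in> L \<Longrightarrow> (ci p, - cj q) \<in> orth L"
  using conj_eq pair_conj_simp[of p q] by (metis imageI)

locale gluing_square =
  P012: gluing_pair c0 c1 c2 L01 L12 L02 \<alpha>012 + P013: gluing_pair c0 c1 c3 L01 L13 L03 \<alpha>013 +
  P023: gluing_pair c0 c2 c3 L02 L23 L03 \<alpha>023 + P123: gluing_pair c1 c2 c3 L12 L23 L13 \<alpha>123
  for c0 :: "'w0::hermitian_space \<Rightarrow> 'w0" and c1 :: "'w1::hermitian_space \<Rightarrow> 'w1"
    and c2 :: "'w2::hermitian_space \<Rightarrow> 'w2" and c3 :: "'w3::hermitian_space \<Rightarrow> 'w3"
    and L01 L12 L23 L02 L13 L03 \<alpha>012 \<alpha>013 \<alpha>023 \<alpha>123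
begin

abbreviation "K012 \<equiv> Kspace L01 L12"
abbreviation "K013 \<equiv> Kspace L01 L13"
abbreviation "K023 \<equiv> Kspace L02 L23"
abbreviation "K123 \<equiv> Kspace L12 L23"
abbreviation "A' \<equiv> orth K012 \<inter> K013"
abbreviation "B' \<equiv> orth K123 \<inter> K023"
abbreviation "r0 \<equiv> rho0 K123 K023 L12"

lemmas sL01 = P012.A.sub and sL12 = P012.B.sub and sL23 = P023.B.sub
lemmas sK012 = P012.K_sub and sK013 = P013.K_sub and sK023 = P023.K_sub and sK123 = P123.K_sub

lemma zero_in: "(0, 0) \<in> L01" "(0, 0) \<in> L12" "(0, 0) \<in> L23"
  using complex_vector.subspace_0[OF sL01] complex_vector.subspace_0[OF sL12] complex_vector.subspace_0[OF sL23]
  by (simp_all add: zero_prod_def)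

lemma K012_le: "K012 \<subseteq> K013"
  using zero_in by (auto simp: Kspace_def P123.comp)

lemma K123_le: "K123 \<subseteq> K023"
  using zero_in by (auto simp: Kspace_def P012.comp)

lemma sA': "csubspace A'" and sB': "csubspace B'"
  by (intro complex_vector.subspace_inter csubspace_orth sK013 sK023)+

lemma L12_add: "(a, b) \<in> L12 \<Longrightarrow> (a', b') \<in> L12 \<Longrightarrow> (a + a', b + b') \<in> L12"
  and L12_diff: "(a, b) \<in> L12 \<Longrightarrow> (a', b') \<in> L12 \<Longrightarrow> (a - a', b - b') \<in> L12"
  and L12_scale: "(a, b) \<in> L12 \<Longrightarrow> (s *\<^sub>C a, s *\<^sub>C b) \<in> L12"
  using complex_vector.subspace_add[OF sL12, of "(a, b)" "(a', b')"] complex_vector.subspace_diff[OF sL12, of "(a, b)" "(a', b')"]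
    complex_vector.subspace_scale[OF sL12, of "(a, b)" s] by simp_all

lemma L12_K023: "u \<in> K013 \<Longrightarrow> (u, s) \<in> L12 \<Longrightarrow> (s, 0) \<in> L23 \<Longrightarrow> s \<in> K023"
  by (auto simp: Kspace_def P012.comp)

lemma orthD: "s \<in> S \<Longrightarrow> v \<in> orth S \<Longrightarrow> cinner s v = 0"
  by (simp add: orth_iff)

lemma orth_meet: "x \<in> orth S \<Longrightarrow> x \<in> S \<Longrightarrow> x = 0"
  by (auto simp: orth_iff dest!: bspec[of _ _ x])

text \<open>
  Two candidates for \<open>\<rho>\<^sub>0 u\<close> differ by an element of \<open>K123\<close>, which is also orthogonal to \<open>K123\<close>. Existence
  is by projecting away the component of an arbitrary candidate in \<open>K123\<close>.
\<close>

lemma r0_unique: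
  assumes "s \<in> B'" "(u, s) \<in> L12" "t \<in> B'" "(u, t) \<in> L12" shows "s = t"
proof -
  have "(0, s - t) \<in> L12" using L12_diff[OF assms(2,4)] by simp
  moreover have "s - t \<in> B'" using assms by (intro complex_vector.subspace_diff[OF sB'])
  moreover from this have "(s - t, 0) \<in> L23" by (simp add: Kspace_def)
  ultimately have "s - t \<in> K123" "s - t \<in> orth K123" by (auto simp: Kspace_def)
  then show ?thesis using orth_meet by force
qed

lemma r0_ex:
  assumes u: "u \<in> A'" shows "\<exists>s. s \<in> B' \<and> (u, s) \<in> L12"
proof -
  obtain s where s: "(u, s) \<in> L12" "(s, 0) \<in> L23" using u by (auto simp: Kspace_def P123.comp)
  have sK: "s \<in> K023" using u s by (intro L12_K023) auto
  note p = proj_exists[OF sK123 P123.fin, of s]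
  have "s - proj K123 s \<in> B'"
    using p K123_le sK complex_vector.subspace_diff[OF sK023] by blast
  moreover have "(0, proj K123 s) \<in> L12" using p(1) by (simp add: Kspace_def)
  then have "(u, s - proj K123 s) \<in> L12" using L12_diff[OF s(1)] by fastforce
  ultimately show ?thesis by blast
qed

lemma r0: assumes "u \<in> A'" shows r0_in: "r0 u \<in> B'" and r0_rel: "(u, r0 u) \<in> L12"
proof -
  obtain s where s: "s \<in> B'" "(u, s) \<in> L12" using r0_ex[OF assms] by blast
  have "r0 u = s" unfolding rho0_def
    using s r0_unique by (intro the_equality) blast+
  with s show "r0 u \<in> B'" "(u, r0 u) \<in> L12" by auto
qed

lemma r0_eqI: "u \<in> A' \<Longrightarrow> s \<in> B' \<Longrightarrow> (u, s) \<in> L12 \<Longrightarrow> r0 u = s"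
  using r0_unique r0_in r0_rel by blast

lemma r0_lin: "lin_on A' r0"
  unfolding lin_on_def
  using r0_in r0_rel
  by (auto simp del: Int_iff intro!: r0_eqI complex_vector.subspace_add[OF sA'] complex_vector.subspace_add[OF sB']
      complex_vector.subspace_scale[OF sA'] complex_vector.subspace_scale[OF sB'] L12_add L12_scale)

lemma r0_inj: assumes "u \<in> A'" "v \<in> A'" "r0 u = r0 v" shows "u = v"
proof -
  have "(u - v, 0) \<in> L12" using L12_diff[OF r0_rel[OF assms(1)] r0_rel[OF assms(2)]] assms(3) by simp
  moreover have w: "u - v \<in> A'" using assms by (intro complex_vector.subspace_diff[OF sA'])
  moreover from this have "(0, u - v) \<in> L01" by (simp add: Kspace_def)
  ultimately have "u - v \<in> K012" by (simp add: Kspace_def)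
  then show ?thesis using w orth_meet by force
qed

lemma r0_surj: assumes s: "s \<in> B'" obtains u where "u \<in> A'" "r0 u = s"
proof -
  obtain r where r: "(0, r) \<in> L01" "(r, s) \<in> L12" "(s, 0) \<in> L23" using s by (auto simp: Kspace_def P012.comp)
  have rK: "r \<in> K013" using r by (auto simp: Kspace_def P123.comp)
  note p = proj_exists[OF sK012 P012.fin, of r]
  have u: "r - proj K012 r \<in> A'"
    using p K012_le rK complex_vector.subspace_diff[OF sK013] by blast
  have "(proj K012 r, 0) \<in> L12" using p(1) by (simp add: Kspace_def)
  then have "(r - proj K012 r, s) \<in> L12" using L12_diff[OF r(2)] by fastforce
  then show ?thesis using r0_eqI[OF u s] u that by blast
qed

lemma fin_A': "cfinite_dim A'" and fin_B': "cfinite_dim B'"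
  using P013.fin P023.fin by (auto intro: cfinite_dim_subset)

lemma proj_mem: "k \<in> K \<Longrightarrow> csubspace K \<Longrightarrow> proj K k = k"
  by (rule proj_eqI) (auto simp: complex_vector.subspace_0[OF csubspace_orth])

lemma proj_orth: "k \<in> orth K \<Longrightarrow> csubspace K \<Longrightarrow> proj K k = 0"
  by (rule proj_eqI) (auto simp: complex_vector.subspace_0)

lemma split013: "x \<in> K013 \<Longrightarrow> proj K012 x \<in> K012 \<and> x - proj K012 x \<in> A'"
  using proj_exists[OF sK012 P012.fin, of x] K012_le complex_vector.subspace_diff[OF sK013] by blast

lemma proj012_lin: "proj K012 (x + y) = proj K012 x + proj K012 y" "proj K012 (s *\<^sub>C x) = s *\<^sub>C proj K012 x"
proof -
  note p = proj_exists[OF sK012 P012.fin]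
  have "(x + y) - (proj K012 x + proj K012 y) = (x - proj K012 x) + (y - proj K012 y)" by simp
  then have "(x + y) - (proj K012 x + proj K012 y) \<in> orth K012"
    using complex_vector.subspace_add[OF csubspace_orth p(2)[of x] p(2)[of y]] by (simp only:)
  then show "proj K012 (x + y) = proj K012 x + proj K012 y"
    by (intro proj_eqI sK012 complex_vector.subspace_add[OF sK012] p(1))
  have "s *\<^sub>C x - s *\<^sub>C proj K012 x = s *\<^sub>C (x - proj K012 x)"
    by (simp add: complex_vector.scale_right_diff_distrib)
  then have "s *\<^sub>C x - s *\<^sub>C proj K012 x \<in> orth K012"
    using complex_vector.subspace_scale[OF csubspace_orth p(2)[of x], of s] by (simp only:)
  then show "proj K012 (s *\<^sub>C x) = s *\<^sub>C proj K012 x"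
    by (intro proj_eqI sK012 complex_vector.subspace_scale[OF sK012] p(1))
qed

abbreviation "\<rho>' \<equiv> rho K012 K123 K023 L12"
abbreviation "KK \<equiv> K013 \<times> K123"

lemma rho_Pair: "\<rho>' (x, u) = (proj K012 x, u + r0 (x - proj K012 x))"
  by (simp add: rho_def)

lemma rho_lin: "lin_on KK \<rho>'"
proof -
  note r = r0_lin[unfolded lin_on_def, THEN conjunct1, rule_format] r0_lin[unfolded lin_on_def, THEN conjunct2, rule_format]
  have "\<rho>' ((x, u) + (y, v)) = \<rho>' (x, u) + \<rho>' (y, v)" if "x \<in> K013" "y \<in> K013" for x y u v
  proof -
    have e: "x + y - (proj K012 x + proj K012 y) = (x - proj K012 x) + (y - proj K012 y)" by simp
    show ?thesis
      unfolding add_Pair rho_Pair proj012_lin e r(1)[OF split013[THEN conjunct2] split013[THEN conjunct2], OF that]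
      by simp
  qed
  moreover have "\<rho>' (s *\<^sub>C (x, u)) = s *\<^sub>C \<rho>' (x, u)" if "x \<in> K013" for s x u
  proof -
    have e: "s *\<^sub>C x - s *\<^sub>C proj K012 x = s *\<^sub>C (x - proj K012 x)"
      by (simp add: complex_vector.scale_right_diff_distrib)
    show ?thesis
      unfolding scaleC_Pair rho_Pair proj012_lin e r(2)[OF split013[THEN conjunct2], OF that]
      by (simp add: scaleC_add_right)
  qed
  ultimately show ?thesis unfolding lin_on_def by auto
qed

lemma rho_in: "\<rho>' ` KK \<subseteq> K012 \<times> K023"
proof
  fix y assume "y \<in> \<rho>' ` KK"
  then obtain x u where x: "x \<in> K013" "u \<in> K123" "y = \<rho>' (x, u)" by blast
  have "r0 (x - proj K012 x) \<in> K023" using r0_in[OF split013[OF x(1), THEN conjunct2]] by blast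
  then have "u + r0 (x - proj K012 x) \<in> K023"
    using x(2) K123_le by (intro complex_vector.subspace_add[OF sK023]) blast+
  then show "y \<in> K012 \<times> K023" using split013[OF x(1)] by (simp add: x(3) rho_Pair)
qed

text \<open>
  The endomorphism \<open>\<rho>\<^sup>*\<rho>\<close> of \<open>K013 \<oplus> K123\<close>, whose determinant occurs in the theorem.
\<close>

definition T where "T x = adjoint_on KK \<rho>' (\<rho>' x)"

lemma sKK: "csubspace KK"
  by (rule csubspace_Times[OF sK013 sK123])

lemma T_eqI:
  assumes "z \<in> KK" "\<And>k. k \<in> KK \<Longrightarrow> cinner z k = cinner (\<rho>' x) (\<rho>' k)" shows "T x = z"
  unfolding T_def adjoint_on_def
proof (rule the_equality)
  fix y assume y: "y \<in> KK \<and> (\<forall>k\<in>KK. cinner y k = cinner (\<rho>' x) (\<rho>' k))"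
  have d: "y - z \<in> KK" using y assms(1) by (intro complex_vector.subspace_diff[OF sKK]) auto
  then have "cinner y (y - z) = cinner z (y - z)" using y assms(2)[OF d] by (metis (no_types))
  then have "cinner (y - z) (y - z) = 0" by (simp add: cinner_diff_left)
  then show "y = z" by simp
qed (use assms in auto)

lemma T_props: "T x \<in> KK" "k \<in> KK \<Longrightarrow> cinner (T x) k = cinner (\<rho>' x) (\<rho>' k)"
proof -
  obtain es where es: "dual_basis es es K013" using orthonormal_basis_exists[OF sK013 P013.fin] by blast
  obtain fs where fs: "dual_basis fs fs K123" using orthonormal_basis_exists[OF sK123 P123.fin] by blast
  have l: "lin_on KK (\<lambda>k. cinner (\<rho>' x) (\<rho>' k))"
    using rho_lin unfolding lin_on_def by (simp add: cinner_add_right cinner_scaleC_right)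
  obtain z where z: "z \<in> KK" "\<And>k. k \<in> KK \<Longrightarrow> cinner z k = cinner (\<rho>' x) (\<rho>' k)"
    using riesz_finite[OF dual_basis_Times[OF es fs] l] by blast
  then have "T x = z" by (rule T_eqI)
  with z show "T x \<in> KK" "k \<in> KK \<Longrightarrow> cinner (T x) k = cinner (\<rho>' x) (\<rho>' k)" by auto
qed

lemma T_lin: "lin_on KK T"
  unfolding lin_on_def
proof (intro conjI ballI allI)
  fix v w assume "v \<in> KK" "w \<in> KK"
  then have "\<rho>' (v + w) = \<rho>' v + \<rho>' w" using rho_lin unfolding lin_on_def by blast
  then show "T (v + w) = T v + T w"
    by (intro T_eqI complex_vector.subspace_add[OF sKK] T_props(1)) (simp add: T_props(2) cinner_add_left)
next
  fix a v assume "v \<in> KK"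
  then have "\<rho>' (a *\<^sub>C v) = a *\<^sub>C \<rho>' v" using rho_lin unfolding lin_on_def by blast
  then show "T (a *\<^sub>C v) = a *\<^sub>C T v"
    by (intro T_eqI complex_vector.subspace_scale[OF sKK] T_props(1)) (simp add: T_props(2) cinner_scaleC_left)
qed

subsection \<open>Vectors that pass the middle factor\<close>

text \<open>
  The condition of \<open>vector_passes_middle\<close> under which \<open>p\<close> on the left of the middle vacuum can be traded for \<open>q\<close> on
  its right; by the Lagrangian condition, orthogonal complements are conjugates.
\<close>

definition passes :: "'w1 \<Rightarrow> 'w2 \<Rightarrow> bool" where
  "passes p q \<longleftrightarrow> (\<exists>z x x' y y' v. p = x + x' \<and> q = y' - y \<and> (z, x) \<in> orth L01 \<and> (x', y) \<in> orth L12 \<and> (y', v) \<in> orth L23)"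

lemma passes_add: assumes "passes p q" "passes p' q'" shows "passes (p + p') (q + q')"
proof -
  obtain z x x' y y' v where 1: "p = x + x'" "q = y' - y" "(z, x) \<in> orth L01" "(x', y) \<in> orth L12" "(y', v) \<in> orth L23"
    using assms(1) unfolding passes_def by blast
  obtain z1 x1 x1' y1 y1' v1 where 2: "p' = x1 + x1'" "q' = y1' - y1" "(z1, x1) \<in> orth L01" "(x1', y1) \<in> orth L12" "(y1', v1) \<in> orth L23"
    using assms(2) unfolding passes_def by blast
  note s = complex_vector.subspace_add[OF csubspace_orth]
  have "(z + z1, x + x1) \<in> orth L01" "(x' + x1', y + y1) \<in> orth L12" "(y' + y1', v + v1) \<in> orth L23"
    using s[OF 1(3) 2(3)] s[OF 1(4) 2(4)] s[OF 1(5) 2(5)] by simp_all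
  moreover have "p + p' = (x + x1) + (x' + x1')" "q + q' = (y' + y1') - (y + y1)" by (simp_all add: 1 2)
  ultimately show ?thesis unfolding passes_def by blast
qed

lemma orth_zero: "(0, 0) \<in> orth L01" "(0, 0) \<in> orth L12" "(0, 0) \<in> orth L23"
  using complex_vector.subspace_0[OF csubspace_orth[of L01]] complex_vector.subspace_0[OF csubspace_orth[of L12]]
    complex_vector.subspace_0[OF csubspace_orth[of L23]] by (simp_all add: zero_prod_def)

text \<open>
  Decompose \<open>w\<close> for the pair \<open>(L01, L13)\<close>. The conjugate of \<open>L13\<close> factors through those of \<open>L12\<close> and \<open>L23\<close>, and the
  vectors of \<open>W\<^sub>2\<close> in between cancel.
\<close>

lemma passes_left: "\<exists>k\<in>K013. passes (w - k) 0"
proof -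
  obtain z x x' v k where w: "w = x + x' + k" "(z, x) \<in> pair_conj c0 c1 ` L01"
     "(x', v) \<in> pair_conj c1 c3 ` L13" "k \<in> K013" by (rule P013.middle_space_spanned)
  obtain p q where pq: "(p, q) \<in> L13" "x' = c1 p" "v = - c3 q"
    using w(3) by (auto simp: pair_conj_def neg_conj_def)
  from pq(1) obtain s where s: "(p, s) \<in> L12" "(s, q) \<in> L23" by (auto simp: P123.comp)
  have 1: "(x', - c2 s) \<in> orth L12" unfolding pq(2) by (rule P012.B.conj_in_orth[OF s(1)])
  have "(c2 s, - c3 q) \<in> orth L23" by (rule P023.B.conj_in_orth[OF s(2)])
  then have 2: "(- c2 s, c3 q) \<in> orth L23"
    using complex_vector.subspace_neg[OF csubspace_orth, of "(c2 s, - c3 q)" L23] by simp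
  have "(z, x) \<in> orth L01" using w(2) P012.A.conj_eq by simp
  moreover have "w - k = x + x'" "0 = - c2 s - (- c2 s)" using w by simp_all
  ultimately have "passes (w - k) 0" unfolding passes_def using 1 2 by blast
  then show ?thesis using w(4) by blast
qed

lemma passes_modulo: "\<exists>k\<in>K013. \<exists>l\<in>K123. passes (p - k) (q - l)"
proof -
  obtain z x x' v l where q: "q = x + x' + l" "(z, x) \<in> pair_conj c1 c2 ` L12"
     "(x', v) \<in> pair_conj c2 c3 ` L23" "l \<in> K123" by (rule P123.middle_space_spanned)
  have "(z, x) \<in> orth L12" "(x', v) \<in> orth L23" using q P012.B.conj_eq P023.B.conj_eq by simp_all
  then have "(- z, - x) \<in> orth L12" "(x', v) \<in> orth L23"
    using complex_vector.subspace_neg[OF csubspace_orth, of "(z, x)" L12] by simp_all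
  moreover have "- z = 0 + - z" "q - l = x' - (- x)" using q by simp_all
  ultimately have 1: "passes (- z) (q - l)" unfolding passes_def using orth_zero by blast
  obtain k where k: "k \<in> K013" "passes ((p + z) - k) 0" using passes_left by blast
  have "passes (- z + ((p + z) - k)) ((q - l) + 0)" by (rule passes_add[OF 1 k(2)])
  moreover have "- z + ((p + z) - k) = p - k" "(q - l) + 0 = q - l" by simp_all
  ultimately show ?thesis using k q(4) by metis
qed

text \<open>
  The three terms of a pair that passes are orthogonal to \<open>(0, n1)\<close>, \<open>(n1, - n2)\<close> and \<open>(n2, 0)\<close>, and the sum of
  the three relations is the claim.
\<close>

lemma passes_orth:
  assumes "passes p q" and n: "(0, n1) \<in> L01" "(n1, - n2) \<in> L12" "(n2, 0) \<in> L23"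
  shows "cinner n1 p + cinner n2 q = 0"
proof -
  obtain z x x' y y' v where 1: "p = x + x'" "q = y' - y" "(z, x) \<in> orth L01" "(x', y) \<in> orth L12" "(y', v) \<in> orth L23"
    using assms(1) unfolding passes_def by blast
  have "cinner (0, n1) (z, x) = 0" "cinner (n1, - n2) (x', y) = 0" "cinner (n2, 0) (y', v) = 0"
    using n 1 unfolding orth_iff by blast+
  then show ?thesis by (simp add: 1 cinner_add_right cinner_diff_right)
qed

subsection \<open>Adapted bases\<close>

text \<open>
  \<open>as\<close>, \<open>bs\<close>, \<open>\<beta>s\<close> are orthonormal bases of \<open>K012\<close>, \<open>K123\<close> and of the orthogonal complement of
  \<open>K123\<close> in \<open>K023\<close>; \<open>ps\<close> are the preimages of \<open>\<beta>s\<close> under \<open>\<rho>\<^sub>0\<close>, and \<open>cs = \<rho>\<^sub>0\<^sup>* \<beta>s\<close>. Hence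
  \<open>cs\<close> is the basis dual to \<open>ps\<close>, and it is the image of \<open>ps\<close> under \<open>\<rho>\<^sub>0\<^sup>*\<rho>\<^sub>0\<close>.
\<close>

definition adapted :: "'w1 list \<Rightarrow> 'w2 list \<Rightarrow> 'w2 list \<Rightarrow> 'w1 list \<Rightarrow> 'w1 list \<Rightarrow> bool" where
  "adapted as bs \<beta>s ps cs \<longleftrightarrow> dual_basis as as K012 \<and> dual_basis bs bs K123 \<and> dual_basis \<beta>s \<beta>s B' \<and>
     set ps \<subseteq> A' \<and> map r0 ps = \<beta>s \<and> length cs = length ps \<and> set cs \<subseteq> A' \<and>
     (\<forall>i<length ps. \<forall>u\<in>A'. cinner (cs ! i) u = cinner (\<beta>s ! i) (r0 u))"

lemma adapted_exists: obtains as bs \<beta>s ps cs where "adapted as bs \<beta>s ps cs"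
proof -
  obtain as where as: "dual_basis as as K012" using orthonormal_basis_exists[OF sK012 P012.fin] by blast
  obtain bs where bs: "dual_basis bs bs K123" using orthonormal_basis_exists[OF sK123 P123.fin] by blast
  obtain \<beta>s where \<beta>s: "dual_basis \<beta>s \<beta>s B'" using orthonormal_basis_exists[OF sB' fin_B'] by blast
  obtain es where es: "dual_basis es es A'" using orthonormal_basis_exists[OF sA' fin_A'] by blast
  have "\<forall>\<beta>\<in>B'. \<exists>u. u \<in> A' \<and> r0 u = \<beta>" using r0_surj by metis
  then obtain g where g: "\<And>\<beta>. \<beta> \<in> B' \<Longrightarrow> g \<beta> \<in> A' \<and> r0 (g \<beta>) = \<beta>" by metis
  have "\<exists>c. c \<in> A' \<and> (\<forall>u\<in>A'. cinner c u = cinner \<beta> (r0 u))" for \<beta>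
  proof -
    have "lin_on A' (\<lambda>u. cinner \<beta> (r0 u))"
      using r0_lin unfolding lin_on_def by (simp add: cinner_add_right cinner_scaleC_right)
    then show ?thesis using riesz_finite[OF es] by metis
  qed
  then obtain h where h: "\<And>\<beta>. h \<beta> \<in> A' \<and> (\<forall>u\<in>A'. cinner (h \<beta>) u = cinner \<beta> (r0 u))" by metis
  have B: "set \<beta>s \<subseteq> B'" using \<beta>s by (simp add: dual_basis_def)
  have "map r0 (map g \<beta>s) = \<beta>s" using g B by (intro nth_equalityI) (auto simp: subset_iff)
  moreover have "set (map g \<beta>s) \<subseteq> A'" "set (map h \<beta>s) \<subseteq> A'" using g h B unfolding set_map by blast+
  ultimately have "adapted as bs \<beta>s (map g \<beta>s) (map h \<beta>s)"
    using as bs \<beta>s h unfolding adapted_def by (simp del: Int_iff map_map)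
  then show ?thesis using that by blast
qed

lemma orth_commute: "(\<forall>s\<in>S. cinner v s = 0) \<longleftrightarrow> v \<in> orth S"
  by (auto simp: orth_iff cinner_eq_0_sym[of v])

context
  fixes as bs \<beta>s ps cs
  assumes ad: "adapted as bs \<beta>s ps cs"
begin

lemma ad_bases: "dual_basis as as K012" "dual_basis bs bs K123" "dual_basis \<beta>s \<beta>s B'"
  and ad_ps: "set ps \<subseteq> A'" and ad_r0: "map r0 ps = \<beta>s" and ad_len: "length cs = length ps"
  and ad_cs: "set cs \<subseteq> A'" and ad_c: "\<And>i u. i < length ps \<Longrightarrow> u \<in> A' \<Longrightarrow> cinner (cs ! i) u = cinner (\<beta>s ! i) (r0 u)"
  using ad by (auto simp: adapted_def)

lemma ad_len': "length \<beta>s = length ps" using ad_r0 by (metis length_map)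

lemma r0_nth: "i < length ps \<Longrightarrow> r0 (ps ! i) = \<beta>s ! i"
  using ad_r0 by (metis nth_map)

lemma biorth_\<beta>s: "biorth \<beta>s \<beta>s" using ad_bases by (simp add: dual_basis_def)

lemma nth_A': "i < length ps \<Longrightarrow> ps ! i \<in> A'" "i < length ps \<Longrightarrow> cs ! i \<in> A'"
  using ad_ps ad_cs ad_len by (metis nth_mem subsetD)+

lemma biorth_cs_ps: "biorth cs ps"
  using biorth_nth[OF biorth_\<beta>s] ad_len ad_len' nth_A'
  by (intro biorth_nthI) (simp_all del: Int_iff add: ad_c r0_nth)

lemma as_in: "set as \<subseteq> K012" and bs_in: "set bs \<subseteq> K123" and \<beta>s_in: "set \<beta>s \<subseteq> B'"
  using ad_bases by (auto simp: dual_basis_def)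

text \<open>
  The spanning part uses that \<open>\<rho>\<^sub>0\<close> is injective and maps \<open>ps\<close> to a basis of its target.
\<close>

lemma basis013: "dual_basis (as @ cs) (as @ ps) K013"
proof -
  have "biorth (as @ cs) (as @ ps)"
  proof (subst biorth_append, simp, intro conjI biorth_cs_ps)
    show "biorth as as" using ad_bases(1) by (simp add: dual_basis_def)
    show "\<forall>u\<in>set as. \<forall>b\<in>set ps. cinner u b = 0" using as_in ad_ps orthD by blast
    have "\<forall>u\<in>set cs. \<forall>b\<in>set as. cinner b u = 0" using as_in ad_cs orthD by blast
    then show "\<forall>u\<in>set cs. \<forall>b\<in>set as. cinner u b = 0" using cinner_eq_0_sym by blast
  qed
  moreover have "set (as @ ps) \<subseteq> K013" using as_in K012_le ad_ps by auto
  moreover have "K013 \<subseteq> cspan (set (as @ ps))"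
  proof
    fix x assume x: "x \<in> K013"
    let ?v = "x - proj K012 x"
    have v: "?v \<in> A'" and p: "proj K012 x \<in> K012" using split013[OF x] by auto
    have spA: "cspan (set ps) \<subseteq> A'" using ad_ps sA' by (rule complex_vector.span_minimal)
    have r: "r0 (u + w) = r0 u + r0 w" "r0 (s *\<^sub>C u) = s *\<^sub>C r0 u" if "u \<in> A'" "w \<in> A'" for u w s
      using r0_lin that unfolding lin_on_def by blast+
    have "csubspace (r0 ` cspan (set ps))"
    proof (rule complex_vector.subspaceI)
      have "r0 0 = 0" using r(2)[OF complex_vector.subspace_0[OF sA'] complex_vector.subspace_0[OF sA'], of 0] by simp
      then show "0 \<in> r0 ` cspan (set ps)" using complex_vector.span_zero by (metis image_eqI)
    next
      fix s t assume "s \<in> r0 ` cspan (set ps)" "t \<in> r0 ` cspan (set ps)"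
      then obtain u w where u: "u \<in> cspan (set ps)" "w \<in> cspan (set ps)" "s = r0 u" "t = r0 w" by blast
      have "u \<in> A'" "w \<in> A'" using u(1,2) spA by blast+
      then have "s + t = r0 (u + w)" using u(3,4) r(1)[of u w] by (simp only:)
      then show "s + t \<in> r0 ` cspan (set ps)" using complex_vector.span_add[OF u(1,2)] by blast
    next
      fix a s assume "s \<in> r0 ` cspan (set ps)"
      then obtain u where u: "u \<in> cspan (set ps)" "s = r0 u" by blast
      have "u \<in> A'" using u(1) spA by blast
      then have "a *\<^sub>C s = r0 (a *\<^sub>C u)" using u(2) r(2)[of u u a] by (simp only:)
      then show "a *\<^sub>C s \<in> r0 ` cspan (set ps)" using complex_vector.span_scale[OF u(1)] by blast
    qed
    moreover have "set \<beta>s \<subseteq> r0 ` cspan (set ps)"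
      using ad_r0 complex_vector.span_base by (metis image_mono set_map subsetI)
    ultimately have "B' \<subseteq> r0 ` cspan (set ps)"
      using ad_bases(3) complex_vector.span_minimal unfolding dual_basis_def by blast
    then obtain u where u: "u \<in> cspan (set ps)" "r0 ?v = r0 u" using r0_in[OF v] by blast
    then have "?v = u" using r0_inj[OF v] spA by blast
    moreover have "cspan (set ps) \<subseteq> cspan (set (as @ ps))" "cspan (set as) \<subseteq> cspan (set (as @ ps))"
      by (intro complex_vector.span_mono; simp)+
    ultimately have "?v \<in> cspan (set (as @ ps))" "proj K012 x \<in> cspan (set (as @ ps))"
      using u(1) p ad_bases(1) unfolding dual_basis_def by blast+
    then have "?v + proj K012 x \<in> cspan (set (as @ ps))" by (rule complex_vector.span_add)
    then show "x \<in> cspan (set (as @ ps))" by simp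
  qed
  ultimately show ?thesis using sK013 by (simp add: dual_basis_def)
qed

lemma basis013': "dual_basis (as @ ps) (as @ cs) K013"
  using as_in K012_le ad_cs by (intro dual_basis_flip[OF basis013]) auto

lemma basis023: "dual_basis (\<beta>s @ bs) (\<beta>s @ bs) K023"
proof -
  have "biorth (\<beta>s @ bs) (\<beta>s @ bs)"
  proof (subst biorth_append, simp, intro conjI)
    show "biorth \<beta>s \<beta>s" "biorth bs bs" using ad_bases by (simp_all add: dual_basis_def)
    show *: "\<forall>u\<in>set bs. \<forall>b\<in>set \<beta>s. cinner u b = 0" using bs_in \<beta>s_in orthD by blast
    then show "\<forall>u\<in>set \<beta>s. \<forall>b\<in>set bs. cinner u b = 0" using cinner_eq_0_sym by blast
  qed
  moreover have "set (\<beta>s @ bs) \<subseteq> K023" using \<beta>s_in bs_in K123_le by auto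
  moreover have "K023 \<subseteq> cspan (set (\<beta>s @ bs))"
  proof
    fix x assume x: "x \<in> K023"
    note p = proj_exists[OF sK123 P123.fin, of x]
    have "x - proj K123 x \<in> B'" using p x K123_le complex_vector.subspace_diff[OF sK023] by blast
    moreover have "cspan (set \<beta>s) \<subseteq> cspan (set (\<beta>s @ bs))" "cspan (set bs) \<subseteq> cspan (set (\<beta>s @ bs))"
      by (intro complex_vector.span_mono; simp)+
    ultimately have "x - proj K123 x \<in> cspan (set (\<beta>s @ bs))" "proj K123 x \<in> cspan (set (\<beta>s @ bs))"
      using p(1) ad_bases(2,3) unfolding dual_basis_def by blast+
    then have "(x - proj K123 x) + proj K123 x \<in> cspan (set (\<beta>s @ bs))" by (rule complex_vector.span_add)
    then show "x \<in> cspan (set (\<beta>s @ bs))" by simp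
  qed
  ultimately show ?thesis using sK023 by (simp add: dual_basis_def)
qed

definition fs where "fs = map (\<lambda>a. (a, 0)) (as @ ps) @ map (\<lambda>b. (0 :: 'w1, b)) bs"
definition gs where "gs = map (\<lambda>a. (a, 0)) (as @ cs) @ map (\<lambda>b. (0 :: 'w1, b)) bs"

lemma r0_0: "r0 0 = 0"
proof -
  have "r0 (0 *\<^sub>C 0) = 0 *\<^sub>C r0 0"
    using r0_lin complex_vector.subspace_0[OF sA'] unfolding lin_on_def by blast
  then show ?thesis by simp
qed

lemma rho_as: "a \<in> K012 \<Longrightarrow> \<rho>' (a, 0) = (a, 0)" and rho_bs: "\<rho>' (0, b) = (0, b)"
  and rho_A': "u \<in> A' \<Longrightarrow> \<rho>' (u, 0) = (0, r0 u)"
  using proj_orth[of _ K012, OF _ sK012] proj_mem[OF complex_vector.subspace_0[OF sK012] sK012]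
  by (auto simp: rho_Pair proj_mem[OF _ sK012] r0_0)

lemma rho_fs: "map \<rho>' fs = map (\<lambda>a. (a, 0)) as @ map (\<lambda>b. (0, b)) (\<beta>s @ bs)"
proof -
  have "map (\<rho>' \<circ> (\<lambda>a. (a, 0))) as = map (\<lambda>a. (a, 0)) as" using as_in rho_as by auto
  moreover have "map (\<rho>' \<circ> (\<lambda>a. (a, 0))) ps = map ((\<lambda>b. (0, b)) \<circ> r0) ps" using ad_ps rho_A' by auto
  moreover have "\<dots> = map (\<lambda>b. (0, b)) \<beta>s" using ad_r0 by (metis map_map)
  moreover have "map (\<rho>' \<circ> (\<lambda>b. (0, b))) bs = map (\<lambda>b. (0, b)) bs" using rho_bs by auto
  ultimately show ?thesis by (simp add: fs_def)
qed

text \<open>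
  On \<open>K012\<close> and \<open>K123\<close> the map \<open>\<rho>\<close> is the inclusion, with image orthogonal to that of \<open>\<rho>\<^sub>0\<close>, so \<open>\<rho>\<^sup>*\<rho>\<close> is
  the identity there; on the complement of \<open>K012\<close> it is \<open>\<rho>\<^sub>0\<^sup>*\<rho>\<^sub>0\<close>.
\<close>

lemma T_fs: "map T fs = gs"
proof -
  have "T (a, 0) = (a, 0)" if "a \<in> set as" for a
  proof (rule T_eqI)
    have a: "a \<in> K012" using that as_in by auto
    then show "(a, 0) \<in> KK" using K012_le complex_vector.subspace_0[OF sK123] by auto
    fix k assume "k \<in> KK"
    then obtain k1 k2 where k: "k = (k1, k2)" "k1 \<in> K013" by auto
    have "cinner a (k1 - proj K012 k1) = 0" using split013[OF k(2)] a by (auto simp: orth_iff)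
    then show "cinner (a, 0) k = cinner (\<rho>' (a, 0)) (\<rho>' k)"
      unfolding rho_as[OF a] k by (simp add: rho_Pair cinner_diff_right)
  qed
  moreover have "T (0, b) = (0, b)" if "b \<in> set bs" for b
  proof (rule T_eqI)
    have b: "b \<in> K123" using that bs_in by auto
    then show "(0, b) \<in> KK" using complex_vector.subspace_0[OF sK013] by auto
    fix k assume "k \<in> KK"
    then obtain k1 k2 where k: "k = (k1, k2)" "k1 \<in> K013" by auto
    have "cinner b (r0 (k1 - proj K012 k1)) = 0"
      using r0_in[of "k1 - proj K012 k1"] split013[OF k(2)] b by (auto simp: orth_iff)
    then show "cinner (0, b) k = cinner (\<rho>' (0, b)) (\<rho>' k)"
      unfolding rho_bs k by (simp add: rho_Pair cinner_add_right)
  qed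
  moreover have "T (ps ! i, 0) = (cs ! i, 0)" if i: "i < length ps" for i
  proof (rule T_eqI)
    show "(cs ! i, 0) \<in> KK" using nth_A'(2)[OF i] complex_vector.subspace_0[OF sK123] by auto
    fix k assume "k \<in> KK"
    then obtain k1 k2 where k: "k = (k1, k2)" "k1 \<in> K013" "k2 \<in> K123" by auto
    have v: "k1 - proj K012 k1 \<in> A'" "proj K012 k1 \<in> K012" using split013[OF k(2)] by auto
    have "cinner (cs ! i) (proj K012 k1) = 0"
      using nth_A'(2)[OF i] v(2) by (auto simp: orth_commute[symmetric])
    then have "cinner (cs ! i) k1 = cinner (cs ! i) (k1 - proj K012 k1)" by (simp add: cinner_diff_right)
    also have "\<dots> = cinner (\<beta>s ! i) (r0 (k1 - proj K012 k1))" by (rule ad_c[OF i v(1)])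
    finally have 1: "cinner (cs ! i) k1 = cinner (\<beta>s ! i) (r0 (k1 - proj K012 k1))" .
    have "\<beta>s ! i \<in> B'" using \<beta>s_in i ad_len' by (metis nth_mem subsetD)
    then have 2: "cinner (\<beta>s ! i) k2 = 0" using k(3) by (auto simp: orth_commute[symmetric])
    show "cinner (cs ! i, 0) k = cinner (\<rho>' (ps ! i, 0)) (\<rho>' k)"
      unfolding rho_A'[OF nth_A'(1)[OF i]] r0_nth[OF i] k using 1 2 by (simp add: rho_Pair cinner_add_right)
  qed
  then have "map (T \<circ> (\<lambda>a. (a, 0))) ps = map (\<lambda>a. (a, 0)) cs"
    using ad_len by (intro nth_equalityI) auto
  ultimately show ?thesis by (simp add: fs_def gs_def)
qed

lemma basis_fs: "dual_basis gs fs KK" and basis_gs: "dual_basis fs gs KK"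
  unfolding fs_def gs_def
  by (rule dual_basis_Times[OF basis013 ad_bases(2)] dual_basis_Times[OF basis013' ad_bases(2)])+

abbreviation "d \<equiv> endo_det KK T"

text \<open>
  The passage from \<open>fs\<close> to \<open>gs\<close> is by \<open>\<rho>\<^sup>*\<rho>\<close>, whence the determinant.
\<close>

lemma wdg_gs: "wdg KK gs = d \<odot>\<^bsub>ext_top KK\<^esub> wdg KK fs"
proof -
  have fK: "set fs \<subseteq> KK" using basis_fs by (simp add: dual_basis_def)
  have TK: "T ` KK \<subseteq> KK" using T_props(1) by blast
  have "ext_map KK T (wdg KK fs) = d \<odot>\<^bsub>exterior KK\<^esub> wdg KK fs"
    using wdg_in_top[OF fK] dual_basis_cdim[OF basis_fs]
    by (intro ext_map_top_det[OF dual_basis_list[OF basis_fs] T_lin TK]) simp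
  then show ?thesis using ext_map_wdg[OF sKK T_lin TK fK] by (simp add: T_fs ext_top_simps)
qed

lemma d_nonzero: "d \<noteq> 0"
proof
  assume "d = 0"
  interpret E: cmod "ext_top KK" by (rule cmod_ext_top)
  have fK: "set fs \<subseteq> KK" "set gs \<subseteq> KK" "biorth fs gs" using basis_fs basis_gs by (simp_all add: dual_basis_def)
  have "wdg KK fs \<in> carrier (ext_top KK)"
    using wdg_in_top[OF fK(1)] dual_basis_cdim[OF basis_fs] by simp
  then have "wdg KK gs = \<zero>\<^bsub>ext_top KK\<^esub>" by (simp add: wdg_gs \<open>d = 0\<close>)
  then have "word gs \<in> ext_ideal KK" by (simp add: ext_top_simps exterior_simps coset_eq_iff)
  then show False using wdg_nonzero[OF sKK fK(3,2)] by simp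
qed

text \<open>
  By \<open>passes_modulo\<close>, the pair passes after subtracting some \<open>(k, l)\<close> in \<open>K013 \<times> K123\<close>. Now \<open>passes_orth\<close> is applied to
  \<open>(0, l)\<close>, to the component of \<open>k\<close> in \<open>K012\<close>, and to \<open>(k, - \<rho>\<^sub>0 k)\<close>; the pair \<open>(c, \<beta>)\<close> is
  orthogonal to all of these, the last one because \<open>c\<close> represents \<open>u \<mapsto> \<langle>\<beta>, \<rho>\<^sub>0 u\<rangle>\<close>. So \<open>k\<close> and \<open>l\<close> vanish.
\<close>

lemma cs_pass: assumes i: "i < length ps" shows "passes (cs ! i) (\<beta>s ! i)"
proof -
  let ?c = "cs ! i" and ?b = "\<beta>s ! i"
  have c: "?c \<in> A'" by (rule nth_A'(2)[OF i])
  have b: "?b \<in> B'" using \<beta>s_in i ad_len' by (metis nth_mem subsetD)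
  obtain k l where kl: "k \<in> K013" "l \<in> K123" "passes (?c - k) (?b - l)" using passes_modulo by blast
  note o = passes_orth[OF kl(3)]
  let ?a = "proj K012 k" and ?u = "k - proj K012 k"
  have a: "?a \<in> K012" and u: "?u \<in> A'" using split013[OF kl(1)] by auto
  have l0: "l = 0"
  proof -
    have "(0, - l) \<in> L12" using complex_vector.subspace_neg[OF sL12, of "(0, l)"] kl(2) by (simp add: Kspace_def)
    then have "cinner 0 (?c - k) + cinner l (?b - l) = 0"
      using kl(2) zero_in by (intro o) (simp_all add: Kspace_def)
    moreover have "cinner l ?b = 0" using kl(2) b by (auto simp: orth_iff)
    ultimately show ?thesis by (simp add: cinner_diff_right)
  qed
  have a0: "?a = 0"
  proof -
    have "cinner ?a (?c - k) + cinner 0 (?b - l) = 0"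
      using a zero_in by (intro o) (simp_all add: Kspace_def)
    moreover have "cinner ?a ?c = 0" using a c by (auto simp: orth_iff)
    moreover have "cinner ?a ?u = 0" using a u by (auto simp: orth_iff)
    then have "cinner ?a k = cinner ?a ?a" by (simp add: cinner_diff_right)
    ultimately show ?thesis by (simp add: cinner_diff_right)
  qed
  then have kA: "k \<in> A'" using u by simp
  have "cinner k (?c - k) + cinner (- r0 k) (?b - l) = 0"
  proof (rule o)
    show "(0, k) \<in> L01" using kl(1) by (simp add: Kspace_def)
    show "(k, - (- r0 k)) \<in> L12" using r0_rel[OF kA] by simp
    have "(r0 k, 0) \<in> L23" using r0_in[OF kA] by (simp add: Kspace_def)
    then show "(- r0 k, 0) \<in> L23" using complex_vector.subspace_neg[OF sL23, of "(r0 k, 0)"] by simp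
  qed
  moreover have "cinner k ?c = cinner (r0 k) ?b"
    using ad_c[OF i kA] by (metis cinner_commute)
  ultimately have "k = 0" by (simp add: l0 cinner_diff_right)
  with kl(3) l0 show ?thesis by simp
qed

end

end


section \<open>The two composites on generators\<close>

lemma clin_id' [simp]: "clin M M id"
  by (simp add: clin_def)

lemma ext_map_top_clin:
  assumes ws0: "dual_basis us ws K" and f: "lin_on K f" "f ` K \<subseteq> K'" and ws: "length ws = cdim K'"
  shows "clin (ext_top K) (ext_top K') (ext_map K' f)"
proof -
  have K: "csubspace K" "set ws \<subseteq> K" using ws0 by (auto simp: dual_basis_def)
  note c = ext_map_clin[OF K(1) f]
  have e: "ext_map K' f (wdg K ws) = wdg K' (map f ws)" by (rule ext_map_wdg[OF K(1) f K(2)])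
  have i: "wdg K' (map f ws) \<in> carrier (ext_top K')" using f(2) K(2) ws by (intro wdg_in_top) auto
  have i0: "wdg K ws \<in> carrier (exterior K)"
    using wdg_in_top[OF K(2)] dual_basis_cdim[OF ws0] ext_top_sub by auto
  interpret E: cmod "ext_top K'" by (rule cmod_ext_top)
  show ?thesis
  proof (rule clinI)
    fix x assume x: "x \<in> carrier (ext_top K)"
    obtain a where a: "x = a \<odot>\<^bsub>ext_top K\<^esub> wdg K ws" using ext_top_span[OF dual_basis_list[OF ws0] x] .
    show "ext_map K' f x \<in> carrier (ext_top K')"
      using clin_smult[OF c i0, of a] E.smult_closed[OF i, of a] by (simp add: a ext_top_simps(4) e)
    fix r show "ext_map K' f (r \<odot>\<^bsub>ext_top K\<^esub> x) = r \<odot>\<^bsub>ext_top K'\<^esub> ext_map K' f x"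
      using clin_smult[OF c, of x r] x ext_top_sub by (auto simp: ext_top_simps(4))
  next
    fix x y assume "x \<in> carrier (ext_top K)" "y \<in> carrier (ext_top K)"
    then show "ext_map K' f (x \<oplus>\<^bsub>ext_top K\<^esub> y) = ext_map K' f x \<oplus>\<^bsub>ext_top K'\<^esub> ext_map K' f y"
      using clin_add[OF c, of x y] ext_top_sub by (auto simp: ext_top_simps(3))
  qed
qed

context gluing_square begin

abbreviation "F01 \<equiv> ext_bimod c0 c1 L01"
abbreviation "F12 \<equiv> ext_bimod c1 c2 L12"
abbreviation "F23 \<equiv> ext_bimod c2 c3 L23"
abbreviation "F02 \<equiv> ext_bimod c0 c2 L02"
abbreviation "F13 \<equiv> ext_bimod c1 c3 L13"
abbreviation "F03 \<equiv> ext_bimod c0 c3 L03"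

lemmas b01 = P012.A.cbimod_F and b12 = P012.B.cbimod_F and b23 = P023.B.cbimod_F
  and b02 = P012.C.cbimod_F and b13 = P013.B.cbimod_F

sublocale V: vacuum_chain c0 c1 c2 c3 F01 F12 F23 P012.A.vac P012.B.vac P023.B.vac L01 L12 L23
proof (intro vacuum_chain.intro vacuum_chain_axioms.intro b01 b12 b23)
  show "P012.A.vac \<in> carrier F01" "P012.B.vac \<in> carrier F12" "P023.B.vac \<in> carrier F23"
    by (rule P012.A.vac_in P012.B.vac_in P023.B.vac_in)+
  show "real_structure c1" "real_structure c2" by (rule P012.A.rsj P012.B.rsj)+
  show "c0 0 = 0" "c3 0 = 0" by (rule P012.A.ci_0 P023.B.cj_0)+
  show "lact F01 z P012.A.vac = \<ominus>\<^bsub>F01\<^esub> ract F01 P012.A.vac x" if "(z, x) \<in> pair_conj c0 c1 ` L01" for z x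
    using P012.A.vac_conj[OF that] P012.A.F_minus[of "ract F01 P012.A.vac x"] P012.A.F.ract_closed[OF P012.A.vac_in]
    by simp
  show "lact F12 z P012.B.vac = \<ominus>\<^bsub>F12\<^esub> ract F12 P012.B.vac x" if "(z, x) \<in> pair_conj c1 c2 ` L12" for z x
    using P012.B.vac_conj[OF that] P012.B.F_minus[of "ract F12 P012.B.vac x"] P012.B.F.ract_closed[OF P012.B.vac_in]
    by simp
  show "lact F23 z P023.B.vac = \<ominus>\<^bsub>F23\<^esub> ract F23 P023.B.vac x" if "(z, x) \<in> pair_conj c2 c3 ` L23" for z x
    using P023.B.vac_conj[OF that] P023.B.F_minus[of "ract F23 P023.B.vac x"] P023.B.F.ract_closed[OF P023.B.vac_in]
    by simp
qed

abbreviation "S12 \<equiv> cl_tens c1 F01 F12"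
abbreviation "S23 \<equiv> cl_tens c2 F12 F23"
abbreviation "TT \<equiv> cl_tens c1 F01 S23"

text \<open>
  The last two maps of the first composite, for a fixed element \<open>b\<close> of the second top power. They commute with
  the right action up to the sign of the twist by \<open>K123\<close>.
\<close>

definition first_tail where "first_tail b t = cl_tens_map c1 F01 S23 id \<alpha>123 (assoc_twist c1 F01 F13 K123
   (pure (cl_tens c1 F01 F13) (ext_top K123) t b))"

lemmas map123_clin = cl_tens_map_clin[OF b01 P123.X.cbimod_axioms b01 P123.T.cbimod_axioms clin_id' P123.\<alpha>_clin]
lemmas map123_pure = cl_tens_map_pure[OF b01 P123.X.cbimod_axioms b01 P123.T.cbimod_axioms clin_id' P123.\<alpha>_clin]

lemma map123: "clin (cl_tens c1 F01 (top_twist F13 K123)) TT (cl_tens_map c1 F01 S23 id \<alpha>123)"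
  "\<xi> \<in> carrier F01 \<Longrightarrow> y \<in> carrier (top_twist F13 K123) \<Longrightarrow>
    cl_tens_map c1 F01 S23 id \<alpha>123 (cl_pure c1 F01 (top_twist F13 K123) \<xi> y) = cl_pure c1 F01 S23 \<xi> (\<alpha>123 y)"
  using map123_clin map123_pure P123.\<alpha>_lact by simp_all

lemma first_tail_clin: "b \<in> carrier (ext_top K123) \<Longrightarrow> clin (cl_tens c1 F01 F13) TT (first_tail b)"
  unfolding first_tail_def
  by (rule clin_comp[OF clin_comp[OF cbilinD2[OF pure_cbilin[OF cmod_cl_tens cmod_ext_top]]
        assoc_twist_clin[OF b01 b13]] map123(1)])

lemma first_tail_pure:
  assumes "b \<in> carrier (ext_top K123)" "\<xi> \<in> carrier F01" "\<eta> \<in> carrier F13"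
  shows "first_tail b (cl_pure c1 F01 F13 \<xi> \<eta>) = cl_pure c1 F01 S23 \<xi> (\<alpha>123 (pure F13 (ext_top K123) \<eta> b))"
  unfolding first_tail_def assoc_twist_pure[OF b01 b13 assms(2,3,1)]
  using assms pure_closed[OF cmod_ext_bimod cmod_ext_top assms(3,1)]
  by (intro map123(2)) (simp_all add: top_twist_simps(1))

lemma a123_in: "\<eta> \<in> carrier F13 \<Longrightarrow> b \<in> carrier (ext_top K123) \<Longrightarrow> \<alpha>123 (pure F13 (ext_top K123) \<eta> b) \<in> carrier S23"
  using pure_closed[OF cmod_ext_bimod cmod_ext_top] by (intro clin_closed[OF P123.\<alpha>_clin]) (simp add: top_twist_simps(1))

lemma a012_in: "\<eta> \<in> carrier F02 \<Longrightarrow> a \<in> carrier (ext_top K012) \<Longrightarrow> \<alpha>012 (pure F02 (ext_top K012) \<eta> a) \<in> carrier S12"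
  using pure_closed[OF cmod_ext_bimod cmod_ext_top] by (intro clin_closed[OF P012.\<alpha>_clin]) (simp add: top_twist_simps(1))

lemma a013_in: "\<eta> \<in> carrier F03 \<Longrightarrow> a \<in> carrier (ext_top K013) \<Longrightarrow> \<alpha>013 (pure F03 (ext_top K013) \<eta> a) \<in> carrier (cl_tens c1 F01 F13)"
  using pure_closed[OF cmod_ext_bimod cmod_ext_top] by (intro clin_closed[OF P013.\<alpha>_clin]) (simp add: top_twist_simps(1))

lemma a023_in: "\<eta> \<in> carrier F03 \<Longrightarrow> a \<in> carrier (ext_top K023) \<Longrightarrow> \<alpha>023 (pure F03 (ext_top K023) \<eta> a) \<in> carrier (cl_tens c2 F02 F23)"
  using pure_closed[OF cmod_ext_bimod cmod_ext_top] by (intro clin_closed[OF P023.\<alpha>_clin]) (simp add: top_twist_simps(1))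

lemma first_tail_lact:
  assumes b: "b \<in> carrier (ext_top K123)" and t: "t \<in> carrier (cl_tens c1 F01 F13)"
  shows "first_tail b (lact (cl_tens c1 F01 F13) w t) = lact TT w (first_tail b t)"
proof (rule cl_tens_clin_eq[OF cmod_ext_bimod cmod_ext_bimod clin_comp[OF cl_tens_lact_clin[OF b01 b13] first_tail_clin[OF b]]
      clin_comp[OF first_tail_clin[OF b] V.T.lact_clin] _ t])
  fix m n assume mn: "m \<in> carrier F01" "n \<in> carrier F13"
  show "first_tail b (lact (cl_tens c1 F01 F13) w (cl_pure c1 F01 F13 m n)) = lact TT w (first_tail b (cl_pure c1 F01 F13 m n))"
    using mn a123_in[OF mn(2) b] by (simp only: cl_tens_lact_pure[OF b01 b13] first_tail_pure[OF b] P012.A.F.lact_closed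
      cl_tens_lact_pure[OF b01 P123.T.cbimod_axioms])
qed

lemma first_tail_ract:
  assumes b: "b \<in> carrier (ext_top K123)" and t: "t \<in> carrier (cl_tens c1 F01 F13)"
  shows "first_tail b (ract (cl_tens c1 F01 F13) t v) = (-1) ^ cdim K123 \<odot>\<^bsub>TT\<^esub> ract TT (first_tail b t) v"
proof (rule cl_tens_clin_eq[OF cmod_ext_bimod cmod_ext_bimod clin_comp[OF cl_tens_ract_clin[OF b01 b13] first_tail_clin[OF b]]
      clin_scale[OF cmod_cl_tens clin_comp[OF first_tail_clin[OF b] V.T.ract_clin]] _ t])
  fix m n assume mn: "m \<in> carrier F01" "n \<in> carrier F13"
  have a: "ract S23 (\<alpha>123 (pure F13 (ext_top K123) n b)) v \<in> carrier S23"
    using a123_in[OF mn(2) b] by (rule P123.T.ract_closed)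
  show "first_tail b (ract (cl_tens c1 F01 F13) (cl_pure c1 F01 F13 m n) v) =
      (-1) ^ cdim K123 \<odot>\<^bsub>TT\<^esub> ract TT (first_tail b (cl_pure c1 F01 F13 m n)) v"
    using mn a123_in[OF mn(2) b] P013.B.F.ract_closed[OF mn(2)] a
    by (simp only: cl_tens_ract_pure[OF b01 b13] first_tail_pure[OF b] P123.\<alpha>_ract_pure[OF mn(2) b]
      clin_smult[OF cbilinD1[OF V.pT mn(1)]] cl_tens_ract_pure[OF b01 P123.T.cbimod_axioms])
qed

abbreviation "assoc \<equiv> cl_assoc c1 c2 F01 F12 F23"
abbreviation "P3 \<equiv> cl_pure c2 S12 F23"
abbreviation "par \<equiv> ext_parity L23 ^^ cdim K012"

text \<open>
  The last three maps of the second composite, for a fixed element \<open>a\<close> of the second top power. The sign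
  for the right action comes from the parity operators in the interchange map.
\<close>

definition second_tail where "second_tail a t = assoc (cl_tens_map c2 S12 F23 \<alpha>012 id (interchange_twist c2 c3 F02 L23 K012
   (pure (cl_tens c2 F02 F23) (ext_top K012) t a)))"

lemma bS12: "cbimod c0 c2 S12"
  by (rule P012.T.cbimod_axioms)

lemma map012: "clin (cl_tens c2 (top_twist F02 K012) F23) (cl_tens c2 S12 F23) (cl_tens_map c2 S12 F23 \<alpha>012 id)"
  "y \<in> carrier (top_twist F02 K012) \<Longrightarrow> \<eta> \<in> carrier F23 \<Longrightarrow>
    cl_tens_map c2 S12 F23 \<alpha>012 id (cl_pure c2 (top_twist F02 K012) F23 y \<eta>) = P3 (\<alpha>012 y) \<eta>"
  using cl_tens_map_clin[OF P012.X.cbimod_axioms b23 bS12 b23 P012.\<alpha>_clin clin_id']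
    cl_tens_map_pure[OF P012.X.cbimod_axioms b23 bS12 b23 P012.\<alpha>_clin clin_id'] P012.\<alpha>_ract by simp_all

lemma second_tail_clin: "a \<in> carrier (ext_top K012) \<Longrightarrow> clin (cl_tens c2 F02 F23) TT (second_tail a)"
  unfolding second_tail_def
  by (rule clin_comp[OF clin_comp[OF clin_comp[OF cbilinD2[OF pure_cbilin[OF cmod_cl_tens cmod_ext_top]]
        P023.B.interchange_twist_clin[OF b02]] map012(1)] cl_assoc_clin[OF b01 b12 b23]])

lemma second_tail_pure:
  assumes "a \<in> carrier (ext_top K012)" "\<xi> \<in> carrier F02" "\<eta> \<in> carrier F23"
  shows "second_tail a (cl_pure c2 F02 F23 \<xi> \<eta>) = assoc (P3 (\<alpha>012 (pure F02 (ext_top K012) \<xi> a)) (par \<eta>))"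
proof -
  have "pure F02 (ext_top K012) \<xi> a \<in> carrier (top_twist F02 K012)"
    using pure_closed[OF cmod_ext_bimod cmod_ext_top assms(2,1)] by (simp add: top_twist_simps(1))
  then show ?thesis
    unfolding second_tail_def P023.B.interchange_twist_pure[OF b02 assms(2,3,1)]
    by (simp add: map012(2) P023.B.par_pow_in[OF assms(3)])
qed

lemma P3_bil: "cbilin S12 F23 (cl_tens c2 S12 F23) P3"
  by (rule cl_pure_cbilin[OF cmod_cl_tens cmod_ext_bimod])

lemma second_tail_lact:
  assumes a: "a \<in> carrier (ext_top K012)" and t: "t \<in> carrier (cl_tens c2 F02 F23)"
  shows "second_tail a (lact (cl_tens c2 F02 F23) w t) = lact TT w (second_tail a t)"
proof (rule cl_tens_clin_eq[OF cmod_ext_bimod cmod_ext_bimod clin_comp[OF cl_tens_lact_clin[OF b02 b23] second_tail_clin[OF a]]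
      clin_comp[OF second_tail_clin[OF a] V.T.lact_clin] _ t])
  fix m n assume mn: "m \<in> carrier F02" "n \<in> carrier F23"
  have "second_tail a (cl_pure c2 F02 F23 (lact F02 w m) n) = assoc (P3 (lact S12 w (\<alpha>012 (pure F02 (ext_top K012) m a))) (par n))"
    using mn by (simp add: second_tail_pure[OF a] P012.\<alpha>_lact_pure[OF mn(1) a])
  also have "\<dots> = lact TT w (assoc (P3 (\<alpha>012 (pure F02 (ext_top K012) m a)) (par n)))"
    by (rule cl_assoc_lact[OF b01 b12 b23 a012_in[OF mn(1) a] P023.B.par_pow_in[OF mn(2)]])
  finally show "second_tail a (lact (cl_tens c2 F02 F23) w (cl_pure c2 F02 F23 m n)) = lact TT w (second_tail a (cl_pure c2 F02 F23 m n))"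
    by (simp only: cl_tens_lact_pure[OF b02 b23 mn] second_tail_pure[OF a mn])
qed

lemma second_tail_ract:
  assumes a: "a \<in> carrier (ext_top K012)" and t: "t \<in> carrier (cl_tens c2 F02 F23)"
  shows "second_tail a (ract (cl_tens c2 F02 F23) t v) = (-1) ^ cdim K012 \<odot>\<^bsub>TT\<^esub> ract TT (second_tail a t) v"
proof (rule cl_tens_clin_eq[OF cmod_ext_bimod cmod_ext_bimod clin_comp[OF cl_tens_ract_clin[OF b02 b23] second_tail_clin[OF a]]
      clin_scale[OF cmod_cl_tens clin_comp[OF second_tail_clin[OF a] V.T.ract_clin]] _ t])
  fix m n assume mn: "m \<in> carrier F02" "n \<in> carrier F23"
  let ?s = "(-1) ^ cdim K012 :: complex" and ?x = "\<alpha>012 (pure F02 (ext_top K012) m a)"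
  note x = a012_in[OF mn(1) a] and pn = P023.B.par_pow_in[OF mn(2), of "cdim K012"]
  have rp: "ract F23 (par n) v \<in> carrier F23" by (rule P023.B.F.ract_closed[OF pn])
  have "second_tail a (cl_pure c2 F02 F23 m (ract F23 n v)) = assoc (P3 ?x (?s \<odot>\<^bsub>F23\<^esub> ract F23 (par n) v))"
    using mn by (simp add: second_tail_pure[OF a] P023.B.par_pow_ract)
  also have "P3 ?x (?s \<odot>\<^bsub>F23\<^esub> ract F23 (par n) v) = ?s \<odot>\<^bsub>cl_tens c2 S12 F23\<^esub> P3 ?x (ract F23 (par n) v)"
    by (rule clin_smult[OF cbilinD1[OF P3_bil x] rp])
  also have "assoc \<dots> = ?s \<odot>\<^bsub>TT\<^esub> assoc (P3 ?x (ract F23 (par n) v))"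
    by (rule clin_smult[OF cl_assoc_clin[OF b01 b12 b23] cbilin_closed[OF P3_bil x rp]])
  also have "assoc (P3 ?x (ract F23 (par n) v)) = ract TT (assoc (P3 ?x (par n))) v"
    by (rule cl_assoc_ract[OF b01 b12 b23 x pn])
  finally show "second_tail a (ract (cl_tens c2 F02 F23) (cl_pure c2 F02 F23 m n) v) =
      ?s \<odot>\<^bsub>TT\<^esub> ract TT (second_tail a (cl_pure c2 F02 F23 m n)) v"
    by (simp only: cl_tens_ract_pure[OF b02 b23 mn] second_tail_pure[OF a mn])
qed

context
  fixes as bs \<beta>s ps cs
  assumes ad: "adapted as bs \<beta>s ps cs"
begin

abbreviation "wa \<equiv> wdg K013 (as @ cs)"
abbreviation "wb \<equiv> wdg K123 bs"
abbreviation "wa' \<equiv> wdg K012 as"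
abbreviation "wb' \<equiv> wdg K023 (\<beta>s @ bs)"

lemmas dims = dual_basis_cdim[OF basis013[OF ad]] dual_basis_cdim[OF ad_bases(1)[OF ad]]
  dual_basis_cdim[OF ad_bases(2)[OF ad]] dual_basis_cdim[OF basis023[OF ad]]

lemma dims_eq: "cdim K013 + cdim K123 = cdim K012 + cdim K023" "cdim K013 = length (as @ cs)"
  using dims ad_len[OF ad] ad_len'[OF ad] by simp_all

lemma sets: "set (as @ cs) \<subseteq> K013" "set bs \<subseteq> K123" "set as \<subseteq> K012" "set (\<beta>s @ bs) \<subseteq> K023"
  using basis013'[OF ad] ad_bases[OF ad] basis023[OF ad] unfolding dual_basis_def by blast+

lemma w_in: "wa \<in> carrier (ext_top K013)" "wb \<in> carrier (ext_top K123)"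
  "wa' \<in> carrier (ext_top K012)" "wb' \<in> carrier (ext_top K023)"
  using dims dims_eq sets by (auto intro!: wdg_in_top simp del: set_append)

text \<open>
  The two composites as maps on the bimodule \<open>F03\<close>, after inserting the wedge products of the adapted bases. For the second
  one, the factor \<open>1 / d\<close> is left out, and the sign is that of interchanging the two top powers.
\<close>

definition first_at_basis where "first_at_basis \<xi> = first_tail wb (\<alpha>013 (pure F03 (ext_top K013) \<xi> wa))"
definition second_at_basis where "second_at_basis \<xi> = (-1) ^ (cdim K012 * cdim K023) \<odot>\<^bsub>TT\<^esub> second_tail wa' (\<alpha>023 (pure F03 (ext_top K023) \<xi> wb'))"

lemma first_at_basis_clin: "clin F03 TT first_at_basis"
proof -
  have "clin F03 (top_twist F03 K013) (\<lambda>\<xi>. pure F03 (ext_top K013) \<xi> wa)"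
    using cbilinD2[OF pure_cbilin[OF cmod_ext_bimod cmod_ext_top] w_in(1)] by (simp add: clin_top_twist_iff)
  then show ?thesis unfolding first_at_basis_def by (rule clin_comp[OF clin_comp[OF _ P013.\<alpha>_clin] first_tail_clin[OF w_in(2)]])
qed

lemma second_at_basis_clin: "clin F03 TT second_at_basis"
proof -
  have "clin F03 (top_twist F03 K023) (\<lambda>\<xi>. pure F03 (ext_top K023) \<xi> wb')"
    using cbilinD2[OF pure_cbilin[OF cmod_ext_bimod cmod_ext_top] w_in(4)] by (simp add: clin_top_twist_iff)
  then show ?thesis unfolding second_at_basis_def
    by (rule clin_scale[OF cmod_cl_tens clin_comp[OF clin_comp[OF _ P023.\<alpha>_clin] second_tail_clin[OF w_in(3)]]])
qed

lemma first_at_basis_lact: "\<xi> \<in> carrier F03 \<Longrightarrow> first_at_basis (lact F03 w \<xi>) = lact TT w (first_at_basis \<xi>)"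
  using a013_in w_in by (simp add: first_at_basis_def P013.\<alpha>_lact_pure first_tail_lact)

lemma first_at_basis_ract:
  assumes x: "\<xi> \<in> carrier F03"
  shows "first_at_basis (ract F03 \<xi> v) = (-1) ^ (cdim K013 + cdim K123) \<odot>\<^bsub>TT\<^esub> ract TT (first_at_basis \<xi>) v"
proof -
  note a = a013_in[OF x w_in(1)]
  have r: "ract (cl_tens c1 F01 F13) (\<alpha>013 (pure F03 (ext_top K013) \<xi> wa)) v \<in> carrier (cl_tens c1 F01 F13)"
    by (rule P013.T.ract_closed[OF a])
  have h: "ract TT (first_tail wb (\<alpha>013 (pure F03 (ext_top K013) \<xi> wa))) v \<in> carrier TT"
    by (intro V.T.ract_closed clin_closed[OF first_tail_clin[OF w_in(2)] a])
  show ?thesis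
    unfolding first_at_basis_def P013.\<alpha>_ract_pure[OF x w_in(1)] clin_smult[OF first_tail_clin[OF w_in(2)] r] first_tail_ract[OF w_in(2) a]
      V.T.smult_assoc[OF h] by (simp only: power_add)
qed

lemma second_at_basis_lact:
  assumes x: "\<xi> \<in> carrier F03" shows "second_at_basis (lact F03 w \<xi>) = lact TT w (second_at_basis \<xi>)"
proof -
  have "second_tail wa' (\<alpha>023 (pure F03 (ext_top K023) \<xi> wb')) \<in> carrier TT"
    by (rule clin_closed[OF second_tail_clin[OF w_in(3)] a023_in[OF x w_in(4)]])
  then show ?thesis
    by (simp only: second_at_basis_def P023.\<alpha>_lact_pure[OF x w_in(4)] second_tail_lact[OF w_in(3) a023_in[OF x w_in(4)]]
      clin_smult[OF V.T.lact_clin])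
qed

lemma second_at_basis_ract:
  assumes x: "\<xi> \<in> carrier F03"
  shows "second_at_basis (ract F03 \<xi> v) = (-1) ^ (cdim K013 + cdim K123) \<odot>\<^bsub>TT\<^esub> ract TT (second_at_basis \<xi>) v"
proof -
  note a = a023_in[OF x w_in(4)]
  let ?y = "second_tail wa' (\<alpha>023 (pure F03 (ext_top K023) \<xi> wb'))"
  have r: "ract (cl_tens c2 F02 F23) (\<alpha>023 (pure F03 (ext_top K023) \<xi> wb')) v \<in> carrier (cl_tens c2 F02 F23)"
    by (rule P023.T.ract_closed[OF a])
  have y: "?y \<in> carrier TT" by (rule clin_closed[OF second_tail_clin[OF w_in(3)] a])
  have h: "ract TT ?y v \<in> carrier TT" by (rule V.T.ract_closed[OF y])
  show ?thesis
    unfolding second_at_basis_def P023.\<alpha>_ract_pure[OF x w_in(4)] clin_smult[OF second_tail_clin[OF w_in(3)] r] second_tail_ract[OF w_in(3) a]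
      clin_smult[OF V.T.ract_clin y] V.T.smult_assoc[OF h] V.T.smult_assoc[OF V.T.smult_closed[OF h]] dims_eq(1)
    by (simp only: power_add mult_ac)
qed

lemma first_on_vacuum: "first_at_basis P013.C.vac = V.inserted (as @ cs) bs"
proof -
  have 1: "\<alpha>013 (pure F03 (ext_top K013) P013.C.vac wa) = cl_pure c1 F01 F13 (foldl (ract F01) P012.A.vac (as @ cs)) P013.B.vac"
    using sets(1) dims_eq(2) by (intro P013.\<alpha>_vac) simp_all
  have 2: "\<alpha>123 (pure F13 (ext_top K123) P013.B.vac wb) = cl_pure c2 F12 F23 (foldl (ract F12) P012.B.vac bs) P023.B.vac"
    using sets(2) dims(3) by (intro P123.\<alpha>_vac) simp_all
  show ?thesis
    unfolding first_at_basis_def 1 using P012.A.vac_in P013.B.vac_in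
    by (subst first_tail_pure[OF w_in(2)]) (simp_all add: 2 V.inserted_def V.inserted_right_def)
qed

text \<open>
  The map \<open>\<alpha>012\<close> commutes with the right action up to the sign of the twist by \<open>K012\<close>, once for each letter.
\<close>

lemma a012_foldl:
  "\<alpha>012 (pure F02 (ext_top K012) (foldl (ract F02) P012.C.vac us) wa') =
     (-1) ^ (cdim K012 * length us) \<odot>\<^bsub>S12\<^esub> cl_pure c1 F01 F12 (foldl (ract F01) P012.A.vac as) (foldl (ract F12) P012.B.vac us)"
proof (induction us rule: rev_induct)
  case Nil
  have "\<alpha>012 (pure F02 (ext_top K012) P012.C.vac wa') = cl_pure c1 F01 F12 (foldl (ract F01) P012.A.vac as) P012.B.vac"
    using sets(3) dims(2) by (intro P012.\<alpha>_vac) simp_all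
  moreover have "cl_pure c1 F01 F12 (foldl (ract F01) P012.A.vac as) P012.B.vac \<in> carrier S12"
    using P012.A.vac_in P012.B.vac_in by (intro cl_pure_closed cmod_ext_bimod) simp_all
  ultimately show ?case by (simp add: P012.T.smult_one)
next
  case (snoc u us)
  let ?m = "foldl (ract F02) P012.C.vac us" and ?l = "foldl (ract F01) P012.A.vac as"
    and ?r = "foldl (ract F12) P012.B.vac us"
  have c: "?m \<in> carrier F02" "?l \<in> carrier F01" "?r \<in> carrier F12"
    using P012.A.vac_in P012.B.vac_in P012.C.vac_in by simp_all
  have p: "cl_pure c1 F01 F12 ?l ?r \<in> carrier S12" "cl_pure c1 F01 F12 ?l (ract F12 ?r u) \<in> carrier S12"
    using c by (intro cl_pure_closed cmod_ext_bimod; simp)+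
  show ?case
    using c p by (simp add: P012.\<alpha>_ract_pure[OF c(1) w_in(3)] snoc clin_smult[OF P012.T.ract_clin]
       cl_tens_ract_pure[OF b01 b12] P012.T.smult_assoc power_add)
qed

text \<open>
  The sign of moving \<open>dim K023\<close> letters past the twist by \<open>K012\<close> cancels the sign of interchanging the two top powers.
\<close>

lemma second_on_vacuum: "second_at_basis P013.C.vac = V.inserted as (\<beta>s @ bs)"
proof -
  let ?s = "(-1) ^ (cdim K012 * cdim K023) :: complex"
  have s: "?s * ?s = 1" by (simp flip: power_add mult_2)
  have 1: "\<alpha>023 (pure F03 (ext_top K023) P013.C.vac wb') = cl_pure c2 F02 F23 (foldl (ract F02) P012.C.vac (\<beta>s @ bs)) P023.B.vac"
    using sets(4) dims(4) by (intro P023.\<alpha>_vac) simp_all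
  let ?l = "foldl (ract F01) P012.A.vac as" and ?r = "foldl (ract F12) P012.B.vac (\<beta>s @ bs)"
  have c: "?l \<in> carrier F01" "?r \<in> carrier F12" "foldl (ract F02) P012.C.vac (\<beta>s @ bs) \<in> carrier F02"
    using P012.A.vac_in P012.B.vac_in P012.C.vac_in by simp_all
  have p: "cl_pure c1 F01 F12 ?l ?r \<in> carrier S12" using c by (intro cl_pure_closed cmod_ext_bimod)
  have "second_tail wa' (cl_pure c2 F02 F23 (foldl (ract F02) P012.C.vac (\<beta>s @ bs)) P023.B.vac) =
      assoc (P3 (?s \<odot>\<^bsub>S12\<^esub> cl_pure c1 F01 F12 ?l ?r) P023.B.vac)"
    using a012_foldl[of "\<beta>s @ bs"] dims(4)
    by (simp only: second_tail_pure[OF w_in(3) c(3) P023.B.vac_in] P023.B.par_pow_vac)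
  also have "\<dots> = ?s \<odot>\<^bsub>TT\<^esub> assoc (P3 (cl_pure c1 F01 F12 ?l ?r) P023.B.vac)"
    by (simp only: clin_smult[OF cbilinD2[OF P3_bil P023.B.vac_in] p]
      clin_smult[OF cl_assoc_clin[OF b01 b12 b23] cbilin_closed[OF P3_bil p P023.B.vac_in]])
  also have "assoc (P3 (cl_pure c1 F01 F12 ?l ?r) P023.B.vac) = V.inserted as (\<beta>s @ bs)"
    unfolding V.inserted_def V.inserted_right_def by (rule cl_assoc_pure[OF b01 b12 b23 c(1,2) P023.B.vac_in])
  finally have "second_at_basis P013.C.vac = ?s \<odot>\<^bsub>TT\<^esub> (?s \<odot>\<^bsub>TT\<^esub> V.inserted as (\<beta>s @ bs))"
    by (simp only: second_at_basis_def 1)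
  moreover have "V.inserted as (\<beta>s @ bs) \<in> carrier TT" unfolding V.inserted_def using c(1) by simp
  ultimately show ?thesis by (simp only: V.T.smult_assoc s V.T.smult_one)
qed

lemma vacua_agree: "V.inserted (as @ cs) bs = V.inserted as (\<beta>s @ bs)"
proof (rule V.vectors_pass_middle[where q = "length ps" and us = ps and vs = \<beta>s])
  show "length cs = length ps" "length ps = length ps" "length \<beta>s = length ps" "length \<beta>s = length ps"
    using ad_len[OF ad] ad_len'[OF ad] by simp_all
  fix i assume i: "i < length ps"
  note p = nth_A'(1)[OF ad i] and r = r0_nth[OF ad i]
  have b: "\<beta>s ! i \<in> B'" using r0_in[OF p] by (simp only: r)
  have rel: "(ps ! i, \<beta>s ! i) \<in> L12" using r0_rel[OF p] by (simp only: r)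
  have "cinner (\<beta>s ! i) (\<beta>s ! i) = 1"
    using biorth_nth[OF biorth_\<beta>s[OF ad], of i i] i ad_len'[OF ad] by simp
  then have "\<beta>s ! i \<noteq> 0" by auto
  then show "(0, ps ! i) \<in> L01 \<and> (ps ! i, \<beta>s ! i) \<in> L12 \<and> (\<beta>s ! i, 0) \<in> L23 \<and> (ps ! i \<noteq> 0 \<or> \<beta>s ! i \<noteq> 0)"
    using p b rel by (simp add: Kspace_def)
  show "cinner (ps ! i) a = 0" if "a \<in> set as" for a
    using that sets(3) p orthD[of a K012 "ps ! i"] cinner_eq_0_sym by blast
  show "cinner (\<beta>s ! i) b' = 0" if "b' \<in> set bs" for b'
    using that sets(2) b orthD[of b' K123 "\<beta>s ! i"] cinner_eq_0_sym by blast
  show "\<exists>z x x' y y' v. cs ! i = x + x' \<and> \<beta>s ! i = y' - y \<and> (z, x) \<in> pair_conj c0 c1 ` L01 \<and>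
      (x', y) \<in> pair_conj c1 c2 ` L12 \<and> (y', v) \<in> pair_conj c2 c3 ` L23"
    using cs_pass[OF ad i] unfolding passes_def P012.A.conj_eq P012.B.conj_eq P023.B.conj_eq .
next
  fix i j assume ij: "i < length ps" "j < length ps" "i \<noteq> j"
  have "cinner (cs ! j) (ps ! i) = 0" 
    using biorth_nth[OF biorth_cs_ps[OF ad], of j i] ij ad_len[OF ad] by simp
  moreover have "cinner (\<beta>s ! i) (\<beta>s ! j) = 0"
    using biorth_nth[OF biorth_\<beta>s[OF ad], of i j] ij ad_len'[OF ad] by simp
  ultimately show "cinner (ps ! i) (cs ! j) = 0 \<and> cinner (\<beta>s ! i) (\<beta>s ! j) = 0"
    by (simp add: cinner_eq_0_sym[of "ps ! i"])
qed

text \<open>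
  Both maps are linear and commute with the actions, up to the same sign, so the set on which they agree contains
  everything that the vacuum generates.
\<close>

lemma composites_agree_at_basis:
  assumes "\<xi> \<in> carrier F03" shows "first_at_basis \<xi> = second_at_basis \<xi>"
proof -
  have "\<xi> \<in> carrier (exterior L03)" using assms by (simp add: P013.C.F_simps)
  then show ?thesis
  proof (induction rule: P013.C.F_induct)
    case (add x y)
    then show ?case using clin_add[OF first_at_basis_clin, of x y] clin_add[OF second_at_basis_clin, of x y] by (simp add: P013.C.F_simps)
  next
    case (scale a x)
    then show ?case using clin_smult[OF first_at_basis_clin, of x a] clin_smult[OF second_at_basis_clin, of x a] by (simp add: P013.C.F_simps)
  next
    case vac
    show ?case by (simp only: first_on_vacuum second_on_vacuum vacua_agree)
  next
    case (lact w x)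
    then have "x \<in> carrier F03" by (simp add: P013.C.F_simps)
    then show ?case using lact by (simp only: first_at_basis_lact second_at_basis_lact)
  next
    case (ract w x)
    then have "x \<in> carrier F03" by (simp add: P013.C.F_simps)
    then show ?case using ract by (simp only: first_at_basis_ract second_at_basis_ract)
  qed
qed

abbreviation "K2 \<equiv> K012 \<times> K023"

definition first_composite where "first_composite x = cl_tens_map c1 F01 S23 id \<alpha>123 (assoc_twist c1 F01 F13 K123
   (tens_map (cl_tens c1 F01 F13) (ext_top K123) \<alpha>013 id (assoc_top F03 K013 K123
     (tens_map F03 (tens (ext_top K013) (ext_top K123)) id (top_split K013 K123) x))))"

definition second_composite where "second_composite x = assoc (cl_tens_map c2 S12 F23 \<alpha>012 id (interchange_twist c2 c3 F02 L23 K012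
   (tens_map (cl_tens c2 F02 F23) (ext_top K012) \<alpha>023 id (assoc_top F03 K023 K012
     (tens_map F03 (tens (ext_top K023) (ext_top K012)) id (\<lambda>\<kappa>. top_swap K012 K023 (top_split K012 K023 \<kappa>))
       (tens_map F03 (ext_top K2) id (\<lambda>\<kappa>. (1 / d) \<odot>\<^bsub>ext_top K2\<^esub> ext_map K2 \<rho>' \<kappa>) x))))))"

lemmas split1_clin = top_split_clin[OF basis013'[OF ad] ad_bases(2)[OF ad]]
  and split1_wdg = top_split_wdg[OF basis013'[OF ad] ad_bases(2)[OF ad]]
  and split2_clin = top_split_clin[OF ad_bases(1)[OF ad] basis023[OF ad]]
  and split2_wdg = top_split_wdg[OF ad_bases(1)[OF ad] basis023[OF ad]]

lemma first_composite_clin: "clin (tens F03 (ext_top KK)) TT first_composite"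
  unfolding first_composite_def
  by (rule clin_comp[OF clin_comp[OF clin_comp[OF clin_comp[OF
       tens_map_clin[OF cmod_ext_bimod cmod_ext_top cmod_ext_bimod cmod_tens clin_id' split1_clin]
       assoc_top_clin[OF cmod_ext_bimod]]
       tens_map_clin[OF cmod_top_twist cmod_ext_top cmod_cl_tens cmod_ext_top P013.\<alpha>_clin clin_id']]
       assoc_twist_clin[OF b01 b13]] map123(1)])

lemma gs_in: "wdg KK (gs as bs cs) \<in> carrier (ext_top KK)" and fs_in: "wdg KK (fs as bs ps) \<in> carrier (ext_top KK)"
  using basis_fs[OF ad] basis_gs[OF ad] dual_basis_cdim[OF basis_fs[OF ad]] dual_basis_cdim[OF basis_gs[OF ad]]
  by (auto simp: dual_basis_def intro!: wdg_in_top)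

lemma first_composite_pure:
  assumes x: "\<xi> \<in> carrier F03"
  shows "first_composite (pure F03 (ext_top KK) \<xi> (wdg KK (gs as bs cs))) = first_at_basis \<xi>"
proof -
  have g: "top_split K013 K123 (wdg KK (gs as bs cs)) = pure (ext_top K013) (ext_top K123) wa wb"
    unfolding gs_def[OF ad] by (rule split1_wdg)
  have p: "pure F03 (ext_top K013) \<xi> wa \<in> carrier (top_twist F03 K013)"
    using pure_closed[OF cmod_ext_bimod cmod_ext_top x w_in(1)] by (simp add: top_twist_simps(1))
  show ?thesis
    unfolding first_composite_def first_at_basis_def first_tail_def
      tens_map_pure[OF cmod_ext_bimod cmod_ext_top cmod_ext_bimod cmod_tens clin_id' split1_clin x gs_in] g id_apply
      assoc_top_pure[OF cmod_ext_bimod x w_in(1,2)]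
      tens_map_pure[OF cmod_top_twist cmod_ext_top cmod_cl_tens cmod_ext_top P013.\<alpha>_clin clin_id' p w_in(2)] ..
qed

lemma basis_K2: "dual_basis (map (\<lambda>a. (a, 0)) as @ map (\<lambda>b. (0, b)) (\<beta>s @ bs)) (map (\<lambda>a. (a, 0)) as @ map (\<lambda>b. (0, b)) (\<beta>s @ bs)) K2"
  by (rule dual_basis_Times[OF ad_bases(1)[OF ad] basis023[OF ad]])

lemma len_fs: "length (fs as bs ps) = cdim K2"
  using dual_basis_cdim[OF basis_K2] ad_len'[OF ad] by (simp add: fs_def[OF ad])

lemma rho_top_clin: "clin (ext_top KK) (ext_top K2) (\<lambda>\<kappa>. (1 / d) \<odot>\<^bsub>ext_top K2\<^esub> ext_map K2 \<rho>' \<kappa>)"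
  by (rule clin_scale[OF cmod_ext_top ext_map_top_clin[OF basis_fs[OF ad] rho_lin rho_in len_fs]])

lemmas swap_split_clin = clin_comp[OF split2_clin top_swap_clin]

lemma second_composite_clin: "clin (tens F03 (ext_top KK)) TT second_composite"
  unfolding second_composite_def
  by (rule clin_comp[OF clin_comp[OF clin_comp[OF clin_comp[OF clin_comp[OF clin_comp[OF
       tens_map_clin[OF cmod_ext_bimod cmod_ext_top cmod_ext_bimod cmod_ext_top clin_id' rho_top_clin]
       tens_map_clin[OF cmod_ext_bimod cmod_ext_top cmod_ext_bimod cmod_tens clin_id' swap_split_clin]]
       assoc_top_clin[OF cmod_ext_bimod]]
       tens_map_clin[OF cmod_top_twist cmod_ext_top cmod_cl_tens cmod_ext_top P023.\<alpha>_clin clin_id']]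
       P023.B.interchange_twist_clin[OF b02]] map012(1)] cl_assoc_clin[OF b01 b12 b23]])

lemma second_composite_pure:
  assumes x: "\<xi> \<in> carrier F03"
  shows "second_composite (pure F03 (ext_top KK) \<xi> (wdg KK (fs as bs ps))) = (1 / d) \<odot>\<^bsub>TT\<^esub> second_at_basis \<xi>"
proof -
  let ?W = "wdg K2 (map (\<lambda>a. (a, 0)) as @ map (\<lambda>b. (0, b)) (\<beta>s @ bs))"
  let ?s = "(-1) ^ (cdim K012 * cdim K023) :: complex"
  have fK: "set (fs as bs ps) \<subseteq> KK" using basis_fs[OF ad] by (simp add: dual_basis_def)
  have r: "ext_map K2 \<rho>' (wdg KK (fs as bs ps)) = ?W"
    unfolding ext_map_wdg[OF sKK rho_lin rho_in fK] rho_fs[OF ad] ..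
  have W: "?W \<in> carrier (ext_top K2)"
    using basis_K2 dual_basis_cdim[OF basis_K2] by (intro wdg_in_top) (simp_all add: dual_basis_def)
  have dW: "(1 / d) \<odot>\<^bsub>ext_top K2\<^esub> ?W \<in> carrier (ext_top K2)"
    by (rule cmod.smult_closed[OF cmod_ext_top W])
  have p0: "pure (ext_top K023) (ext_top K012) wb' wa' \<in> carrier (tens (ext_top K023) (ext_top K012))"
    by (rule pure_closed[OF cmod_ext_top cmod_ext_top w_in(4,3)])
  have sw: "top_swap K012 K023 (top_split K012 K023 ?W) =
      ?s \<odot>\<^bsub>tens (ext_top K023) (ext_top K012)\<^esub> pure (ext_top K023) (ext_top K012) wb' wa'"
    unfolding split2_wdg by (rule top_swap_pure[OF w_in(3,4)])
  let ?T3 = "tens F03 (tens (ext_top K023) (ext_top K012))"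
  let ?p3 = "pure F03 (tens (ext_top K023) (ext_top K012)) \<xi> (pure (ext_top K023) (ext_top K012) wb' wa')"
  have p3: "?p3 \<in> carrier ?T3" by (rule pure_closed[OF cmod_ext_bimod cmod_tens x p0])
  have "tens_map F03 (tens (ext_top K023) (ext_top K012)) id (\<lambda>\<kappa>. top_swap K012 K023 (top_split K012 K023 \<kappa>))
       (tens_map F03 (ext_top K2) id (\<lambda>\<kappa>. (1 / d) \<odot>\<^bsub>ext_top K2\<^esub> ext_map K2 \<rho>' \<kappa>) (pure F03 (ext_top KK) \<xi> (wdg KK (fs as bs ps)))) =
     pure F03 (tens (ext_top K023) (ext_top K012)) \<xi> (top_swap K012 K023 (top_split K012 K023 ((1 / d) \<odot>\<^bsub>ext_top K2\<^esub> ?W)))"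
    unfolding tens_map_pure[OF cmod_ext_bimod cmod_ext_top cmod_ext_bimod cmod_ext_top clin_id' rho_top_clin x fs_in] r id_apply
      tens_map_pure[OF cmod_ext_bimod cmod_ext_top cmod_ext_bimod cmod_tens clin_id' swap_split_clin x dW] ..
  also have "top_swap K012 K023 (top_split K012 K023 ((1 / d) \<odot>\<^bsub>ext_top K2\<^esub> ?W)) =
      (1 / d) \<odot>\<^bsub>tens (ext_top K023) (ext_top K012)\<^esub> (?s \<odot>\<^bsub>tens (ext_top K023) (ext_top K012)\<^esub> pure (ext_top K023) (ext_top K012) wb' wa')"
    unfolding clin_smult[OF swap_split_clin W] sw ..
  also have "pure F03 (tens (ext_top K023) (ext_top K012)) \<xi> \<dots> = (1 / d) \<odot>\<^bsub>?T3\<^esub> (?s \<odot>\<^bsub>?T3\<^esub> ?p3)"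
    unfolding clin_smult[OF cbilinD1[OF pure_cbilin[OF cmod_ext_bimod cmod_tens] x] cmod.smult_closed[OF cmod_tens p0]]
      clin_smult[OF cbilinD1[OF pure_cbilin[OF cmod_ext_bimod cmod_tens] x] p0] ..
  finally have 1: "second_composite (pure F03 (ext_top KK) \<xi> (wdg KK (fs as bs ps))) =
      assoc (cl_tens_map c2 S12 F23 \<alpha>012 id (interchange_twist c2 c3 F02 L23 K012
       (tens_map (cl_tens c2 F02 F23) (ext_top K012) \<alpha>023 id (assoc_top F03 K023 K012 ((1 / d) \<odot>\<^bsub>?T3\<^esub> (?s \<odot>\<^bsub>?T3\<^esub> ?p3))))))"
    unfolding second_composite_def by (simp only:)
  note rest = clin_comp[OF clin_comp[OF clin_comp[OF clin_comp[OF
       assoc_top_clin[OF cmod_ext_bimod[of c0 c3 L03], of K023 K012]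
       tens_map_clin[OF cmod_top_twist cmod_ext_top cmod_cl_tens cmod_ext_top P023.\<alpha>_clin clin_id']]
       P023.B.interchange_twist_clin[OF b02]] map012(1)] cl_assoc_clin[OF b01 b12 b23]]
  have p: "pure F03 (ext_top K023) \<xi> wb' \<in> carrier (top_twist F03 K023)"
    using pure_closed[OF cmod_ext_bimod cmod_ext_top x w_in(4)] by (simp add: top_twist_simps(1))
  have 2: "tens_map (cl_tens c2 F02 F23) (ext_top K012) \<alpha>023 id (assoc_top F03 K023 K012 ?p3) =
      pure (cl_tens c2 F02 F23) (ext_top K012) (\<alpha>023 (pure F03 (ext_top K023) \<xi> wb')) wa'"
    unfolding assoc_top_pure[OF cmod_ext_bimod x w_in(4,3)]
      tens_map_pure[OF cmod_top_twist cmod_ext_top cmod_cl_tens cmod_ext_top P023.\<alpha>_clin clin_id' p w_in(3)] id_apply ..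
  show ?thesis
    unfolding 1 clin_smult[OF rest cmod.smult_closed[OF cmod_tens p3]] clin_smult[OF rest p3] 2 second_at_basis_def second_tail_def ..
qed

text \<open>
  The line is generated by the wedge product \<open>gs\<close>, at which the first composite is known. The second
  one is known at \<open>fs\<close>, with the factor \<open>1 / d\<close>, and \<open>d\<close> is the ratio of the two generators.
\<close>

lemma composites_agree:
  assumes "x \<in> carrier (tens F03 (ext_top KK))" shows "first_composite x = second_composite x"
proof (rule tens_clin_eq[OF cmod_ext_bimod cmod_ext_top first_composite_clin second_composite_clin _ assms])
  fix \<xi> \<kappa> assume x: "\<xi> \<in> carrier F03" and k: "\<kappa> \<in> carrier (ext_top KK)"
  let ?p = "pure F03 (ext_top KK) \<xi>" and ?g = "wdg KK (gs as bs cs)" and ?f = "wdg KK (fs as bs ps)"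
  note c = cbilinD1[OF pure_cbilin[OF cmod_ext_bimod cmod_ext_top] x]
  obtain t where t: "\<kappa> = t \<odot>\<^bsub>ext_top KK\<^esub> ?g"
    using ext_top_span[OF dual_basis_list[OF basis_gs[OF ad]] k] .
  have pg: "?p ?g \<in> carrier (tens F03 (ext_top KK))" and pf: "?p ?f \<in> carrier (tens F03 (ext_top KK))"
    using clin_closed[OF c] gs_in fs_in by auto
  have q: "second_at_basis \<xi> \<in> carrier TT" by (rule clin_closed[OF second_at_basis_clin x])
  have "?p ?g = d \<odot>\<^bsub>tens F03 (ext_top KK)\<^esub> ?p ?f"
    unfolding wdg_gs[OF ad] by (rule clin_smult[OF c fs_in])
  then have "second_composite (?p ?g) = d \<odot>\<^bsub>TT\<^esub> ((1 / d) \<odot>\<^bsub>TT\<^esub> second_at_basis \<xi>)"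
    by (simp only: clin_smult[OF second_composite_clin pf] second_composite_pure[OF x])
  also have "\<dots> = second_at_basis \<xi>"
    using d_nonzero[OF ad] by (simp add: V.T.smult_assoc[OF q] V.T.smult_one[OF q])
  finally have "first_composite (?p ?g) = second_composite (?p ?g)" by (simp only: first_composite_pure[OF x] composites_agree_at_basis[OF x])
  then show "first_composite (?p \<kappa>) = second_composite (?p \<kappa>)"
    unfolding t clin_smult[OF c gs_in] clin_smult[OF first_composite_clin pg] clin_smult[OF second_composite_clin pg] by (rule arg_cong)
qed

end

end

theorem theorem2p18:
  fixes c0 :: "'w0::hermitian_space \<Rightarrow> 'w0" and c1 :: "'w1::hermitian_space \<Rightarrow> 'w1"
    and c2 :: "'w2::hermitian_space \<Rightarrow> 'w2" and c3 :: "'w3::hermitian_space \<Rightarrow> 'w3"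
    and L01 :: "('w0 \<times> 'w1) set" and L12 :: "('w1 \<times> 'w2) set" and L23 :: "('w2 \<times> 'w3) set"
    and L02 :: "('w0 \<times> 'w2) set" and L13 :: "('w1 \<times> 'w3) set" and L03 :: "('w0 \<times> 'w3) set"
    and K012 K013 :: "'w1 set" and K023 K123 :: "'w2 set"
  assumes "real_structure c0" "real_structure c1" "real_structure c2" "real_structure c3"
    and "lagrangian (pair_conj c0 c1) L01" "lagrangian (pair_conj c1 c2) L12"
        "lagrangian (pair_conj c2 c3) L23"
    and "L02 = L01 O L12" "L13 = L12 O L23" "L03 = L01 O L12 O L23"
    and "lagrangian (pair_conj c0 c2) L02" "lagrangian (pair_conj c1 c3) L13"
        "lagrangian (pair_conj c0 c3) L03"
    and "closed_range_condition L01 L12" "closed_range_condition L01 L13"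
        "closed_range_condition L02 L23" "closed_range_condition L12 L23"
    and "closed_projection_condition c0 c1 c2 L01 L12"
        "closed_projection_condition c0 c1 c3 L01 L13"
        "closed_projection_condition c0 c2 c3 L02 L23"
        "closed_projection_condition c1 c2 c3 L12 L23"
    and "K012 = Kspace L01 L12" "K013 = Kspace L01 L13"
        "K023 = Kspace L02 L23" "K123 = Kspace L12 L23"
    and "cfinite_dim K012" "cfinite_dim K013" "cfinite_dim K023" "cfinite_dim K123"
    and "gluing_iso c0 c1 c2 L01 L12 \<alpha>012" "gluing_iso c0 c1 c3 L01 L13 \<alpha>013"
        "gluing_iso c0 c2 c3 L02 L23 \<alpha>023" "gluing_iso c1 c2 c3 L12 L23 \<alpha>123"
    and "F01 = ext_bimod c0 c1 L01" "F12 = ext_bimod c1 c2 L12" "F23 = ext_bimod c2 c3 L23"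
        "F02 = ext_bimod c0 c2 L02" "F13 = ext_bimod c1 c3 L13" "F03 = ext_bimod c0 c3 L03"
    and "\<rho> = rho K012 K123 K023 L12"
    and "d = endo_det (K013 \<times> K123) (\<lambda>x. adjoint_on (K013 \<times> K123) \<rho> (\<rho> x))"
  shows "\<forall>x \<in> carrier (tens F03 (ext_top (K013 \<times> K123))).
    (cl_tens_map c1 F01 (cl_tens c2 F12 F23) id \<alpha>123 \<circ>
     assoc_twist c1 F01 F13 K123 \<circ>
     tens_map (cl_tens c1 F01 F13) (ext_top K123) \<alpha>013 id \<circ>
     assoc_top F03 K013 K123 \<circ>
     tens_map F03 (tens (ext_top K013) (ext_top K123)) id (top_split K013 K123)) x
    =
    cl_assoc c1 c2 F01 F12 F23
    ((cl_tens_map c2 (cl_tens c1 F01 F12) F23 \<alpha>012 id \<circ>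
      interchange_twist c2 c3 F02 L23 K012 \<circ>
      tens_map (cl_tens c2 F02 F23) (ext_top K012) \<alpha>023 id \<circ>
      assoc_top F03 K023 K012 \<circ>
      tens_map F03 (tens (ext_top K023) (ext_top K012)) id
        (top_swap K012 K023 \<circ> top_split K012 K023) \<circ>
      tens_map F03 (ext_top (K012 \<times> K023)) id
        (\<lambda>\<kappa>. (1 / d) \<odot>\<^bsub>ext_top (K012 \<times> K023)\<^esub> ext_map (K012 \<times> K023) \<rho> \<kappa>)) x)"
proof -
  note K = assms(22-25) and lag = assms(1-7,11-13)
  have comp: "L03 = L01 O L13" "L03 = L02 O L23" using assms(8-10) by (simp_all only: O_assoc)
  have p012: "gluing_pair c0 c1 c2 L01 L12 L02 \<alpha>012"
    by (intro gluing_pair.intro gluing_pair_axioms.intro lagr_pair.intro lag assms(8,30) assms(26)[unfolded K])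
  have p013: "gluing_pair c0 c1 c3 L01 L13 L03 \<alpha>013"
    by (intro gluing_pair.intro gluing_pair_axioms.intro lagr_pair.intro lag comp(1) assms(31) assms(27)[unfolded K])
  have p023: "gluing_pair c0 c2 c3 L02 L23 L03 \<alpha>023"
    by (intro gluing_pair.intro gluing_pair_axioms.intro lagr_pair.intro lag comp(2) assms(32) assms(28)[unfolded K])
  have p123: "gluing_pair c1 c2 c3 L12 L23 L13 \<alpha>123"
    by (intro gluing_pair.intro gluing_pair_axioms.intro lagr_pair.intro lag assms(9,33) assms(29)[unfolded K])
  interpret G: gluing_square c0 c1 c2 c3 L01 L12 L23 L02 L13 L03 \<alpha>012 \<alpha>013 \<alpha>023 \<alpha>123
    by (rule gluing_square.intro[OF p012 p013 p023 p123])
  obtain as bs \<beta>s ps cs where ad: "G.adapted as bs \<beta>s ps cs" by (rule G.adapted_exists)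
  have \<rho>: "\<rho> = rho G.K012 G.K123 G.K023 L12" unfolding assms(40) K ..
  have T: "d = endo_det (G.K013 \<times> G.K123) G.T" unfolding assms(41) \<rho> K G.T_def[abs_def] ..
  show ?thesis
    unfolding K assms(34-39) T \<rho>
    using G.composites_agree[OF ad]
    unfolding G.first_composite_def[OF ad] G.second_composite_def[OF ad] comp_def by blast
qed

end
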